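(* Suppose that $n$, of weight $w$, is the level of some $d\in\Delta^\times$ with $\mathrm{nr}(d)=1$ which is not congruent to any $\Pi$-commutator product $\bmod\ \Pi^{n+1}\Delta$. Then $p^r-1\le n<p^{r+s-1}$ and either $n$ has type $t<w\le s-1$, or $n$ is exceptional with type $t=w<s-1$.
   Context: Let $p$ be an odd prime, $r\ge1$, $s\ge1$ integers, $F/\mathbb Q_p$ a finite unramified extension with ring of integers $\mathfrak O$. Fix primitive $p^m$-th roots of unity $\zeta_m$ with $\zeta_0=1$, $\zeta_m^p=\zeta_{m-1}$; put $\mathfrak O_m=\mathfrak O[\zeta_m]$, $\pi_m=1-\zeta_m$, $\Pi=\pi_{r+s}$, $\pi=\pi_r$, $A=\mathfrak O_r[[T]]$, $B=\mathfrak O_{r+s}[[T]]$, with fraction fields $\mathfrak q(A),\mathfrak q(B)$. Let $g$ be the generator of the cyclic group $\mathrm{Gal}(\mathfrak q(B)/\mathfrak q(A))$ (of order $p^s$) fixing $\mathfrak q(A)$ with $\zeta_{r+s}\mapsto\zeta_{r+s}^{1+p^r}$. $D=\bigoplus_{j=0}^{p^s-1}\mathfrak q(B)u^j$ with $ub={}^gb\,u$ and $u^{p^s}=1+T$ is a division algebra with centre $\mathfrak q(A)$, $\Delta=\bigoplus_{j=0}^{p^s-1}Bu^j$ is an $A$-order in $D$ with $\Pi\Delta=\Delta\Pi$, and $\mathrm{nr}:D\to\mathfrak q(A)$ is the reduced norm. The level of $d\in1+\Pi\Delta$ is $\max\{k\ge1:d\in1+\Pi^k\Delta\}$ (every $d\in\Delta^\times$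 with $\mathrm{nr}(d)=1$ lies in $1+\Pi\Delta$). The weight of $n\ge1$ is the smallest $w\ge0$ with $n<p^{r+w}+p^w$. The integer $n\ge1$ has type $t\ge0$ if $n=p^{r+t}+p^tm-1$ for some $m\ge1$ with $m\not\equiv0\bmod p$. It is exceptional if $n=p^{r+w}+p^w-1$ with $w$ its weight. Write $[x,y]=xyx^{-1}y^{-1}$. A $\Pi$-commutator is an element $[\Pi,x]$ with $x\in\Delta^\times$; a $\Pi$-commutator product is any finite product of $\Pi$-commutators or elements of the commutator subgroup $[\Delta^\times,\Delta^\times]$. *)

theory Defs
  imports
    "HOL-Computational_Algebra.Formal_Laurent_Series"
    "HOL-Algebra.Finite_Extensions"
    "HOL-Algebra.Algebraic_Closure_Type"
    "HOL-Algebra.Generated_Groups"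
    "Jordan_Normal_Form.Determinant"
begin

section \<open>The \<open>p\<close>-adic numbers and their finite unramified extensions\<close>

text \<open>
  All fields of algebraic numbers over \<open>\<rat>\<^sub>p\<close> are subfields of one ambient field, a type \<open>'k\<close> of
  characteristic 0. The value of an absolute value \<open>v\<close> matters only on the subfield in question.
\<close>

abbreviation amb :: "'k::field ring" where
  "amb \<equiv> ring_of_type_algebra"

definition padic_abs :: "nat \<Rightarrow> rat \<Rightarrow> real" where
  "padic_abs p x =
     (if x = 0 then 0
      else real p powi (int (multiplicity (int p) (snd (quotient_of x)))
                        - int (multiplicity (int p) (fst (quotient_of x)))))"

definition nonarch_abs_on :: "'k::field set \<Rightarrow> ('k \<Rightarrow> real) \<Rightarrow> bool" where
  "nonarch_abs_on K v \<longleftrightarrow>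
     (\<forall>x\<in>K. v x \<ge> 0 \<and> (v x = 0 \<longleftrightarrow> x = 0)) \<and>
     (\<forall>x\<in>K. \<forall>y\<in>K. v (x * y) = v x * v y \<and> v (x + y) \<le> max (v x) (v y))"

definition complete_on :: "'k::field set \<Rightarrow> ('k \<Rightarrow> real) \<Rightarrow> bool" where
  "complete_on K v \<longleftrightarrow>
     (\<forall>c::nat \<Rightarrow> 'k. (\<forall>i. c i \<in> K) \<longrightarrow>
        (\<forall>e>0. \<exists>N. \<forall>i\<ge>N. \<forall>j\<ge>N. v (c i - c j) < e) \<longrightarrow>
        (\<exists>x\<in>K. (\<lambda>i. v (c i - x)) \<longlonglongrightarrow> 0))"

text \<open>\<open>\<rat>\<^sub>p\<close> is the completion of \<open>\<rat>\<close> with respect to the \<open>p\<close>-adic absolute value.\<close>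

definition is_padic_field :: "nat \<Rightarrow> 'k::field_char_0 set \<Rightarrow> ('k \<Rightarrow> real) \<Rightarrow> bool" where
  "is_padic_field p Q v \<longleftrightarrow>
     subfield Q amb \<and> nonarch_abs_on Q v \<and>
     (\<forall>x. v (of_rat x) = padic_abs p x) \<and>
     complete_on Q v \<and>
     (\<forall>x\<in>Q. \<forall>e>0. \<exists>q. v (x - of_rat q) < e)"

text \<open>
  \<open>v\<close> on \<open>F\<close> is the (unique) extension of the absolute value of \<open>Q = \<rat>\<^sub>p\<close>. Residue fields being
  finite, \<open>F / Q\<close> is unramified iff its ramification index, the index of the value
  group of \<open>Q\<close> in that of \<open>F\<close>, is 1.
\<close>

definition finite_unramified :: "'k::field_char_0 set \<Rightarrow> 'k set \<Rightarrow> ('k \<Rightarrow> real) \<Rightarrow> bool" where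
  "finite_unramified Q F v \<longleftrightarrow>
     subfield F amb \<and> Q \<subseteq> F \<and> ring.finite_dimension amb Q F \<and> nonarch_abs_on F v \<and>
     v ` (F - {0}) = v ` (Q - {0})"

definition int_ring :: "'k::field set \<Rightarrow> ('k \<Rightarrow> real) \<Rightarrow> 'k set" where
  "int_ring F v = {x \<in> F. v x \<le> 1}"

definition primitive_root :: "nat \<Rightarrow> 'k::field \<Rightarrow> bool" where
  "primitive_root m z \<longleftrightarrow> z ^ m = 1 \<and> (\<forall>k. 0 < k \<and> k < m \<longrightarrow> z ^ k \<noteq> 1)"


section \<open>Power series rings and their fraction fields\<close>

definition ps_ring :: "'k::field set \<Rightarrow> 'k fps set" where
  "ps_ring R = {f. \<forall>i. fps_nth f i \<in> R}"

text \<open>The fraction field of \<open>R[[T]]\<close>, realized inside the field \<open>'k((T))\<close>.\<close>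

definition frac_field :: "'k::field fps set \<Rightarrow> 'k fls set" where
  "frac_field S = {fps_to_fls a / fps_to_fls b | a b. a \<in> S \<and> b \<in> S \<and> b \<noteq> 0}"

definition subring_of_type :: "'a::ring_1 set \<Rightarrow> 'a ring" where
  "subring_of_type S = ring_of_type_algebra \<lparr>carrier := S\<rparr>"


section \<open>Cyclic algebras\<close>

text \<open>
  The cyclic algebra \<open>\<Oplus>\<^bsub>j<N\<^esub> K u\<^sup>j\<close> with \<open>u b = g(b) u\<close> and \<open>u\<^sup>N = a\<close>. The element
  \<open>\<Sum>\<^bsub>j<N\<^esub> x\<^sub>j u\<^sup>j\<close> is the function \<open>j \<mapsto> x\<^sub>j\<close>, extended by 0 to all \<open>j \<ge> N\<close>; the product comes from
  \<open>x\<^sub>i u\<^sup>i \<cdot> y\<^sub>j u\<^sup>j = x\<^sub>i g\<^sup>i(y\<^sub>j) u\<^sup>i\<^sup>+\<^sup>j\<close>.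
\<close>

definition cyc_monom :: "'a::field \<Rightarrow> nat \<Rightarrow> nat \<Rightarrow> 'a" where
  "cyc_monom b i = (\<lambda>j. if j = i then b else 0)"

definition cyclic_algebra ::
  "'a::field set \<Rightarrow> ('a \<Rightarrow> 'a) \<Rightarrow> nat \<Rightarrow> 'a \<Rightarrow> (nat \<Rightarrow> 'a) ring" where
  "cyclic_algebra K g N a =
     \<lparr> carrier = {x. (\<forall>j<N. x j \<in> K) \<and> (\<forall>j\<ge>N. x j = 0)},
       monoid.mult = (\<lambda>x y k. \<Sum>i<N. \<Sum>j<N.
                 if (i + j) mod N = k then x i * (g ^^ i) (y j) * a ^ ((i + j) div N) else 0),
       one = cyc_monom 1 0,
       zero = (\<lambda>_. 0),
       add = (\<lambda>x y k. x k + y k) \<rparr>"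

text \<open>
  The suborder \<open>\<Oplus>\<^bsub>j<N\<^esub> S u\<^sup>j\<close> for a subring \<open>S\<close> of \<open>K\<close>.
\<close>

definition cyclic_order :: "(nat \<Rightarrow> 'a::field) ring \<Rightarrow> 'a set \<Rightarrow> nat \<Rightarrow> (nat \<Rightarrow> 'a) ring" where
  "cyclic_order D S N = D \<lparr>carrier := {x \<in> carrier D. \<forall>j<N. x j \<in> S}\<rparr>"

text \<open>
  The reduced norm is the determinant under a splitting of the central simple algebra. The maximal
  subfield \<open>K\<close> splits the cyclic algebra \<open>D\<close>, with centre \<open>k\<close>: right multiplication by \<open>d\<close> is \<open>K\<close>-linear on the
  left \<open>K\<close>-space \<open>D\<close> with basis \<open>u\<^sup>0, \<dots>, u\<^sup>N\<^sup>-\<^sup>1\<close>, and its matrix \<open>\<rho>(d)\<close>, given by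
  \<open>u\<^sup>i d = \<Sum>\<^sub>j \<rho>(d)\<^sub>i\<^sub>j u\<^sup>j\<close>, induces an isomorphism \<open>D \<otimes>\<^sub>k K \<cong> M\<^sub>N(K)\<close>.
\<close>

definition splitting_matrix :: "(nat \<Rightarrow> 'a::field) ring \<Rightarrow> nat \<Rightarrow> (nat \<Rightarrow> 'a) \<Rightarrow> 'a mat" where
  "splitting_matrix D N d = mat N N (\<lambda>(i, j). (cyc_monom 1 i \<otimes>\<^bsub>D\<^esub> d) j)"

definition reduced_norm :: "(nat \<Rightarrow> 'a::field) ring \<Rightarrow> nat \<Rightarrow> (nat \<Rightarrow> 'a) \<Rightarrow> 'a" where
  "reduced_norm D N d = Determinant.det (splitting_matrix D N d)"


section \<open>Levels and commutator products\<close>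

definition cong_mod_power :: "('a, 'b) ring_scheme \<Rightarrow> 'a \<Rightarrow> nat \<Rightarrow> 'a \<Rightarrow> 'a \<Rightarrow> bool" where
  "cong_mod_power \<Delta> P k x y \<longleftrightarrow>
     (\<exists>\<delta>\<in>carrier \<Delta>. x = y \<oplus>\<^bsub>\<Delta>\<^esub> (P [^]\<^bsub>\<Delta>\<^esub> k) \<otimes>\<^bsub>\<Delta>\<^esub> \<delta>)"

definition is_level :: "('a, 'b) ring_scheme \<Rightarrow> 'a \<Rightarrow> 'a \<Rightarrow> nat \<Rightarrow> bool" where
  "is_level \<Delta> P d n \<longleftrightarrow>
     n \<ge> 1 \<and> cong_mod_power \<Delta> P n d \<one>\<^bsub>\<Delta>\<^esub> \<and>
     (\<forall>k\<ge>1. cong_mod_power \<Delta> P k d \<one>\<^bsub>\<Delta>\<^esub> \<longrightarrow> k \<le> n)"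

text \<open>
  Here \<open>P\<close> is a unit of \<open>D\<close> only, whence the inverses in \<open>D\<close>.
\<close>

definition Pi_commutators :: "('a, 'b) ring_scheme \<Rightarrow> ('a, 'b) ring_scheme \<Rightarrow> 'a \<Rightarrow> 'a set" where
  "Pi_commutators D \<Delta> P =
     {P \<otimes>\<^bsub>D\<^esub> x \<otimes>\<^bsub>D\<^esub> inv\<^bsub>D\<^esub> P \<otimes>\<^bsub>D\<^esub> inv\<^bsub>D\<^esub> x | x. x \<in> Units \<Delta>}"

definition Pi_commutator_products ::
  "('a, 'b) ring_scheme \<Rightarrow> ('a, 'b) ring_scheme \<Rightarrow> 'a \<Rightarrow> 'a set" where
  "Pi_commutator_products D \<Delta> P =
     {foldr (monoid.mult D) xs \<one>\<^bsub>D\<^esub> | xs.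
        set xs \<subseteq> Pi_commutators D \<Delta> P \<union> derived (units_of \<Delta>) (Units \<Delta>)}"


section \<open>Weight, type and exceptional integers\<close>

definition weight :: "nat \<Rightarrow> nat \<Rightarrow> nat \<Rightarrow> nat" where
  "weight p r n = (LEAST w. n < p ^ (r + w) + p ^ w)"

definition has_type :: "nat \<Rightarrow> nat \<Rightarrow> nat \<Rightarrow> nat \<Rightarrow> bool" where
  "has_type p r n t \<longleftrightarrow> (\<exists>m\<ge>1. \<not> p dvd m \<and> n = p ^ (r + t) + p ^ t * m - 1)"

definition exceptional :: "nat \<Rightarrow> nat \<Rightarrow> nat \<Rightarrow> bool" where
  "exceptional p r n \<longleftrightarrow> n = p ^ (r + weight p r n) + p ^ weight p r n - 1"

end

theory Submission
  imports Defs "Jordan_Normal_Form.Char_Poly" "HOL-Number_Theory.Residues"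
begin

text \<open>
  In fact every \<open>d\<close> with \<open>nr(d) = 1\<close> and \<open>d \<equiv> 1\<close> modulo \<open>\<Pi>\<^sup>n\<close> is congruent modulo \<open>\<Pi>\<^sup>n\<^sup>+\<^sup>1\<close> to a \<open>\<Pi>\<close>-commutator
  product, so that the hypotheses of the theorem are contradictory. Write \<open>d \<equiv> 1 + \<Pi>\<^sup>n \<Sum>\<^sub>i a\<^sub>i u\<^sup>i\<close> with
  \<open>a\<^sub>i \<in> A\<close>. If \<open>n + 1 = p\<^bsup>r+t\<^esup> + p\<^sup>t j\<close> with \<open>t < s\<close> and \<open>p\<close> not dividing \<open>j\<close>, then the commutators
  \<open>[u, 1 + y f]\<close>, where \<open>y\<close> is the product of the \<open>g\<^sup>l(\<Pi>)\<close> for \<open>l < p\<^sup>t j\<close> and \<open>f\<close> has coefficients in \<open>A\<close>,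
  realise all \<open>a\<close>, since \<open>g(y) - y \<equiv> j \<Pi>\<^sup>n\<close>. Otherwise let \<open>q \<le> s\<close> be least with \<open>q = s\<close> or
  \<open>n < p\<^bsup>r+q\<^esup>\<close>; then \<open>p\<^sup>q\<close> divides \<open>n + 1\<close>, and one \<open>[\<Pi>, x]\<close> realises the \<open>a\<^sub>i\<close> with \<open>p\<^sup>q\<close> not dividing \<open>i\<close>.
  Expanding the reduced norm in traces of powers shows that \<open>nr(d) = 1\<close> forces
  \<open>\<Sum>\<^sub>j b\<^sub>j\<^bsup>p^(s-q)\<^esup> (1 + T)\<^sup>j \<equiv> 0\<close> modulo \<open>\<Pi>\<close> for \<open>b\<^sub>j = a\<^bsub>j p^q\<^esub>\<close>, hence all \<open>b\<^sub>j \<equiv> 0\<close>, except when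
  \<open>q < s\<close> and \<open>n + 1 = p\<^bsup>r+q\<^esup>\<close>. There the left-hand side acquires the correction
  \<open>- \<Sum>\<^sub>j b\<^bsub>pj\<^esub>\<^bsup>p^(s-q-1)\<^esup> (1 + T)\<^sup>j\<close>, and the congruence becomes Cartier's criterion for \<open>- \<Sum>\<^sub>j b\<^sub>j V\<^sup>j\<close> to be
  the logarithmic derivative of some \<open>h\<close>, where \<open>V = u\<^bsup>p^q\<^esup>\<close>; then \<open>[\<Pi>, h(V)]\<close> realises the \<open>b\<^sub>j\<close>.
\<close>

subsection \<open>Determinants and power sums\<close>

text \<open>Sizes are measured by the ideals \<open>I k\<close> of the commutative ring
  \<open>B\<close>, never in a quotient. Newton's identities turn the norm of \<open>1 + z\<close>,
  a determinant, into the exponential of the sum of the terms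
  \<open>(-1) ^ (k + 1) * Tr (z ^ k) / k\<close>. The obstacle is the denominator \<open>k\<close>;
  it is harmless because traces from \<open>B\<close> are divisible by \<open>p ^ s\<close>, the
  powers of zeta with exponent strictly between 0 and \<open>p ^ s\<close> having trace 0. What
  remains is a competition between the factors \<open>p\<close> lost through \<open>k\<close> and
  the factors Pi gained in \<open>z ^ k\<close>. At the levels left over by the commutators with
  \<open>u\<close>, the index \<open>p ^ (s - q)\<close> wins alone, except that for
  \<open>q < s\<close> and \<open>n + 1 = p ^ (r + q)\<close> the index
  \<open>p ^ (s - q - 1)\<close> ties, because \<open>p ^ r - p ^ (r - 1)\<close> is the
  ramification index belonging to one factor \<open>p\<close>. The correction is negative because
  \<open>p\<close> is minus a principal unit times a power of Pi. Powers of a general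
  \<open>z\<close> are out of reach, so \<open>d\<close> is first replaced by a product of factors
  \<open>1 + a * Pi ^ n * u ^ i\<close>. That the congruence can be solved coefficient by
  coefficient rests on the independence, modulo Pi, of the powers of \<open>1 + T\<close> below
  \<open>p ^ m\<close> over \<open>p ^ m\<close>-th powers.\<close>

definition mat_trace :: "'a::comm_ring_1 mat \<Rightarrow> 'a" where
  "mat_trace M = (\<Sum>i<dim_row M. M $$ (i, i))"

text \<open>\<open>W k\<close> is the trace of \<open>adj (X - Z) * Z ^ k\<close>. Since the
  adjugate times \<open>X - Z\<close> is the scalar matrix of the characteristic polynomial, a
  factor \<open>X\<close> can be traded for a factor \<open>Z\<close> at the cost of
  \<open>char_poly Z\<close> times the trace of \<open>Z ^ k\<close>.\<close>

lemma adj_char_poly_recursion: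
  fixes Z :: "'a::idom mat" and k :: nat
  assumes Z: "Z \<in> carrier_mat n n"
  defines "W \<equiv> \<lambda>k. \<Sum>i<n. \<Sum>j<n. adj_mat (char_poly_matrix Z) $$ (i, j) * [:(Z ^\<^sub>m k) $$ (j, i):]"
  shows "[:0, 1:] * W k = char_poly Z * [:mat_trace (Z ^\<^sub>m k):] + W (Suc k)"
proof -
  define P where "P = char_poly_matrix Z"
  define Q where "Q = adj_mat P"
  define Y where "Y = Z ^\<^sub>m k"
  have P: "P \<in> carrier_mat n n" using Z by (simp add: P_def)
  have Q: "Q \<in> carrier_mat n n" using adj_mat(1)[OF P] by (simp add: Q_def)
  have Y: "Y \<in> carrier_mat n n" using Z by (simp add: Y_def)
  have Psub: "P $$ (l, j) = (if l = j then [:0, 1:] else 0) - [:Z $$ (l, j):]" if "l < n" "j < n" for l j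
    using that Z by (auto simp: P_def char_poly_matrix_def)
  have QP: "(\<Sum>l<n. Q $$ (i, l) * P $$ (l, j)) = (if i = j then char_poly Z else 0)"
    if "i < n" "j < n" for i j
  proof -
    have "(Q * P) $$ (i, j) = (\<Sum>l<n. Q $$ (i, l) * P $$ (l, j))"
      using that P Q by (auto simp: scalar_prod_def atLeast0LessThan)
    moreover have "(Q * P) $$ (i, j) = (if i = j then char_poly Z else 0)"
      unfolding Q_def adj_mat(3)[OF P] using that by (auto simp: char_poly_def P_def)
    ultimately show ?thesis by simp
  qed
  have comm: "Z ^\<^sub>m Suc k = Z * Y"
  proof -
    have "Z ^\<^sub>m Suc j = Z * Z ^\<^sub>m j" for j
    proof (induction j)
      case (Suc j)
      have "Z ^\<^sub>m Suc (Suc j) = (Z * Z ^\<^sub>m j) * Z" using Suc by simp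
      also have "\<dots> = Z * (Z ^\<^sub>m j * Z)" using Z by (intro assoc_mult_mat) auto
      finally show ?case by simp
    qed (use Z in auto)
    then show ?thesis by (simp add: Y_def)
  qed
  have ZY: "(Z ^\<^sub>m Suc k) $$ (l, i) = (\<Sum>j<n. Z $$ (l, j) * Y $$ (j, i))" if "l < n" "i < n" for l i
    unfolding comm using that Z Y by (auto simp: scalar_prod_def atLeast0LessThan)
  \<comment> \<open>The product of the adjugate with \<open>X - Z\<close>, solved for the part
    containing \<open>X\<close>.\<close>
  have split: "Q $$ (i, j) * [:0, 1:] = (if i = j then char_poly Z else 0) + (\<Sum>l<n. Q $$ (i, l) * [:Z $$ (l, j):])"
    if "i < n" "j < n" for i j
  proof -
    have "(\<Sum>l<n. Q $$ (i, l) * P $$ (l, j)) =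
        (\<Sum>l<n. Q $$ (i, l) * (if l = j then [:0, 1:] else 0)) - (\<Sum>l<n. Q $$ (i, l) * [:Z $$ (l, j):])"
      unfolding sum_subtractf[symmetric] using that
      by (intro sum.cong) (auto simp: Psub right_diff_distrib)
    moreover have "(\<Sum>l<n. Q $$ (i, l) * (if l = j then [:0, 1:] else 0)) = Q $$ (i, j) * [:0, 1:]"
      using that by (simp add: if_distrib[of "\<lambda>x. _ * x"] cong: if_cong)
    ultimately show ?thesis using QP[OF that] by (simp add: algebra_simps)
  qed
  have "[:0, 1:] * W k = (\<Sum>i<n. \<Sum>j<n. (Q $$ (i, j) * [:0, 1:]) * [:Y $$ (j, i):])"
    unfolding W_def P_def[symmetric] Q_def[symmetric] Y_def[symmetric]
    by (simp only: sum_distrib_left ac_simps)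
  also have "\<dots> = (\<Sum>i<n. \<Sum>j<n. (if i = j then char_poly Z else 0) * [:Y $$ (j, i):])
      + (\<Sum>i<n. \<Sum>j<n. (\<Sum>l<n. Q $$ (i, l) * [:Z $$ (l, j):]) * [:Y $$ (j, i):])"
    unfolding sum.distrib[symmetric]
    by (intro sum.cong refl) (simp only: split lessThan_iff distrib_right)
  also have "(\<Sum>i<n. \<Sum>j<n. (if i = j then char_poly Z else 0) * [:Y $$ (j, i):]) =
      char_poly Z * [:mat_trace Y:]"
  proof -
    have "(\<Sum>i<n. \<Sum>j<n. (if i = j then char_poly Z else 0) * [:Y $$ (j, i):]) =
       (\<Sum>i<n. \<Sum>j<n. (if j = i then char_poly Z * [:Y $$ (i, i):] else 0))"
      by (intro sum.cong refl) auto
    also have "\<dots> = (\<Sum>i<n. char_poly Z * [:Y $$ (i, i):])"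
      by (intro sum.cong refl) (simp add: sum.delta')
    also have "\<dots> = char_poly Z * (\<Sum>i<n. [:Y $$ (i, i):])" by (simp only: sum_distrib_left)
    also have "(\<Sum>i<n. [:Y $$ (i, i):]) = [:\<Sum>i<n. Y $$ (i, i):]"
      by (induction n) auto
    finally show ?thesis using Y by (simp add: mat_trace_def)
  qed
  also have "(\<Sum>i<n. \<Sum>j<n. (\<Sum>l<n. Q $$ (i, l) * [:Z $$ (l, j):]) * [:Y $$ (j, i):]) = W (Suc k)"
  proof -
    have "(\<Sum>j<n. (\<Sum>l<n. Q $$ (i, l) * [:Z $$ (l, j):]) * [:Y $$ (j, i):]) =
        (\<Sum>l<n. Q $$ (i, l) * [:(Z ^\<^sub>m Suc k) $$ (l, i):])" if i: "i < n" for i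
    proof -
      have "(\<Sum>j<n. (\<Sum>l<n. Q $$ (i, l) * [:Z $$ (l, j):]) * [:Y $$ (j, i):]) =
         (\<Sum>l<n. \<Sum>j<n. Q $$ (i, l) * ([:Z $$ (l, j):] * [:Y $$ (j, i):]))"
        by (simp only: sum_distrib_right mult.assoc) (rule sum.swap)
      also have "\<dots> = (\<Sum>l<n. Q $$ (i, l) * (\<Sum>j<n. [:Z $$ (l, j) * Y $$ (j, i):]))"
        by (simp add: sum_distrib_left mult.commute)
      also have "\<dots> = (\<Sum>l<n. Q $$ (i, l) * [:(Z ^\<^sub>m Suc k) $$ (l, i):])"
      proof (intro sum.cong refl)
        fix l assume "l \<in> {..<n}"
        then have l: "l < n" by simp
        have "(\<Sum>j<n. [:Z $$ (l, j) * Y $$ (j, i):]) = [:\<Sum>j<n. Z $$ (l, j) * Y $$ (j, i):]"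
          by (induction n) auto
        then show "Q $$ (i, l) * (\<Sum>j<n. [:Z $$ (l, j) * Y $$ (j, i):]) = Q $$ (i, l) * [:(Z ^\<^sub>m Suc k) $$ (l, i):]"
          using ZY[OF l i] by simp
      qed
      finally show ?thesis .
    qed
    then show ?thesis unfolding W_def P_def[symmetric] Q_def[symmetric] by simp
  qed
  finally show ?thesis by (simp add: Y_def)
qed

lemma coeff_X_mult_Suc:
  fixes q :: "'a::idom poly"
  shows "poly.coeff ([:0, 1:] * q) (Suc k) = poly.coeff q k"
  by simp

lemma coeff_X_power_mult:
  fixes q :: "'a::idom poly"
  shows "poly.coeff ([:0, 1:] ^ m * q) (m + k) = poly.coeff q k"
proof (induction m)
  case (Suc m)
  have "poly.coeff ([:0, 1:] ^ Suc m * q) (Suc m + k) = poly.coeff ([:0, 1:] * ([:0, 1:] ^ m * q)) (Suc (m + k))"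
    by (simp only: power_Suc mult.assoc add_Suc)
  then show ?case using Suc by (simp only: coeff_X_mult_Suc)
qed (simp only: power_0 mult_1 add_0)

text \<open>The recursion is iterated \<open>m + 1\<close> times from \<open>W 0\<close>, the
  derivative of the characteristic polynomial, and coefficients of \<open>X ^ n\<close> are
  compared. The remainder \<open>W (m + 1)\<close> does not contribute, because cofactors of
  \<open>X - Z\<close> have degree below \<open>n\<close>.\<close>

theorem newton_identities_char_poly:
  fixes Z :: "'a::idom mat"
  assumes Z: "Z \<in> carrier_mat n n" and m: "m \<le> n" and n: "n > 0"
  shows "of_nat (n - m) * poly.coeff (char_poly Z) (n - m) =
    (\<Sum>i\<le>m. poly.coeff (char_poly Z) (n - m + i) * mat_trace (Z ^\<^sub>m i))"
proof -
  define Q where "Q = adj_mat (char_poly_matrix Z)"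
  define W where "W = (\<lambda>k. \<Sum>i<n. \<Sum>j<n. Q $$ (i, j) * [:(Z ^\<^sub>m k) $$ (j, i):])"
  define \<chi> where "\<chi> = char_poly Z"
  have P: "char_poly_matrix Z \<in> carrier_mat n n" using Z by simp
  have rec: "[:0, 1:] * W k = \<chi> * [:mat_trace (Z ^\<^sub>m k):] + W (Suc k)" for k
    using adj_char_poly_recursion[OF Z, of k] by (simp add: W_def Q_def \<chi>_def)
  have Qij: "Q $$ (i, j) = cofactor (char_poly_matrix Z) j i" if "i < n" "j < n" for i j
    using that P by (simp add: Q_def adj_mat_def)
  have W0: "W 0 = pderiv \<chi>"
  proof -
    have "W 0 = (\<Sum>i<n. Q $$ (i, i))"
    proof -
      have "(\<Sum>j<n. Q $$ (i, j) * [:(Z ^\<^sub>m 0) $$ (j, i):]) = Q $$ (i, i)" if i: "i < n" for i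
      proof -
        have "(\<Sum>j<n. Q $$ (i, j) * [:(Z ^\<^sub>m 0) $$ (j, i):]) = (\<Sum>j<n. if j = i then Q $$ (i, i) else 0)"
          using i Z by (intro sum.cong refl) auto
        then show ?thesis using i by simp
      qed
      then show ?thesis by (simp add: W_def)
    qed
    also have "\<dots> = (\<Sum>i<n. char_poly (mat_delete Z i i))"
    proof (intro sum.cong refl)
      fix i assume "i \<in> {..<n}"
      then have i: "i < n" by simp
      have "mat_delete (char_poly_matrix Z) i i = char_poly_matrix (mat_delete Z i i)"
        using Z i by (intro eq_matI) (auto simp: mat_delete_def char_poly_matrix_def)
      then show "Q $$ (i, i) = char_poly (mat_delete Z i i)"
        using i by (simp add: Qij cofactor_def char_poly_def)
    qed
    also have "\<dots> = pderiv \<chi>" by (simp add: \<chi>_def pderiv_char_poly[OF Z])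
    finally show ?thesis .
  qed
  have degQ: "Polynomial.degree (Q $$ (i, j)) \<le> n - 1" if ij: "i < n" "j < n" for i j
  proof -
    have "Polynomial.degree (Determinant.det (mat_delete (char_poly_matrix Z) j i)) \<le> 1 * (n - 1)"
    proof (rule degree_det_le)
      show "mat_delete (char_poly_matrix Z) j i \<in> carrier_mat (n - 1) (n - 1)"
        by (rule mat_delete_carrier[OF P])
    next
      fix a b assume ab: "a < n - 1" "b < n - 1"
      have "Polynomial.degree (char_poly_matrix Z $$ (a', b')) \<le> 1" if "a' < n" "b' < n" for a' b'
        using that Z by (auto simp: char_poly_matrix_def)
      then show "Polynomial.degree (mat_delete (char_poly_matrix Z) j i $$ (a, b)) \<le> 1"
        using ab P by (auto simp: mat_delete_def)
    qed
    moreover have "Polynomial.degree ((- 1) ^ (j + i) * q) \<le> Polynomial.degree q" for q :: "'a poly"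
      by (cases "even (j + i)") auto
    ultimately show ?thesis unfolding Qij[OF ij] cofactor_def by (metis le_trans mult_1)
  qed
  have degW: "poly.coeff (W k) n = 0" for k
  proof -
    have "poly.coeff (Q $$ (i, j) * [:c:]) n = 0" if "i < n" "j < n" for i j c
    proof (rule coeff_eq_0)
      have "Polynomial.degree (Q $$ (i, j) * [:c:]) \<le> Polynomial.degree (Q $$ (i, j)) + Polynomial.degree [:c:]"
        by (rule degree_mult_le)
      then show "Polynomial.degree (Q $$ (i, j) * [:c:]) < n" using degQ[OF that] n by simp
    qed
    then show ?thesis unfolding W_def by (simp add: coeff_sum del: mult_pCons_right)
  qed
  have iter: "[:0, 1:] ^ Suc m * W 0 = (\<Sum>i\<le>m. [:0, 1:] ^ (m - i) * (\<chi> * [:mat_trace (Z ^\<^sub>m i):])) + W (Suc m)" for m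
  proof (induction m)
    case 0
    then show ?case using rec[of 0] by simp
  next
    case (Suc m)
    have "[:0, 1:] ^ Suc (Suc m) * W 0 = [:0, 1:] * ([:0, 1:] ^ Suc m * W 0)" by (simp only: power_Suc mult.assoc)
    also have "\<dots> = (\<Sum>i\<le>m. [:0, 1:] * ([:0, 1:] ^ (m - i) * (\<chi> * [:mat_trace (Z ^\<^sub>m i):]))) + [:0, 1:] * W (Suc m)"
      unfolding Suc.IH by (simp only: distrib_left sum_distrib_left)
    also have "(\<Sum>i\<le>m. [:0, 1:] * ([:0, 1:] ^ (m - i) * (\<chi> * [:mat_trace (Z ^\<^sub>m i):]))) =
       (\<Sum>i\<le>m. [:0, 1:] ^ (Suc m - i) * (\<chi> * [:mat_trace (Z ^\<^sub>m i):]))"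
      by (intro sum.cong refl) (simp only: atMost_iff Suc_diff_le power_Suc mult.assoc)
    finally show ?case using rec[of "Suc m"] by (simp only: sum.atMost_Suc diff_self_eq_0 power_0 mult_1 add.assoc)
  qed
  have cm: "poly.coeff ([:0, 1:] ^ a * q) n = poly.coeff q (n - a)" if "a \<le> n" for a and q :: "'a poly"
    using coeff_X_power_mult[of a q "n - a"] that by simp
  have 1: "poly.coeff ([:0, 1:] ^ Suc m * W 0) n = of_nat (n - m) * poly.coeff \<chi> (n - m)"
  \<comment> \<open>The truncated difference \<open>n - Suc m\<close> sets the case
    \<open>m = n\<close> apart; there both sides vanish.\<close>
  proof (cases "m = n")
    case True
    have "poly.coeff ([:0, 1:] ^ Suc n * W 0) n = poly.coeff ([:0, 1:] ^ n * ([:0, 1:] * W 0)) (n + 0)"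
      by (simp only: power_Suc2 mult.assoc add_0_right)
    also have "\<dots> = 0" by (simp only: coeff_X_power_mult) simp
    finally show ?thesis using True by simp
  next
    case False
    then have "poly.coeff ([:0, 1:] ^ Suc m * W 0) n = poly.coeff (pderiv \<chi>) (n - Suc m)"
      using m cm[of "Suc m" "W 0"] W0 by simp
    also have "\<dots> = of_nat (n - m) * poly.coeff \<chi> (n - m)"
      using m False by (simp add: coeff_pderiv Suc_diff_Suc)
    finally show ?thesis .
  qed
  have "poly.coeff ([:0, 1:] ^ Suc m * W 0) n =
      (\<Sum>i\<le>m. poly.coeff ([:0, 1:] ^ (m - i) * (\<chi> * [:mat_trace (Z ^\<^sub>m i):])) n)"
    unfolding iter by (simp only: coeff_add coeff_sum degW add_0_right)
  also have "\<dots> = (\<Sum>i\<le>m. poly.coeff \<chi> (n - m + i) * mat_trace (Z ^\<^sub>m i))"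
  proof (intro sum.cong refl)
    fix i assume "i \<in> {..m}"
    then have i: "i \<le> m" by simp
    have "poly.coeff ([:0, 1:] ^ (m - i) * (\<chi> * [:mat_trace (Z ^\<^sub>m i):])) n = poly.coeff (\<chi> * [:mat_trace (Z ^\<^sub>m i):]) (n - (m - i))"
      using m by (intro cm) simp
    also have "n - (m - i) = n - m + i" using m i by simp
    finally show "poly.coeff ([:0, 1:] ^ (m - i) * (\<chi> * [:mat_trace (Z ^\<^sub>m i):])) n = poly.coeff \<chi> (n - m + i) * mat_trace (Z ^\<^sub>m i)"
      by (simp add: mult.commute)
  qed
  finally show ?thesis using 1 by (simp add: \<chi>_def)
qed

lemma uminus_pow_mat:
  fixes Z :: "'a::comm_ring_1 mat"
  assumes Z: "Z \<in> carrier_mat n n"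
  shows "(- Z) ^\<^sub>m k = (-1) ^ k \<cdot>\<^sub>m (Z ^\<^sub>m k)"
proof (induction k)
  case 0
  show ?case using Z by (intro eq_matI) auto
next
  case (Suc k)
  have Y: "Z ^\<^sub>m k \<in> carrier_mat n n" using Z by simp
  show ?case
  proof (rule eq_matI)
    fix i j assume "i < dim_row ((-1) ^ Suc k \<cdot>\<^sub>m (Z ^\<^sub>m Suc k))" "j < dim_col ((-1) ^ Suc k \<cdot>\<^sub>m (Z ^\<^sub>m Suc k))"
    then have ij: "i < n" "j < n" using Y Z by auto
    have "((- Z) ^\<^sub>m Suc k) $$ (i, j) = (((-1) ^ k \<cdot>\<^sub>m (Z ^\<^sub>m k)) * (- Z)) $$ (i, j)" using Suc by simp
    also have "\<dots> = ((-1) ^ Suc k \<cdot>\<^sub>m (Z ^\<^sub>m Suc k)) $$ (i, j)"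
      using ij Y Z by (auto simp: scalar_prod_def sum_distrib_left mult_ac sum_negf)
    finally show "((- Z) ^\<^sub>m Suc k) $$ (i, j) = ((-1) ^ Suc k \<cdot>\<^sub>m (Z ^\<^sub>m Suc k)) $$ (i, j)" .
  qed (use Y Z in auto)
qed

text \<open>\<open>F m\<close> is the \<open>m\<close>-th elementary symmetric function of the
  eigenvalues of \<open>Z\<close>, read off as a coefficient of \<open>char_poly (- Z)\<close>; that
  polynomial at 1 is the determinant.\<close>

theorem det_one_plus_newton:
  fixes Z :: "'a::idom mat"
  assumes Z: "Z \<in> carrier_mat n n"
  obtains F where "F 0 = 1" and "Determinant.det (1\<^sub>m n + Z) = (\<Sum>m\<le>n. F m)"
    and "\<And>m. 1 \<le> m \<Longrightarrow> m \<le> n \<Longrightarrow>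
      of_nat m * F m = (\<Sum>i=1..m. (-1) ^ (i + 1) * mat_trace (Z ^\<^sub>m i) * F (m - i))"
proof -
  define \<chi> where "\<chi> = char_poly (- Z)"
  define F where "F = (\<lambda>m. poly.coeff \<chi> (n - m))"
  have Zm: "- Z \<in> carrier_mat n n" using Z by simp
  have deg: "Polynomial.degree \<chi> = n" "lead_coeff \<chi> = 1"
    using degree_monic_char_poly[OF Zm] by (auto simp: \<chi>_def)
  have F0: "F 0 = 1" using deg by (simp add: F_def)
  have det: "Determinant.det (1\<^sub>m n + Z) = (\<Sum>m\<le>n. F m)"
  proof -
    have h: "comm_ring_hom (\<lambda>q :: 'a poly. poly q 1)" by unfold_locales auto
    have "map_mat (\<lambda>q. poly q 1) (char_poly_matrix (- Z)) = 1\<^sub>m n + Z"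
      using Z by (intro eq_matI) (auto simp: char_poly_matrix_def)
    then have "Determinant.det (1\<^sub>m n + Z) = poly \<chi> 1"
      using Determinant.comm_ring_hom.hom_det[OF h, of "char_poly_matrix (- Z)"] by (simp add: \<chi>_def char_poly_def)
    also have "\<dots> = (\<Sum>i\<le>n. poly.coeff \<chi> i)" by (simp add: poly_altdef deg)
    also have "\<dots> = (\<Sum>m\<le>n. F m)"
      unfolding F_def by (rule sum.reindex_bij_witness[of _ "\<lambda>m. n - m" "\<lambda>m. n - m"]) auto
    finally show ?thesis .
  qed
  have tr: "mat_trace ((- Z) ^\<^sub>m i) = (-1) ^ i * mat_trace (Z ^\<^sub>m i)" for i
    unfolding uminus_pow_mat[OF Z] using Z by (simp add: mat_trace_def sum_distrib_left)
  have tr0: "mat_trace (Z ^\<^sub>m 0) = of_nat n" using Z by (simp add: mat_trace_def)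
  have newton: "of_nat m * F m = (\<Sum>i=1..m. (-1) ^ (i + 1) * mat_trace (Z ^\<^sub>m i) * F (m - i))"
    if m: "1 \<le> m" "m \<le> n" for m
  proof -
    have "of_nat (n - m) * F m = (\<Sum>i\<le>m. poly.coeff \<chi> (n - m + i) * mat_trace ((- Z) ^\<^sub>m i))"
      using newton_identities_char_poly[OF Zm, of m] m by (simp add: F_def \<chi>_def)
    also have "\<dots> = (\<Sum>i\<le>m. F (m - i) * ((-1) ^ i * mat_trace (Z ^\<^sub>m i)))"
      using m by (intro sum.cong refl) (simp add: F_def tr)
    also have "\<dots> = F m * of_nat n + (\<Sum>i=1..m. F (m - i) * ((-1) ^ i * mat_trace (Z ^\<^sub>m i)))"
      by (simp add: atMost_atLeast0 sum.atLeast_Suc_atMost tr0 del: pow_mat.simps)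
    finally have "of_nat (n - m) * F m - F m * of_nat n =
        (\<Sum>i=1..m. F (m - i) * ((-1) ^ i * mat_trace (Z ^\<^sub>m i)))" by simp
    moreover have "of_nat (n - m) * F m - F m * of_nat n = - (of_nat m * F m)"
      using m by (simp add: of_nat_diff algebra_simps)
    ultimately have "- (of_nat m * F m) = (\<Sum>i=1..m. F (m - i) * ((-1) ^ i * mat_trace (Z ^\<^sub>m i)))" by simp
    moreover have "x = - y" if "- x = y" for x y :: 'a using that by auto
    ultimately have "of_nat m * F m = - (\<Sum>i=1..m. F (m - i) * ((-1) ^ i * mat_trace (Z ^\<^sub>m i)))" by blast
    then show ?thesis by (simp add: sum_negf[symmetric] mult_ac)
  qed
  show ?thesis
    by (rule that[of F, OF F0 det newton])
qed

subsection \<open>Exponential expansion of the Newton recursion\<close>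

text \<open>A weak form of Legendre's bound \<open>(m - 1) / (p - 1)\<close>. At multiples of
  \<open>p\<close> the valuation of \<open>(p * k)!\<close> is \<open>k\<close> plus that of
  \<open>k!\<close>, and oddness enters through \<open>3 * k <= p * k\<close>.\<close>

lemma twice_multiplicity_fact_less:
  assumes p: "prime p" "odd p" and m: "m > 0"
  shows "2 * multiplicity p (fact m :: nat) < m"
  using m
proof (induction m rule: less_induct)
  case (less m)
  show ?case
  proof (cases "p dvd m")
    case False
    show ?thesis
    proof (cases "m = 1")
      case True
      then show ?thesis by simp
    next
      case m1: False
      have "(fact m :: nat) = m * fact (m - 1)" using less.prems by (metis fact_reduce of_nat_id)
      moreover have "multiplicity p (m * fact (m - 1)) = multiplicity p m + multiplicity p (fact (m - 1) :: nat)"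
        using p less.prems by (intro prime_elem_multiplicity_mult_distrib) auto
      ultimately have "multiplicity p (fact m :: nat) = multiplicity p (fact (m - 1) :: nat)"
        using False by (simp add: not_dvd_imp_multiplicity_0)
      then show ?thesis using less.IH[of "m - 1"] less.prems m1 by simp
    qed
  next
    case True
    then obtain k where k: "m = p * k" by (elim dvdE)
    have k0: "k > 0" using less.prems k by simp
    have p3: "p \<ge> 3" using p prime_ge_2_nat[of p] by (cases "p = 2") auto
    have mult: "multiplicity p (fact (p * j) :: nat) = j + multiplicity p (fact j :: nat)" for j
    proof (induction j)
      case 0
      show ?case by simp
    next
      case (Suc j)
      have step: "multiplicity p (fact (p * j + i) :: nat) = multiplicity p (fact (p * j) :: nat)" if "i < p" for i
        using that
      proof (induction i)
        case (Suc i)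
        have nd: "\<not> p dvd (p * j + Suc i)"
          using Suc.prems by (metis dvd_add_right_iff dvd_triv_left nat_dvd_not_less zero_less_Suc)
        have "multiplicity p ((p * j + Suc i) * fact (p * j + i)) =
            multiplicity p (p * j + Suc i) + multiplicity p (fact (p * j + i) :: nat)"
          using p by (intro prime_elem_multiplicity_mult_distrib) auto
        then show ?case using Suc nd by (simp add: not_dvd_imp_multiplicity_0)
      qed simp
      have "(fact (p * Suc j) :: nat) = (p * Suc j) * fact (p * j + (p - 1))"
      proof -
        have "p * Suc j = Suc (p * j + (p - 1))" using p3 by simp
        then show ?thesis by (metis fact_Suc of_nat_id)
      qed
      moreover have "multiplicity p ((p * Suc j) * fact (p * j + (p - 1)) :: nat) =
          multiplicity p (p * Suc j) + multiplicity p (fact (p * j + (p - 1)) :: nat)"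
        using p by (intro prime_elem_multiplicity_mult_distrib) auto
      moreover have "multiplicity p (p * Suc j) = multiplicity p p + multiplicity p (Suc j)"
        using p by (intro prime_elem_multiplicity_mult_distrib) auto
      moreover have "multiplicity p p = 1" using p by simp
      moreover have "multiplicity p (Suc j * fact j :: nat) = multiplicity p (Suc j) + multiplicity p (fact j :: nat)"
        using p by (intro prime_elem_multiplicity_mult_distrib) auto
      ultimately show ?case using Suc step[of "p - 1"] p3 by simp
    qed
    have km: "k < m" using k k0 p3 by simp
    have "2 * multiplicity p (fact k :: nat) < k" using less.IH[OF km k0] .
    moreover have "2 * (k + M) < 3 * k" if "2 * M < k" for M :: nat using that by simp
    ultimately have "2 * (k + multiplicity p (fact k :: nat)) < 3 * k" by blast
    also have "3 * k \<le> p * k" using p3 by (rule mult_le_mono1)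
    finally show ?thesis unfolding k mult[of k] .
  qed
qed

text \<open>Says that \<open>p ^ (m - 2) / m!\<close> is \<open>p\<close>-integral. The exponent
  \<open>m - 2\<close> leaves two factors of \<open>x ^ m\<close> untouched when \<open>x\<close> is
  divisible by \<open>p\<close>, which is what makes divided powers small.\<close>

lemma prime_power_div_fact:
  assumes p: "prime p" "odd p" and m: "m \<ge> 2"
  obtains u v :: nat where "\<not> p dvd v" and "v * p ^ (m - 2) = u * fact m"
proof -
  define a where "a = multiplicity p (fact m :: nat)"
  have "2 * a < m" using twice_multiplicity_fact_less[of p m] p m by (simp add: a_def)
  then have a: "a \<le> m - 2" using m by linarith
  obtain v where v: "(fact m :: nat) = p ^ a * v" "\<not> p dvd v"
    using multiplicity_decompose'[of "fact m :: nat" p] prime_gt_1_nat[OF p(1)]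
    unfolding a_def by (metis fact_nonzero nat_dvd_1_iff_1 less_irrefl)
  have "v * p ^ (m - 2) = p ^ (m - 2 - a) * fact m"
  proof -
    have "p ^ (m - 2) = p ^ (m - 2 - a) * p ^ a" using a by (metis le_add_diff_inverse2 power_add)
    then show ?thesis by (simp add: v(1))
  qed
  then show ?thesis using that v(2) by blast
qed

text \<open>The recursion says that the generating function of \<open>F\<close> is the exponential
  of the series with coefficients \<open>L i\<close>. Modulo \<open>J'\<close> only the linear part
  of the exponential survives. Divided powers get a hypothesis of their own because
  \<open>J'\<close> need not be stable under division by factorials.\<close>

lemma newton_exp_expansion:
  fixes F L :: "nat \<Rightarrow> 'a::field_char_0"
  assumes F0: "F 0 = 1"
    and F: "\<And>m. 1 \<le> m \<Longrightarrow> m \<le> n \<Longrightarrow> of_nat m * F m = (\<Sum>i=1..m. of_nat i * L i * F (m - i))"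
    and J0: "0 \<in> J'" and Jadd: "\<And>x y. x \<in> J' \<Longrightarrow> y \<in> J' \<Longrightarrow> x + y \<in> J'"
    and JJ: "J' \<subseteq> J" "\<And>x y. x \<in> J \<Longrightarrow> y \<in> J \<Longrightarrow> x + y \<in> J" "\<And>x y. x \<in> J \<Longrightarrow> y \<in> J \<Longrightarrow> x * y \<in> J'"
    and L: "\<And>i. 1 \<le> i \<Longrightarrow> i \<le> n \<Longrightarrow> L i \<in> J"
    and Lm: "\<And>i m. 1 \<le> i \<Longrightarrow> 2 \<le> m \<Longrightarrow> i * m \<le> n \<Longrightarrow> L i ^ m / fact m \<in> J'"
    and k: "1 \<le> k" "k \<le> n"
  shows "F k - L k \<in> J'"
proof -
  \<comment> \<open>\<open>E i\<close> is the exponential of \<open>L i * X ^ i\<close>, and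
    \<open>G j\<close> is the product of the first \<open>j\<close> of them; \<open>n\<close>
    factors suffice up to degree \<open>n\<close>.\<close>
  define E where "E = (\<lambda>i. Abs_fps (\<lambda>k. if i dvd k then L i ^ (k div i) / fact (k div i) else 0))"
  define G where "G = (\<lambda>j. \<Prod>i=1..j. E i)"
  have E0: "E i $ 0 = 1" for i by (simp add: E_def)
  have XE: "fps_X * fps_deriv (E i) = fps_const (of_nat i * L i) * fps_X ^ i * E i" if i: "i \<ge> 1" for i
  proof (rule fps_ext)
    fix k
    show "(fps_X * fps_deriv (E i)) $ k = (fps_const (of_nat i * L i) * fps_X ^ i * E i) $ k"
    proof (cases "i dvd k")
      case True
      then obtain m where m: "k = i * m" by (elim dvdE)
      show ?thesis
      proof (cases m)
        case 0
        then show ?thesis using i m by (simp add: mult.assoc fps_X_power_mult_nth)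
      next
        case (Suc m')
        have k: "k \<noteq> 0" "i \<le> k" "k - i = i * m'" "k div i = Suc m'" "i dvd k - i" "(k - i) div i = m'"
          using m Suc i by auto
        have ofk: "(of_nat k :: 'a) = of_nat i * of_nat (Suc m')" using m Suc by (simp only: of_nat_mult)
        have fact: "fact (Suc m') = (of_nat (Suc m') * fact m' :: 'a)" by simp
        have nz: "of_nat (Suc m') \<noteq> (0 :: 'a)" using of_nat_0_neq by metis
        have "(fps_X * fps_deriv (E i)) $ k = of_nat k * (L i ^ Suc m' / fact (Suc m'))"
          using k True by (simp add: E_def fps_deriv_nth del: power_Suc fact_Suc of_nat_Suc)
        also have "\<dots> = of_nat i * L i * (L i ^ m' / fact m')"
          unfolding ofk fact power_Suc using nz by (simp add: field_simps del: of_nat_Suc)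
        also have "\<dots> = (fps_const (of_nat i * L i) * fps_X ^ i * E i) $ k"
          using k by (simp add: mult.assoc fps_X_power_mult_nth E_def)
        finally show ?thesis .
      qed
    next
      case False
      then have "\<not> i dvd (k - i)" if "i \<le> k" using that by (simp add: dvd_minus_self)
      then show ?thesis using False by (auto simp: mult.assoc fps_X_power_mult_nth E_def fps_deriv_nth)
    qed
  qed
  have XG: "fps_X * fps_deriv (G j) = (\<Sum>i=1..j. fps_const (of_nat i * L i) * fps_X ^ i) * G j" for j
  proof (induction j)
    case 0
    show ?case by (simp add: G_def)
  next
    case (Suc j)
    have "G (Suc j) = G j * E (Suc j)" by (simp add: G_def)
    then have "fps_X * fps_deriv (G (Suc j)) =
        (fps_X * fps_deriv (G j)) * E (Suc j) + G j * (fps_X * fps_deriv (E (Suc j)))"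
      by (simp add: algebra_simps)
    also have "\<dots> = (\<Sum>i=1..Suc j. fps_const (of_nat i * L i) * fps_X ^ i) * G (Suc j)"
      unfolding Suc XE[OF le_add1[of 1 j, unfolded plus_1_eq_Suc]] by (simp add: G_def algebra_simps del: of_nat_Suc)
    finally show ?case .
  qed
  have G0: "G j $ 0 = 1" for j by (induction j) (simp_all add: G_def E0)
  have Grec: "of_nat m * G n $ m = (\<Sum>i=1..m. of_nat i * L i * G n $ (m - i))" if m: "1 \<le> m" "m \<le> n" for m
  proof -
    have "of_nat m * G n $ m = (fps_X * fps_deriv (G n)) $ m" using m by (simp add: fps_deriv_nth)
    also have "\<dots> = (\<Sum>i=1..n. (fps_const (of_nat i * L i) * (fps_X ^ i * G n)) $ m)"
      unfolding XG by (simp add: sum_distrib_right fps_sum_nth mult.assoc)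
    also have "\<dots> = (\<Sum>i=1..n. if i \<le> m then of_nat i * L i * G n $ (m - i) else 0)"
      by (intro sum.cong refl) (auto simp: fps_X_power_mult_nth)
    also have "\<dots> = (\<Sum>i=1..m. of_nat i * L i * G n $ (m - i))"
      using m by (intro sum.mono_neutral_cong_right) auto
    finally show ?thesis .
  qed
  have FG: "F m = G n $ m" if "m \<le> n" for m
    using that
  proof (induction m rule: less_induct)
    case (less m)
    show ?case
    proof (cases "m = 0")
      case False
      then have m: "1 \<le> m" by simp
      have "of_nat m * F m = of_nat m * G n $ m"
        unfolding F[OF m less.prems] Grec[OF m less.prems]
        using less by (intro sum.cong refl) auto
      then show ?thesis using False by simp
    qed (simp add: F0 G0)
  qed
  have J'sum: "sum f S \<in> J'" if "finite S" "\<And>x. x \<in> S \<Longrightarrow> f x \<in> J'" for f and S :: "nat set"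
    using that by (induction S rule: finite_induct) (auto intro: J0 Jadd)
  \<comment> \<open>The factors are multiplied in one at a time; every mixed term is a product of
    two coefficients from \<open>J\<close>.\<close>
  have bound: "\<forall>k. 1 \<le> k \<longrightarrow> k \<le> n \<longrightarrow> G j $ k - (if k \<le> j then L k else 0) \<in> J'" if "j \<le> n" for j
    using that
  proof (induction j)
    case 0
    show ?case using J0 by (simp add: G_def)
  next
    case (Suc j)
    then have IH: "G j $ k - (if k \<le> j then L k else 0) \<in> J'" if "1 \<le> k" "k \<le> n" for k using that by auto
    have GJ: "G j $ k \<in> J" if "1 \<le> k" "k \<le> n" for k
    proof (cases "k \<le> j")
      case True
      then have "(G j $ k - L k) + L k \<in> J" using IH[OF that] L[OF that] JJ(1) by (intro JJ(2)) auto
      then show ?thesis by simp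
    next
      case False
      then show ?thesis using IH[OF that] JJ(1) by auto
    qed
    have EJ: "E (Suc j) $ k - (if k = Suc j then L k else 0) \<in> J'" if k: "1 \<le> k" "k \<le> n" for k
    proof (cases "Suc j dvd k")
      case True
      then obtain m where m: "k = Suc j * m" by (elim dvdE)
      show ?thesis
      proof (cases "m \<ge> 2")
        case True
        then have "Suc j * 2 \<le> k" unfolding m by (intro mult_le_mono2)
        then have "k \<noteq> Suc j" by simp
        moreover have "L (Suc j) ^ m / fact m \<in> J'" using Lm[of "Suc j" m] True m k by simp
        moreover have "k div Suc j = m" using m by (simp del: mult_Suc)
        ultimately show ?thesis using \<open>Suc j dvd k\<close> by (simp add: E_def)
      next
        case False
        then have "m = 1" using m k by (cases m) auto
        then show ?thesis using m J0 by (simp add: E_def)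
      qed
    next
      case False
      then show ?thesis using J0 by (auto simp: E_def)
    qed
    show ?case
    proof (intro allI impI)
      fix k assume k: "1 \<le> k" "k \<le> n"
      have "G (Suc j) $ k = (\<Sum>i=0..k. G j $ i * E (Suc j) $ (k - i))"
        by (simp add: G_def fps_mult_nth)
      also have "\<dots> = E (Suc j) $ k + (\<Sum>i=1..k. G j $ i * E (Suc j) $ (k - i))"
        by (simp add: sum.atLeast_Suc_atMost G0)
      also have "(\<Sum>i=1..k. G j $ i * E (Suc j) $ (k - i)) =
          G j $ k + (\<Sum>i\<in>{1..<k}. G j $ i * E (Suc j) $ (k - i))"
      proof -
        have "{1..k} = insert k {1..<k}" using k by auto
        then show ?thesis by (simp add: E0)
      qed
      finally have eq: "G (Suc j) $ k - (if k \<le> Suc j then L k else 0) =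
         (E (Suc j) $ k - (if k = Suc j then L k else 0)) + (G j $ k - (if k \<le> j then L k else 0))
         + (\<Sum>i\<in>{1..<k}. G j $ i * E (Suc j) $ (k - i))"
        by (auto split: if_splits)
      have "E (Suc j) $ i \<in> J" if i: "1 \<le> i" "i \<le> n" for i
      proof -
        have "(E (Suc j) $ i - (if i = Suc j then L i else 0)) + (if i = Suc j then L i else 0) \<in> J"
          using EJ[OF i] JJ(1) L[OF i] J0 by (intro JJ(2)) auto
        then show ?thesis by simp
      qed
      then have "(\<Sum>i\<in>{1..<k}. G j $ i * E (Suc j) $ (k - i)) \<in> J'"
        using k GJ by (intro J'sum JJ(3)) auto
      then show "G (Suc j) $ k - (if k \<le> Suc j then L k else 0) \<in> J'"
        unfolding eq using EJ[OF k] IH[OF k] Jadd by blast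
    qed
  qed
  show ?thesis using bound[of n] FG[of k] k by auto
qed

subsection \<open>Cyclic algebras over subrings of a field\<close>

lemma add_diff_mod_eq: "(k + N - i) mod N = (if k < i then k + N - i else k - i)"
  if "i < N" "k < N" for i k N :: nat
proof (cases "k < i")
  case False
  then have "k + N - i = k - i + N" by simp
  then have "(k + N - i) mod N = (k - i + N) mod N" by (rule arg_cong)
  also have "\<dots> = k - i" using that by simp
  finally show ?thesis using False by simp
qed (use that in simp)

text \<open>Here \<open>K\<close> is just a subring of the field, so that the order over
  \<open>B\<close> and the algebra over the fraction field become two instances with the same
  multiplication formula.\<close>

locale cyclic_ring =
  fixes K :: "'a::field set" and g :: "'a \<Rightarrow> 'a" and N :: nat and a :: 'a
  assumes N_pos: "N > 0"
    and K_0 [simp]: "0 \<in> K" and K_1 [simp]: "1 \<in> K"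
    and K_add [simp]: "\<And>x y. x \<in> K \<Longrightarrow> y \<in> K \<Longrightarrow> x + y \<in> K"
    and K_mult [simp]: "\<And>x y. x \<in> K \<Longrightarrow> y \<in> K \<Longrightarrow> x * y \<in> K"
    and K_uminus [simp]: "\<And>x. x \<in> K \<Longrightarrow> - x \<in> K"
    and a_K [simp]: "a \<in> K"
    and g_K [simp]: "\<And>x. x \<in> K \<Longrightarrow> g x \<in> K"
    and g_add: "\<And>x y. x \<in> K \<Longrightarrow> y \<in> K \<Longrightarrow> g (x + y) = g x + g y"
    and g_mult: "\<And>x y. x \<in> K \<Longrightarrow> y \<in> K \<Longrightarrow> g (x * y) = g x * g y"
    and g_1: "g 1 = 1"
    and g_a: "g a = a"
    and g_N: "\<And>x. x \<in> K \<Longrightarrow> (g ^^ N) x = x"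
begin

abbreviation D :: "(nat \<Rightarrow> 'a) ring" where "D \<equiv> cyclic_algebra K g N a"

lemma K_diff [simp]: "x \<in> K \<Longrightarrow> y \<in> K \<Longrightarrow> x - y \<in> K"
  using K_add[of x "- y"] by simp

lemma K_sum [simp]: "(\<And>i. i \<in> I \<Longrightarrow> f i \<in> K) \<Longrightarrow> sum f I \<in> K"
  by (induction I rule: infinite_finite_induct) auto

lemma K_prod [simp]: "(\<And>i. i \<in> I \<Longrightarrow> f i \<in> K) \<Longrightarrow> prod f I \<in> K"
  by (induction I rule: infinite_finite_induct) auto

lemma K_power [simp]: "x \<in> K \<Longrightarrow> x ^ n \<in> K"
  by (induction n) auto

lemma K_of_nat [simp]: "of_nat n \<in> K"
  by (induction n) auto

lemma g_0: "g 0 = 0"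
  using g_add[of 0 0] by (metis K_0 add_0 add_cancel_right_right)

lemma g_uminus: "x \<in> K \<Longrightarrow> g (- x) = - g x"
  using g_add[of x "- x"] by (simp add: g_0 eq_neg_iff_add_eq_0 add.commute)

lemma g_diff: "x \<in> K \<Longrightarrow> y \<in> K \<Longrightarrow> g (x - y) = g x - g y"
  using g_add[of x "- y"] by (simp add: g_uminus)

lemma gi_K [simp]: "x \<in> K \<Longrightarrow> (g ^^ i) x \<in> K"
  by (induction i) auto

lemma gi_0 [simp]: "(g ^^ i) 0 = 0"
  by (induction i) (auto simp: g_0)

lemma gi_1 [simp]: "(g ^^ i) 1 = 1"
  by (induction i) (auto simp: g_1)

lemma gi_a [simp]: "(g ^^ i) a = a"
  by (induction i) (auto simp: g_a)

lemma gi_add: "x \<in> K \<Longrightarrow> y \<in> K \<Longrightarrow> (g ^^ i) (x + y) = (g ^^ i) x + (g ^^ i) y"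
  by (induction i) (auto simp: g_add)

lemma gi_mult: "x \<in> K \<Longrightarrow> y \<in> K \<Longrightarrow> (g ^^ i) (x * y) = (g ^^ i) x * (g ^^ i) y"
  by (induction i) (auto simp: g_mult)

lemma gi_diff: "x \<in> K \<Longrightarrow> y \<in> K \<Longrightarrow> (g ^^ i) (x - y) = (g ^^ i) x - (g ^^ i) y"
  by (induction i) (auto simp: g_diff)

lemma gi_sum: "(\<And>j. j \<in> I \<Longrightarrow> f j \<in> K) \<Longrightarrow> (g ^^ i) (sum f I) = (\<Sum>j\<in>I. (g ^^ i) (f j))"
  by (induction I rule: infinite_finite_induct) (auto simp: gi_add)

lemma gi_prod: "(\<And>j. j \<in> I \<Longrightarrow> f j \<in> K) \<Longrightarrow> (g ^^ i) (prod f I) = (\<Prod>j\<in>I. (g ^^ i) (f j))"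
  by (induction I rule: infinite_finite_induct) (auto simp: gi_mult)

lemma gi_power: "x \<in> K \<Longrightarrow> (g ^^ i) (x ^ n) = (g ^^ i) x ^ n"
  by (induction n) (auto simp: gi_mult)

lemma gi_of_nat: "(g ^^ i) (of_nat n) = of_nat n"
  by (induction n) (auto simp: gi_add)

lemma gi_gi: "(g ^^ i) ((g ^^ j) x) = (g ^^ (i + j)) x"
  by (simp add: funpow_add)

lemma gi_mod: "x \<in> K \<Longrightarrow> (g ^^ (i mod N)) x = (g ^^ i) x"
proof -
  assume x: "x \<in> K"
  have "(g ^^ (N * k + l)) x = (g ^^ l) x" for k l
  proof (induction k)
    case (Suc k)
    have "(g ^^ (N * Suc k + l)) x = (g ^^ N) ((g ^^ (N * k + l)) x)"
      by (simp only: gi_gi mult_Suc_right add.assoc)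
    then show ?case using Suc x by (simp add: g_N)
  qed simp
  from this[of "i div N" "i mod N"] show ?thesis by simp
qed

lemma carrier_iff: "x \<in> carrier D \<longleftrightarrow> (\<forall>j<N. x j \<in> K) \<and> (\<forall>j\<ge>N. x j = 0)"
  unfolding cyclic_algebra_def by (simp only: partial_object.select_convs mem_Collect_eq)

lemma carrier_nth [simp]: "x \<in> carrier D \<Longrightarrow> x j \<in> K"
  by (cases "j < N") (auto simp: carrier_iff)

lemma carrier_nth_0: "x \<in> carrier D \<Longrightarrow> j \<ge> N \<Longrightarrow> x j = 0"
  by (simp add: carrier_iff)

lemma add_nth: "(x \<oplus>\<^bsub>D\<^esub> y) k = x k + y k"
  unfolding cyclic_algebra_def by (simp only: ring.select_convs)

lemma zero_nth: "\<zero>\<^bsub>D\<^esub> k = 0"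
  unfolding cyclic_algebra_def by (simp only: ring.select_convs)

lemma one_eq: "\<one>\<^bsub>D\<^esub> = cyc_monom 1 0"
  unfolding cyclic_algebra_def by (simp only: monoid.select_convs)

lemma mult_nth': "(x \<otimes>\<^bsub>D\<^esub> y) k = (\<Sum>i<N. \<Sum>j<N.
    if (i + j) mod N = k then x i * (g ^^ i) (y j) * a ^ ((i + j) div N) else 0)"
  unfolding cyclic_algebra_def by (simp only: monoid.select_convs)

text \<open>The coefficient at \<open>u ^ j\<close> of \<open>u ^ i * d\<close>; the factor
  \<open>a\<close> records the wrap-around \<open>u ^ N = a\<close>. These are the entries of the
  splitting matrix.\<close>

definition rm :: "(nat \<Rightarrow> 'a) \<Rightarrow> nat \<Rightarrow> nat \<Rightarrow> 'a" where
  "rm d i j = (g ^^ i) (d ((j + N - i) mod N)) * (if j < i then a else 1)"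

lemma rm_K [simp]: "x \<in> carrier D \<Longrightarrow> rm x i j \<in> K"
  by (simp add: rm_def)

lemma mult_nth: "(x \<otimes>\<^bsub>D\<^esub> y) k = (if k < N then \<Sum>i<N. x i * rm y i k else 0)"
proof (cases "k < N")
  case True
  have "(\<Sum>j<N. if (i + j) mod N = k then x i * (g ^^ i) (y j) * a ^ ((i + j) div N) else 0) = x i * rm y i k"
    if i: "i < N" for i
  proof -
    define j0 where "j0 = (k + N - i) mod N"
    have j0: "j0 < N" using N_pos by (simp add: j0_def)
    have uniq: "(i + j) mod N = k \<longleftrightarrow> j = j0" if "j < N" for j
    proof (cases "k < i")
      case True
      then have "j0 = k + N - i" using i by (simp add: j0_def)
      moreover have "(i + j) mod N = (if i + j < N then i + j else i + j - N)"
        using i that by (simp add: mod_if)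
      ultimately show ?thesis using that i True \<open>k < N\<close> by auto
    next
      case False
      then have "j0 = k - i" using \<open>k < N\<close> i by (simp add: j0_def add_diff_mod_eq)
      moreover have "(i + j) mod N = (if i + j < N then i + j else i + j - N)"
        using i that by (simp add: mod_if)
      ultimately show ?thesis using that i False \<open>k < N\<close> by auto
    qed
    have dv: "(i + j0) div N = (if k < i then 1 else 0)"
    proof (cases "k < i")
      case True
      then have "i + j0 = k + N" using i by (simp add: j0_def)
      then show ?thesis using True \<open>k < N\<close> by simp
    next
      case False
      then have "i + j0 = k" using \<open>k < N\<close> False i by (simp add: j0_def add_diff_mod_eq)
      then show ?thesis using False \<open>k < N\<close> by simp
    qed
    have "(\<Sum>j<N. if (i + j) mod N = k then x i * (g ^^ i) (y j) * a ^ ((i + j) div N) else 0) =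
        (\<Sum>j<N. if j = j0 then x i * (g ^^ i) (y j0) * a ^ ((i + j0) div N) else 0)"
      by (intro sum.cong refl) (auto simp: uniq)
    also have "\<dots> = x i * (g ^^ i) (y j0) * a ^ ((i + j0) div N)" using j0 by simp
    finally show ?thesis unfolding dv by (simp add: rm_def j0_def mult.assoc)
  qed
  then show ?thesis using True by (simp add: mult_nth')
next
  case False
  have "(i + j) mod N \<noteq> k" for i j using False N_pos by (metis mod_less_divisor)
  then show ?thesis using False by (simp add: mult_nth')
qed

text \<open>Comparison of coefficients in \<open>(u ^ i * y) * z = u ^ i * (y * z)\<close>. This one
  identity yields associativity as well as the multiplicativity of the splitting matrix, hence of
  the reduced norm.\<close>

lemma rm_mult:
  assumes y: "y \<in> carrier D" and z: "z \<in> carrier D" and i: "i < N" and k: "k < N"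
  shows "rm (y \<otimes>\<^bsub>D\<^esub> z) i k = (\<Sum>m<N. rm y i m * rm z m k)"
proof -
  define k' where "k' = (k + N - i) mod N"
  have k': "k' = (if k < i then k + N - i else k - i)"
    using i k by (simp add: k'_def add_diff_mod_eq)
  have k'N: "k' < N" using N_pos by (simp add: k'_def)
  \<comment> \<open>Under the substitution \<open>m = (i + l) mod N\<close> the factors
    \<open>a\<close> match, because both sides count how often the exponent passes
    \<open>N\<close>.\<close>
  have key: "(g ^^ i) (rm z l k') * (if k < i then a else 1) = (if (i + l) mod N < i then a else 1) * rm z ((i + l) mod N) k"
    if l: "l < N" for l
  proof -
    define m where "m = (i + l) mod N"
    have m: "m = (if i + l < N then i + l else i + l - N)" using i l by (simp add: m_def mod_if)
    have idx: "(k' + N - l) mod N = (k + N - m) mod N"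
    proof -
      have "int ((k' + N - l) mod N) = int ((k + N - m) mod N)"
      proof -
        have "int (k' + N - l) = int k' + int N - int l" using l by (simp add: of_nat_diff)
        then have e1: "int ((k' + N - l) mod N) = (int k' + int N - int l) mod int N"
          by (simp only: zmod_int)
        have "m < N" using N_pos by (simp add: m_def)
        then have "int (k + N - m) = int k + int N - int m" by (simp add: of_nat_diff)
        then have e2: "int ((k + N - m) mod N) = (int k + int N - int m) mod int N"
          by (simp only: zmod_int)
        have "int k' = int k - int i + (if k < i then int N else 0)"
          using k' i by (auto simp: of_nat_diff)
        moreover have "int m = int i + int l - (if i + l < N then 0 else int N)"
          using m by (auto simp: of_nat_diff)
        ultimately have "(int k' + int N - int l) - (int k + int N - int m) = 
           (if k < i then int N else 0) - (if i + l < N then 0 else int N)" by simp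
        then have "int N dvd (int k' + int N - int l) - (int k + int N - int m)" by auto
        then show ?thesis unfolding e1 e2 by (simp add: mod_eq_dvd_iff)
      qed
      then show ?thesis by simp
    qed
    have "(g ^^ i) (rm z l k') = (g ^^ (i + l)) (z ((k + N - m) mod N)) * (if k' < l then a else 1)"
      using z by (auto simp: rm_def idx gi_mult gi_gi)
    also have "(g ^^ (i + l)) (z ((k + N - m) mod N)) = (g ^^ m) (z ((k + N - m) mod N))"
      using z by (simp add: m_def gi_mod)
    finally have L: "(g ^^ i) (rm z l k') = (g ^^ m) (z ((k + N - m) mod N)) * (if k' < l then a else 1)" .
    have "(if k' < l then a else 1) * (if k < i then a else 1) = (if m < i then a else 1) * (if k < m then a else 1)"
      using k' m i l k by auto
    then show ?thesis unfolding L m_def[symmetric] by (simp add: rm_def mult_ac)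
  qed
  have "rm (y \<otimes>\<^bsub>D\<^esub> z) i k = (\<Sum>l<N. (g ^^ i) (y l) * ((g ^^ i) (rm z l k') * (if k < i then a else 1)))"
  proof -
    have "rm (y \<otimes>\<^bsub>D\<^esub> z) i k = (g ^^ i) (\<Sum>l<N. y l * rm z l k') * (if k < i then a else 1)"
      using k'N by (simp add: rm_def mult_nth k'_def[symmetric])
    also have "(g ^^ i) (\<Sum>l<N. y l * rm z l k') = (\<Sum>l<N. (g ^^ i) (y l) * (g ^^ i) (rm z l k'))"
      using y z by (simp add: gi_sum gi_mult)
    finally show ?thesis by (simp only: sum_distrib_right mult.assoc)
  qed
  also have "\<dots> = (\<Sum>l<N. (g ^^ i) (y l) * ((if (i + l) mod N < i then a else 1) * rm z ((i + l) mod N) k))"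
    by (intro sum.cong refl) (simp only: key lessThan_iff)
  also have "\<dots> = (\<Sum>m<N. rm y i m * rm z m k)"
  proof (rule sum.reindex_bij_witness[of _ "\<lambda>m. (m + N - i) mod N" "\<lambda>l. (i + l) mod N"])
    fix l assume "l \<in> {..<N}"
    then have l: "l < N" by simp
    have m: "(i + l) mod N = (if i + l < N then i + l else i + l - N)" using i l by (simp add: mod_if)
    have inv: "((i + l) mod N + N - i) mod N = l"
    proof (cases "i + l < N")
      case False
      then have "(i + l) mod N + N - i = l" using m i by simp
      then show ?thesis using l by simp
    qed (use l i in \<open>simp add: m\<close>)
    then show "((i + l) mod N + N - i) mod N = l" .
    show "(i + l) mod N \<in> {..<N}" using N_pos by simp
    show "rm y i ((i + l) mod N) * rm z ((i + l) mod N) k =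
        (g ^^ i) (y l) * ((if (i + l) mod N < i then a else 1) * rm z ((i + l) mod N) k)"
      unfolding rm_def[of y] inv by (simp add: mult.assoc)
  next
    fix m assume "m \<in> {..<N}"
    then have m: "m < N" by simp
    show "(m + N - i) mod N \<in> {..<N}" using N_pos by simp
    show "(i + (m + N - i) mod N) mod N = m"
    proof -
      have "(i + (m + N - i) mod N) mod N = (i + (m + N - i)) mod N" by (rule mod_add_right_eq)
      also have "i + (m + N - i) = m + N" using i by (intro le_add_diff_inverse) simp
      finally show ?thesis using m by simp
    qed
  qed
  finally show ?thesis .
qed

lemma mult_closed: "x \<in> carrier D \<Longrightarrow> y \<in> carrier D \<Longrightarrow> x \<otimes>\<^bsub>D\<^esub> y \<in> carrier D"
  unfolding carrier_iff[of "x \<otimes>\<^bsub>D\<^esub> y"] by (auto simp: mult_nth)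

lemma mult_assoc:
  assumes x: "x \<in> carrier D" and y: "y \<in> carrier D" and z: "z \<in> carrier D"
  shows "(x \<otimes>\<^bsub>D\<^esub> y) \<otimes>\<^bsub>D\<^esub> z = x \<otimes>\<^bsub>D\<^esub> (y \<otimes>\<^bsub>D\<^esub> z)"
proof
  fix k
  show "((x \<otimes>\<^bsub>D\<^esub> y) \<otimes>\<^bsub>D\<^esub> z) k = (x \<otimes>\<^bsub>D\<^esub> (y \<otimes>\<^bsub>D\<^esub> z)) k"
  proof (cases "k < N")
    case True
    have "((x \<otimes>\<^bsub>D\<^esub> y) \<otimes>\<^bsub>D\<^esub> z) k = (\<Sum>m<N. (\<Sum>i<N. x i * rm y i m) * rm z m k)"
      using True by (simp add: mult_nth)
    also have "\<dots> = (\<Sum>i<N. \<Sum>m<N. x i * (rm y i m * rm z m k))"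
      unfolding sum_distrib_right mult.assoc by (rule sum.swap)
    also have "\<dots> = (\<Sum>i<N. x i * rm (y \<otimes>\<^bsub>D\<^esub> z) i k)"
      using y z True by (intro sum.cong refl) (simp add: rm_mult sum_distrib_left)
    finally show ?thesis using True by (simp add: mult_nth)
  qed (simp add: mult_nth)
qed

lemma cyc_monom_carrier [simp]: "b \<in> K \<Longrightarrow> i < N \<Longrightarrow> cyc_monom b i \<in> carrier D"
  by (auto simp: carrier_iff cyc_monom_def)

lemma monom_mult_nth:
  assumes "i < N"
  shows "(cyc_monom b i \<otimes>\<^bsub>D\<^esub> x) k = (if k < N then b * rm x i k else 0)"
proof (cases "k < N")
  case True
  have "(cyc_monom b i \<otimes>\<^bsub>D\<^esub> x) k = (\<Sum>l<N. if l = i then b * rm x i k else 0)"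
    unfolding mult_nth if_P[OF True] by (intro sum.cong refl) (auto simp: cyc_monom_def)
  then show ?thesis using True assms by simp
qed (simp add: mult_nth)

lemma rm_const: "i < N \<Longrightarrow> k < N \<Longrightarrow> rm (cyc_monom b 0) i k = (if k = i then (g ^^ i) b else 0)"
proof -
  assume i: "i < N" and k: "k < N"
  have "(k + N - i) mod N = 0 \<longleftrightarrow> k = i"
    using i k by (auto simp: add_diff_mod_eq)
  then show ?thesis by (auto simp: rm_def cyc_monom_def)
qed

lemma mult_const_nth: "(x \<otimes>\<^bsub>D\<^esub> cyc_monom b 0) k = (if k < N then x k * (g ^^ k) b else 0)"
proof (cases "k < N")
  case True
  have "(x \<otimes>\<^bsub>D\<^esub> cyc_monom b 0) k = (\<Sum>i<N. if i = k then x k * (g ^^ k) b else 0)"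
    unfolding mult_nth if_P[OF True] using True by (intro sum.cong refl) (auto simp: rm_const)
  then show ?thesis using True by simp
qed (simp add: mult_nth)

lemma const_mult_nth: "x \<in> carrier D \<Longrightarrow> (cyc_monom b 0 \<otimes>\<^bsub>D\<^esub> x) k = b * x k"
  using N_pos by (cases "k < N") (simp_all add: monom_mult_nth rm_def carrier_nth_0)

sublocale ring: Ring.ring D
proof (rule ringI)
  show "abelian_group D"
  proof (rule abelian_groupI)
    fix x assume x: "x \<in> carrier D"
    show "\<exists>y\<in>carrier D. y \<oplus>\<^bsub>D\<^esub> x = \<zero>\<^bsub>D\<^esub>"
      using x by (intro bexI[of _ "\<lambda>k. - x k"] ext) (auto simp: add_nth zero_nth carrier_iff)
  qed (auto simp: carrier_iff add_nth zero_nth fun_eq_iff add.assoc add.commute)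
  show "monoid D"
  proof (rule monoidI)
    show "\<one>\<^bsub>D\<^esub> \<in> carrier D" using N_pos by (simp add: one_eq)
    fix x assume x: "x \<in> carrier D"
    show "\<one>\<^bsub>D\<^esub> \<otimes>\<^bsub>D\<^esub> x = x" using x by (auto simp: one_eq const_mult_nth)
    show "x \<otimes>\<^bsub>D\<^esub> \<one>\<^bsub>D\<^esub> = x" using x by (auto simp: one_eq mult_const_nth carrier_nth_0)
  qed (auto simp: mult_closed mult_assoc)
  fix x y z assume xyz: "x \<in> carrier D" "y \<in> carrier D" "z \<in> carrier D"
  show "(x \<oplus>\<^bsub>D\<^esub> y) \<otimes>\<^bsub>D\<^esub> z = x \<otimes>\<^bsub>D\<^esub> z \<oplus>\<^bsub>D\<^esub> y \<otimes>\<^bsub>D\<^esub> z"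
    by (auto simp: fun_eq_iff add_nth mult_nth distrib_right sum.distrib)
  have "rm (x \<oplus>\<^bsub>D\<^esub> y) i k = rm x i k + rm y i k" for i k
    using xyz by (simp add: rm_def add_nth gi_add distrib_right)
  then show "z \<otimes>\<^bsub>D\<^esub> (x \<oplus>\<^bsub>D\<^esub> y) = z \<otimes>\<^bsub>D\<^esub> x \<oplus>\<^bsub>D\<^esub> z \<otimes>\<^bsub>D\<^esub> y"
    by (auto simp: fun_eq_iff add_nth mult_nth distrib_left sum.distrib)
qed

lemma a_inv_nth:
  assumes "x \<in> carrier D" shows "(\<ominus>\<^bsub>D\<^esub> x) k = - x k"
proof -
  have "\<ominus>\<^bsub>D\<^esub> x \<oplus>\<^bsub>D\<^esub> x = \<zero>\<^bsub>D\<^esub>" using assms by (rule ring.l_neg)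
  then have "(\<ominus>\<^bsub>D\<^esub> x) k + x k = 0" by (metis add_nth zero_nth)
  then show ?thesis by (simp add: eq_neg_iff_add_eq_0)
qed

lemma a_minus_nth: "x \<in> carrier D \<Longrightarrow> y \<in> carrier D \<Longrightarrow> (x \<ominus>\<^bsub>D\<^esub> y) k = x k - y k"
  by (simp add: a_minus_def add_nth a_inv_nth)

section \<open>The splitting matrix, the reduced norm and the trace\<close>

lemma splitting_matrix_carrier [simp]: "splitting_matrix D N x \<in> carrier_mat N N"
  by (simp add: splitting_matrix_def)

lemma splitting_matrix_nth: "i < N \<Longrightarrow> j < N \<Longrightarrow> splitting_matrix D N x $$ (i, j) = rm x i j"
  by (simp add: splitting_matrix_def monom_mult_nth)

lemma splitting_matrix_mult:
  assumes "x \<in> carrier D" "y \<in> carrier D"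
  shows "splitting_matrix D N (x \<otimes>\<^bsub>D\<^esub> y) = splitting_matrix D N x * splitting_matrix D N y"
proof (rule eq_matI)
  fix i j assume "i < dim_row (splitting_matrix D N x * splitting_matrix D N y)"
     "j < dim_col (splitting_matrix D N x * splitting_matrix D N y)"
  then have ij: "i < N" "j < N" by (simp_all add: splitting_matrix_def)
  have d: "dim_row (splitting_matrix D N z) = N" "dim_col (splitting_matrix D N z) = N" for z
    by (simp_all add: splitting_matrix_def)
  show "splitting_matrix D N (x \<otimes>\<^bsub>D\<^esub> y) $$ (i, j) = (splitting_matrix D N x * splitting_matrix D N y) $$ (i, j)"
    using ij assms by (simp add: splitting_matrix_nth rm_mult scalar_prod_def atLeast0LessThan d)
qed (simp_all add: splitting_matrix_def)

lemma splitting_matrix_one: "splitting_matrix D N \<one>\<^bsub>D\<^esub> = 1\<^sub>m N"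
proof (rule eq_matI)
  fix i j assume "i < dim_row (1\<^sub>m N :: 'a mat)" "j < dim_col (1\<^sub>m N :: 'a mat)"
  then show "splitting_matrix D N \<one>\<^bsub>D\<^esub> $$ (i, j) = 1\<^sub>m N $$ (i, j)"
    by (auto simp: splitting_matrix_nth one_eq rm_const)
qed (simp_all add: splitting_matrix_def)

lemma splitting_matrix_add:
  assumes "x \<in> carrier D" "y \<in> carrier D"
  shows "splitting_matrix D N (x \<oplus>\<^bsub>D\<^esub> y) = splitting_matrix D N x + splitting_matrix D N y"
proof (rule eq_matI)
  fix i j assume "i < dim_row (splitting_matrix D N x + splitting_matrix D N y)"
     "j < dim_col (splitting_matrix D N x + splitting_matrix D N y)"
  then have ij: "i < N" "j < N" by (simp_all add: splitting_matrix_def)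
  have d: "dim_row (splitting_matrix D N z) = N" "dim_col (splitting_matrix D N z) = N" for z
    by (simp_all add: splitting_matrix_def)
  show "splitting_matrix D N (x \<oplus>\<^bsub>D\<^esub> y) $$ (i, j) = (splitting_matrix D N x + splitting_matrix D N y) $$ (i, j)"
    using ij assms by (simp add: splitting_matrix_nth d rm_def add_nth gi_add distrib_right)
qed (simp_all add: splitting_matrix_def)

lemma splitting_matrix_pow:
  assumes "x \<in> carrier D"
  shows "splitting_matrix D N (x [^]\<^bsub>D\<^esub> (k::nat)) = splitting_matrix D N x ^\<^sub>m k"
proof (induction k)
  case 0
  show ?case by (simp add: splitting_matrix_one) (simp add: splitting_matrix_def)
next
  case (Suc k)
  then show ?case using assms by (simp add: splitting_matrix_mult)
qed

lemma reduced_norm_mult: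
  "x \<in> carrier D \<Longrightarrow> y \<in> carrier D \<Longrightarrow>
    reduced_norm D N (x \<otimes>\<^bsub>D\<^esub> y) = reduced_norm D N x * reduced_norm D N y"
  unfolding reduced_norm_def by (simp add: splitting_matrix_mult det_mult[OF splitting_matrix_carrier splitting_matrix_carrier])

lemma reduced_norm_one: "reduced_norm D N \<one>\<^bsub>D\<^esub> = 1"
  by (simp add: reduced_norm_def splitting_matrix_one)

definition Tr :: "'a \<Rightarrow> 'a" where "Tr x = (\<Sum>l<N. (g ^^ l) x)"

text \<open>The diagonal entries are the conjugates of the coefficient at \<open>u ^ 0\<close>; no
  other coefficient reaches the diagonal.\<close>

lemma mat_trace_splitting_matrix: "mat_trace (splitting_matrix D N x) = Tr (x 0)"
proof -
  have "rm x i i = (g ^^ i) (x 0)" for i by (simp add: rm_def)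
  moreover have "dim_row (splitting_matrix D N x) = N" by (simp add: splitting_matrix_def)
  ultimately show ?thesis
    by (simp add: mat_trace_def Tr_def splitting_matrix_nth)
qed

lemma reduced_norm_newton:
  assumes z: "z \<in> carrier D"
  obtains F where "F 0 = 1" and "reduced_norm D N (\<one>\<^bsub>D\<^esub> \<oplus>\<^bsub>D\<^esub> z) = (\<Sum>m\<le>N. F m)"
    and "\<And>m. 1 \<le> m \<Longrightarrow> m \<le> N \<Longrightarrow>
      of_nat m * F m = (\<Sum>i=1..m. (-1) ^ (i + 1) * Tr ((z [^]\<^bsub>D\<^esub> i) 0) * F (m - i))"
proof -
  from det_one_plus_newton[OF splitting_matrix_carrier[of z]] obtain F where F: "F 0 = 1"
    "Determinant.det (1\<^sub>m N + splitting_matrix D N z) = (\<Sum>m\<le>N. F m)"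
    "\<And>m. 1 \<le> m \<Longrightarrow> m \<le> N \<Longrightarrow>
      of_nat m * F m = (\<Sum>i=1..m. (-1) ^ (i + 1) * mat_trace (splitting_matrix D N z ^\<^sub>m i) * F (m - i))"
    by blast
  have 1: "reduced_norm D N (\<one>\<^bsub>D\<^esub> \<oplus>\<^bsub>D\<^esub> z) = (\<Sum>m\<le>N. F m)"
    using z F(2) by (simp add: reduced_norm_def splitting_matrix_add splitting_matrix_one)
  have 2: "mat_trace (splitting_matrix D N z ^\<^sub>m i) = Tr ((z [^]\<^bsub>D\<^esub> i) 0)" for i :: nat
    using z by (simp add: splitting_matrix_pow[symmetric] mat_trace_splitting_matrix)
  show ?thesis by (rule that[of F, OF F(1) 1]) (use F(3) in \<open>simp add: 2\<close>)
qed

lemma u_mult: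
  assumes x: "x \<in> carrier D" and N: "N > 1"
  shows "cyc_monom 1 1 \<otimes>\<^bsub>D\<^esub> x = (\<lambda>k. g (x k)) \<otimes>\<^bsub>D\<^esub> cyc_monom 1 1"
proof
  fix k
  show "(cyc_monom 1 1 \<otimes>\<^bsub>D\<^esub> x) k = ((\<lambda>k. g (x k)) \<otimes>\<^bsub>D\<^esub> cyc_monom 1 1) k"
  proof (cases "k < N")
    case True
    define j where "j = (k + N - 1) mod N"
    have j: "j < N" using N_pos by (simp add: j_def)
    have rmu: "rm (cyc_monom 1 1) i k = (if i = j then (if k < 1 then a else 1) else 0)" if i: "i < N" for i
    proof -
      have "(k + N - i) mod N = 1 \<longleftrightarrow> i = j"
      proof -
        have "j = (if k = 0 then N - 1 else k - 1)" using True N by (auto simp: j_def add_diff_mod_eq)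
        then show ?thesis using i True N by (auto simp: add_diff_mod_eq)
      qed
      moreover have "k < i \<longleftrightarrow> k < 1" if "i = j"
      proof -
        have "j = (if k = 0 then N - 1 else k - 1)" using True N by (auto simp: j_def add_diff_mod_eq)
        then show ?thesis using that N by auto
      qed
      ultimately show ?thesis by (auto simp: rm_def cyc_monom_def)
    qed
    have "((\<lambda>k. g (x k)) \<otimes>\<^bsub>D\<^esub> cyc_monom 1 1) k = (\<Sum>i<N. if i = j then g (x j) * (if k < 1 then a else 1) else 0)"
      unfolding mult_nth if_P[OF True] by (intro sum.cong refl) (auto simp: rmu[unfolded One_nat_def])
    also have "\<dots> = g (x j) * (if k < 1 then a else 1)" using j by simp
    also have "\<dots> = (cyc_monom 1 1 \<otimes>\<^bsub>D\<^esub> x) k"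
      using True N by (simp add: monom_mult_nth rm_def j_def)
    finally show ?thesis by simp
  qed (simp add: mult_nth)
qed

lemma monom_mult_monom:
  assumes "i < N" "j < N" "c \<in> K"
  shows "cyc_monom b i \<otimes>\<^bsub>D\<^esub> cyc_monom c j =
    cyc_monom (b * (g ^^ i) c * a ^ ((i + j) div N)) ((i + j) mod N)"
proof
  fix k
  show "(cyc_monom b i \<otimes>\<^bsub>D\<^esub> cyc_monom c j) k =
    cyc_monom (b * (g ^^ i) c * a ^ ((i + j) div N)) ((i + j) mod N) k"
  proof (cases "k < N")
    case True
    have "(k + N - i) mod N = j \<longleftrightarrow> k = (i + j) mod N"
    proof
      assume "(k + N - i) mod N = j"
      then have "(i + j) mod N = (i + (k + N - i)) mod N" by (metis mod_add_right_eq)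
      also have "i + (k + N - i) = k + N" using assms by (intro le_add_diff_inverse) simp
      finally show "k = (i + j) mod N" using True by simp
    next
      assume k: "k = (i + j) mod N"
      have ij: "(i + j) mod N = (if i + j < N then i + j else i + j - N)" using assms by (simp add: mod_if)
      show "(k + N - i) mod N = j"
      proof (cases "i + j < N")
        case False
        then have "k + N - i = j" using k ij assms by simp
        then show ?thesis using assms by simp
      qed (use k ij assms in simp)
    qed
    moreover have "(if k < i then a else 1) = a ^ ((i + j) div N)" if "k = (i + j) mod N"
    proof -
      have ij: "(i + j) mod N = (if i + j < N then i + j else i + j - N)" using assms by (simp add: mod_if)
      have dv: "(i + j) div N = (if i + j < N then 0 else 1)" using assms by (simp add: div_if)
      show ?thesis unfolding dv using that ij assms by auto
    qed
    moreover have "(cyc_monom b i \<otimes>\<^bsub>D\<^esub> cyc_monom c j) k = b * rm (cyc_monom c j) i k"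
      using True assms by (simp add: monom_mult_nth)
    ultimately show ?thesis
      by (auto simp: rm_def cyc_monom_def)
  next
    case False
    then show ?thesis using N_pos by (auto simp: mult_nth cyc_monom_def)
  qed
qed

text \<open>The coefficient is a product over an orbit of \<open>g ^ i\<close>. The computation of
  norms of monomials rests on such orbit products.\<close>

lemma monom_pow:
  assumes i: "i < N" and b: "b \<in> K"
  shows "cyc_monom b i [^]\<^bsub>D\<^esub> (k::nat) =
    cyc_monom ((\<Prod>l<k. (g ^^ (l * i)) b) * a ^ (i * k div N)) (i * k mod N)"
proof (induction k)
  case 0
  show ?case by (simp add: one_eq)
next
  case (Suc k)
  have lt: "i * k mod N < N" using N_pos by simp
  have "cyc_monom b i [^]\<^bsub>D\<^esub> Suc k =
      cyc_monom ((\<Prod>l<k. (g ^^ (l * i)) b) * a ^ (i * k div N)) (i * k mod N) \<otimes>\<^bsub>D\<^esub> cyc_monom b i"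
    using Suc by simp
  also have "\<dots> = cyc_monom ((\<Prod>l<k. (g ^^ (l * i)) b) * a ^ (i * k div N) * (g ^^ (i * k mod N)) b *
      a ^ ((i * k mod N + i) div N)) ((i * k mod N + i) mod N)"
    by (rule monom_mult_monom[OF lt i b])
  also have "(i * k mod N + i) mod N = i * Suc k mod N" by (metis mod_add_left_eq mult_Suc_right add.commute)
  also have "(g ^^ (i * k mod N)) b = (g ^^ (k * i)) b" using b by (simp add: gi_mod mult.commute)
  also have "(\<Prod>l<k. (g ^^ (l * i)) b) * a ^ (i * k div N) * (g ^^ (k * i)) b * a ^ ((i * k mod N + i) div N) =
     (\<Prod>l<Suc k. (g ^^ (l * i)) b) * a ^ (i * k div N + (i * k mod N + i) div N)"
    by (simp add: power_add mult_ac)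
  also have "i * k div N + (i * k mod N + i) div N = i * Suc k div N"
  proof -
    have "i * Suc k = N * (i * k div N) + (i * k mod N + i)" by simp
    then have "i * Suc k div N = (N * (i * k div N) + (i * k mod N + i)) div N" by (rule arg_cong)
    also have "\<dots> = i * k div N + (i * k mod N + i) div N" using N_pos by (subst div_mult_self4) simp_all
    finally show ?thesis by (simp add: add.commute)
  qed
  finally show ?case by simp
qed

lemma Tr_diff: "x \<in> K \<Longrightarrow> y \<in> K \<Longrightarrow> Tr (x - y) = Tr x - Tr y"
  by (simp add: Tr_def gi_diff sum_subtractf)

lemma Tr_sum: "(\<And>j. j \<in> I \<Longrightarrow> f j \<in> K) \<Longrightarrow> Tr (sum f I) = (\<Sum>j\<in>I. Tr (f j))"
  by (simp add: Tr_def gi_sum sum.swap[of _ I])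

lemma Tr_fixed_mult: "x \<in> K \<Longrightarrow> c \<in> K \<Longrightarrow> g c = c \<Longrightarrow> Tr (c * x) = c * Tr x"
proof -
  assume x: "x \<in> K" and c: "c \<in> K" and gc: "g c = c"
  have "(g ^^ l) c = c" for l by (induction l) (auto simp: gc)
  then show ?thesis using x c by (simp add: Tr_def gi_mult sum_distrib_left)
qed

lemma Tr_gi: "x \<in> K \<Longrightarrow> Tr ((g ^^ i) x) = Tr x"
proof (induction i)
  case (Suc i)
  define y where "y = (g ^^ i) x"
  have y: "y \<in> K" using Suc by (simp add: y_def)
  have "Tr (g y) = (\<Sum>l<N. (g ^^ Suc l) y)" by (simp add: Tr_def funpow_swap1)
  also have "\<dots> = (\<Sum>l=1..<Suc N. (g ^^ l) y)"
    by (simp only: One_nat_def sum.shift_bounds_Suc_ivl atLeast0LessThan[symmetric])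
  also have "\<dots> = (\<Sum>l=1..<N. (g ^^ l) y) + (g ^^ N) y" using N_pos by (simp add: atLeastLessThanSuc)
  also have "\<dots> = Tr y"
    using N_pos y unfolding Tr_def g_N[OF y] by (simp add: lessThan_atLeast0 sum.atLeast_Suc_lessThan)
  finally show ?case using Suc by (simp add: y_def)
qed simp

end

subsection \<open>Powers of \<open>1 + p\<^sup>r\<close>\<close>

lemma one_plus_power_expansion:
  fixes y :: "'a::comm_ring_1"
  shows "\<exists>z. (1 + y) ^ n = 1 + of_nat n * y + of_nat (n choose 2) * y\<^sup>2 + y ^ 3 * z"
proof (induction n)
  case 0
  show ?case by (intro exI[of _ 0]) (simp add: binomial_eq_0)
next
  case (Suc n)
  then obtain z where z: "(1 + y) ^ n = 1 + of_nat n * y + of_nat (n choose 2) * y\<^sup>2 + y ^ 3 * z" by blast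
  have "(1 + y) ^ Suc n = 1 + of_nat (Suc n) * y + (of_nat n + of_nat (n choose 2)) * y\<^sup>2
      + y ^ 3 * (z + y * z + of_nat (n choose 2))"
    by (simp add: z algebra_simps power2_eq_square power3_eq_cube)
  moreover have "Suc n choose 2 = n + (n choose 2)" by (simp add: numeral_2_eq_2)
  ultimately show ?case by (metis of_nat_add)
qed

text \<open>A \<open>p\<close>-th power moves the deviation from 1 up by exactly one power of
  \<open>p\<close>. The quadratic term is negligible because \<open>p\<close>, being odd, divides
  \<open>p choose 2\<close>, the cubic one because \<open>3 * m >= m + 2\<close>.\<close>

lemma cong_power_prime_step:
  fixes x c :: int
  assumes p: "prime p" "odd p" and m: "m \<ge> 1" and x: "[x = 1 + int p ^ m * c] (mod int p ^ (m + 1))"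
  shows "[x ^ p = 1 + int p ^ (m + 1) * c] (mod int p ^ (m + 2))"
proof -
  from x obtain d where d: "x = 1 + int p ^ m * c + int p ^ (m + 1) * d"
    by (metis cong_iff_lin cong_sym)
  define y where "y = int p ^ m * (c + int p * d)"
  have xy: "x = 1 + y" by (simp add: d y_def algebra_simps)
  obtain z where z: "(1 + y) ^ p = 1 + of_nat p * y + of_nat (p choose 2) * y\<^sup>2 + y ^ 3 * z"
    using one_plus_power_expansion by blast
  have p2: "p > 2" using p prime_gt_1_nat[of p] by (cases "p = 2") auto
  then have "p dvd (p choose 2)" using p by (intro dvd_choose_prime) auto
  then obtain b where b: "p choose 2 = p * b" by (elim dvdE)
  have "int p ^ m dvd y" by (simp add: y_def)
  have "int p ^ (m + 2) dvd int (p choose 2) * y\<^sup>2"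
  proof -
    have "int p ^ (m + 2) dvd int p ^ (1 + (m + m))" by (rule le_imp_power_dvd) (use m in simp)
    also have "\<dots> dvd int p * (y * y)"
      unfolding power_add power_one_right by (intro mult_dvd_mono dvd_refl \<open>int p ^ m dvd y\<close>)
    also have "\<dots> dvd int (p choose 2) * y\<^sup>2" by (simp add: b power2_eq_square)
    finally show ?thesis .
  qed
  moreover have "int p ^ (m + 2) dvd y ^ 3 * z"
  proof -
    have "int p ^ (m + 2) dvd int p ^ (m + m + m)" by (rule le_imp_power_dvd) (use m in simp)
    also have "\<dots> dvd y * y * y"
      unfolding power_add by (intro mult_dvd_mono \<open>int p ^ m dvd y\<close>)
    also have "\<dots> dvd y ^ 3 * z" by (simp add: power3_eq_cube)
    finally show ?thesis .
  qed
  moreover have "int p ^ (m + 2) dvd int p * y - int p ^ (m + 1) * c"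
    by (simp add: y_def algebra_simps)
  ultimately have "int p ^ (m + 2) dvd (int p * y - int p ^ (m + 1) * c) + int (p choose 2) * y\<^sup>2 + y ^ 3 * z"
    by (intro dvd_add)
  also have "\<dots> = x ^ p - (1 + int p ^ (m + 1) * c)" by (simp add: xy z)
  finally show ?thesis by (simp add: cong_iff_dvd_diff)
qed

lemma cong_one_plus_prime_power:
  assumes p: "prime p" "odd p" and r: "r \<ge> 1"
  shows "[(1 + int p ^ r) ^ (p ^ t * j) = 1 + int p ^ (r + t) * int j] (mod int p ^ (r + t + 1))"
proof -
  have 1: "[(1 + int p ^ r) ^ (p ^ t) = 1 + int p ^ (r + t) * 1] (mod int p ^ (r + t + 1))"
  proof (induction t)
    case (Suc t)
    have "[((1 + int p ^ r) ^ (p ^ t)) ^ p = 1 + int p ^ (r + t + 1) * 1] (mod int p ^ (r + t + 2))"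
      using r by (intro cong_power_prime_step[OF p _ Suc]) simp
    then show ?case by (simp add: power_mult[symmetric] mult.commute)
  qed simp
  define y where "y = int p ^ (r + t)"
  have "[((1 + int p ^ r) ^ (p ^ t)) ^ j = (1 + y) ^ j] (mod int p ^ (r + t + 1))"
    using 1 by (intro cong_pow) (simp add: y_def)
  moreover have "[(1 + y) ^ j = 1 + y * int j] (mod int p ^ (r + t + 1))"
  proof -
    obtain z where z: "(1 + y) ^ j = 1 + of_nat j * y + of_nat (j choose 2) * y\<^sup>2 + y ^ 3 * z"
      using one_plus_power_expansion by blast
    have "int p ^ (r + t + 1) dvd int p ^ ((r + t) + (r + t))" by (rule le_imp_power_dvd) (use r in simp)
    also have "\<dots> = y\<^sup>2" by (simp add: y_def power_add power2_eq_square)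
    also have "y\<^sup>2 dvd y\<^sup>2 * (of_nat (j choose 2) + y * z)" by simp
    also have "\<dots> = (1 + y) ^ j - (1 + y * int j)"
      by (simp add: z algebra_simps power2_eq_square power3_eq_cube)
    finally show ?thesis by (simp add: cong_iff_dvd_diff)
  qed
  ultimately show ?thesis by (metis cong_trans power_mult y_def)
qed

text \<open>Describes \<open>g ^ (p ^ t * j)\<close> on zeta: the exponent of zeta changes by
  \<open>p ^ (r + t)\<close> times a number congruent to \<open>j\<close>. It is stated for naturals
  because it is used inside exponents.\<close>

lemma one_plus_prime_power_expansion:
  assumes p: "prime p" "odd p" and r: "r \<ge> 1" and j: "j \<ge> 1"
  obtains c :: nat where "(1 + p ^ r) ^ (p ^ t * j) = 1 + p ^ (r + t) * c" and "[c = j] (mod p)"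
proof -
  have pt: "int p ^ (r + t) > 0" using p prime_gt_0_nat by simp
  have "int p ^ (r + t + 1) dvd (1 + int p ^ r) ^ (p ^ t * j) - (1 + int p ^ (r + t) * int j)"
    using cong_one_plus_prime_power[OF p r, of t j] by (simp add: cong_iff_dvd_diff)
  then obtain d where "(1 + int p ^ r) ^ (p ^ t * j) - (1 + int p ^ (r + t) * int j) = int p ^ (r + t + 1) * d"
    by (elim dvdE)
  then have d: "(1 + int p ^ r) ^ (p ^ t * j) = 1 + int p ^ (r + t) * int j + int p ^ (r + t + 1) * d"
    by (metis diff_add_cancel add.commute)
  define c where "c = int j + int p * d"
  have c: "(1 + int p ^ r) ^ (p ^ t * j) = 1 + int p ^ (r + t) * c" unfolding d by (simp add: c_def algebra_simps)
  have "(1 + int p ^ r) ^ (p ^ t * j) \<ge> 1" by (intro one_le_power) simp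
  then have "int p ^ (r + t) * c \<ge> 0" using c by simp
  then have c0: "c \<ge> 0" using pt by (metis mult_pos_neg not_le)
  have "int ((1 + p ^ r) ^ (p ^ t * j)) = int (1 + p ^ (r + t) * nat c)"
    using c c0 by simp
  then have "(1 + p ^ r) ^ (p ^ t * j) = 1 + p ^ (r + t) * nat c" by (simp only: of_nat_eq_iff)
  moreover have "[int (nat c) = int j] (mod int p)" using c0 by (simp add: c_def cong_def)
  ultimately show ?thesis using that by (metis cong_int_iff)
qed

declare One_nat_def [simp del]

subsection \<open>The arithmetic of a cyclotomic power series ring\<close>

text \<open>
  \<open>A \<subseteq> B\<close> are the power series rings over \<open>\<OO>\<^sub>r \<subseteq> \<OO>\<^bsub>r+s\<^esub>\<close>, \<open>K\<close> is the fraction field of \<open>B\<close>, and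
  \<open>I k\<close> is the ideal generated by \<open>\<Pi>\<^sup>k\<close>, where \<open>\<Pi> = 1 - \<zeta>\<close>.
\<close>

locale cyclotomic_order =
  fixes p r s :: nat and A B K :: "'a::field_char_0 set" and \<zeta> T :: 'a and g :: "'a \<Rightarrow> 'a"
  assumes p: "prime p" "odd p" and r: "r \<ge> 1" and s: "s \<ge> 1"
    and A_B: "\<And>x. x \<in> A \<Longrightarrow> x \<in> B" and B_K: "\<And>x. x \<in> B \<Longrightarrow> x \<in> K"
    and A_1: "1 \<in> A"
    and A_add: "\<And>x y. x \<in> A \<Longrightarrow> y \<in> A \<Longrightarrow> x + y \<in> A"
    and A_mult: "\<And>x y. x \<in> A \<Longrightarrow> y \<in> A \<Longrightarrow> x * y \<in> A"
    and A_uminus: "\<And>x. x \<in> A \<Longrightarrow> - x \<in> A"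
    and B_add: "\<And>x y. x \<in> B \<Longrightarrow> y \<in> B \<Longrightarrow> x + y \<in> B"
    and B_mult: "\<And>x y. x \<in> B \<Longrightarrow> y \<in> B \<Longrightarrow> x * y \<in> B"
    and B_uminus: "\<And>x. x \<in> B \<Longrightarrow> - x \<in> B"
    and K_frac: "\<And>x. x \<in> K \<longleftrightarrow> (\<exists>b\<in>B. \<exists>c\<in>B. c \<noteq> 0 \<and> x = b / c)"
    and T_A: "T \<in> A"
    and zeta_B: "\<zeta> \<in> B" and zeta_N_A: "\<zeta> ^ (p ^ s) \<in> A"
    and zeta_pow: "\<zeta> ^ (p ^ (r + s)) = 1" and zeta_pow_ne: "\<zeta> ^ (p ^ (r + s - 1)) \<noteq> 1"
    and span: "\<And>b. b \<in> B \<Longrightarrow> \<exists>c. (\<forall>j. c j \<in> A) \<and> b = (\<Sum>j<p ^ s. c j * \<zeta> ^ j)"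
    and one_not_max: "\<And>b c. b \<in> B \<Longrightarrow> c \<in> B \<Longrightarrow> (1 - \<zeta>) * b + T * c \<noteq> 1"
    and local: "\<And>x. x \<in> B \<Longrightarrow> (\<exists>b\<in>B. \<exists>c\<in>B. x = (1 - \<zeta>) * b + T * c) \<or> (\<exists>y\<in>B. x * y = 1)"
    and prime_Pi: "\<And>x y b. x \<in> B \<Longrightarrow> y \<in> B \<Longrightarrow> b \<in> B \<Longrightarrow> x * y = (1 - \<zeta>) * b \<Longrightarrow>
        (\<exists>b\<in>B. x = (1 - \<zeta>) * b) \<or> (\<exists>b\<in>B. y = (1 - \<zeta>) * b)"
    and frobenius_basis: "\<And>m c b i. (\<And>j. c j \<in> A) \<Longrightarrow> b \<in> B \<Longrightarrow>
        (\<Sum>j<p ^ m. c j ^ (p ^ m) * (1 + T) ^ j) = (1 - \<zeta>) * b \<Longrightarrow> i < p ^ m \<Longrightarrow>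
        \<exists>b\<in>B. c i = (1 - \<zeta>) * b"
    and gK: "\<And>x. x \<in> K \<Longrightarrow> g x \<in> K"
    and gK_add: "\<And>x y. x \<in> K \<Longrightarrow> y \<in> K \<Longrightarrow> g (x + y) = g x + g y"
    and gK_mult: "\<And>x y. x \<in> K \<Longrightarrow> y \<in> K \<Longrightarrow> g (x * y) = g x * g y"
    and g_A: "\<And>x. x \<in> A \<Longrightarrow> g x = x"
    and g_zeta: "g \<zeta> = \<zeta> ^ (1 + p ^ r)"
begin

abbreviation N :: nat where "N \<equiv> p ^ s"
abbreviation Pi :: 'a ("\<Pi>") where "\<Pi> \<equiv> 1 - \<zeta>"
abbreviation \<tau> :: 'a where "\<tau> \<equiv> 1 + T"

lemma p_gt: "p > 2" using p prime_gt_1_nat[of p] by (cases "p = 2") auto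

lemma p_pos [simp]: "p > 0" using p_gt by simp

lemma N_gt_1: "N > 1"
  using p_gt s by (intro one_less_power) auto

lemma B_1: "1 \<in> B" using A_B A_1 by blast
lemma A_0: "0 \<in> A" using A_add[OF A_1 A_uminus[OF A_1]] by simp
lemma B_0: "0 \<in> B" using A_B A_0 by blast
lemma B_diff: "x \<in> B \<Longrightarrow> y \<in> B \<Longrightarrow> x - y \<in> B" using B_add[of x "- y"] B_uminus by simp
lemma A_diff: "x \<in> A \<Longrightarrow> y \<in> A \<Longrightarrow> x - y \<in> A" using A_add[of x "- y"] A_uminus by simp
lemma A_power: "x \<in> A \<Longrightarrow> x ^ n \<in> A" by (induction n) (auto intro: A_1 A_mult)
lemma A_of_nat: "of_nat n \<in> A" by (induction n) (auto intro: A_0 A_1 A_add)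
lemma A_sum: "(\<And>i. i \<in> S \<Longrightarrow> f i \<in> A) \<Longrightarrow> sum f S \<in> A"
  by (induction S rule: infinite_finite_induct) (auto intro: A_0 A_add)
lemma tau_A: "\<tau> \<in> A" by (intro A_add A_1 T_A)
lemma B_power: "x \<in> B \<Longrightarrow> x ^ n \<in> B" by (induction n) (auto intro: B_1 B_mult)
lemma B_of_nat: "of_nat n \<in> B" using A_of_nat A_B by blast
lemma B_sum: "(\<And>i. i \<in> S \<Longrightarrow> f i \<in> B) \<Longrightarrow> sum f S \<in> B"
  by (induction S rule: infinite_finite_induct) (auto intro: B_0 B_add)
lemma B_prod: "(\<And>i. i \<in> S \<Longrightarrow> f i \<in> B) \<Longrightarrow> prod f S \<in> B"
  by (induction S rule: infinite_finite_induct) (auto intro: B_1 B_mult)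
lemma Pi_B: "\<Pi> \<in> B" by (intro B_diff B_1 zeta_B)
lemma T_B: "T \<in> B" using A_B T_A by blast
lemma tau_B: "\<tau> \<in> B" using A_B tau_A by blast

lemmas B_intros = B_1 B_0 B_diff B_add B_mult B_uminus B_power B_of_nat B_sum B_prod Pi_B T_B tau_B zeta_B

lemma K_1: "1 \<in> K" using B_K B_1 by blast

lemma g_1': "g 1 = 1" using g_A A_1 by blast

lemma K_inverse: "x \<in> K \<Longrightarrow> inverse x \<in> K"
proof -
  assume "x \<in> K"
  then obtain b c where bc: "b \<in> B" "c \<in> B" "c \<noteq> 0" "x = b / c" using K_frac by blast
  show ?thesis
  proof (cases "b = 0")
    case True
    then show ?thesis using bc B_0 B_K by simp
  next
    case False
    then have "inverse x = c / b" using bc by simp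
    then show ?thesis using K_frac bc False by blast
  qed
qed

lemma K_add: "x \<in> K \<Longrightarrow> y \<in> K \<Longrightarrow> x + y \<in> K"
proof -
  assume "x \<in> K" "y \<in> K"
  then obtain b c b' c' where bc: "b \<in> B" "c \<in> B" "c \<noteq> 0" "x = b / c" "b' \<in> B" "c' \<in> B" "c' \<noteq> 0" "y = b' / c'"
    using K_frac by blast
  then have "x + y = (b * c' + b' * c) / (c * c')" by (simp add: add_frac_eq)
  moreover have "b * c' + b' * c \<in> B" "c * c' \<in> B" "c * c' \<noteq> 0" using bc by (auto intro: B_intros)
  ultimately show ?thesis using K_frac by blast
qed

lemma K_mult: "x \<in> K \<Longrightarrow> y \<in> K \<Longrightarrow> x * y \<in> K"
proof -
  assume "x \<in> K" "y \<in> K"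
  then obtain b c b' c' where bc: "b \<in> B" "c \<in> B" "c \<noteq> 0" "x = b / c" "b' \<in> B" "c' \<in> B" "c' \<noteq> 0" "y = b' / c'"
    using K_frac by blast
  then have "x * y = (b * b') / (c * c')" by simp
  moreover have "b * b' \<in> B" "c * c' \<in> B" "c * c' \<noteq> 0" using bc by (auto intro: B_intros)
  ultimately show ?thesis using K_frac by blast
qed

lemma K_uminus: "x \<in> K \<Longrightarrow> - x \<in> K"
  using K_mult[of "-1" x] B_K[OF B_uminus[OF B_1]] by simp

lemma g_zeta_power: "g (\<zeta> ^ j) = \<zeta> ^ (j * (1 + p ^ r))"
proof (induction j)
  case (Suc j)
  have "g (\<zeta> ^ Suc j) = g \<zeta> * g (\<zeta> ^ j)"
    by (simp add: gK_mult B_K B_intros)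
  then show ?case unfolding Suc g_zeta by (simp add: power_add)
qed (simp add: g_1')

lemma g_sum: "(\<And>j. j \<in> S \<Longrightarrow> f j \<in> B) \<Longrightarrow> g (sum f S) = (\<Sum>j\<in>S. g (f j))"
proof (induction S rule: infinite_finite_induct)
  case (insert x F)
  then show ?case by (simp add: gK_add B_K B_intros)
qed (use g_A[OF A_0] in auto)

lemma g_B: "b \<in> B \<Longrightarrow> g b \<in> B"
proof -
  assume "b \<in> B"
  then obtain c where c: "\<And>j. c j \<in> A" "b = (\<Sum>j<N. c j * \<zeta> ^ j)" using span by blast
  have "g b = (\<Sum>j<N. g (c j * \<zeta> ^ j))" unfolding c(2) using c(1) A_B by (intro g_sum) (auto intro: B_intros)
  also have "\<dots> = (\<Sum>j<N. c j * \<zeta> ^ (j * (1 + p ^ r)))"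
    using c(1) by (intro sum.cong refl) (simp add: gK_mult B_K A_B B_intros g_A g_zeta_power del: mult_Suc_right)
  also have "\<dots> \<in> B" using c(1) A_B by (auto intro!: B_intros)
  finally show ?thesis .
qed

lemma zeta_power_cong: "[a = b] (mod p ^ (r + s)) \<Longrightarrow> \<zeta> ^ a = \<zeta> ^ b"
proof -
  have "\<zeta> ^ a = \<zeta> ^ (a mod p ^ (r + s))" for a
  proof -
    have "\<zeta> ^ a = \<zeta> ^ (p ^ (r + s) * (a div p ^ (r + s)) + a mod p ^ (r + s))" by simp
    also have "\<dots> = (\<zeta> ^ (p ^ (r + s))) ^ (a div p ^ (r + s)) * \<zeta> ^ (a mod p ^ (r + s))"
      by (simp only: power_add power_mult)
    finally show ?thesis unfolding zeta_pow by simp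
  qed
  then show "[a = b] (mod p ^ (r + s)) \<Longrightarrow> \<zeta> ^ a = \<zeta> ^ b" by (metis cong_def)
qed

lemma gi_zeta_power: "(g ^^ i) (\<zeta> ^ j) = \<zeta> ^ (j * (1 + p ^ r) ^ i)"
proof (induction i)
  case (Suc i)
  have "(g ^^ Suc i) (\<zeta> ^ j) = g ((g ^^ i) (\<zeta> ^ j))" by simp
  also have "\<dots> = \<zeta> ^ (j * (1 + p ^ r) ^ i * (1 + p ^ r))" unfolding Suc by (rule g_zeta_power)
  also have "j * (1 + p ^ r) ^ i * (1 + p ^ r) = j * (1 + p ^ r) ^ Suc i" by (simp only: power_Suc mult_ac)
  finally show ?case .
qed simp

lemma gi_zeta: "(g ^^ i) \<zeta> = \<zeta> ^ ((1 + p ^ r) ^ i)"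
  using gi_zeta_power[of i 1] by simp

lemma gi_A: "x \<in> A \<Longrightarrow> (g ^^ i) x = x"
  by (induction i) (auto simp: g_A)

lemma gi_zeta_N: "(g ^^ N) (\<zeta> ^ j) = \<zeta> ^ j"
proof -
  obtain c where "(1 + p ^ r) ^ (p ^ s * 1) = 1 + p ^ (r + s) * c"
    using one_plus_prime_power_expansion[OF p r, of 1 s] by auto
  then have "[(1 + p ^ r) ^ N = 1] (mod p ^ (r + s))" unfolding cong_def mult_1_right by (simp only: mod_mult_self2)
  then have "[j * (1 + p ^ r) ^ N = j * 1] (mod p ^ (r + s))" by (rule cong_scalar_left)
  then show ?thesis unfolding gi_zeta_power using zeta_power_cong by fastforce
qed

lemma giB: "b \<in> B \<Longrightarrow> (g ^^ i) b \<in> B"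
  by (induction i) (auto simp: g_B)

lemma giK: "b \<in> K \<Longrightarrow> (g ^^ i) b \<in> K"
  by (induction i) (auto simp: gK)

lemma giK_mult: "x \<in> K \<Longrightarrow> y \<in> K \<Longrightarrow> (g ^^ i) (x * y) = (g ^^ i) x * (g ^^ i) y"
  by (induction i) (auto simp: gK_mult giK)

lemma giB_sum: "(\<And>j. j \<in> S \<Longrightarrow> f j \<in> B) \<Longrightarrow> (g ^^ i) (sum f S) = (\<Sum>j\<in>S. (g ^^ i) (f j))"
  by (induction i) (auto simp: g_sum giB)

lemma gi_span:
  assumes "\<And>j. c j \<in> A"
  shows "(g ^^ i) (\<Sum>j<N. c j * \<zeta> ^ j) = (\<Sum>j<N. c j * (g ^^ i) (\<zeta> ^ j))"
  using assms by (simp add: giB_sum giK_mult gi_A A_B B_K B_intros)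

lemma giB_N: "b \<in> B \<Longrightarrow> (g ^^ N) b = b"
proof -
  assume "b \<in> B"
  then obtain c where c: "\<And>j. c j \<in> A" "b = (\<Sum>j<N. c j * \<zeta> ^ j)" using span by blast
  show ?thesis unfolding c(2) gi_span[OF c(1)] gi_zeta_N ..
qed

lemma giK_N: "b \<in> K \<Longrightarrow> (g ^^ N) b = b"
proof -
  assume "b \<in> K"
  then obtain x c where bc: "x \<in> B" "c \<in> B" "c \<noteq> 0" "b = x / c" using K_frac by blast
  have "(g ^^ N) b * (g ^^ N) c = (g ^^ N) x"
    using bc \<open>b \<in> K\<close> B_K by (subst giK_mult[symmetric]) auto
  then have "(g ^^ N) b * c = x" using bc giB_N by simp
  then show ?thesis using bc by (metis nonzero_mult_div_cancel_right)
qed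

sublocale B: cyclic_ring B g N \<tau>
  using p_pos by unfold_locales
    (auto simp: B_K gK_add gK_mult g_B g_1' giB_N intro: B_intros g_A tau_A)

sublocale K: cyclic_ring K g N \<tau>
  using p_pos by unfold_locales
    (auto simp: gK gK_add gK_mult K_add K_mult K_1 K_uminus g_1' giK_N intro: g_A tau_A B_K B_0 tau_B)

section \<open>The ideals generated by powers of Pi, principal units, and the size of
  \<open>p\<close>\<close>

definition I :: "nat \<Rightarrow> 'a set" where "I k = (\<lambda>b. \<Pi> ^ k * b) ` B"

lemma zeta_ne_1: "\<zeta> \<noteq> 1" using zeta_pow_ne by auto

lemma Pi_ne_0: "\<Pi> \<noteq> 0" using zeta_ne_1 by simp

lemma II: "b \<in> B \<Longrightarrow> \<Pi> ^ k * b \<in> I k" unfolding I_def by (rule imageI)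

lemma IE: assumes "x \<in> I k" obtains b where "b \<in> B" "x = \<Pi> ^ k * b"
  using assms by (auto simp: I_def)

lemma I_0: "I 0 = B" by (simp add: I_def)

lemma I_zero [simp]: "0 \<in> I k" using II[OF B_0, of k] by simp

lemma I_B: "x \<in> I k \<Longrightarrow> x \<in> B" by (auto simp: I_def intro: B_intros)

lemma I_add: "x \<in> I k \<Longrightarrow> y \<in> I k \<Longrightarrow> x + y \<in> I k"
  by (elim IE) (metis II B_add distrib_left)

lemma I_uminus: "x \<in> I k \<Longrightarrow> - x \<in> I k"
  by (elim IE) (metis II B_uminus mult_minus_right)

lemma I_diff: "x \<in> I k \<Longrightarrow> y \<in> I k \<Longrightarrow> x - y \<in> I k"
  using I_add[of x k "- y"] I_uminus by simp

lemma I_sum: "(\<And>i. i \<in> S \<Longrightarrow> f i \<in> I k) \<Longrightarrow> sum f S \<in> I k"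
  by (induction S rule: infinite_finite_induct) (auto intro: I_add)

lemma I_mult: "x \<in> I j \<Longrightarrow> y \<in> I k \<Longrightarrow> x * y \<in> I (j + k)"
proof -
  assume "x \<in> I j" "y \<in> I k"
  then obtain b c where "b \<in> B" "x = \<Pi> ^ j * b" "c \<in> B" "y = \<Pi> ^ k * c" by (auto elim!: IE)
  moreover from this have "x * y = \<Pi> ^ (j + k) * (b * c)" by (simp add: power_add)
  ultimately show ?thesis by (metis II B_mult)
qed

lemma I_mult_left: "b \<in> B \<Longrightarrow> x \<in> I k \<Longrightarrow> b * x \<in> I k"
  using I_mult[of b 0 x k] I_0 by simp

lemma I_mult_right: "x \<in> I k \<Longrightarrow> b \<in> B \<Longrightarrow> x * b \<in> I k"
  using I_mult[of x k b 0] I_0 by simp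

lemma I_mono: "j \<le> k \<Longrightarrow> x \<in> I k \<Longrightarrow> x \<in> I j"
proof -
  assume jk: "j \<le> k" and "x \<in> I k"
  then obtain b where b: "b \<in> B" "x = \<Pi> ^ k * b" by (auto elim: IE)
  have "x = \<Pi> ^ j * (\<Pi> ^ (k - j) * b)" using b jk by (simp add: mult.assoc[symmetric] power_add[symmetric])
  then show ?thesis using b by (metis II B_mult B_power Pi_B)
qed

lemma Pi_power_I: "\<Pi> ^ k \<in> I k" using II[OF B_1, of k] by simp

lemma I_power: "x \<in> I j \<Longrightarrow> x ^ n \<in> I (j * n)"
proof (induction n)
  case (Suc n)
  then have "x * x ^ n \<in> I (j + j * n)" by (intro I_mult) auto
  then show ?case by simp
qed (simp add: I_0 B_1)

lemma I_cancel: "\<Pi> ^ j * x \<in> I (j + k) \<Longrightarrow> x \<in> I k"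
proof -
  assume "\<Pi> ^ j * x \<in> I (j + k)"
  then obtain b where b: "b \<in> B" "\<Pi> ^ j * x = \<Pi> ^ (j + k) * b" by (auto elim: IE)
  then have "\<Pi> ^ j * x = \<Pi> ^ j * (\<Pi> ^ k * b)" by (simp add: power_add mult.assoc)
  then have "x = \<Pi> ^ k * b" using Pi_ne_0 by simp
  then show ?thesis using b II by blast
qed

definition U1 :: "'a set" where "U1 = {x. x - 1 \<in> I 1}"

definition Bunit :: "'a \<Rightarrow> bool" where "Bunit x \<longleftrightarrow> x \<in> B \<and> inverse x \<in> B \<and> x \<noteq> 0"

lemma BunitI: "x \<in> B \<Longrightarrow> y \<in> B \<Longrightarrow> x * y = 1 \<Longrightarrow> Bunit x"
  unfolding Bunit_def by (metis inverse_unique mult_zero_left zero_neq_one)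

text \<open>Pi and \<open>T\<close> generate the maximal ideal of \<open>B\<close>: by
  \<open>local\<close> an element outside it is invertible, and by \<open>one_not_max\<close> no
  translate of 1 by it lies inside.\<close>

lemma max_one_plus_unit:
  assumes "b \<in> B" "c \<in> B"
  shows "Bunit (1 + (\<Pi> * b + T * c))"
proof -
  have in_B: "1 + (\<Pi> * b + T * c) \<in> B" using assms by (intro B_intros)
  have "\<not> (\<exists>b'\<in>B. \<exists>c'\<in>B. 1 + (\<Pi> * b + T * c) = \<Pi> * b' + T * c')"
  proof
    assume "\<exists>b'\<in>B. \<exists>c'\<in>B. 1 + (\<Pi> * b + T * c) = \<Pi> * b' + T * c'"
    then obtain b' c' where bc: "b' \<in> B" "c' \<in> B" "1 + (\<Pi> * b + T * c) = \<Pi> * b' + T * c'" by blast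
    have "\<Pi> * (b' - b) + T * (c' - c) = 1" using bc(3) by (simp add: algebra_simps)
    then show False using one_not_max bc assms B_diff by blast
  qed
  then obtain y where "y \<in> B" "(1 + (\<Pi> * b + T * c)) * y = 1" using local[OF in_B] by blast
  then show ?thesis using BunitI in_B by blast
qed

lemma U1_unit: "x \<in> U1 \<Longrightarrow> Bunit x"
proof -
  assume "x \<in> U1"
  then obtain b where b: "b \<in> B" "x - 1 = \<Pi> * b" by (auto simp: U1_def elim!: IE)
  have "x = 1 + (\<Pi> * b + T * 0)" using b(2) by (simp add: algebra_simps)
  then show ?thesis using max_one_plus_unit[OF b(1) B_0] by simp
qed

lemma U1_B: "x \<in> U1 \<Longrightarrow> x \<in> B" and U1_inverse_B: "x \<in> U1 \<Longrightarrow> inverse x \<in> B" and U1_ne_0: "x \<in> U1 \<Longrightarrow> x \<noteq> 0"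
  using U1_unit by (auto simp: Bunit_def)

lemma U1_1: "1 \<in> U1" by (simp add: U1_def)

lemma U1I: "x \<in> I 1 \<Longrightarrow> 1 + x \<in> U1" by (simp add: U1_def)

lemma U1_mult: "x \<in> U1 \<Longrightarrow> y \<in> U1 \<Longrightarrow> x * y \<in> U1"
proof -
  assume xy: "x \<in> U1" "y \<in> U1"
  have "x * y - 1 = (x - 1) * y + (y - 1)" by (simp add: algebra_simps)
  moreover have "(x - 1) * y \<in> I 1" "y - 1 \<in> I 1"
    using xy U1_B[OF xy(2)] by (auto simp: U1_def intro: I_mult_right)
  ultimately have "x * y - 1 \<in> I 1" by (metis I_add)
  then show ?thesis by (simp add: U1_def)
qed

lemma U1_power: "x \<in> U1 \<Longrightarrow> x ^ n \<in> U1"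
  by (induction n) (auto intro: U1_1 U1_mult)

lemma U1_inverse: "x \<in> U1 \<Longrightarrow> inverse x \<in> U1"
proof -
  assume x: "x \<in> U1"
  have "inverse x - 1 = - ((x - 1) * inverse x)" using U1_ne_0[OF x] by (simp add: field_simps)
  moreover have "x - 1 \<in> I 1" using x by (simp add: U1_def)
  ultimately have "inverse x - 1 \<in> I 1" using U1_inverse_B[OF x] by (auto intro: I_uminus I_mult_right)
  then show ?thesis by (simp add: U1_def)
qed

lemma U1_diff_I: "u \<in> U1 \<Longrightarrow> x \<in> I k \<Longrightarrow> x * u - x \<in> I (k + 1)"
proof -
  assume u: "u \<in> U1" and x: "x \<in> I k"
  have "x * (u - 1) \<in> I (k + 1)" using u x unfolding U1_def by (intro I_mult) auto
  then show ?thesis by (simp add: right_diff_distrib)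
qed

abbreviation P1 :: nat where "P1 \<equiv> p ^ (r + s - 1)"
text \<open>The ramification index of the field of \<open>p ^ r\<close>-th roots of unity. The next
  constant \<open>e\<close> is that of the \<open>p ^ (r + s)\<close>-th ones, so \<open>p\<close>
  has the size of the \<open>e\<close>-th power of Pi.\<close>

definition \<epsilon> :: nat where "\<epsilon> = p ^ (r - 1) * (p - 1)"
definition e :: nat where "e = N * \<epsilon>"

lemma e_eq: "e = P1 * (p - 1)"
proof -
  have "P1 = p ^ (s + (r - 1))" using r by (simp add: add.commute)
  then show ?thesis by (simp add: e_def \<epsilon>_def power_add mult.assoc)
qed

lemma eps_ge_2: "\<epsilon> \<ge> 2"
proof -
  have "p ^ (r - 1) \<ge> 1" by (intro one_le_power) (use p_gt in simp)
  then have "p ^ (r - 1) * (p - 1) \<ge> 1 * 2" using p_gt by (intro mult_le_mono) auto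
  then show ?thesis by (simp add: \<epsilon>_def)
qed

lemma one_minus_prime_power:
  assumes "x \<in> B"
  shows "\<exists>\<theta>\<in>B. (1 - x) ^ p = 1 - x ^ p + of_nat p * x * \<theta>"
proof -
  define \<theta> where "\<theta> = - (\<Sum>j=1..<p. of_nat ((p choose j) div p) * (- x) ^ (j - 1))"
  have "(1 - x) ^ p = (\<Sum>j\<le>p. of_nat (p choose j) * (- x) ^ j)"
    using binomial_ring[of "- x" 1 p] by (simp add: add.commute)
  also have "{..p} = insert 0 (insert p {1..<p})" using p_gt by auto
  also have "(\<Sum>j\<in>insert 0 (insert p {1..<p}). of_nat (p choose j) * (- x) ^ j) =
     1 + (- x) ^ p + (\<Sum>j=1..<p. of_nat (p choose j) * (- x) ^ j)"
    using p_gt by (simp add: add.assoc)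
  also have "(\<Sum>j=1..<p. of_nat (p choose j) * (- x) ^ j) = of_nat p * x * \<theta>"
    unfolding \<theta>_def sum_negf[symmetric] sum_distrib_left
  proof (intro sum.cong refl)
    fix j assume j: "j \<in> {1..<p}"
    have "p dvd (p choose j)" using p j by (intro dvd_choose_prime) auto
    then have "of_nat (p choose j) = (of_nat p * of_nat ((p choose j) div p) :: 'a)"
      by (metis dvd_mult_div_cancel of_nat_mult)
    moreover have "(- x) ^ j = (- x) * (- x) ^ (j - 1)" using j by (cases j) auto
    ultimately show "of_nat (p choose j) * (- x) ^ j = of_nat p * x * - (of_nat ((p choose j) div p) * (- x) ^ (j - 1))"
      by simp
  qed
  also have "(- x) ^ p = - (x ^ p)" using p by simp
  finally have "(1 - x) ^ p = 1 - x ^ p + of_nat p * x * \<theta>" by simp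
  moreover have "\<theta> \<in> B" unfolding \<theta>_def using assms by (intro B_intros)
  ultimately show ?thesis by blast
qed

text \<open>\<open>zeta ^ P1\<close> is a primitive \<open>p\<close>-th root of unity. Expanding
  \<open>(1 - x) ^ p = 1\<close> and cancelling one factor \<open>x\<close> compares
  \<open>p\<close> with \<open>x ^ (p - 1)\<close>; the middle binomials merely perturb
  \<open>p\<close> by the factor \<open>1 + x * theta\<close>.\<close>

lemma one_minus_zeta1:
  defines "x \<equiv> 1 - \<zeta> ^ P1"
  shows "\<exists>\<theta>\<in>B. of_nat p * (1 + x * \<theta>) = - (x ^ (p - 1))" and "x \<noteq> 0" and "x \<in> I 1"
proof -
  show x0: "x \<noteq> 0" using zeta_pow_ne by (simp add: x_def)
  have "x = \<Pi> * (\<Sum>i<P1. \<zeta> ^ i)" by (simp add: x_def one_diff_power_eq)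
  then show xI: "x \<in> I 1" using II[of "\<Sum>i<P1. \<zeta> ^ i" 1] by (auto intro: B_intros)
  have xB: "x \<in> B" using I_B[OF xI] .
  define S where "S = (\<Sum>j=2..<p. of_nat ((p choose j) div p) * (- x) ^ (j - 2))"
  have "(1 - x) ^ p = 1"
  proof -
    have "(1 - x) ^ p = \<zeta> ^ (P1 * p)" by (simp add: x_def power_mult)
    also have "P1 * p = p ^ (r + s)" using r by (metis One_nat_def add_eq_0_iff_both_eq_0 le_zero_eq n_not_Suc_n power_eq_if mult.commute)
    finally show ?thesis using zeta_pow by simp
  qed
  moreover have "(1 - x) ^ p = (\<Sum>j\<le>p. of_nat (p choose j) * (- x) ^ j)"
    using binomial_ring[of "- x" 1 p] by (simp add: add.commute)
  moreover have "{..p} = insert 0 (insert 1 (insert p {2..<p}))" using p_gt by auto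
  ultimately have "1 = (\<Sum>j\<in>insert 0 (insert 1 (insert p {2..<p})). of_nat (p choose j) * (- x) ^ j)" by metis
  also have "\<dots> = 1 + (of_nat p * (- x) + (- x) ^ p + (\<Sum>j=2..<p. of_nat (p choose j) * (- x) ^ j))"
    using p_gt by (simp add: add.assoc choose_one)
  finally have "0 = of_nat p * (- x) + (- x) ^ p + (\<Sum>j=2..<p. of_nat (p choose j) * (- x) ^ j)"
    by (metis add_cancel_right_right)
  also have "(\<Sum>j=2..<p. of_nat (p choose j) * (- x) ^ j) = of_nat p * x\<^sup>2 * S"
    unfolding S_def sum_distrib_left
  proof (intro sum.cong refl)
    fix j assume j: "j \<in> {2..<p}"
    have "p dvd (p choose j)" using p j by (intro dvd_choose_prime) auto
    then have "of_nat (p choose j) = (of_nat p * of_nat ((p choose j) div p) :: 'a)"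
      by (metis dvd_mult_div_cancel of_nat_mult)
    moreover have "(- x) ^ j = (- x)\<^sup>2 * (- x) ^ (j - 2)" using j by (metis atLeastLessThan_iff le_add_diff_inverse power_add)
    ultimately show "of_nat (p choose j) * (- x) ^ j = of_nat p * x\<^sup>2 * (of_nat ((p choose j) div p) * (- x) ^ (j - 2))"
      by simp
  qed
  also have "(- x) ^ p = - (x * x ^ (p - 1))" using p p_pos by (metis power_minus_odd power_eq_if neq0_conv)
  finally have "x * (of_nat p * (1 + x * (- S))) = x * (- (x ^ (p - 1)))"
    by (simp add: algebra_simps power2_eq_square)
  then have "of_nat p * (1 + x * (- S)) = - (x ^ (p - 1))" using x0 by (simp only: mult_cancel_left) simp
  moreover have "- S \<in> B" unfolding S_def using xB by (intro B_intros)
  ultimately show "\<exists>\<theta>\<in>B. of_nat p * (1 + x * \<theta>) = - (x ^ (p - 1))" by blast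
qed

lemma one_minus_prime_power_power:
  assumes x: "x \<in> B"
  shows "\<exists>\<theta>\<in>B. (1 - x) ^ (p ^ k) = 1 - x ^ (p ^ k) + of_nat p * x * \<theta>"
proof (induction k)
  case 0
  show ?case by (intro bexI[of _ 0]) (auto intro: B_intros)
next
  case (Suc k)
  then obtain \<theta> where \<theta>: "\<theta> \<in> B" "(1 - x) ^ (p ^ k) = 1 - x ^ (p ^ k) + of_nat p * x * \<theta>" by blast
  define q where "q = p ^ k"
  have q: "q > 0" by (simp add: q_def)
  have xq: "x ^ q \<in> B" using x by (intro B_intros)
  obtain \<eta> where \<eta>: "\<eta> \<in> B" "(1 - x ^ q) ^ p = 1 - (x ^ q) ^ p + of_nat p * x ^ q * \<eta>"
    using one_minus_prime_power[OF xq] by blast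
  define a where "a = 1 - x ^ q"
  define b where "b = of_nat p * x * \<theta>"
  have aB: "a \<in> B" "b \<in> B" unfolding a_def b_def using x \<theta> by (auto intro!: B_intros)
  have "(a + b) ^ p - a ^ p = b * (\<Sum>i<p. a ^ (p - Suc i) * (a + b) ^ i)"
    using power_diff_sumr2[of "a + b" p a] by simp
  then have "(a + b) ^ p = 1 - (x ^ q) ^ p + of_nat p * x ^ q * \<eta> + b * (\<Sum>i<p. a ^ (p - Suc i) * (a + b) ^ i)"
    using \<eta>(2) by (simp add: a_def[symmetric] algebra_simps)
  also have "of_nat p * x ^ q * \<eta> = of_nat p * x * (x ^ (q - 1) * \<eta>)"
    using q by (cases q) (auto simp: mult_ac)
  finally have "(a + b) ^ p = 1 - (x ^ q) ^ p + of_nat p * x * (x ^ (q - 1) * \<eta> + \<theta> * (\<Sum>i<p. a ^ (p - Suc i) * (a + b) ^ i))"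
    by (simp add: b_def algebra_simps)
  moreover have "(1 - x) ^ (p ^ Suc k) = (a + b) ^ p"
    using \<theta>(2) by (simp add: a_def b_def q_def power_mult mult.commute[of p])
  moreover have "(x ^ q) ^ p = x ^ (p ^ Suc k)" by (simp add: q_def power_mult[symmetric] mult.commute)
  moreover have "x ^ (q - 1) * \<eta> + \<theta> * (\<Sum>i<p. a ^ (p - Suc i) * (a + b) ^ i) \<in> B"
    using x \<theta> \<eta> aB by (intro B_intros)
  ultimately show ?case by metis
qed

text \<open>The expansion of \<open>(1 - Pi) ^ P1\<close> has an error divisible by
  \<open>p * Pi\<close>, and \<open>p\<close> is itself a multiple of
  \<open>x = 1 - zeta ^ P1\<close>. Moving the error to the side of \<open>x\<close> shows that
  \<open>x\<close> times a principal unit is \<open>Pi ^ P1\<close>.\<close>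

lemma one_minus_zeta1_eq: "\<exists>u\<in>U1. 1 - \<zeta> ^ P1 = \<Pi> ^ P1 * u"
proof -
  define x where "x = 1 - \<zeta> ^ P1"
  note x = one_minus_zeta1[folded x_def]
  obtain \<theta> where \<theta>: "\<theta> \<in> B" "of_nat p * (1 + x * \<theta>) = - (x ^ (p - 1))" using x(1) by blast
  have xB: "x \<in> B" using x(3) I_B by blast
  have u1: "1 + x * \<theta> \<in> U1" using x(3) \<theta>(1) by (intro U1I I_mult_right)
  obtain \<eta> where \<eta>: "\<eta> \<in> B" "(1 - \<Pi>) ^ P1 = 1 - \<Pi> ^ P1 + of_nat p * \<Pi> * \<eta>"
    using one_minus_prime_power_power[OF Pi_B] by blast
  have pe: "of_nat p = - (x * x ^ (p - 2)) * inverse (1 + x * \<theta>)"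
  proof -
    have "x ^ (p - 1) = x * x ^ (p - 2)" using p_gt by (metis Suc_diff_Suc Suc_1 diff_Suc_1 less_imp_le_nat numeral_2_eq_2 power_Suc Suc_diff_le diff_Suc_Suc)
    then show ?thesis using \<theta>(2) U1_ne_0[OF u1] by (simp add: field_simps)
  qed
  have "x = \<Pi> ^ P1 - of_nat p * \<Pi> * \<eta>" using \<eta>(2) by (simp add: x_def)
  then have "x * (1 + \<Pi> * (- (x ^ (p - 2) * inverse (1 + x * \<theta>) * \<eta>))) = \<Pi> ^ P1"
    unfolding pe by (simp add: algebra_simps)
  moreover define w where "w = 1 + \<Pi> * (- (x ^ (p - 2) * inverse (1 + x * \<theta>) * \<eta>))"
  ultimately have xw: "x * w = \<Pi> ^ P1" by simp
  have "- (x ^ (p - 2) * inverse (1 + x * \<theta>) * \<eta>) \<in> B"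
    using xB U1_inverse_B[OF u1] \<eta>(1) by (intro B_intros)
  then have w: "w \<in> U1" unfolding w_def by (intro U1I) (metis II power_one_right)
  then have "x = \<Pi> ^ P1 * inverse w" using xw U1_ne_0[OF w] by (simp add: field_simps)
  then show ?thesis using U1_inverse[OF w] by (auto simp: x_def)
qed

lemma p_eq: "\<exists>u\<in>U1. of_nat p = - (\<Pi> ^ e) * u"
proof -
  define x where "x = 1 - \<zeta> ^ P1"
  note x = one_minus_zeta1[folded x_def]
  obtain \<theta> where \<theta>: "\<theta> \<in> B" "of_nat p * (1 + x * \<theta>) = - (x ^ (p - 1))" using x(1) by blast
  have u1: "1 + x * \<theta> \<in> U1" using x(3) \<theta>(1) by (intro U1I I_mult_right)
  obtain u where u: "u \<in> U1" "x = \<Pi> ^ P1 * u" using one_minus_zeta1_eq by (auto simp: x_def)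
  have "x ^ (p - 1) = \<Pi> ^ e * u ^ (p - 1)" by (simp add: u(2) e_eq power_mult_distrib power_mult)
  then have "of_nat p = - (\<Pi> ^ e) * (u ^ (p - 1) * inverse (1 + x * \<theta>))"
    using \<theta>(2) U1_ne_0[OF u1] by (simp add: field_simps)
  moreover have "u ^ (p - 1) * inverse (1 + x * \<theta>) \<in> U1"
    by (intro U1_mult U1_power u U1_inverse u1)
  ultimately show ?thesis by blast
qed

lemma p_I: "of_nat p \<in> I e"
proof -
  obtain u where u: "u \<in> U1" "of_nat p = - (\<Pi> ^ e) * u" using p_eq by blast
  then show ?thesis using II[of "- u" e] U1_B by (auto intro: B_intros)
qed

lemma p_power_I: "of_nat (p ^ k) \<in> I (e * k)"
  using I_power[OF p_I, of k] by simp

lemma e_pos: "e \<ge> 1"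
  using eps_ge_2 N_gt_1 mult_le_mono[of 1 N 1 \<epsilon>] by (simp add: e_def)

lemma p_I1: "of_nat p \<in> I 1" using I_mono[OF e_pos p_I] .

text \<open>An error divisible by \<open>p\<close> is thus at least as small as the square of
  \<open>1 - zeta ^ (p ^ k)\<close>; the factor 2 is used up when traces of powers are
  compared.\<close>

lemma power_P_le: "k < r + s \<Longrightarrow> 2 * p ^ k \<le> e"
proof -
  assume "k < r + s"
  then have "p ^ k \<le> P1" using p_gt by (intro power_increasing) auto
  then have "p ^ k * 2 \<le> P1 * (p - 1)" using p_gt by (intro mult_le_mono) auto
  then show ?thesis by (simp add: e_eq mult.commute)
qed

lemma one_minus_zeta_power: "k < r + s \<Longrightarrow> \<exists>u\<in>U1. 1 - \<zeta> ^ (p ^ k) = \<Pi> ^ (p ^ k) * u"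
proof -
  assume k: "k < r + s"
  obtain \<eta> where \<eta>: "\<eta> \<in> B" "(1 - \<Pi>) ^ (p ^ k) = 1 - \<Pi> ^ (p ^ k) + of_nat p * \<Pi> * \<eta>"
    using one_minus_prime_power_power[OF Pi_B] by blast
  have "of_nat p * \<Pi> * \<eta> \<in> I (e + 1)"
  proof (rule I_mult_right[OF _ \<eta>(1)])
    show "of_nat p * \<Pi> \<in> I (e + 1)" using I_mult[OF p_I Pi_power_I[of 1]] by simp
  qed
  moreover have "p ^ k + 1 \<le> e + 1" using power_P_le[OF k] by simp
  ultimately have "of_nat p * \<Pi> * \<eta> \<in> I (p ^ k + 1)" by (metis I_mono)
  then obtain b where b: "b \<in> B" "of_nat p * \<Pi> * \<eta> = \<Pi> ^ (p ^ k + 1) * b" by (auto elim: IE)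
  have "1 - \<zeta> ^ (p ^ k) = \<Pi> ^ (p ^ k) * (1 + \<Pi> * (- b))"
    using \<eta>(2) unfolding b(2) power_add power_one_right by (simp add: algebra_simps)
  moreover have "1 + \<Pi> * (- b) \<in> U1" using II[of "- b" 1] b(1) by (intro U1I) (simp add: B_uminus)
  ultimately show ?thesis by blast
qed

lemma of_nat_unit: "\<not> p dvd j \<Longrightarrow> Bunit (of_nat j)"
proof -
  assume "\<not> p dvd j"
  then have "coprime j p" using p by (metis coprime_commute prime_imp_coprime)
  then obtain x where "[j * x = 1] (mod p)" using cong_solve_coprime_nat[of j p] by (auto simp: One_nat_def)
  moreover have "j * x \<ge> 1"
  proof (rule ccontr)
    assume "\<not> j * x \<ge> 1"
    then have "j * x = 0" by (metis less_one not_le)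
    then have "[0 = 1] (mod p)" using \<open>[j * x = 1] (mod p)\<close> by metis
    then show False using p_gt by (simp add: cong_def)
  qed
  ultimately obtain y where y: "j * x = 1 + p * y"
    by (metis add.commute cong_le_nat mult.commute)
  have "of_nat (j * x) = (1 + of_nat p * of_nat y :: 'a)" by (simp add: y)
  also have "\<dots> \<in> U1" by (intro U1I I_mult_right p_I1 B_of_nat)
  finally have "Bunit (of_nat (j * x))" by (rule U1_unit)
  then have nz: "of_nat (j * x) \<noteq> (0 :: 'a)" and invB: "inverse (of_nat (j * x) :: 'a) \<in> B"
    unfolding Bunit_def by blast+
  have inv: "of_nat (j * x) * inverse (of_nat (j * x)) = (1 :: 'a)" using nz by (rule right_inverse)
  have "of_nat j * (of_nat x * inverse (of_nat (j * x))) = (1 :: 'a)"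
    using inv by (simp only: of_nat_mult mult.assoc)
  then show ?thesis by (intro BunitI[of _ "of_nat x * inverse (of_nat (j * x))"] B_intros invB)
qed

lemma of_nat_cong_I: "[a = b] (mod p) \<Longrightarrow> of_nat a - of_nat b \<in> I 1"
proof -
  have *: "of_nat a - of_nat b \<in> I 1" if ab: "[a = b] (mod p)" "b \<le> a" for a b
  proof -
    from ab obtain y where "a = b + p * y" by (metis cong_le_nat cong_sym add.commute mult.commute)
    then show ?thesis by (auto intro!: I_mult_right p_I1 B_of_nat)
  qed
  assume ab: "[a = b] (mod p)"
  show ?thesis
  proof (cases "b \<le> a")
    case False
    then have "of_nat b - of_nat a \<in> I 1" using ab by (intro *) (auto simp: cong_sym)
    then show ?thesis using I_uminus by fastforce
  qed (use * ab in auto)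
qed

lemma gi_Pi_diff_I: "(g ^^ i) \<Pi> - \<Pi> \<in> I (p ^ r)"
proof -
  have "[(1 + p ^ r) ^ i = 1 ^ i] (mod p ^ r)" by (intro cong_pow) (metis cong_def mod_add_self2)
  then have "[(1 + p ^ r) ^ i = 1] (mod p ^ r)" by simp
  moreover have "(1 + p ^ r) ^ i \<ge> 1" by (intro one_le_power) simp
  ultimately obtain c where c: "(1 + p ^ r) ^ i = 1 + p ^ r * c" by (metis add.commute cong_le_nat mult.commute)
  have "(g ^^ i) \<Pi> - \<Pi> = \<zeta> - \<zeta> ^ (1 + p ^ r * c)"
    by (simp add: B.gi_diff B_intros gi_zeta c)
  also have "\<dots> = \<zeta> * (1 - (\<zeta> ^ (p ^ r)) ^ c)" by (simp add: power_add power_mult right_diff_distrib)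
  also have "1 - (\<zeta> ^ (p ^ r)) ^ c = (1 - \<zeta> ^ (p ^ r)) * (\<Sum>i<c. (\<zeta> ^ (p ^ r)) ^ i)"
    by (rule one_diff_power_eq)
  finally have eq: "(g ^^ i) \<Pi> - \<Pi> = \<zeta> * ((1 - \<zeta> ^ (p ^ r)) * (\<Sum>i<c. (\<zeta> ^ (p ^ r)) ^ i))" .
  obtain u where u: "u \<in> U1" "1 - \<zeta> ^ (p ^ r) = \<Pi> ^ (p ^ r) * u" using one_minus_zeta_power[of r] s by auto
  have "1 - \<zeta> ^ (p ^ r) \<in> I (p ^ r)" unfolding u(2) by (intro II U1_B u)
  then show ?thesis unfolding eq by (intro I_mult_left I_mult_right B_intros)
qed

text \<open>With \<open>q = p ^ (r + t)\<close> the difference is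
  \<open>zeta * (1 - zeta ^ (q * c))\<close> for some \<open>c\<close> congruent to
  \<open>j\<close>, that is, zeta times \<open>1 - zeta ^ q\<close> times a sum of \<open>c\<close>
  powers of zeta, each of which is 1 modulo Pi.\<close>

lemma gi_Pi_diff:
  assumes t: "t < s"
  shows "(g ^^ (p ^ t * j)) \<Pi> - \<Pi> - of_nat j * \<Pi> ^ (p ^ (r + t)) \<in> I (p ^ (r + t) + 1)"
proof (cases "j = 0")
  case False
  then obtain c where c: "(1 + p ^ r) ^ (p ^ t * j) = 1 + p ^ (r + t) * c" "[c = j] (mod p)"
    using one_plus_prime_power_expansion[OF p r, of j t] by auto
  define q where "q = p ^ (r + t)"
  obtain u where u: "u \<in> U1" "1 - \<zeta> ^ q = \<Pi> ^ q * u" using one_minus_zeta_power[of "r + t"] t by (auto simp: q_def)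
  define S where "S = (\<Sum>i<c. (\<zeta> ^ q) ^ i)"
  have "(g ^^ (p ^ t * j)) \<Pi> - \<Pi> = \<zeta> - \<zeta> ^ (1 + q * c)"
    by (simp add: B.gi_diff B_intros gi_zeta c q_def)
  also have "\<dots> = \<zeta> * (1 - (\<zeta> ^ q) ^ c)" by (simp add: power_add power_mult right_diff_distrib)
  also have "1 - (\<zeta> ^ q) ^ c = (1 - \<zeta> ^ q) * S" unfolding S_def by (rule one_diff_power_eq)
  finally have eq: "(g ^^ (p ^ t * j)) \<Pi> - \<Pi> = \<Pi> ^ q * (u * \<zeta> * S)" unfolding u(2) by (simp only: mult_ac)
  have z1: "1 - \<zeta> ^ k \<in> I 1" for k
  proof -
    have "1 - \<zeta> ^ k = \<Pi> ^ 1 * (\<Sum>i<k. \<zeta> ^ i)" by (simp add: one_diff_power_eq)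
    then show ?thesis by (metis II B_sum B_power zeta_B)
  qed
  have "of_nat c - S = (\<Sum>i<c. 1 - \<zeta> ^ (q * i))" by (simp add: S_def sum_subtractf power_mult)
  also have "\<dots> \<in> I 1" by (intro I_sum z1)
  finally have "of_nat c - S \<in> I 1" .
  then have "(of_nat c - of_nat j) - (of_nat c - S) \<in> I 1" using I_diff[OF of_nat_cong_I[OF c(2)]] by blast
  then have Sj: "S - of_nat j \<in> I 1" by simp
  have SB: "S \<in> B" unfolding S_def by (intro B_intros)
  have "u * \<zeta> \<in> U1" using u(1) z1[of 1] I_uminus[OF z1[of 1]] by (intro U1_mult) (auto simp: U1_def)
  then have "(u * \<zeta> - 1) * S \<in> I 1" using SB by (intro I_mult_right) (auto simp: U1_def)
  then have "(u * \<zeta> - 1) * S + (S - of_nat j) \<in> I 1" using Sj by (intro I_add)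
  then have "u * \<zeta> * S - of_nat j \<in> I 1" by (simp add: algebra_simps)
  then have "\<Pi> ^ q * (u * \<zeta> * S - of_nat j) \<in> I (q + 1)" by (intro I_mult Pi_power_I)
  moreover have "(g ^^ (p ^ t * j)) \<Pi> - \<Pi> - of_nat j * \<Pi> ^ p ^ (r + t) = \<Pi> ^ q * (u * \<zeta> * S - of_nat j)"
    unfolding eq q_def[symmetric] by (simp only: right_diff_distrib mult.commute)
  ultimately show ?thesis by (simp only: q_def)
qed simp

lemma gi_Pi: "\<exists>u\<in>U1. (g ^^ i) \<Pi> = \<Pi> * u"
proof -
  have "2 \<le> p ^ r" using p_gt r by (metis One_nat_def less_imp_le_nat order_trans self_le_power zero_less_Suc less_le_trans p_pos Suc_leI)
  then have "(g ^^ i) \<Pi> - \<Pi> \<in> I 2" using gi_Pi_diff_I I_mono by blast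
  then obtain b where b: "b \<in> B" "(g ^^ i) \<Pi> - \<Pi> = \<Pi>\<^sup>2 * b" by (auto elim: IE)
  have "(g ^^ i) \<Pi> = \<Pi> * (1 + \<Pi> * b)" using b(2) by (simp add: algebra_simps power2_eq_square)
  moreover have "1 + \<Pi> * b \<in> U1" using II[OF b(1), of 1] by (intro U1I) simp
  ultimately show ?thesis by blast
qed

lemma gi_I: "x \<in> I k \<Longrightarrow> (g ^^ i) x \<in> I k"
proof -
  assume "x \<in> I k"
  then obtain b where b: "b \<in> B" "x = \<Pi> ^ k * b" by (auto elim: IE)
  obtain u where u: "u \<in> U1" "(g ^^ i) \<Pi> = \<Pi> * u" using gi_Pi by blast
  have "(g ^^ i) x = \<Pi> ^ k * (u ^ k * (g ^^ i) b)"
    using b Pi_B by (simp add: B.gi_mult B.gi_power u(2) power_mult_distrib mult.assoc)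
  moreover have "u ^ k * (g ^^ i) b \<in> B" using U1_B[OF u(1)] b by (intro B_intros giB)
  ultimately show ?thesis using II by auto
qed

text \<open>Replacing zeta by 1 in an expansion over \<open>A\<close> changes nothing modulo Pi.
  Residues are therefore represented by elements fixed by \<open>g\<close>, which commute with
  \<open>u\<close>.\<close>

lemma lift_A: "b \<in> B \<Longrightarrow> \<exists>a\<in>A. b - a \<in> I 1"
proof -
  assume "b \<in> B"
  then obtain c where c: "\<And>j. c j \<in> A" "b = (\<Sum>j<N. c j * \<zeta> ^ j)" using span by blast
  have "b - (\<Sum>j<N. c j) = (\<Sum>j<N. c j * (\<zeta> ^ j - 1))"
    by (simp add: c(2) sum_subtractf algebra_simps)
  also have "\<dots> \<in> I 1"
  proof (intro I_sum I_mult_left)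
    fix j
    show "c j \<in> B" using c(1) A_B by blast
    have "\<zeta> ^ j - 1 = \<Pi> ^ 1 * (- (\<Sum>i<j. \<zeta> ^ i))" using one_diff_power_eq[of \<zeta> j] by (simp add: algebra_simps)
    then show "\<zeta> ^ j - 1 \<in> I 1" by (metis II B_sum B_power zeta_B B_uminus)
  qed
  finally show ?thesis using c(1) by (meson A_sum)
qed

end

subsection \<open>Exponent estimates\<close>

text \<open>Up to \<open>p ^ r\<close> the difference \<open>c - c div p\<close> is at most
  \<open>\<epsilon>\<close>, with equality at \<open>p ^ r - 1\<close> and \<open>p ^ r\<close>; the
  second bound excludes these two values. The equality is the source of the boundary case.\<close>

lemma sub_div_bound:
  fixes p r c :: nat
  assumes p: "p > 2" and r: "r \<ge> 1"
  defines "\<epsilon> \<equiv> p ^ (r - 1) * (p - 1)"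
  shows "c \<le> p ^ r \<Longrightarrow> c \<le> \<epsilon> + c div p"
    and "c + 2 \<le> p ^ r \<Longrightarrow> c + 1 \<le> \<epsilon> + c div p"
proof -
  define Q where "Q = p ^ (r - 1)"
  define d where "d = c div p"
  define f where "f = c mod p"
  define p' where "p' = p - 1"
  have pp: "p = p' + 1" "p' \<ge> 2" using p by (simp_all add: p'_def)
  have pr: "p ^ r = p * Q" using r by (simp add: Q_def power_eq_if)
  have c: "c = p * d + f" by (simp add: d_def f_def)
  have f: "f < p" using p by (simp add: f_def)
  have eps: "\<epsilon> = Q * p'" by (simp add: \<epsilon>_def Q_def p'_def)
  have c': "c = p' * d + d + f" using c pp(1) by (simp add: algebra_simps)
  have Qp: "p * Q = p' * Q + Q" using pp(1) by (simp add: algebra_simps)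
  show "c \<le> \<epsilon> + c div p" if "c \<le> p ^ r"
  proof (cases "d < Q")
    case True
    then have "p' * d + p' \<le> p' * Q" by (metis Suc_leI mult_Suc_right mult_le_mono2 add.commute)
    moreover have "f \<le> p'" using f pp by simp
    ultimately show ?thesis unfolding d_def[symmetric] using c' eps by (simp add: mult.commute)
  next
    case False
    have "d \<le> Q" using that unfolding d_def pr by (metis div_le_mono nonzero_mult_div_cancel_left p not_less_zero)
    then have "d = Q" using False by simp
    then have "f = 0" using that c unfolding pr by simp
    then show ?thesis unfolding d_def[symmetric] using c' eps \<open>d = Q\<close> by (simp add: mult.commute)
  qed
  show "c + 1 \<le> \<epsilon> + c div p" if "c + 2 \<le> p ^ r"
  proof -
    have dQ: "d < Q"
    proof (rule ccontr)
      assume "\<not> d < Q"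
      then have "p * Q \<le> p * d" by (intro mult_le_mono2) simp
      then have "c + 2 \<le> c" using that c unfolding pr by linarith
      then show False by simp
    qed
    show ?thesis
    proof (cases "d + 1 = Q")
      case True
      have "p' * d + p' = p' * Q" using True[symmetric] by (simp add: distrib_left)
      moreover have "f + 1 \<le> p'"
      proof (rule ccontr)
        assume "\<not> f + 1 \<le> p'"
        then have "f \<ge> p'" by simp
        moreover have "p * Q = p' * (d + 1) + (d + 1)" unfolding True by (rule Qp)
        then have "c + 2 \<le> p' * d + p' + d + 1" using that unfolding pr by (simp add: distrib_left)
        ultimately show False using c' by simp
      qed
      ultimately show ?thesis unfolding d_def[symmetric] using c' eps by (simp add: mult.commute)
    next
      case False
      then have "d + 2 \<le> Q" using dQ by simp
      then have "p' * (d + 2) \<le> p' * Q" by (rule mult_le_mono2)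
      moreover have "f \<le> p'" using f pp by simp
      ultimately show ?thesis unfolding d_def[symmetric] using c' eps pp(2) by (simp add: mult.commute)
    qed
  qed
qed

lemma sub_div_power_bound:
  fixes p r c :: nat
  assumes p: "p > 2" and r: "r \<ge> 1"
  defines "\<epsilon> \<equiv> p ^ (r - 1) * (p - 1)"
  shows "c \<le> p ^ r \<Longrightarrow> c \<le> \<beta> * \<epsilon> + c div p ^ \<beta>"
proof (induction \<beta> arbitrary: c)
  case (Suc \<beta>)
  have "c div p \<le> p ^ r" using Suc.prems div_le_dividend order_trans by blast
  then have "c div p \<le> \<beta> * \<epsilon> + c div p div p ^ \<beta>" by (rule Suc.IH)
  moreover have "c \<le> \<epsilon> + c div p" unfolding \<epsilon>_def by (rule sub_div_bound(1)[OF p r Suc.prems])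
  moreover have "c div p div p ^ \<beta> = c div p ^ Suc \<beta>" by (simp add: div_mult2_eq)
  ultimately show ?case by simp
qed simp

text \<open>Two divisions by \<open>p\<close> always gain, because after the first one the value is
  well below \<open>p ^ r\<close>; a single division gains if the extremal value is avoided.\<close>

lemma sub_div_power_bound_strict:
  fixes p r c :: nat
  assumes p: "p > 2" and r: "r \<ge> 1"
  defines "\<epsilon> \<equiv> p ^ (r - 1) * (p - 1)"
  shows "c < p ^ r \<Longrightarrow> \<beta> \<ge> 1 \<Longrightarrow> c + 2 \<le> p ^ r \<or> \<beta> \<ge> 2 \<Longrightarrow> c + 1 \<le> \<beta> * \<epsilon> + c div p ^ \<beta>"
proof (induction \<beta> arbitrary: c)
  case (Suc \<beta>)
  show ?case
  proof (cases "\<beta> = 0")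
    case True
    then have "c + 2 \<le> p ^ r" using Suc.prems by simp
    then show ?thesis using sub_div_bound(2)[OF p r, of c] True by (simp add: \<epsilon>_def)
  next
    case False
    have pr: "p ^ r = p * p ^ (r - 1)" using r by (simp add: power_eq_if)
    then have "c div p < p ^ (r - 1)" using Suc.prems(1) by (simp add: less_mult_imp_div_less mult.commute)
    moreover have "p ^ (r - 1) * 2 \<le> p ^ r" unfolding pr using p by simp
    moreover have "p ^ (r - 1) \<ge> 1" using p by simp
    ultimately have "c div p + 2 \<le> p ^ r" by linarith
    then have "c div p + 1 \<le> \<beta> * \<epsilon> + c div p div p ^ \<beta>" using False by (intro Suc.IH) auto
    moreover have "c \<le> \<epsilon> + c div p" unfolding \<epsilon>_def using Suc.prems(1) by (intro sub_div_bound(1)[OF p r]) simp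
    moreover have "c div p div p ^ \<beta> = c div p ^ Suc \<beta>" by (simp add: div_mult2_eq)
    ultimately show ?thesis by simp
  qed
qed simp

lemma bernoulli_nat: "1 + b * (p - 1) \<le> p ^ b" if p1: "p \<ge> 1" for p b :: nat
proof (induction b)
  case (Suc b)
  obtain p' where p': "p = Suc p'" using p1 by (cases p) auto
  have "1 + Suc b * p' \<le> (1 + b * p') + p' * (1 + b * p')" by simp
  also have "\<dots> = p * (1 + b * p')" by (simp add: p')
  also have "\<dots> \<le> p * p ^ b" using Suc p' by (intro mult_le_mono2) simp
  finally show ?case by (simp add: p')
qed simp

lemma mult_pred_div: "(u * v - 1) div u = v - 1" if uv: "u > 0" "v > 0" for u v :: nat
proof -
  obtain v' where v': "v = Suc v'" using uv by (cases v) auto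
  have "u * v - 1 = (u - 1) + v' * u" using uv v' by (simp add: mult.commute)
  then have "(u * v - 1) div u = ((u - 1) + v' * u) div u" by (rule arg_cong)
  also have "\<dots> = v'" using uv by (subst div_mult_self1) simp_all
  finally show ?thesis by (simp add: v')
qed

lemma double_pred_div: "2 * v - 1 \<le> (2 * (u * v - 1)) div u" if uv: "u > 1" "v > 0" for u v :: nat
proof -
  obtain v' where v': "v = Suc v'" using uv by (cases v) auto
  have "(2 * v - 1) * u = 2 * v' * u + u" by (simp add: v' algebra_simps)
  moreover have "2 * (u * v - 1) = 2 * v' * u + u + (u - 2)" using uv by (simp add: v' algebra_simps)
  ultimately have "(2 * v - 1) * u \<le> 2 * (u * v - 1)" by simp
  then show ?thesis using uv by (simp add: less_eq_div_iff_mult_less_eq)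
qed

section \<open>Comparing the size of an arbitrary trace term with that of the leading one\<close>

context
  fixes p r s q c :: nat
  assumes p: "p > 2" and r: "r \<ge> 1" and q: "q \<le> s"
    and c_gt: "q \<ge> 1 \<Longrightarrow> c > p ^ (r - 1)" and c_le: "q < s \<Longrightarrow> c \<le> p ^ r" and c0: "c \<ge> 1"
begin

private definition \<epsilon> where "\<epsilon> = p ^ (r - 1) * (p - 1)"

text \<open>Bernoulli's inequality: multiplication by \<open>p ^ b\<close> gains at least
  \<open>b * (p - 1) * c\<close>, which exceeds \<open>b * \<epsilon>\<close> for positive
  \<open>b\<close> because then \<open>c\<close> is larger than \<open>p ^ (r - 1)\<close>.\<close>

private lemma mult_bound: "b \<le> q \<Longrightarrow> b * \<epsilon> + c \<le> p ^ b * c"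
  and mult_bound_strict: "b \<le> q \<Longrightarrow> b \<ge> 1 \<Longrightarrow> b * \<epsilon> + c + 1 \<le> p ^ b * c"
proof -
  have strict: "b * \<epsilon> + c + 1 \<le> p ^ b * c" if b: "b \<le> q" "b \<ge> 1"
  proof -
    have "c \<ge> p ^ (r - 1) + 1" using c_gt b by simp
    then have "b * (p - 1) * (p ^ (r - 1) + 1) \<le> b * (p - 1) * c" by (rule mult_le_mono2)
    moreover have "b * (p - 1) * (p ^ (r - 1) + 1) = b * \<epsilon> + b * (p - 1)" by (simp add: \<epsilon>_def algebra_simps)
    moreover have "b * (p - 1) \<ge> 1 * 1" using b p by (intro mult_le_mono) auto
    moreover have "(1 + b * (p - 1)) * c \<le> p ^ b * c" using bernoulli_nat[of p b] p by (intro mult_le_mono1) simp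
    moreover have "(1 + b * (p - 1)) * c = c + b * (p - 1) * c" by (simp add: distrib_right)
    ultimately show ?thesis by linarith
  qed
  then show "b \<le> q \<Longrightarrow> b \<ge> 1 \<Longrightarrow> b * \<epsilon> + c + 1 \<le> p ^ b * c" .
  show "b \<le> q \<Longrightarrow> b * \<epsilon> + c \<le> p ^ b * c" using strict by (cases "b = 0") auto
qed

private lemma power_div: "p ^ a * k * m div p ^ s = k * m div p ^ (s - a)" if "a \<le> s" for a k m :: nat
proof -
  have "p ^ s = p ^ a * p ^ (s - a)" using that by (simp add: power_add[symmetric])
  then show ?thesis using p by (simp add: mult.assoc)
qed

text \<open>Sizes are counted in units of \<open>Pi ^ N\<close>. A trace divided by
  \<open>p ^ a\<close> keeps \<open>s - a\<close> factors \<open>p\<close>, each worth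
  \<open>\<epsilon>\<close>, and the power \<open>p ^ a * k\<close> of an element of level
  \<open>m\<close> contributes the quotient by \<open>p ^ s\<close>. For \<open>a >= s - q\<close>
  the growth of the power pays for the lost factors \<open>p\<close>; for smaller \<open>a\<close>
  the factors \<open>p\<close> that are kept pay for the smaller power.\<close>

lemma exponent_bound:
  assumes a: "a \<le> s" and k: "k \<ge> 1" and m: "m \<ge> p ^ q * c"
  shows "q * (p ^ (r - 1) * (p - 1)) + c \<le> (s - a) * (p ^ (r - 1) * (p - 1)) + p ^ a * k * m div p ^ s"
  unfolding \<epsilon>_def[symmetric]
proof (cases "s - q \<le> a")
  case True
  define b where "b = a - (s - q)"
  have b: "b \<le> q" "s - a = q - b" using True a q by (auto simp: b_def)
  have "p ^ q = p ^ (q - b) * p ^ b" using b by (simp add: power_add[symmetric])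
  then have "p ^ (q - b) * (p ^ b * c) \<le> m" using m by (simp add: mult.assoc)
  also have "m \<le> k * m" using mult_le_mono1[OF k, of m] by simp
  finally have "p ^ (q - b) * (p ^ b * c) div p ^ (q - b) \<le> k * m div p ^ (q - b)" by (rule div_le_mono)
  then have "p ^ b * c \<le> k * m div p ^ (q - b)" using p by simp
  moreover have "q * \<epsilon> = (q - b) * \<epsilon> + b * \<epsilon>" using b by (simp add: distrib_right[symmetric])
  ultimately show "q * \<epsilon> + c \<le> (s - a) * \<epsilon> + p ^ a * k * m div p ^ s"
    using mult_bound[OF b(1)] unfolding power_div[OF a] b(2) by linarith
next
  case False
  define \<beta> where "\<beta> = (s - q) - a"
  have b: "\<beta> \<ge> 1" "s - a = q + \<beta>" "q < s" using False a q by (auto simp: \<beta>_def)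
  have "m \<le> k * m" using mult_le_mono1[OF k, of m] by simp
  then have "p ^ q * c div p ^ (q + \<beta>) \<le> k * m div p ^ (q + \<beta>)" using m by (intro div_le_mono) (rule le_trans)
  moreover have "p ^ q * c div p ^ (q + \<beta>) = c div p ^ \<beta>" using p by (simp add: power_add)
  moreover have "c \<le> \<beta> * \<epsilon> + c div p ^ \<beta>"
    unfolding \<epsilon>_def using c_le b by (intro sub_div_power_bound[OF p r]) simp
  ultimately show "q * \<epsilon> + c \<le> (s - a) * \<epsilon> + p ^ a * k * m div p ^ s"
    unfolding power_div[OF a] b(2) by (simp add: distrib_right)
qed

text \<open>Lowering the level from \<open>p ^ q * c\<close> to \<open>n\<close> can cost 1 through
  the floor. Every index other than the two excluded ones can afford it: by strictness in the
  Bernoulli bound, by a cofactor \<open>k >= 2\<close>, or by a strict gain from dividing by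
  \<open>p\<close>.\<close>

lemma exponent_bound_strict:
  assumes a: "a \<le> s" and k: "k \<ge> 1" "p ^ a * k \<le> p ^ s" and n: "n + 1 = p ^ q * c"
    and ne: "p ^ a * k \<noteq> p ^ (s - q)" "\<not> (q < s \<and> c = p ^ r \<and> p ^ a * k = p ^ (s - q - 1))"
  shows "q * (p ^ (r - 1) * (p - 1)) + c \<le> (s - a) * (p ^ (r - 1) * (p - 1)) + p ^ a * k * n div p ^ s"
  unfolding \<epsilon>_def[symmetric]
proof (cases "s - q \<le> a")
  case True
  define b where "b = a - (s - q)"
  have b: "b \<le> q" "s - a = q - b" using True a q by (auto simp: b_def)
  have pq: "p ^ q = p ^ (q - b) * p ^ b" using b by (simp add: power_add[symmetric])
  have n': "n = p ^ (q - b) * (p ^ b * c) - 1" using n pq by (simp add: mult.assoc)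
  have qe: "q * \<epsilon> = (q - b) * \<epsilon> + b * \<epsilon>" using b by (simp add: distrib_right[symmetric])
  show "q * \<epsilon> + c \<le> (s - a) * \<epsilon> + p ^ a * k * n div p ^ s"
  proof (cases "b = 0")
    case False
    have "n div p ^ (q - b) = p ^ b * c - 1" unfolding n' using p c0 by (intro mult_pred_div) auto
    moreover have "n div p ^ (q - b) \<le> k * n div p ^ (q - b)" using k by (intro div_le_mono) simp
    ultimately show ?thesis using mult_bound_strict[OF b(1)] False
      unfolding power_div[OF a] b(2) qe by linarith
  next
    case True
    then have "a = s - q" using b \<open>s - q \<le> a\<close> a q by (simp add: b_def)
    then have k2: "k \<ge> 2" using ne(1) k(1) by (cases "k = 1") auto
    have q1: "q \<ge> 1"
    proof (rule ccontr)
      assume "\<not> q \<ge> 1"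
      then have "a = s" using \<open>a = s - q\<close> by simp
      then have "p ^ s * k \<le> p ^ s * 1" using k(2) by (simp only: mult_1_right)
      moreover have "p ^ s > 0" using p by simp
      ultimately have "k \<le> 1" by (metis nat_mult_le_cancel1)
      then show False using k2 by simp
    qed
    have "p ^ q > 1" using q1 p by (intro one_less_power) auto
    then have "2 * c - 1 \<le> 2 * (p ^ q * c - 1) div p ^ q" using c0 by (intro double_pred_div) auto
    also have "p ^ q * c - 1 = n" using n by simp
    also have "2 * n div p ^ q \<le> k * n div p ^ q" using k2 by (intro div_le_mono) simp
    finally have "c \<le> k * n div p ^ q" using c0 by linarith
    then show ?thesis unfolding power_div[OF a] b(2) using True by simp
  qed
next
  case False
  define \<beta> where "\<beta> = (s - q) - a"
  have b: "\<beta> \<ge> 1" "s - a = q + \<beta>" "q < s" using False a q by (auto simp: \<beta>_def)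
  have nq: "n = p ^ q * c - 1" using n by simp
  have ndiv: "n div p ^ (q + \<beta>) = (c - 1) div p ^ \<beta>"
    unfolding power_add div_mult2_eq nq using p c0 by (subst mult_pred_div) auto
  show "q * \<epsilon> + c \<le> (s - a) * \<epsilon> + p ^ a * k * n div p ^ s"
  proof (cases "(c - 1) + 2 \<le> p ^ r \<or> \<beta> \<ge> 2")
    case True
    have "c - 1 < p ^ r" using c_le[OF b(3)] c0 by linarith
    then have "c - 1 + 1 \<le> \<beta> * \<epsilon> + (c - 1) div p ^ \<beta>"
      unfolding \<epsilon>_def using True b by (intro sub_div_power_bound_strict[OF p r]) auto
    moreover have "n div p ^ (q + \<beta>) \<le> k * n div p ^ (q + \<beta>)" using k by (intro div_le_mono) simp
    ultimately show ?thesis using ndiv c0 unfolding power_div[OF a] b(2) by (simp add: distrib_right)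
  next
    case c_big: False
    then have \<beta>1: "\<beta> = 1" using b by simp
    have cr: "c = p ^ r" using c_big c_le[OF b(3)] c0 by linarith
    have "a = s - q - 1" using \<beta>1 b by simp
    then have k2: "k \<ge> 2" using ne(2) cr b(3) k(1) by (cases "k = 1") auto
    have pr: "p ^ r = p * p ^ (r - 1)" using r by (simp add: power_eq_if)
    have n2: "n = p ^ (q + 1) * p ^ (r - 1) - 1" using nq cr pr by (simp add: power_add mult_ac)
    have "2 * p ^ (r - 1) - 1 \<le> 2 * (p ^ (q + 1) * p ^ (r - 1) - 1) div p ^ (q + 1)"
      using p by (intro double_pred_div one_less_power) auto
    also have "\<dots> = 2 * n div p ^ (q + 1)" using n2 by simp
    also have "\<dots> \<le> k * n div p ^ (q + 1)" using k2 by (intro div_le_mono) simp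
    finally have "p ^ (r - 1) \<le> k * n div p ^ (q + 1)"
    proof -
      assume h: "2 * p ^ (r - 1) - 1 \<le> k * n div p ^ (q + 1)"
      have "p ^ (r - 1) \<ge> 1" using p by simp
      then show ?thesis using h by linarith
    qed
    moreover have "c = \<epsilon> + p ^ (r - 1)"
    proof -
      obtain p' where "p = Suc p'" using p by (cases p) auto
      then show ?thesis unfolding cr pr \<epsilon>_def by simp
    qed
    ultimately show ?thesis unfolding power_div[OF a] b(2) \<beta>1 by (simp add: distrib_right)
  qed
qed

text \<open>Passing from \<open>n + 1\<close> to \<open>n\<close> lowers the floor by at most 1,
  since \<open>p ^ a * k <= p ^ s\<close>.\<close>

lemma exponent_bound_pred:
  assumes a: "a \<le> s" and k: "k \<ge> 1" "p ^ a * k \<le> p ^ s" and n: "n + 1 = p ^ q * c"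
  shows "q * (p ^ (r - 1) * (p - 1)) + (c - 1) \<le> (s - a) * (p ^ (r - 1) * (p - 1)) + p ^ a * k * n div p ^ s"
proof -
  have "p ^ a * k * (n + 1) div p ^ s \<le> (p ^ a * k * n + p ^ s) div p ^ s"
    using k(2) by (intro div_le_mono) (simp only: distrib_left mult_1_right add_le_cancel_left)
  also have "\<dots> = p ^ a * k * n div p ^ s + 1" using p by simp
  finally show ?thesis using exponent_bound[OF a k(1), of "n + 1"] n c0 by linarith
qed

end

subsection \<open>Traces\<close>

context cyclotomic_order
begin

lemma zeta1_power_ne_1:
  assumes "\<not> p dvd j"
  shows "(\<zeta> ^ P1) ^ j \<noteq> 1"
proof
  assume 1: "(\<zeta> ^ P1) ^ j = 1"
  have "coprime j p" using p assms by (metis coprime_commute prime_imp_coprime)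
  then obtain x where x: "[j * x = 1] (mod p)" using cong_solve_coprime_nat[of j p] by (auto simp: One_nat_def)
  have zp: "(\<zeta> ^ P1) ^ p = 1"
  proof -
    have "P1 * p = p ^ (r + s)" using r by (cases "r + s") (auto simp: mult.commute)
    then show ?thesis using zeta_pow by (simp add: power_mult[symmetric])
  qed
  have "(\<zeta> ^ P1) ^ a = (\<zeta> ^ P1) ^ (a mod p)" for a
  proof -
    have "(\<zeta> ^ P1) ^ a = (\<zeta> ^ P1) ^ (p * (a div p) + a mod p)" by simp
    also have "\<dots> = ((\<zeta> ^ P1) ^ p) ^ (a div p) * (\<zeta> ^ P1) ^ (a mod p)" by (simp only: power_add power_mult)
    finally show ?thesis unfolding zp by simp
  qed
  then have "(\<zeta> ^ P1) ^ (j * x) = (\<zeta> ^ P1) ^ 1" using x unfolding cong_def by metis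
  then show False using 1 zeta_pow_ne by (simp add: power_mult)
qed

text \<open>Some power of \<open>g\<close> multiplies \<open>zeta ^ j\<close> by a nontrivial
  \<open>p\<close>-th root of unity which \<open>g\<close> fixes. The trace is invariant under
  \<open>g\<close> and linear over fixed elements, so it equals a nontrivial multiple of
  itself.\<close>

lemma Tr_zeta_power:
  assumes j: "0 < j" "j < N"
  shows "B.Tr (\<zeta> ^ j) = 0"
proof -
  obtain j' where j': "j = p ^ multiplicity p j * j'" "\<not> p dvd j'"
    using multiplicity_decompose'[of j p] j p_gt by (metis neq0_conv nat_dvd_1_iff_1 numeral_2_eq_2 less_irrefl less_not_refl2 One_nat_def lessI less_trans)
  define t where "t = multiplicity p j"
  have jt: "j = p ^ t * j'" using j' by (simp add: t_def)
  have t: "t < s"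
  proof (rule ccontr)
    assume "\<not> t < s"
    then have "N dvd j" unfolding jt by (intro dvd_mult2 le_imp_power_dvd) simp
    then show False using j by (auto dest: dvd_imp_le)
  qed
  \<comment> \<open>Chosen so that \<open>j * (1 + p ^ r) ^ i\<close> differs from \<open>j\<close>
    by a multiple of \<open>P1\<close> which \<open>p ^ (r + s)\<close> does not divide.\<close>
  define i where "i = p ^ (s - 1 - t)"
  obtain c where c: "(1 + p ^ r) ^ (p ^ (s - 1 - t) * 1) = 1 + p ^ (r + (s - 1 - t)) * c" "[c = 1] (mod p)"
    using one_plus_prime_power_expansion[OF p r, of 1 "s - 1 - t"] by auto
  define \<omega> where "\<omega> = \<zeta> ^ (P1 * (j' * c))"
  have exps: "j * (1 + p ^ r) ^ i = j + P1 * (j' * c)"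
  proof -
    have "r + s - 1 = t + (r + (s - 1 - t))" using t r by simp
    then have "P1 = p ^ t * p ^ (r + (s - 1 - t))" by (metis power_add)
    then show ?thesis using c(1) by (simp add: i_def jt algebra_simps)
  qed
  have "(g ^^ i) (\<zeta> ^ j) = \<omega> * \<zeta> ^ j"
    unfolding gi_zeta_power exps by (simp add: \<omega>_def power_add)
  moreover have "B.Tr ((g ^^ i) (\<zeta> ^ j)) = B.Tr (\<zeta> ^ j)" by (intro B.Tr_gi B_intros)
  moreover have "B.Tr (\<omega> * \<zeta> ^ j) = \<omega> * B.Tr (\<zeta> ^ j)"
  proof (rule B.Tr_fixed_mult)
    have "[P1 * (j' * c) * (1 + p ^ r) = P1 * (j' * c)] (mod p ^ (r + s))"
    proof -
      have "p ^ (r + s) dvd P1 * p ^ r"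
        unfolding power_add[symmetric] by (rule le_imp_power_dvd) (use r in simp)
      then have "p ^ (r + s) dvd P1 * p ^ r * (j' * c)" by (rule dvd_mult2)
      then have "p ^ (r + s) dvd P1 * (j' * c) * p ^ r" by (simp only: mult_ac)
      then show ?thesis by (simp add: distrib_left cong_def mod_eq_0_iff_dvd) (metis add.right_neutral mod_add_right_eq mod_eq_0_iff_dvd)
    qed
    then show "g \<omega> = \<omega>" unfolding \<omega>_def g_zeta_power by (rule zeta_power_cong)
  qed (auto simp: \<omega>_def intro!: B_intros)
  ultimately have "\<omega> * B.Tr (\<zeta> ^ j) = B.Tr (\<zeta> ^ j)" by simp
  moreover have "\<omega> \<noteq> 1"
  proof -
    have "\<not> p dvd c" using c(2) p_gt by (auto simp: cong_def dvd_eq_mod_eq_0)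
    then have "\<not> p dvd j' * c" using j'(2) p by (simp add: prime_dvd_mult_iff)
    then show ?thesis using zeta1_power_ne_1 unfolding \<omega>_def power_mult[of _ P1] by blast
  qed
  ultimately show ?thesis by simp
qed

lemma Tr_A_mult: "a \<in> A \<Longrightarrow> x \<in> B \<Longrightarrow> B.Tr (a * x) = a * B.Tr x"
  by (intro B.Tr_fixed_mult) (auto simp: A_B g_A)

lemma Tr_1: "B.Tr 1 = of_nat N"
  unfolding B.Tr_def by simp

lemma Tr_span:
  assumes c: "\<And>j. c j \<in> A"
  shows "B.Tr (\<Sum>j<N. c j * \<zeta> ^ j) = of_nat N * c 0"
proof -
  have "B.Tr (\<Sum>j<N. c j * \<zeta> ^ j) = (\<Sum>j<N. B.Tr (c j * \<zeta> ^ j))"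
    using c A_B by (intro B.Tr_sum) (auto intro: B_intros)
  also have "\<dots> = (\<Sum>j<N. if j = 0 then of_nat N * c 0 else 0)"
  proof (intro sum.cong refl)
    fix j assume "j \<in> {..<N}"
    then have "j < N" by simp
    then show "B.Tr (c j * \<zeta> ^ j) = (if j = 0 then of_nat N * c 0 else 0)"
      using c by (auto simp: Tr_A_mult B_intros Tr_zeta_power Tr_1)
  qed
  also have "\<dots> = of_nat N * c 0" using N_gt_1 by simp
  finally show ?thesis .
qed

text \<open>The element \<open>1 - zeta_r\<close>, called pi in the notions of the theorem, since
  \<open>zeta ^ N\<close> is \<open>zeta_r\<close>. It is fixed by \<open>g\<close> and has the size
  of \<open>Pi ^ N\<close>.\<close>

definition piA :: 'a where "piA = 1 - \<zeta> ^ N"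

lemma piA_A: "piA \<in> A" unfolding piA_def by (intro A_diff A_1 zeta_N_A)

lemma piA_eq: "\<exists>u\<in>U1. piA = \<Pi> ^ N * u"
  unfolding piA_def using r by (intro one_minus_zeta_power) simp

lemma piA_power_eq: "\<exists>u\<in>U1. piA ^ k = \<Pi> ^ (N * k) * u"
proof -
  obtain u where "u \<in> U1" "piA = \<Pi> ^ N * u" using piA_eq by blast
  then show ?thesis by (intro bexI[of _ "u ^ k"]) (auto simp: power_mult_distrib power_mult U1_power)
qed

lemma piA_power_I: "piA ^ k \<in> I (N * k)"
  using piA_power_eq[of k] II U1_B by metis

text \<open>Full powers of \<open>piA\<close> pass through the trace because \<open>g\<close> fixes
  them, and what is left has its trace in \<open>N * A\<close>. The floor in the exponent is the
  price of pulling out whole powers.\<close>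

lemma Tr_I: "x \<in> I m \<Longrightarrow> \<exists>y\<in>I (N * (m div N)). B.Tr x = of_nat N * y"
proof -
  assume x: "x \<in> I m"
  define k where "k = m div N"
  have "x \<in> I (N * k)" using x by (intro I_mono[OF _ x]) (simp add: k_def)
  then obtain b where b: "b \<in> B" "x = \<Pi> ^ (N * k) * b" by (auto elim: IE)
  obtain u where u: "u \<in> U1" "piA ^ k = \<Pi> ^ (N * k) * u" using piA_power_eq by blast
  have "x = piA ^ k * (inverse u * b)" using U1_ne_0[OF u(1)] by (simp add: b(2) u(2))
  moreover have ub: "inverse u * b \<in> B" using U1_inverse_B[OF u(1)] b(1) by (rule B_mult)
  ultimately have Trx: "B.Tr x = piA ^ k * B.Tr (inverse u * b)" by (simp add: Tr_A_mult A_power piA_A)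
  obtain c where c: "\<And>j. c j \<in> A" "inverse u * b = (\<Sum>j<N. c j * \<zeta> ^ j)" using span[OF ub] by blast
  have "B.Tr x = of_nat N * (piA ^ k * c 0)" unfolding Trx c(2) Tr_span[OF c(1)] by simp
  moreover have "piA ^ k * c 0 \<in> I (N * k)" using piA_power_I A_B[OF c(1)] by (rule I_mult_right)
  ultimately show ?thesis by (auto simp: k_def)
qed

lemma Tr_I': "x \<in> I m \<Longrightarrow> N * k \<le> m \<Longrightarrow> \<exists>y\<in>I (N * k). B.Tr x = of_nat N * y"
proof -
  assume x: "x \<in> I m" and k: "N * k \<le> m"
  have "x \<in> I (N * k)" by (rule I_mono[OF k x])
  from Tr_I[OF this] show ?thesis using p_pos by simp
qed

end

subsection \<open>Orbit products\<close>

text \<open>\<open>X ^ p - 1\<close> minus the product of the linear factors at the powers of omega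
  has degree below \<open>p\<close> but \<open>p\<close> distinct roots, so it is 0.\<close>

lemma prod_one_minus_root_of_unity:
  fixes \<omega> x :: "'a::field_char_0"
  assumes p: "prime p" and 1: "\<omega> ^ p = 1" "\<omega> \<noteq> 1"
  shows "(\<Prod>c<p. 1 - x * \<omega> ^ c) = 1 - x ^ p"
proof -
  have p0: "p > 0" using p prime_gt_0_nat by blast
  have w0: "\<omega> \<noteq> 0" using 1 p0 by (metis power_eq_0_iff zero_neq_one)
  have inj: "inj_on (\<lambda>c. \<omega> ^ c) {..<p}"
  proof -
    have "c = d" if "c \<le> d" "d < p" "\<omega> ^ c = \<omega> ^ d" for c d
    proof (rule ccontr)
      assume "c \<noteq> d"
      have "\<omega> ^ c * 1 = \<omega> ^ c * \<omega> ^ (d - c)" using that by (metis le_add_diff_inverse mult_1_right power_add)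
      then have e: "\<omega> ^ (d - c) = 1" using w0 by simp
      have "coprime (d - c) p"
        using p that \<open>c \<noteq> d\<close> by (metis coprime_commute diff_less_mono2 le_neq_implies_less less_imp_diff_less nat_dvd_not_less prime_imp_coprime zero_less_diff)
      then obtain y where "[(d - c) * y = 1] (mod p)" using cong_solve_coprime_nat[of "d - c" p] by (auto simp: One_nat_def)
      then have "((d - c) * y) mod p = 1 mod p" by (simp add: cong_def)
      moreover have red: "\<omega> ^ a = \<omega> ^ (a mod p)" for a
      proof -
        have "\<omega> ^ a = \<omega> ^ (p * (a div p) + a mod p)" by simp
        also have "\<dots> = (\<omega> ^ p) ^ (a div p) * \<omega> ^ (a mod p)" by (simp only: power_add power_mult)
        finally show ?thesis using 1 by simp
      qed
      ultimately have "\<omega> ^ ((d - c) * y) = \<omega> ^ 1" by metis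
      then show False using e 1 by (simp add: power_mult)
    qed
    then show ?thesis by (intro inj_onI) (metis lessThan_iff nat_le_linear)
  qed
  define Q where "Q = (\<Prod>c<p. [:- (\<omega> ^ c), 1:])"
  define R where "R = monom 1 p - 1 - Q"
  have degQ1: "Polynomial.degree Q = p" unfolding Q_def by (subst degree_prod_eq_sum_degree) auto
  have "lead_coeff Q = 1" unfolding Q_def lead_coeff_prod by simp
  then have degQ: "Polynomial.degree Q = p" "poly.coeff Q p = 1" using degQ1 by simp_all
  have "Polynomial.degree (monom 1 p - 1 :: 'a poly) \<le> p"
    by (intro degree_diff_le) (auto simp: degree_monom_le)
  then have "Polynomial.degree R \<le> p" unfolding R_def by (rule degree_diff_le) (simp add: degQ1)
  moreover have "poly.coeff R p = 0" using degQ p0 by (simp add: R_def)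
  ultimately have degR: "R = 0 \<or> Polynomial.degree R < p"
    by (metis le_neq_implies_less leading_coeff_0_iff)
  have roots: "(\<lambda>c. \<omega> ^ c) ` {..<p} \<subseteq> {x. poly R x = 0}"
  proof
    fix z assume "z \<in> (\<lambda>c. \<omega> ^ c) ` {..<p}"
    then obtain c where c: "c < p" "z = \<omega> ^ c" by auto
    have "poly Q z = 0" unfolding Q_def poly_prod using c by (intro prod_zero) auto
    moreover have "z ^ p = 1" unfolding c(2) by (metis 1(1) mult.commute power_mult power_one)
    ultimately show "z \<in> {x. poly R x = 0}" by (simp add: R_def poly_monom)
  qed
  have "R = 0"
  proof (rule ccontr)
    assume R: "R \<noteq> 0"
    have "card ((\<lambda>c. \<omega> ^ c) ` {..<p}) \<le> card {x. poly R x = 0}"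
      using roots R poly_roots_finite by (intro card_mono) auto
    also have "\<dots> \<le> Polynomial.degree R" by (rule card_poly_roots_bound[OF R])
    finally show False using degR R inj by (simp add: card_image)
  qed
  then have Q: "poly Q y = y ^ p - 1" for y
  proof -
    have "poly R y = 0" using \<open>R = 0\<close> by simp
    then show ?thesis by (simp add: R_def poly_monom)
  qed
  show ?thesis
  proof (cases "x = 0")
    case False
    have "(\<Prod>c<p. 1 - x * \<omega> ^ c) = (\<Prod>c<p. x * (1 / x - \<omega> ^ c))"
      using False by (intro prod.cong refl) (simp add: field_simps)
    also have "\<dots> = x ^ p * poly Q (1 / x)"
      by (simp add: prod.distrib Q_def poly_prod)
    also have "\<dots> = 1 - x ^ p" using False by (simp add: Q field_simps)
    finally show ?thesis .
  qed (use p0 in simp)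
qed

context cyclotomic_order
begin

lemma P1_p: "P1 * p = p ^ (r + s)"
  using r by (cases "r + s") (auto simp: mult.commute)

lemma zeta1_p: "(\<zeta> ^ P1) ^ p = 1"
  using zeta_pow by (simp add: power_mult[symmetric] P1_p)

text \<open>The automorphism \<open>g ^ (p ^ (s - k - 1) * i)\<close> multiplies
  \<open>zeta ^ (p ^ k)\<close> by a \<open>p\<close>-th root of unity. If \<open>p\<close> does not
  divide \<open>i\<close>, this root is nontrivial and the product is exactly
  \<open>1 - zeta ^ (p ^ (k + 1))\<close>; otherwise all factors agree and their \<open>p\<close>-th
  power gives the same modulo \<open>p\<close>.\<close>

lemma orbit_product_p:
  assumes k: "k + 1 \<le> s"
  shows "\<exists>\<theta>\<in>B. (\<Prod>c<p. (g ^^ (c * (p ^ (s - k - 1) * i))) (1 - \<zeta> ^ (p ^ k))) = 1 - \<zeta> ^ (p ^ (k + 1)) + of_nat p * \<theta>"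
proof -
  define \<omega> where "\<omega> = \<zeta> ^ P1"
  define x where "x = \<zeta> ^ (p ^ k)"
  have xB: "x \<in> B" unfolding x_def by (intro B_intros)
  have wp: "\<omega> ^ p = 1" by (simp add: \<omega>_def zeta1_p)
  have wmod: "\<omega> ^ a = \<omega> ^ b" if "[a = b] (mod p)" for a b
  proof -
    have red: "\<omega> ^ a = \<omega> ^ (a mod p)" for a
    proof -
      have "\<omega> ^ a = \<omega> ^ (p * (a div p) + a mod p)" by simp
      also have "\<dots> = (\<omega> ^ p) ^ (a div p) * \<omega> ^ (a mod p)" by (simp only: power_add power_mult)
      finally show ?thesis using wp by simp
    qed
    then show ?thesis using that unfolding cong_def by metis
  qed
  have gx: "(g ^^ (c * (p ^ (s - k - 1) * i))) (1 - \<zeta> ^ (p ^ k)) = 1 - x * (\<omega> ^ i) ^ c" for c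
  proof (cases "c * i = 0")
    case False
    have ci: "c * (p ^ (s - k - 1) * i) = p ^ (s - k - 1) * (c * i)" by (simp only: mult_ac)
    obtain C where C: "(1 + p ^ r) ^ (p ^ (s - k - 1) * (c * i)) = 1 + p ^ (r + (s - k - 1)) * C" "[C = c * i] (mod p)"
      using one_plus_prime_power_expansion[OF p r, of "c * i" "s - k - 1"] False by auto
    have "p ^ k * (1 + p ^ (r + (s - k - 1)) * C) = p ^ k + P1 * C"
    proof -
      have "r + s - 1 = k + (r + (s - k - 1))" using k by simp
      then have "P1 = p ^ k * p ^ (r + (s - k - 1))" by (metis power_add)
      then show ?thesis by (simp add: algebra_simps)
    qed
    then have "(g ^^ (c * (p ^ (s - k - 1) * i))) (\<zeta> ^ (p ^ k)) = x * \<omega> ^ C"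
      unfolding gi_zeta_power ci C(1) by (simp add: power_add power_mult x_def \<omega>_def)
    also have "\<omega> ^ C = (\<omega> ^ i) ^ c" using wmod[OF C(2)] by (simp add: power_mult[symmetric] mult.commute)
    finally show ?thesis by (simp add: B.gi_diff B_intros)
  next
    case True
    then have h: "c * (p ^ (s - k - 1) * i) = 0" "(\<omega> ^ i) ^ c = 1" by auto
    show ?thesis by (simp only: h funpow.simps id_apply mult_1_right x_def)
  qed
  have xp: "x ^ p = \<zeta> ^ (p ^ (k + 1))" by (simp add: x_def power_mult[symmetric] power_add mult.commute)
  show ?thesis
  proof (cases "p dvd i")
    case True
    then have "[i = 0] (mod p)" by (simp add: cong_def)
    then have "\<omega> ^ i = 1" using wmod by fastforce
    then have "(\<Prod>c<p. (g ^^ (c * (p ^ (s - k - 1) * i))) (1 - \<zeta> ^ (p ^ k))) = (1 - x) ^ p"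
      unfolding gx by simp
    moreover obtain \<theta> where "\<theta> \<in> B" "(1 - x) ^ p = 1 - x ^ p + of_nat p * x * \<theta>"
      using one_minus_prime_power[OF xB] by blast
    ultimately show ?thesis using xB xp by (intro bexI[of _ "x * \<theta>"]) (auto intro: B_intros simp: mult.assoc)
  next
    case False
    have "(\<omega> ^ i) ^ p = 1" using wp by (metis power_mult power_one mult.commute)
    moreover have "\<omega> ^ i \<noteq> 1" using zeta1_power_ne_1[OF False] by (simp add: \<omega>_def)
    ultimately have "(\<Prod>c<p. (g ^^ (c * (p ^ (s - k - 1) * i))) (1 - \<zeta> ^ (p ^ k))) = 1 - x ^ p"
      unfolding gx using p by (intro prod_one_minus_root_of_unity) auto
    then show ?thesis using xp by (intro bexI[of _ 0]) (auto intro: B_intros)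
  qed
qed

lemma prod_add_p_multiple:
  assumes "\<And>l. l \<in> S \<Longrightarrow> f l \<in> B" "\<And>l. l \<in> S \<Longrightarrow> h l \<in> B" "finite S"
  shows "\<exists>\<theta>\<in>B. (\<Prod>l\<in>S. f l + of_nat p * h l) = (\<Prod>l\<in>S. f l) + of_nat p * \<theta>"
  using assms(3,1,2)
proof (induction S rule: finite_induct)
  case empty
  show ?case by (intro bexI[of _ 0]) (auto intro: B_intros)
next
  case (insert x F)
  then obtain \<theta> where \<theta>: "\<theta> \<in> B" "(\<Prod>l\<in>F. f l + of_nat p * h l) = (\<Prod>l\<in>F. f l) + of_nat p * \<theta>" by auto
  have F: "(\<Prod>l\<in>F. f l) \<in> B" using insert by (intro B_intros) auto
  have "(\<Prod>l\<in>insert x F. f l + of_nat p * h l) =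
      (\<Prod>l\<in>insert x F. f l) + of_nat p * (f x * \<theta> + h x * (\<Prod>l\<in>F. f l) + of_nat p * h x * \<theta>)"
    using insert \<theta>(2) by (simp add: algebra_simps)
  moreover have "f x * \<theta> + h x * (\<Prod>l\<in>F. f l) + of_nat p * h x * \<theta> \<in> B"
    using insert.prems \<theta>(1) F by (intro B_intros) auto
  ultimately show ?case by blast
qed

lemma prod_lessThan_add: "(\<Prod>l<a + b. f l) = (\<Prod>l<a. f l) * (\<Prod>l<b. f (a + l))" for f :: "nat \<Rightarrow> 'a" and a b :: nat
  by (induction b) (simp_all add: mult.assoc)

lemma prod_lessThan_mult:
  "(\<Prod>l<a * b. f l) = (\<Prod>l<a. \<Prod>c<b. f (l + a * c))" for f :: "nat \<Rightarrow> 'a" and a b :: nat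
proof (induction b)
  case (Suc b)
  have "(\<Prod>l<a * Suc b. f l) = (\<Prod>l<a * b + a. f l)" by (simp add: add.commute)
  also have "\<dots> = (\<Prod>l<a * b. f l) * (\<Prod>l<a. f (a * b + l))" by (rule prod_lessThan_add)
  finally show ?case unfolding Suc by (simp add: prod.distrib add.commute)
qed simp

text \<open>The index is split as \<open>l + p ^ m * c\<close>: the inner product over
  \<open>c\<close> raises \<open>k\<close> by 1, and the induction hypothesis treats the result.
  Modulo \<open>p\<close> the outcome does not depend on how often the orbit repeats itself, so
  divisibility of \<open>i\<close> beyond the hypothesis needs no cases.\<close>

lemma orbit_product:
  "k + m \<le> s \<Longrightarrow> p ^ (s - k - m) dvd i \<Longrightarrow>
    \<exists>\<theta>\<in>B. (\<Prod>l<p ^ m. (g ^^ (l * i)) (1 - \<zeta> ^ (p ^ k))) = 1 - \<zeta> ^ (p ^ (k + m)) + of_nat p * \<theta>"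
proof (induction m arbitrary: k)
  case 0
  show ?case by (intro bexI[of _ 0]) (auto intro: B_intros)
next
  case (Suc m)
  from Suc.prems(2) obtain i' where i': "i = p ^ (s - k - Suc m) * i'" by (elim dvdE)
  have pm: "p ^ m * i = p ^ (s - k - 1) * i'"
  proof -
    have "m + (s - k - Suc m) = s - k - 1" using Suc.prems(1) by simp
    then show ?thesis by (simp add: i' power_add[symmetric] mult.assoc[symmetric])
  qed
  obtain \<theta> where \<theta>: "\<theta> \<in> B" "(\<Prod>c<p. (g ^^ (c * (p ^ (s - k - 1) * i'))) (1 - \<zeta> ^ (p ^ k))) = 1 - \<zeta> ^ (p ^ (k + 1)) + of_nat p * \<theta>"
    using orbit_product_p[of k i'] Suc.prems(1) by auto
  define y where "y = 1 - \<zeta> ^ (p ^ k)"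
  define y' where "y' = 1 - \<zeta> ^ (p ^ (k + 1))"
  have yB: "y \<in> B" "y' \<in> B" unfolding y_def y'_def by (intro B_intros)+
  have "(\<Prod>l<p ^ Suc m. (g ^^ (l * i)) y) = (\<Prod>l<p ^ m * p. (g ^^ (l * i)) y)" by (simp add: mult.commute)
  also have "\<dots> = (\<Prod>l<p ^ m. \<Prod>c<p. (g ^^ ((l + p ^ m * c) * i)) y)" by (rule prod_lessThan_mult)
  also have "\<dots> = (\<Prod>l<p ^ m. (g ^^ (l * i)) (\<Prod>c<p. (g ^^ (c * (p ^ (s - k - 1) * i'))) y))"
  proof (intro prod.cong refl)
    fix l
    have "(l + p ^ m * c) * i = l * i + c * (p ^ (s - k - 1) * i')" for c
      unfolding pm[symmetric] by (simp add: algebra_simps)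
    then show "(\<Prod>c<p. (g ^^ ((l + p ^ m * c) * i)) y) = (g ^^ (l * i)) (\<Prod>c<p. (g ^^ (c * (p ^ (s - k - 1) * i'))) y)"
      using yB by (simp add: B.gi_prod B.gi_gi)
  qed
  also have "\<dots> = (\<Prod>l<p ^ m. (g ^^ (l * i)) y' + of_nat p * (g ^^ (l * i)) \<theta>)"
    using \<theta> yB unfolding y_def[symmetric] y'_def[symmetric]
    by (simp add: B.gi_add B.gi_mult B.gi_of_nat)
  finally have 1: "(\<Prod>l<p ^ Suc m. (g ^^ (l * i)) y) = (\<Prod>l<p ^ m. (g ^^ (l * i)) y' + of_nat p * (g ^^ (l * i)) \<theta>)" .
  obtain \<eta> where \<eta>: "\<eta> \<in> B" "(\<Prod>l<p ^ m. (g ^^ (l * i)) y' + of_nat p * (g ^^ (l * i)) \<theta>) =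
      (\<Prod>l<p ^ m. (g ^^ (l * i)) y') + of_nat p * \<eta>"
    using prod_add_p_multiple[of "{..<p ^ m}" "\<lambda>l. (g ^^ (l * i)) y'" "\<lambda>l. (g ^^ (l * i)) \<theta>"] yB \<theta>(1) giB by auto
  have "s - (k + 1) - m = s - k - Suc m" by simp
  then obtain \<theta>' where \<theta>': "\<theta>' \<in> B" "(\<Prod>l<p ^ m. (g ^^ (l * i)) y') = 1 - \<zeta> ^ (p ^ (k + 1 + m)) + of_nat p * \<theta>'"
    using Suc.IH[of "k + 1"] Suc.prems unfolding y'_def by auto
  have "(\<Prod>l<p ^ Suc m. (g ^^ (l * i)) y) = 1 - \<zeta> ^ (p ^ (k + Suc m)) + of_nat p * (\<theta>' + \<eta>)"
    unfolding 1 \<eta>(2) \<theta>'(2) by (simp add: distrib_left One_nat_def)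
  then show ?case using \<theta>' \<eta> unfolding y_def by (meson B_add)
qed

lemma power_diff_I:
  assumes "x \<in> I j" "y \<in> I j" "x - y \<in> I k" "n \<ge> 1"
  shows "x ^ n - y ^ n \<in> I (k + j * (n - 1))"
proof -
  have "x ^ n - y ^ n = (x - y) * (\<Sum>i<n. y ^ (n - Suc i) * x ^ i)"
    by (rule power_diff_sumr2)
  moreover have "(\<Sum>i<n. y ^ (n - Suc i) * x ^ i) \<in> I (j * (n - 1))"
  proof (intro I_sum)
    fix i assume "i \<in> {..<n}"
    then have "n - 1 = (n - Suc i) + i" by (simp add: One_nat_def)
    then have "j * (n - 1) = j * (n - Suc i) + j * i" by (simp only: distrib_left)
    moreover have "y ^ (n - Suc i) * x ^ i \<in> I (j * (n - Suc i) + j * i)"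
      using assms by (intro I_mult I_power)
    ultimately show "y ^ (n - Suc i) * x ^ i \<in> I (j * (n - 1))" by simp
  qed
  ultimately show ?thesis using I_mult[OF assms(3)] by simp
qed

text \<open>The relevant trace is computed modulo \<open>p\<^sup>s\<pi>\<^sup>c\<close> because
  \<open>(1 - \<zeta>\<^sup>M)\<^bsup>p^q\<^esup> \<equiv> 1 - \<zeta>\<^sup>N\<close> modulo \<open>p\<close>.\<close>

lemma Tr_orbit_power:
  assumes q: "q \<le> s" and n: "n + 1 = p ^ q * c" "n \<ge> 1"
    and \<theta>: "\<theta> \<in> B" and \<kappa>: "\<kappa> = 1 - \<zeta> ^ (p ^ (s - q)) + of_nat p * \<theta>"
  shows "\<exists>y\<in>I (N * c). B.Tr (\<kappa> ^ n) = of_nat N * (piA ^ (c - 1) + y)"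
proof -
  define M where "M = p ^ (s - q)"
  define y1 where "y1 = 1 - \<zeta> ^ M"
  have c1: "c \<ge> 1" using n(1) by (cases c) auto
  have MN: "M * p ^ q = N" using q by (simp add: M_def power_add[symmetric])
  have sq: "s - q < r + s" using r by simp
  have eM: "2 * M \<le> e" unfolding M_def by (rule power_P_le[OF sq])
  have eN: "2 * N \<le> e" using power_P_le[of s] r by simp
  have MleN: "M \<le> N" unfolding M_def using p_gt by (intro power_increasing) auto
  have y1I: "y1 \<in> I M"
    using one_minus_zeta_power[OF sq] II U1_B unfolding y1_def M_def by metis
  have pth: "of_nat p * \<theta> \<in> I e" using p_I \<theta> by (rule I_mult_right)
  then have "of_nat p * \<theta> \<in> I M" using eM by (intro I_mono[OF _ pth]) simp
  then have kI: "\<kappa> \<in> I M" unfolding \<kappa> M_def[symmetric] y1_def[symmetric] using y1I by (intro I_add)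
  have "\<kappa> - y1 \<in> I e" using pth by (simp add: \<kappa> y1_def M_def)
  then have "\<kappa> ^ n - y1 ^ n \<in> I (e + M * (n - 1))" using kI y1I n(2) by (intro power_diff_I)
  moreover have "N * c \<le> e + M * (n - 1)"
  proof -
    have "N * c = M * (n + 1)" by (simp only: MN[symmetric] n(1) mult.assoc)
    also have "\<dots> = M * (n - 1) + 2 * M" using n(2) by (simp add: algebra_simps)
    finally show ?thesis using eM by simp
  qed
  ultimately have "\<exists>y\<in>I (N * c). B.Tr (\<kappa> ^ n - y1 ^ n) = of_nat N * y" by (rule Tr_I')
  then obtain z1 where z1: "z1 \<in> I (N * c)" "B.Tr (\<kappa> ^ n - y1 ^ n) = of_nat N * z1" by blast
  \<comment> \<open>Since \<open>n = p ^ q * (c - 1) + (p ^ q - 1)\<close>, this is what remains of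
    \<open>y1 ^ n\<close> beside \<open>c - 1\<close> factors \<open>y1 ^ (p ^ q)\<close>, each of
    which may be replaced by \<open>piA\<close>.\<close>
  define w where "w = y1 ^ (p ^ q - 1)"
  have y1B: "y1 \<in> B" using y1I I_B by blast
  have wI: "w \<in> I (M * (p ^ q - 1))" unfolding w_def by (intro I_power y1I)
  obtain \<eta> where \<eta>: "\<eta> \<in> B" "(1 - \<zeta> ^ M) ^ (p ^ q) = 1 - (\<zeta> ^ M) ^ (p ^ q) + of_nat p * \<zeta> ^ M * \<eta>"
    using one_minus_prime_power_power[of "\<zeta> ^ M" q] by (auto intro: B_intros)
  have y1pi: "y1 ^ (p ^ q) - piA \<in> I e"
  proof -
    have "y1 ^ (p ^ q) - piA = of_nat p * (\<zeta> ^ M * \<eta>)"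
      unfolding y1_def \<eta>(2) power_mult[symmetric] MN piA_def by (simp add: mult.assoc)
    then show ?thesis using \<eta>(1) by (auto intro!: I_mult_right p_I B_intros)
  qed
  have y1n: "y1 ^ n = (y1 ^ (p ^ q)) ^ (c - 1) * w"
  proof -
    have "p ^ q \<ge> 1" using p_gt by (intro one_le_power) simp
    moreover have "p ^ q * c = p ^ q * (c - 1) + p ^ q" using c1 by (cases c) auto
    ultimately have "n = p ^ q * (c - 1) + (p ^ q - 1)" using n(1) by linarith
    then show ?thesis by (simp only: w_def power_add power_mult)
  qed
  have "y1 ^ n - piA ^ (c - 1) * w \<in> I (N * c)"
  proof (cases "c = 1")
    case True
    then show ?thesis using y1n by simp
  next
    case False
    have y1N: "y1 ^ (p ^ q) \<in> I N" using I_power[OF y1I, of "p ^ q"] MN by simp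
    have "(y1 ^ (p ^ q)) ^ (c - 1) - piA ^ (c - 1) \<in> I (e + N * (c - 1 - 1))"
      using y1N piA_power_I[of 1] y1pi False c1 by (intro power_diff_I) auto
    then have "((y1 ^ (p ^ q)) ^ (c - 1) - piA ^ (c - 1)) * w \<in> I (e + N * (c - 1 - 1))"
      using I_B[OF wI] by (rule I_mult_right)
    moreover have "N * c \<le> e + N * (c - 1 - 1)"
    proof -
      have "c = (c - 2) + 2" using False c1 by simp
      then obtain c' where "c = c' + 2" by blast
      then show ?thesis using eN by (simp add: algebra_simps)
    qed
    ultimately show ?thesis unfolding y1n by (metis I_mono left_diff_distrib)
  qed
  then have "\<exists>y\<in>I (N * c). B.Tr (y1 ^ n - piA ^ (c - 1) * w) = of_nat N * y" by (rule Tr_I') simp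
  then obtain z2 where z2: "z2 \<in> I (N * c)" "B.Tr (y1 ^ n - piA ^ (c - 1) * w) = of_nat N * z2" by blast
  \<comment> \<open>The binomial expansion contains only exponents \<open>M * j\<close> below
    \<open>N\<close>, so every term but the constant one has trace 0. Here it matters that
    \<open>n\<close> is one below a multiple of \<open>p ^ q\<close>.\<close>
  have Trw: "B.Tr w = of_nat N"
  proof -
    define m where "m = p ^ q - 1"
    have "w = (\<Sum>j\<le>m. of_nat (m choose j) * (- (\<zeta> ^ M)) ^ j)"
      using binomial_ring[of "- (\<zeta> ^ M)" 1 m] by (simp add: w_def y1_def m_def add.commute)
    also have "\<dots> = (\<Sum>j\<le>m. ((-1) ^ j * of_nat (m choose j)) * \<zeta> ^ (M * j))"
    proof (intro sum.cong refl)
      fix j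
      have "(- (\<zeta> ^ M)) ^ j = (-1) ^ j * \<zeta> ^ (M * j)" by (subst power_minus) (simp add: power_mult)
      then show "of_nat (m choose j) * (- (\<zeta> ^ M)) ^ j = (-1) ^ j * of_nat (m choose j) * \<zeta> ^ (M * j)" by simp
    qed
    finally have "B.Tr w = (\<Sum>j\<le>m. B.Tr (((-1) ^ j * of_nat (m choose j)) * \<zeta> ^ (M * j)))"
      by (simp only:) (intro B.Tr_sum B_intros)
    also have "\<dots> = (\<Sum>j\<le>m. if j = 0 then of_nat N else 0)"
    proof (intro sum.cong refl)
      fix j assume j: "j \<in> {..m}"
      have A': "(-1) ^ j * of_nat (m choose j) \<in> A" by (intro A_mult A_power A_uminus A_1 A_of_nat)
      have "B.Tr (\<zeta> ^ (M * j)) = 0" if "j > 0"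
      proof (rule Tr_zeta_power)
        show "0 < M * j" using that by (simp add: M_def)
        have "p ^ q \<ge> 1" using p_gt by (intro one_le_power) simp
        then have "j < p ^ q" using j unfolding m_def atMost_iff by linarith
        then have "M * j < M * p ^ q" by (simp add: M_def)
        then show "M * j < N" by (simp only: MN)
      qed
      then show "B.Tr (((-1) ^ j * of_nat (m choose j)) * \<zeta> ^ (M * j)) = (if j = 0 then of_nat N else 0)"
        using Tr_A_mult[OF A', of "\<zeta> ^ (M * j)"] by (cases "j = 0") (auto simp: Tr_1 intro: B_intros)
    qed
    also have "\<dots> = of_nat N" by simp
    finally show ?thesis .
  qed
  have piB: "piA ^ (c - 1) \<in> B" using A_B A_power piA_A by blast
  have kB: "\<kappa> ^ n \<in> B" "y1 ^ n \<in> B" "w \<in> B" "piA ^ (c - 1) * w \<in> B"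
    using I_B[OF kI] y1B piB I_B[OF wI] by (auto intro: B_intros)
  have "B.Tr (\<kappa> ^ n) = B.Tr (\<kappa> ^ n - y1 ^ n) + B.Tr (y1 ^ n - piA ^ (c - 1) * w) + B.Tr (piA ^ (c - 1) * w)"
    using kB by (simp add: B.Tr_diff)
  also have "B.Tr (piA ^ (c - 1) * w) = piA ^ (c - 1) * of_nat N"
    using kB A_power[OF piA_A] by (simp add: Tr_A_mult Trw)
  finally have "B.Tr (\<kappa> ^ n) = of_nat N * (piA ^ (c - 1) + (z1 + z2))" unfolding z1(2) z2(2) by (simp add: algebra_simps)
  then show ?thesis using I_add[OF z1(1) z2(1)] by blast
qed

end

subsection \<open>Units by elimination\<close>

text \<open>Nakayama's lemma in coordinates, for an ideal \<open>M\<close> such that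
  \<open>1 + M\<close> consists of units. The proof is Gaussian elimination with pivots in
  \<open>1 + M\<close>. It serves twice: for left inverses in the order and for units in the ring of
  cyclotomic integers.\<close>

lemma nakayama_vectors:
  fixes U :: "(nat \<Rightarrow> 'a::field) set" and S M :: "'a set"
  assumes S_mult: "\<And>x y. x \<in> S \<Longrightarrow> y \<in> S \<Longrightarrow> x * y \<in> S" and S_uminus: "\<And>x. x \<in> S \<Longrightarrow> - x \<in> S"
    and S_add: "\<And>x y. x \<in> S \<Longrightarrow> y \<in> S \<Longrightarrow> x + y \<in> S" and S_1: "1 \<in> S"
    and M_S: "\<And>x. x \<in> M \<Longrightarrow> x \<in> S" and M_0: "0 \<in> M"
    and M_add: "\<And>x y. x \<in> M \<Longrightarrow> y \<in> M \<Longrightarrow> x + y \<in> M"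
    and M_mult: "\<And>x y. x \<in> S \<Longrightarrow> y \<in> M \<Longrightarrow> x * y \<in> M"
    and unit: "\<And>x. x \<in> M \<Longrightarrow> \<exists>y\<in>S. (1 + x) * y = 1"
    and U_add: "\<And>x y. x \<in> U \<Longrightarrow> y \<in> U \<Longrightarrow> (\<lambda>j. x j + y j) \<in> U"
    and U_smult: "\<And>b x. b \<in> S \<Longrightarrow> x \<in> U \<Longrightarrow> (\<lambda>j. b * x j) \<in> U"
    and U_0: "\<And>x j. x \<in> U \<Longrightarrow> j \<ge> n \<Longrightarrow> x j = 0"
    and gen: "\<And>i. i < n \<Longrightarrow> \<exists>w\<in>U. \<forall>j<n. w j - (if j = i then 1 else 0) \<in> M"
    and i: "i < n"
  shows "(\<lambda>j. if j = i then 1 else 0) \<in> U"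
proof -
  \<comment> \<open>After \<open>k\<close> rounds the first \<open>k\<close> coordinates are exact,
    while the congruences modulo \<open>M\<close> persist in all of them.\<close>
  have "\<forall>i<n. \<exists>w\<in>U. (\<forall>j<n. w j - (if j = i then 1 else 0) \<in> M) \<and> (\<forall>j<k. w j = (if j = i then 1 else 0))"
    if "k \<le> n" for k
    using that
  proof (induction k)
    case 0
    show ?case using gen by simp
  next
    case (Suc k)
    then have k: "k < n" by simp
    from Suc obtain w where w: "w \<in> U" "\<And>j. j < n \<Longrightarrow> w j - (if j = k then 1 else 0) \<in> M"
      "\<And>j. j < k \<Longrightarrow> w j = (if j = k then 1 else 0)"
      by (metis Suc_leD k)
    obtain y where y: "y \<in> S" "w k * y = 1" using unit[OF w(2)[OF k]] by auto
    define v where "v = (\<lambda>j. y * w j)"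
    have vU: "v \<in> U" unfolding v_def using y(1) w(1) by (rule U_smult)
    have vk: "v k = 1" using y(2) by (simp add: v_def mult.commute)
    have v0: "v j = 0" if "j < k" for j using w(3)[OF that] that by (simp add: v_def)
    have vM: "v j \<in> M" if "j < n" "j \<noteq> k" for j
      unfolding v_def using w(2)[OF that(1)] that y(1) by (intro M_mult) auto
    have vS: "v j \<in> S" if "j < n" for j using vM[OF that] vk M_S S_1 by (cases "j = k") auto
    show ?case
    proof (intro allI impI)
      fix i assume i: "i < n"
      show "\<exists>w\<in>U. (\<forall>j<n. w j - (if j = i then 1 else 0) \<in> M) \<and> (\<forall>j<Suc k. w j = (if j = i then 1 else 0))"
      proof (cases "i = k")
        case True
        show ?thesis
        proof (intro bexI[OF _ vU] conjI allI impI)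
          fix j assume "j < n"
          then show "v j - (if j = i then 1 else 0) \<in> M" using vM vk True M_0 by (cases "j = k") auto
        next
          fix j assume "j < Suc k"
          then show "v j = (if j = i then 1 else 0)" using v0 vk True by (cases "j = k") auto
        qed
      next
        case False
        from Suc i obtain x where x: "x \<in> U" "\<And>j. j < n \<Longrightarrow> x j - (if j = i then 1 else 0) \<in> M"
          "\<And>j. j < k \<Longrightarrow> x j = (if j = i then 1 else 0)"
          by (metis Suc_leD)
        have xk: "x k \<in> M" using x(2)[OF k] False by simp
        define z where "z = (\<lambda>j. x j + (- x k) * v j)"
        have zU: "z \<in> U" unfolding z_def using x(1) vU xk M_S S_uminus by (intro U_add U_smult) auto
        show ?thesis
        proof (intro bexI[OF _ zU] conjI allI impI)
          fix j assume j: "j < n"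
          have "(- v j) * x k \<in> M" using vS[OF j] xk by (intro M_mult S_uminus)
          then have "(x j - (if j = i then 1 else 0)) + (- v j) * x k \<in> M" using x(2)[OF j] by (intro M_add)
          then show "z j - (if j = i then 1 else 0) \<in> M" by (simp add: z_def algebra_simps)
        next
          fix j assume "j < Suc k"
          then show "z j = (if j = i then 1 else 0)"
            using x(3)[of j] v0[of j] vk False by (cases "j = k") (auto simp: z_def)
        qed
      qed
    qed
  qed
  from this[of n] i obtain w where w: "w \<in> U" "\<And>j. j < n \<Longrightarrow> w j = (if j = i then 1 else 0)" by auto
  have "w = (\<lambda>j. if j = i then 1 else 0)"
    using w U_0[OF w(1)] i by (intro ext) (metis not_less)
  then show ?thesis using w(1) by simp
qed

context cyclotomic_order
begin

section \<open>Units of the order and its filtration by powers of Pi\<close>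

abbreviation \<Delta> :: "(nat \<Rightarrow> 'a) ring" where "\<Delta> \<equiv> cyclic_algebra B g N \<tau>"

definition mx :: "'a set" where "mx = {\<Pi> * b + T * c | b c. b \<in> B \<and> c \<in> B}"

lemma mx_0: "0 \<in> mx"
proof -
  have "0 = \<Pi> * 0 + T * 0" by simp
  then show ?thesis unfolding mx_def using B_0 by blast
qed

lemma mx_add: "x \<in> mx \<Longrightarrow> y \<in> mx \<Longrightarrow> x + y \<in> mx"
proof -
  assume "x \<in> mx" "y \<in> mx"
  then obtain b c b' c' where h: "b \<in> B" "c \<in> B" "b' \<in> B" "c' \<in> B" "x = \<Pi> * b + T * c" "y = \<Pi> * b' + T * c'"
    unfolding mx_def by blast
  have "x + y = \<Pi> * (b + b') + T * (c + c')" unfolding h(5,6) by (simp add: algebra_simps)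
  then show ?thesis unfolding mx_def using h B_add by blast
qed

lemma mx_mult: "x \<in> B \<Longrightarrow> y \<in> mx \<Longrightarrow> x * y \<in> mx"
proof -
  assume x: "x \<in> B" and "y \<in> mx"
  then obtain b c where h: "b \<in> B" "c \<in> B" "y = \<Pi> * b + T * c" unfolding mx_def by blast
  have "x * y = \<Pi> * (x * b) + T * (x * c)" unfolding h(3) by (simp add: algebra_simps)
  then show ?thesis unfolding mx_def using h x B_mult by blast
qed

lemma mx_B: "x \<in> mx \<Longrightarrow> x \<in> B"
  unfolding mx_def by (auto intro: B_intros)

lemma mx_uminus: "x \<in> mx \<Longrightarrow> - x \<in> mx"
  using mx_mult[of "-1" x] B_uminus[OF B_1] by simp

lemma mx_sum: "(\<And>i. i \<in> S \<Longrightarrow> f i \<in> mx) \<Longrightarrow> sum f S \<in> mx"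
  by (induction S rule: infinite_finite_induct) (auto intro: mx_0 mx_add)

lemma mx_unit: "x \<in> mx \<Longrightarrow> Bunit (1 + x)"
  unfolding mx_def using max_one_plus_unit by blast

lemma I1_mx: "x \<in> I 1 \<Longrightarrow> x \<in> mx"
proof -
  assume "x \<in> I 1"
  then obtain b where "b \<in> B" "x = \<Pi> * b + T * 0" by (auto elim: IE)
  then show ?thesis unfolding mx_def using B_0 by blast
qed

lemma T_mx: "T \<in> mx"
proof -
  have "T = \<Pi> * 0 + T * 1" by simp
  then show ?thesis unfolding mx_def using B_0 B_1 by blast
qed

lemma gi_mx: "x \<in> mx \<Longrightarrow> (g ^^ i) x \<in> mx"
proof -
  assume "x \<in> mx"
  then obtain b c where h: "b \<in> B" "c \<in> B" "x = \<Pi> * b + T * c" unfolding mx_def by blast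
  have "(g ^^ i) x = (g ^^ i) (\<Pi> * b) + (g ^^ i) c * T"
    using h by (simp add: B.gi_add B.gi_mult B_intros gi_A T_A mult.commute)
  moreover have "\<Pi> * b \<in> I 1" using II[OF h(1), of 1] by simp
  ultimately show ?thesis using gi_I[of "\<Pi> * b" 1 i] h giB by (metis I1_mx T_mx mx_add mx_mult)
qed

lemma rm_ideal:
  assumes "\<And>x i. x \<in> J \<Longrightarrow> (g ^^ i) x \<in> J" "\<And>x b. b \<in> B \<Longrightarrow> x \<in> J \<Longrightarrow> b * x \<in> J" "\<And>i. z i \<in> J"
  shows "B.rm z i k \<in> J"
  unfolding B.rm_def using assms by (auto simp: mult.commute[of _ \<tau>] tau_B)

lemma mult_ideal_right:
  assumes J: "\<And>x i. x \<in> J \<Longrightarrow> (g ^^ i) x \<in> J" "\<And>x b. b \<in> B \<Longrightarrow> x \<in> J \<Longrightarrow> b * x \<in> J"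
    "0 \<in> J" "\<And>x y. x \<in> J \<Longrightarrow> y \<in> J \<Longrightarrow> x + y \<in> J"
    and z: "\<And>i. z i \<in> J" and y: "y \<in> carrier \<Delta>"
  shows "(y \<otimes>\<^bsub>\<Delta>\<^esub> z) k \<in> J"
proof -
  have sum: "sum f S \<in> J" if "\<And>i. i \<in> S \<Longrightarrow> f i \<in> J" for f :: "nat \<Rightarrow> 'a" and S
    using that by (induction S rule: infinite_finite_induct) (auto intro: J)
  show ?thesis unfolding B.mult_nth using J y rm_ideal[OF J(1,2) z]
    by (auto intro!: sum J(2))
qed

lemma one_nth: "\<one>\<^bsub>\<Delta>\<^esub> k = (if k = 0 then 1 else 0)"
  by (simp add: B.one_eq cyc_monom_def)

lemma mult_nth_0: "k \<ge> N \<Longrightarrow> (x \<otimes>\<^bsub>\<Delta>\<^esub> y) k = 0"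
  by (simp add: B.mult_nth)

text \<open>The left ideal generated by \<open>x\<close> contains \<open>u ^ i * x\<close>, which is
  the \<open>i\<close>-th unit vector modulo the maximal ideal, so Nakayama applies. The inverse is
  again 1 modulo that ideal; hence it has a left inverse too, which makes it two-sided.\<close>

lemma left_inverse_mx:
  assumes x: "x \<in> carrier \<Delta>" and x1: "\<And>i. x i - \<one>\<^bsub>\<Delta>\<^esub> i \<in> mx"
  obtains y where "y \<in> carrier \<Delta>" "y \<otimes>\<^bsub>\<Delta>\<^esub> x = \<one>\<^bsub>\<Delta>\<^esub>" "\<And>i. y i - \<one>\<^bsub>\<Delta>\<^esub> i \<in> mx"
proof -
  define U where "U = {y \<otimes>\<^bsub>\<Delta>\<^esub> x | y. y \<in> carrier \<Delta>}"
  have "(\<lambda>j. if j = 0 then 1 else 0) \<in> U"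
  proof (rule nakayama_vectors[where S = B and M = mx and n = N])
    fix u v assume "u \<in> U" "v \<in> U"
    then obtain a b where ab: "a \<in> carrier \<Delta>" "u = a \<otimes>\<^bsub>\<Delta>\<^esub> x" "b \<in> carrier \<Delta>" "v = b \<otimes>\<^bsub>\<Delta>\<^esub> x" unfolding U_def by blast
    then have "(\<lambda>j. u j + v j) = (a \<oplus>\<^bsub>\<Delta>\<^esub> b) \<otimes>\<^bsub>\<Delta>\<^esub> x"
      using x by (simp add: B.ring.l_distr fun_eq_iff B.add_nth)
    then show "(\<lambda>j. u j + v j) \<in> U" unfolding U_def using ab by blast
  next
    fix b u assume b: "b \<in> B" and "u \<in> U"
    then obtain a where a: "a \<in> carrier \<Delta>" "u = a \<otimes>\<^bsub>\<Delta>\<^esub> x" unfolding U_def by blast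
    have c: "cyc_monom b 0 \<in> carrier \<Delta>" using b N_gt_1 by simp
    then have "(\<lambda>j. b * u j) = (cyc_monom b 0 \<otimes>\<^bsub>\<Delta>\<^esub> a) \<otimes>\<^bsub>\<Delta>\<^esub> x"
      using a x by (auto simp: B.ring.m_assoc B.const_mult_nth B.mult_closed)
    then show "(\<lambda>j. b * u j) \<in> U" unfolding U_def using a c B.mult_closed by blast
  next
    fix u j assume "u \<in> U" "j \<ge> N"
    then show "u j = 0" unfolding U_def by (auto simp: mult_nth_0)
  next
    fix i assume i: "i < N"
    show "\<exists>w\<in>U. \<forall>j<N. w j - (if j = i then 1 else 0) \<in> mx"
    proof (intro bexI allI impI)
      show "cyc_monom 1 i \<otimes>\<^bsub>\<Delta>\<^esub> x \<in> U" unfolding U_def using i B_1 by auto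
      fix j assume j: "j < N"
      show "(cyc_monom 1 i \<otimes>\<^bsub>\<Delta>\<^esub> x) j - (if j = i then 1 else 0) \<in> mx"
      proof (cases "j = i")
        case True
        have "(g ^^ i) (x 0 - 1) \<in> mx" using x1[of 0] by (intro gi_mx) (simp add: one_nth)
        then show ?thesis using True i x by (simp add: B.monom_mult_nth B.rm_def B.gi_diff B_1)
      next
        case False
        have "(j + N - i) mod N \<noteq> 0" using False i j by (auto simp: add_diff_mod_eq)
        then have "x ((j + N - i) mod N) \<in> mx" using x1[of "(j + N - i) mod N"] by (simp add: one_nth)
        then have "(g ^^ i) (x ((j + N - i) mod N)) \<in> mx" by (rule gi_mx)
        then have "\<tau> * (g ^^ i) (x ((j + N - i) mod N)) \<in> mx" "(g ^^ i) (x ((j + N - i) mod N)) \<in> mx"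
          by (auto intro: mx_mult tau_B)
        moreover have "(cyc_monom 1 i \<otimes>\<^bsub>\<Delta>\<^esub> x) j = (if j < i then \<tau> else 1) * (g ^^ i) (x ((j + N - i) mod N))"
          unfolding B.monom_mult_nth[OF i] B.rm_def if_P[OF j] by (simp only: mult_1 mult.commute)
        ultimately show ?thesis using False by simp
      qed
    qed
  next
    fix z assume "z \<in> mx"
    then have "Bunit (1 + z)" by (rule mx_unit)
    then show "\<exists>y\<in>B. (1 + z) * y = 1" unfolding Bunit_def by (intro bexI[of _ "inverse (1 + z)"]) auto
  qed (use N_gt_1 in \<open>auto intro: B_intros mx_0 mx_add mx_mult mx_B\<close>)
  then obtain y where y: "y \<in> carrier \<Delta>" "y \<otimes>\<^bsub>\<Delta>\<^esub> x = (\<lambda>j. if j = 0 then 1 else 0)" unfolding U_def by fastforce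
  have yx: "y \<otimes>\<^bsub>\<Delta>\<^esub> x = \<one>\<^bsub>\<Delta>\<^esub>" unfolding y(2) by (simp add: fun_eq_iff one_nth)
  have "y i - \<one>\<^bsub>\<Delta>\<^esub> i \<in> mx" for i
  proof -
    have "(y \<otimes>\<^bsub>\<Delta>\<^esub> (x \<ominus>\<^bsub>\<Delta>\<^esub> \<one>\<^bsub>\<Delta>\<^esub>)) i \<in> mx"
      using x y x1 by (intro mult_ideal_right) (auto simp: B.a_minus_nth intro: gi_mx mx_mult mx_0 mx_add)
    moreover have "y \<otimes>\<^bsub>\<Delta>\<^esub> (x \<ominus>\<^bsub>\<Delta>\<^esub> \<one>\<^bsub>\<Delta>\<^esub>) = \<one>\<^bsub>\<Delta>\<^esub> \<ominus>\<^bsub>\<Delta>\<^esub> y"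
      using x y(1) yx by (simp add: a_minus_def B.ring.r_distr B.ring.r_minus)
    ultimately have "\<one>\<^bsub>\<Delta>\<^esub> i - y i \<in> mx" using y(1) by (simp add: B.a_minus_nth)
    then show ?thesis using mx_uminus by fastforce
  qed
  then show ?thesis using that y(1) yx by blast
qed

lemma unit_mx:
  assumes x: "x \<in> carrier \<Delta>" and x1: "\<And>i. x i - \<one>\<^bsub>\<Delta>\<^esub> i \<in> mx"
  shows "x \<in> Units \<Delta>"
proof -
  obtain y where y: "y \<in> carrier \<Delta>" "y \<otimes>\<^bsub>\<Delta>\<^esub> x = \<one>\<^bsub>\<Delta>\<^esub>" "\<And>i. y i - \<one>\<^bsub>\<Delta>\<^esub> i \<in> mx"
    using left_inverse_mx[OF x x1] by blast
  obtain z where z: "z \<in> carrier \<Delta>" "z \<otimes>\<^bsub>\<Delta>\<^esub> y = \<one>\<^bsub>\<Delta>\<^esub>"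
    using left_inverse_mx[OF y(1,3)] by blast
  have "z = (z \<otimes>\<^bsub>\<Delta>\<^esub> y) \<otimes>\<^bsub>\<Delta>\<^esub> x"
    using x y z B.ring.m_assoc[OF z(1) y(1) x] by simp
  then have "z = x" using z x by simp
  then show ?thesis unfolding Units_def using x y z by auto
qed

text \<open>This is \<open>Pi ^ k * Delta\<close> in coordinates, a two-sided ideal because
  \<open>g\<close> preserves every \<open>I k\<close>.\<close>

definition Lv :: "nat \<Rightarrow> (nat \<Rightarrow> 'a) set" where
  "Lv k = {x \<in> carrier \<Delta>. \<forall>i. x i \<in> I k}"

lemma Lv_carrier [simp]: "x \<in> Lv k \<Longrightarrow> x \<in> carrier \<Delta>"
  unfolding Lv_def mem_Collect_eq by (rule conjunct1)

lemma Lv_nth: "x \<in> Lv k \<Longrightarrow> x i \<in> I k"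
  unfolding Lv_def mem_Collect_eq by (drule conjunct2) (rule spec)

lemma LvI: "x \<in> carrier \<Delta> \<Longrightarrow> (\<And>i. i < N \<Longrightarrow> x i \<in> I k) \<Longrightarrow> x \<in> Lv k"
proof -
  assume x: "x \<in> carrier \<Delta>" and I: "\<And>i. i < N \<Longrightarrow> x i \<in> I k"
  have "x i \<in> I k" for i
    by (cases "i < N") (simp_all add: I B.carrier_nth_0[OF x])
  then show "x \<in> Lv k" using x unfolding Lv_def mem_Collect_eq by blast
qed

lemma Lv_mono: "j \<le> k \<Longrightarrow> x \<in> Lv k \<Longrightarrow> x \<in> Lv j"
  unfolding Lv_def mem_Collect_eq using I_mono[of j k] by meson

lemma Lv_0: "Lv 0 = carrier \<Delta>"
proof (intro equalityI subsetI)
  fix x assume "x \<in> carrier \<Delta>"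
  then show "x \<in> Lv 0" unfolding Lv_def mem_Collect_eq I_0 by (blast intro: B.carrier_nth)
qed (rule Lv_carrier)

lemma Lv_add: "x \<in> Lv k \<Longrightarrow> y \<in> Lv k \<Longrightarrow> x \<oplus>\<^bsub>\<Delta>\<^esub> y \<in> Lv k"
  by (rule LvI) (simp_all only: B.ring.add.m_closed B.add_nth I_add Lv_nth Lv_carrier)

lemma Lv_mult:
  assumes "x \<in> Lv j" "y \<in> Lv k"
  shows "x \<otimes>\<^bsub>\<Delta>\<^esub> y \<in> Lv (j + k)"
proof (rule LvI)
  show "x \<otimes>\<^bsub>\<Delta>\<^esub> y \<in> carrier \<Delta>" using assms by (simp add: B.mult_closed)
  fix i
  have "B.rm y l i \<in> I k" for l
    by (rule rm_ideal) (simp_all add: gi_I I_mult_left Lv_nth[OF assms(2)])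
  then show "(x \<otimes>\<^bsub>\<Delta>\<^esub> y) i \<in> I (j + k)"
    unfolding B.mult_nth using Lv_nth[OF assms(1)] by (auto intro!: I_sum I_mult)
qed

lemma Lv_mult_right: "x \<in> Lv j \<Longrightarrow> y \<in> carrier \<Delta> \<Longrightarrow> x \<otimes>\<^bsub>\<Delta>\<^esub> y \<in> Lv j"
  using Lv_mult[of x j y 0] Lv_0 by simp

lemma Lv_mult_left: "y \<in> carrier \<Delta> \<Longrightarrow> x \<in> Lv j \<Longrightarrow> y \<otimes>\<^bsub>\<Delta>\<^esub> x \<in> Lv j"
  using Lv_mult[of y 0 x j] Lv_0 by simp

lemma Lv_pow: "z \<in> Lv m \<Longrightarrow> z [^]\<^bsub>\<Delta>\<^esub> (k::nat) \<in> Lv (m * k)"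
proof (induction k)
  case 0
  then show ?case using Lv_0 by simp
next
  case (Suc k)
  then have "z [^]\<^bsub>\<Delta>\<^esub> k \<otimes>\<^bsub>\<Delta>\<^esub> z \<in> Lv (m * k + m)" by (intro Lv_mult)
  then show ?case by (simp add: add.commute)
qed

lemma unit_one_plus_Lv: "z \<in> Lv k \<Longrightarrow> k \<ge> 1 \<Longrightarrow> \<one>\<^bsub>\<Delta>\<^esub> \<oplus>\<^bsub>\<Delta>\<^esub> z \<in> Units \<Delta>"
proof (rule unit_mx)
  assume z: "z \<in> Lv k" "k \<ge> 1"
  then show "\<one>\<^bsub>\<Delta>\<^esub> \<oplus>\<^bsub>\<Delta>\<^esub> z \<in> carrier \<Delta>" by simp
  fix i
  show "(\<one>\<^bsub>\<Delta>\<^esub> \<oplus>\<^bsub>\<Delta>\<^esub> z) i - \<one>\<^bsub>\<Delta>\<^esub> i \<in> mx"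
    using I_mono[OF z(2) Lv_nth[OF z(1)]] by (simp add: B.add_nth I1_mx)
qed

subsection \<open>Expansion of the reduced norm\<close>

text \<open>The \<open>k\<close>-th term of the reduced trace of \<open>log (1 + z)\<close>.\<close>

definition lterm :: "(nat \<Rightarrow> 'a) \<Rightarrow> nat \<Rightarrow> 'a" where
  "lterm z k = (-1) ^ (k + 1) * B.Tr ((z [^]\<^bsub>\<Delta>\<^esub> k) 0) / of_nat k"

lemma lterm_I:
  assumes z: "(z [^]\<^bsub>\<Delta>\<^esub> k) 0 \<in> I (m * k)" and k: "k = p ^ a * k'" "\<not> p dvd k'" "a \<le> s"
  shows "lterm z k \<in> I (N * ((s - a) * \<epsilon> + p ^ a * k' * m div p ^ s))"
proof -
  obtain y where y: "y \<in> I (N * (m * k div N))" "B.Tr ((z [^]\<^bsub>\<Delta>\<^esub> k) 0) = of_nat N * y"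
    using Tr_I[OF z] by blast
  have "of_nat N = (of_nat (p ^ a) * of_nat (p ^ (s - a)) :: 'a)"
    using k(3) by (simp add: power_add[symmetric])
  moreover have "of_nat (p ^ a) \<noteq> (0 :: 'a)" using p_gt by simp
  ultimately have "lterm z k = (-1) ^ (k + 1) * inverse (of_nat k') * (of_nat (p ^ (s - a)) * y)"
    unfolding lterm_def y(2) unfolding k(1) using p_gt by (simp add: field_simps)
  moreover have "(-1) ^ (k + 1) * inverse (of_nat k') \<in> B"
    using of_nat_unit[OF k(2)] unfolding Bunit_def by (intro B_intros) auto
  moreover have "of_nat (p ^ (s - a)) * y \<in> I (e * (s - a) + N * (m * k div N))"
    using y(1) by (intro I_mult p_power_I)
  moreover have "e * (s - a) + N * (m * k div N) = N * ((s - a) * \<epsilon> + p ^ a * k' * m div p ^ s)"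
    by (simp add: e_def k(1) algebra_simps)
  ultimately show ?thesis by (metis I_mult_left)
qed

text \<open>Since \<open>x\<close> is a multiple of \<open>p\<close>, the factor
  \<open>p ^ (m - 2)\<close> of \<open>x ^ (m - 2)\<close> absorbs the factorial and
  \<open>x * x\<close> is left over; one factor counts as an element of \<open>I j\<close>, the
  other as one of \<open>I e\<close>.\<close>

lemma divided_power_I:
  assumes x: "x \<in> I j" "x \<in> I e" and m: "m \<ge> 2"
  shows "x ^ m / fact m \<in> I (j + e)"
proof -
  obtain u v where uv: "\<not> p dvd v" "v * p ^ (m - 2) = u * fact m"
    using prime_power_div_fact[OF p m] by blast
  obtain w where w: "w \<in> U1" "of_nat p = - (\<Pi> ^ e) * w" using p_eq by blast
  obtain b where b: "b \<in> B" "x = \<Pi> ^ e * b" using x(2) by (rule IE)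
  define c where "c = - (inverse w * b)"
  have c: "c \<in> B" unfolding c_def using w b by (intro B_intros U1_inverse_B)
  have xc: "x = of_nat p * c" using U1_ne_0[OF w(1)] by (simp add: w(2) b(2) c_def)
  have v: "of_nat v \<noteq> (0 :: 'a)" "inverse (of_nat v) \<in> B" using of_nat_unit[OF uv(1)] by (auto simp: Bunit_def)
  have "of_nat v * of_nat p ^ (m - 2) = (of_nat u * fact m :: 'a)"
    using arg_cong[OF uv(2), of "of_nat :: nat \<Rightarrow> 'a"] by simp
  then have pf: "of_nat p ^ (m - 2) / fact m = (of_nat u * inverse (of_nat v) :: 'a)"
    using v(1) by (simp add: field_simps)
  have "x ^ m = x * (x ^ (m - 2) * x)"
    using m by (metis Suc_diff_le Suc_1 diff_Suc_1 mult.commute numeral_2_eq_2 power_Suc Suc_diff_Suc add_2_eq_Suc le_add_diff_inverse)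
  also have "x ^ (m - 2) = of_nat p ^ (m - 2) * c ^ (m - 2)" by (simp add: xc power_mult_distrib)
  finally have "x ^ m / fact m = (of_nat p ^ (m - 2) / fact m) * c ^ (m - 2) * (x * x)" by simp
  also have "\<dots> = (of_nat u * inverse (of_nat v) * c ^ (m - 2)) * (x * x)" unfolding pf ..
  also have "\<dots> \<in> I (j + e)" using v c x by (intro I_mult_left I_mult B_intros)
  finally show ?thesis .
qed

lemma reduced_norm_expansion:
  assumes z: "z \<in> carrier \<Delta>"
    and L0: "\<And>k. 1 \<le> k \<Longrightarrow> k \<le> N \<Longrightarrow> lterm z k \<in> I j0"
    and Le: "\<And>k. 1 \<le> k \<Longrightarrow> k < N \<Longrightarrow> lterm z k \<in> I e"
    and j: "j0 \<le> j1" "j1 \<le> 2 * j0" "j1 \<le> j0 + e"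
  shows "reduced_norm \<Delta> N (\<one>\<^bsub>\<Delta>\<^esub> \<oplus>\<^bsub>\<Delta>\<^esub> z) - 1 - (\<Sum>k=1..N. lterm z k) \<in> I j1"
proof -
  obtain F where F: "F 0 = 1" "reduced_norm \<Delta> N (\<one>\<^bsub>\<Delta>\<^esub> \<oplus>\<^bsub>\<Delta>\<^esub> z) = (\<Sum>m\<le>N. F m)"
    "\<And>m. 1 \<le> m \<Longrightarrow> m \<le> N \<Longrightarrow>
      of_nat m * F m = (\<Sum>i=1..m. (-1) ^ (i + 1) * B.Tr ((z [^]\<^bsub>\<Delta>\<^esub> i) 0) * F (m - i))"
    using B.reduced_norm_newton[OF z] by blast
  have "F k - lterm z k \<in> I j1" if k: "1 \<le> k" "k \<le> N" for k
  proof (rule newton_exp_expansion[where J = "I j0" and n = N])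
    fix m assume m: "1 \<le> m" "m \<le> N"
    show "of_nat m * F m = (\<Sum>i=1..m. of_nat i * lterm z i * F (m - i))"
      unfolding F(3)[OF m] by (intro sum.cong refl) (auto simp: lterm_def)
  next
    fix i m :: nat assume im: "1 \<le> i" "2 \<le> m" "i * m \<le> N"
    \<comment> \<open>Divided powers of order at least 2 involve only indices below
      \<open>N\<close>. This matters because the term at \<open>N\<close> need not be divisible by
      \<open>p\<close>.\<close>
    then have "i < N" using mult_le_mono2[OF im(2), of i] by linarith
    then have "lterm z i ^ m / fact m \<in> I (j0 + e)" using im L0 Le by (intro divided_power_I) auto
    then show "lterm z i ^ m / fact m \<in> I j1" using j(3) I_mono by blast
  next
    fix x y assume "x \<in> I j0" "y \<in> I j0"
    then have "x * y \<in> I (j0 + j0)" by (rule I_mult)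
    then show "x * y \<in> I j1" using j(2) I_mono by (metis mult_2)
  qed (use F(1) k L0 I_mono[OF j(1)] in \<open>auto intro: I_add\<close>)
  then have "(\<Sum>k=1..N. F k - lterm z k) \<in> I j1" by (intro I_sum) auto
  moreover have "(\<Sum>m\<le>N. F m) = 1 + (\<Sum>k=1..N. F k)"
    using F(1) by (simp add: atMost_atLeast0 sum.atLeast_Suc_atMost One_nat_def)
  ultimately show ?thesis unfolding F(2) by (simp add: sum_subtractf)
qed


text \<open>The main part of the term of index \<open>p ^ (s - q)\<close> for the monomial
  \<open>a * Pi ^ n * u ^ i\<close>, where \<open>n + 1 = p ^ q * c\<close>. If \<open>p ^ q\<close>
  does not divide \<open>i\<close>, that power of the monomial has no coefficient at
  \<open>u ^ 0\<close>.\<close>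

definition lead :: "nat \<Rightarrow> nat \<Rightarrow> nat \<Rightarrow> 'a \<Rightarrow> 'a" where
  "lead q c i a = (if p ^ q dvd i then of_nat (p ^ q) * piA ^ (c - 1) * (a ^ (p ^ (s - q)) * \<tau> ^ (i div p ^ q)) else 0)"

lemma monom_Lv: "b \<in> I k \<Longrightarrow> i < N \<Longrightarrow> cyc_monom b i \<in> Lv k"
proof (rule LvI)
  assume "b \<in> I k" "i < N"
  then show "cyc_monom b i \<in> carrier \<Delta>" by (intro B.cyc_monom_carrier I_B)
  show "cyc_monom b i j \<in> I k" for j using \<open>b \<in> I k\<close> by (simp add: cyc_monom_def)
qed

text \<open>The conjugates of Pi multiply to an orbit product, whose \<open>n\<close>-th power has
  trace \<open>N * piA ^ (c - 1)\<close> up to higher order. Division by the index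
  \<open>p ^ (s - q)\<close> turns \<open>N\<close> into \<open>p ^ q\<close>, and the sign is
  positive because the index is odd.\<close>

lemma lterm_monom_lead:
  assumes q: "q \<le> s" and n: "n + 1 = p ^ q * c" "n \<ge> 1" and i: "i < N" and a: "a \<in> A"
  shows "lterm (cyc_monom (a * \<Pi> ^ n) i) (p ^ (s - q)) - lead q c i a \<in> I (e * q + N * c)"
proof -
  define k where "k = p ^ (s - q)"
  have kN: "N = p ^ q * k" using q by (simp add: k_def power_add[symmetric])
  have k0: "k > 0" by (simp add: k_def)
  have aB: "a * \<Pi> ^ n \<in> B" using A_B[OF a] by (intro B_intros)
  have zk: "(cyc_monom (a * \<Pi> ^ n) i [^]\<^bsub>\<Delta>\<^esub> k) 0 =
      (if i * k mod N = 0 then (\<Prod>l<k. (g ^^ (l * i)) (a * \<Pi> ^ n)) * \<tau> ^ (i * k div N) else 0)"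
    unfolding B.monom_pow[OF i aB] by (simp add: cyc_monom_def)
  have dvd: "i * k mod N = 0 \<longleftrightarrow> p ^ q dvd i"
  proof -
    have "i * k mod N = 0 \<longleftrightarrow> p ^ q * k dvd i * k" by (simp only: mod_eq_0_iff_dvd kN)
    then show ?thesis using k0 by simp
  qed
  have dv: "i * k div N = i div p ^ q" unfolding kN using k0 by simp
  have odd_k: "(-1) ^ (k + 1) = (1 :: 'a)" using p by (simp add: k_def)
  show ?thesis
  proof (cases "p ^ q dvd i")
    case False
    then have "lterm (cyc_monom (a * \<Pi> ^ n) i) k = 0"
      using dvd unfolding lterm_def zk by (simp add: B.Tr_def)
    then show ?thesis using False unfolding k_def lead_def by simp
  next
    case True
    have "p ^ (s - 0 - (s - q)) dvd i" using True q by simp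
    then obtain \<theta> where \<theta>: "\<theta> \<in> B" "(\<Prod>l<p ^ (s - q). (g ^^ (l * i)) (1 - \<zeta> ^ (p ^ 0))) = 1 - \<zeta> ^ (p ^ (0 + (s - q))) + of_nat p * \<theta>"
      using orbit_product[of 0 "s - q" i] by auto
    define \<kappa> where "\<kappa> = (\<Prod>l<k. (g ^^ (l * i)) \<Pi>)"
    have \<kappa>: "\<kappa> = 1 - \<zeta> ^ (p ^ (s - q)) + of_nat p * \<theta>" using \<theta>(2) by (simp add: \<kappa>_def k_def)
    have \<kappa>B: "\<kappa> \<in> B" unfolding \<kappa>_def by (intro B_prod giB Pi_B)
    have prod: "(\<Prod>l<k. (g ^^ (l * i)) (a * \<Pi> ^ n)) = a ^ k * \<kappa> ^ n"
      unfolding \<kappa>_def using A_B[OF a] Pi_B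
      by (simp add: B.gi_mult B.gi_power B_power gi_A[OF a] prod.distrib prod_power_distrib)
    obtain y where y: "y \<in> I (N * c)" "B.Tr (\<kappa> ^ n) = of_nat N * (piA ^ (c - 1) + y)"
      using Tr_orbit_power[OF q n \<theta>(1) \<kappa>] by blast
    define w where "w = a ^ k * \<tau> ^ (i div p ^ q)"
    have wA: "w \<in> A" unfolding w_def by (intro A_mult A_power a tau_A)
    have "lterm (cyc_monom (a * \<Pi> ^ n) i) k = B.Tr (w * \<kappa> ^ n) / of_nat k"
      unfolding lterm_def zk odd_k using dvd True by (simp add: prod dv w_def mult_ac)
    also have "B.Tr (w * \<kappa> ^ n) = w * (of_nat N * (piA ^ (c - 1) + y))"
      using Tr_A_mult[OF wA B_power[OF \<kappa>B]] y(2) by simp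
    also have "w * (of_nat N * (piA ^ (c - 1) + y)) / of_nat k = of_nat (p ^ q) * piA ^ (c - 1) * w + w * (of_nat (p ^ q) * y)"
      unfolding kN using k0 by (simp add: field_simps)
    finally have "lterm (cyc_monom (a * \<Pi> ^ n) i) k - lead q c i a = w * (of_nat (p ^ q) * y)"
      using True by (simp add: lead_def w_def k_def)
    moreover have "of_nat (p ^ q) * y \<in> I (e * q + N * c)" using y(1) by (intro I_mult p_power_I)
    ultimately show ?thesis using A_B[OF wA] unfolding k_def by (simp add: I_mult_left)
  qed
qed

lemma exponent_decomp:
  assumes k: "1 \<le> k" "k \<le> N"
  obtains a k' where "k = p ^ a * k'" "\<not> p dvd k'" "a \<le> s" "k' \<ge> 1" "k < N \<Longrightarrow> a < s"
proof -
  have k0: "k \<noteq> 0" using k by simp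
  have pu: "\<not> is_unit p" using p_gt by simp
  obtain k' where k': "k = p ^ multiplicity p k * k'" "\<not> p dvd k'"
    using multiplicity_decompose'[OF k0 pu] by blast
  have k'1: "k' \<ge> 1" using k'(2) by (cases k') (auto simp: One_nat_def)
  have le: "p ^ multiplicity p k \<le> k" using k k0 multiplicity_dvd dvd_imp_le by (metis neq0_conv)
  have "multiplicity p k \<le> s"
  proof (rule ccontr)
    assume "\<not> multiplicity p k \<le> s"
    then have "p ^ s < p ^ multiplicity p k" using p_gt by (intro power_strict_increasing) auto
    then show False using le k by simp
  qed
  moreover have "multiplicity p k < s" if "k < N"
  proof (rule ccontr)
    assume "\<not> multiplicity p k < s"
    then have "p ^ s \<le> p ^ multiplicity p k" using p_gt by (intro power_increasing) auto
    then show False using le that by simp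
  qed
  ultimately show ?thesis using that k' k'1 by blast
qed

text \<open>An index below \<open>N\<close> contains at most \<open>s - 1\<close> factors
  \<open>p\<close>, so one factor \<open>p\<close> of the trace survives whatever the level of
  \<open>z\<close>.\<close>

lemma lterm_I_e: "z \<in> carrier \<Delta> \<Longrightarrow> 1 \<le> k \<Longrightarrow> k < N \<Longrightarrow> lterm z k \<in> I e"
proof -
  assume z: "z \<in> carrier \<Delta>" and k: "1 \<le> k" "k < N"
  then obtain a k' where a: "k = p ^ a * k'" "\<not> p dvd k'" "a \<le> s" "a < s"
    using exponent_decomp[of k] by (metis less_imp_le_nat)
  have "(z [^]\<^bsub>\<Delta>\<^esub> k) 0 \<in> I (0 * k)" using z by (simp add: I_0)
  from lterm_I[OF this a(1-3)] have L: "lterm z k \<in> I (N * ((s - a) * \<epsilon> + p ^ a * k' * 0 div p ^ s))" .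
  have "1 * \<epsilon> \<le> (s - a) * \<epsilon>" using a(4) by (intro mult_le_mono1) simp
  then have "e \<le> N * ((s - a) * \<epsilon> + p ^ a * k' * 0 div p ^ s)" by (simp add: e_def)
  then show ?thesis using L I_mono by blast
qed

lemma eps_p_power: "\<epsilon> + p ^ (r - 1) = p ^ r"
proof -
  have "p ^ r = p ^ (r - 1) * p" using r by (simp add: power_eq_if mult.commute)
  also have "p ^ (r - 1) * p = p ^ (r - 1) * ((p - 1) + 1)" using p_gt by simp
  finally have "p ^ r = p ^ (r - 1) * (p - 1) + p ^ (r - 1) * 1" by (simp only: distrib_left)
  then show ?thesis by (simp add: \<epsilon>_def)
qed

section \<open>The leading term of the reduced norm at a fixed level\<close>

context
  fixes q c n :: nat
  assumes q: "q \<le> s" and n: "n + 1 = p ^ q * c" "n \<ge> 1"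
    and c_gt: "q \<ge> 1 \<Longrightarrow> c > p ^ (r - 1)" and c_le: "q < s \<Longrightarrow> c \<le> p ^ r"
begin

lemma c_pos: "c \<ge> 1" using n(1) by (cases c) (auto simp: One_nat_def)

text \<open>The exponent of Pi in \<open>p ^ q * piA ^ (c - 1)\<close>. Norms are computed modulo
  \<open>I (j0 + 1)\<close>, where exactly the leading terms remain visible.\<close>

private definition j0 where "j0 = e * q + N * (c - 1)"

lemma j0_pos: "j0 \<ge> 1"
proof (cases "q = 0")
  case True
  then have "c \<ge> 2" using n by simp
  then have "N * 1 \<le> N * (c - 1)" by (intro mult_le_mono2) simp
  then have "1 \<le> N * (c - 1)" using N_gt_1 by linarith
  then show ?thesis unfolding j0_def by (rule trans_le_add2)
next
  case False
  then have "e * 1 \<le> e * q" by (intro mult_le_mono2) simp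
  then have "1 \<le> e * q" using e_pos by linarith
  then show ?thesis unfolding j0_def by (rule trans_le_add1)
qed

lemma j0_le: "j0 + 1 \<le> e * q + N * c"
proof -
  have "N * c = N * (c - 1) + N" using c_pos by (cases c) auto
  then show ?thesis using N_gt_1 by (simp add: j0_def)
qed

lemma lterm_bounds:
  assumes k: "1 \<le> k" "k \<le> N"
  shows "z \<in> Lv (n + 1) \<Longrightarrow> lterm z k \<in> I (e * q + N * c)"
    and "z \<in> Lv n \<Longrightarrow> lterm z k \<in> I j0"
    and "z \<in> Lv n \<Longrightarrow> k \<noteq> p ^ (s - q) \<Longrightarrow> \<not> (q < s \<and> c = p ^ r \<and> k = p ^ (s - q - 1)) \<Longrightarrow>
      lterm z k \<in> I (e * q + N * c)"
proof -
  obtain a k' where a: "k = p ^ a * k'" "\<not> p dvd k'" "a \<le> s" "k' \<ge> 1"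
    using exponent_decomp[OF k] by blast
  have L: "lterm z k \<in> I (N * ((s - a) * \<epsilon> + p ^ a * k' * m div p ^ s))" if "z \<in> Lv m" for m
    using Lv_nth[OF Lv_pow[OF that, of k]] a by (intro lterm_I)
  have pa: "p ^ a * k' \<le> p ^ s" using a k by simp
  have conv: "I (N * (q * \<epsilon> + x)) = I (e * q + N * x)" for x
    by (simp add: e_def algebra_simps)
  show "lterm z k \<in> I (e * q + N * c)" if z: "z \<in> Lv (n + 1)"
  proof -
    have "q * \<epsilon> + c \<le> (s - a) * \<epsilon> + p ^ a * k' * (n + 1) div p ^ s"
      unfolding \<epsilon>_def by (rule exponent_bound[OF p_gt r q c_gt c_le c_pos a(3,4)]) (use n in simp_all)
    then have "N * (q * \<epsilon> + c) \<le> N * ((s - a) * \<epsilon> + p ^ a * k' * (n + 1) div p ^ s)" by (rule mult_le_mono2)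
    then show ?thesis using I_mono L[OF z] unfolding conv[symmetric] by blast
  qed
  show "lterm z k \<in> I j0" if z: "z \<in> Lv n"
  proof -
    have "q * \<epsilon> + (c - 1) \<le> (s - a) * \<epsilon> + p ^ a * k' * n div p ^ s"
      unfolding \<epsilon>_def by (rule exponent_bound_pred[OF p_gt r q c_gt c_le c_pos a(3,4) pa n(1)])
    then have "N * (q * \<epsilon> + (c - 1)) \<le> N * ((s - a) * \<epsilon> + p ^ a * k' * n div p ^ s)" by (rule mult_le_mono2)
    then show ?thesis using I_mono L[OF z] unfolding j0_def conv[symmetric] by blast
  qed
  show "lterm z k \<in> I (e * q + N * c)" if z: "z \<in> Lv n" and ne: "k \<noteq> p ^ (s - q)" "\<not> (q < s \<and> c = p ^ r \<and> k = p ^ (s - q - 1))"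
  proof -
    have "q * \<epsilon> + c \<le> (s - a) * \<epsilon> + p ^ a * k' * n div p ^ s"
      unfolding \<epsilon>_def by (rule exponent_bound_strict[OF p_gt r q c_gt c_le c_pos a(3,4) pa n(1)])
        (use ne a(1) in simp_all)
    then have "N * (q * \<epsilon> + c) \<le> N * ((s - a) * \<epsilon> + p ^ a * k' * n div p ^ s)" by (rule mult_le_mono2)
    then show ?thesis using I_mono L[OF z] unfolding conv[symmetric] by blast
  qed
qed

lemma norm_expansion:
  assumes z: "z \<in> Lv n"
  shows "reduced_norm \<Delta> N (\<one>\<^bsub>\<Delta>\<^esub> \<oplus>\<^bsub>\<Delta>\<^esub> z) - 1 - (\<Sum>k=1..N. lterm z k) \<in> I (j0 + 1)"
proof (rule reduced_norm_expansion[where ?j0.0 = j0])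
  show "z \<in> carrier \<Delta>" using z by simp
  show "lterm z k \<in> I e" if "1 \<le> k" "k < N" for k using that z by (intro lterm_I_e) simp
qed (use lterm_bounds(2)[OF _ _ z] j0_pos e_pos in simp_all)

lemma norm_deep:
  assumes z: "z \<in> Lv (n + 1)"
  shows "reduced_norm \<Delta> N (\<one>\<^bsub>\<Delta>\<^esub> \<oplus>\<^bsub>\<Delta>\<^esub> z) - 1 \<in> I (j0 + 1)"
proof -
  have zn: "z \<in> Lv n" by (rule Lv_mono[OF _ z]) simp
  have "lterm z k \<in> I (j0 + 1)" if k: "k \<in> {1..N}" for k
  proof -
    have "lterm z k \<in> I (e * q + N * c)" using k by (intro lterm_bounds(1) z) auto
    then show ?thesis using I_mono[OF j0_le] by blast
  qed
  then have "(\<Sum>k=1..N. lterm z k) \<in> I (j0 + 1)" by (intro I_sum)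
  from I_add[OF norm_expansion[OF zn] this] show ?thesis by simp
qed

text \<open>In this case \<open>n + 1\<close> is also \<open>p ^ (q + 1) * p ^ (r - 1)\<close>, and
  the index \<open>p ^ (s - q - 1)\<close> yields a term of the same size: its additional factor
  \<open>p\<close> is worth \<open>\<epsilon>\<close>, which is the difference of
  \<open>p ^ r\<close> and \<open>p ^ (r - 1)\<close>.\<close>

definition bdry :: bool where "bdry \<longleftrightarrow> q < s \<and> c = p ^ r"

definition lead_total :: "nat \<Rightarrow> 'a \<Rightarrow> 'a" where
  "lead_total i a = lead q c i a + (if bdry then lead (q + 1) (p ^ (r - 1)) i a else 0)"

lemma norm_monom:
  assumes i: "i < N" and a: "a \<in> A"
  shows "reduced_norm \<Delta> N (\<one>\<^bsub>\<Delta>\<^esub> \<oplus>\<^bsub>\<Delta>\<^esub> cyc_monom (a * \<Pi> ^ n) i) - 1 - lead_total i a \<in> I (j0 + 1)"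
proof -
  define z where "z = cyc_monom (a * \<Pi> ^ n) i"
  \<comment> \<open>In the boundary case two distinct indices carry a main term. Otherwise the
    second summand is 0, so it does no harm that the two indices coincide for
    \<open>q = s\<close>.\<close>
  define \<delta> where "\<delta> = (\<lambda>k. (if k = p ^ (s - q) then lead q c i a else 0) +
     (if k = p ^ (s - q - 1) then (if bdry then lead (q + 1) (p ^ (r - 1)) i a else 0) else 0))"
  have z: "z \<in> Lv n" unfolding z_def using A_B[OF a] i by (intro monom_Lv I_mult_left Pi_power_I)
  have ne: "p ^ (s - q) \<noteq> p ^ (s - q - 1)" if bdry
  proof -
    have "s - q > 0" using that by (simp add: bdry_def)
    then have "s - q - 1 < s - q" by (intro diff_less) simp_all
    then have "p ^ (s - q - 1) < p ^ (s - q)" using p_gt by (intro power_strict_increasing) auto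
    then show ?thesis by simp
  qed
  have "lterm z k - \<delta> k \<in> I (e * q + N * c)" if k: "k \<in> {1..N}" for k
  proof (cases "k = p ^ (s - q)")
    case True
    then have "\<delta> k = lead q c i a" using ne by (auto simp: \<delta>_def)
    then show ?thesis using lterm_monom_lead[OF q n i a] True by (simp add: z_def)
  next
    case F1: False
    show ?thesis
    proof (cases "bdry \<and> k = p ^ (s - q - 1)")
      case True
      then have d: "\<delta> k = lead (q + 1) (p ^ (r - 1)) i a" using F1 by (auto simp: \<delta>_def)
      have qs: "q + 1 \<le> s" using True by (simp add: bdry_def)
      have pr: "p ^ r = p * p ^ (r - 1)" using r by (simp add: power_eq_if)
      have n': "n + 1 = p ^ (q + 1) * p ^ (r - 1)" using n(1) True pr by (simp add: bdry_def power_add)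
      have "k = p ^ (s - (q + 1))" using True by simp
      then have "lterm z k - \<delta> k \<in> I (e * (q + 1) + N * p ^ (r - 1))"
        using lterm_monom_lead[OF qs n' n(2) i a] d by (simp add: z_def)
      moreover have "e * (q + 1) + N * p ^ (r - 1) = e * q + N * c"
        using True eps_p_power by (simp add: bdry_def e_def distrib_left[symmetric] distrib_left add.assoc)
      ultimately show ?thesis by simp
    next
      case False
      then have "\<delta> k = 0" using F1 by (auto simp: \<delta>_def)
      moreover have "lterm z k \<in> I (e * q + N * c)"
        using k F1 False by (intro lterm_bounds(3) z) (auto simp: bdry_def)
      ultimately show ?thesis by simp
    qed
  qed
  then have "(\<Sum>k=1..N. lterm z k - \<delta> k) \<in> I (e * q + N * c)" by (intro I_sum)
  then have "(\<Sum>k=1..N. lterm z k) - (\<Sum>k=1..N. \<delta> k) \<in> I (j0 + 1)"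
    using I_mono[OF j0_le] by (simp add: sum_subtractf)
  moreover have "(\<Sum>k=1..N. \<delta> k) = lead_total i a"
  proof -
    have "p ^ k \<in> {1..N}" if "k \<le> s" for k
      using that p_gt by (auto intro!: power_increasing one_le_power)
    then have "p ^ (s - q) \<in> {1..N}" "p ^ (s - q - 1) \<in> {1..N}" by simp_all
    then show ?thesis by (simp only: \<delta>_def sum.distrib sum.delta finite_atLeastAtMost if_True lead_total_def)
  qed
  ultimately have "(\<Sum>k=1..N. lterm z k) - lead_total i a \<in> I (j0 + 1)" by simp
  moreover have "x - 1 - l = (x - 1 - S) + (S - l)" for x S l :: 'a by simp
  ultimately show ?thesis using I_add[OF norm_expansion[OF z]] unfolding z_def by metis
qed

lemma lead_total_I:
  assumes i: "i < N" and a: "a \<in> A"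
  shows "lead_total i a \<in> I j0"
proof -
  define z where "z = cyc_monom (a * \<Pi> ^ n) i"
  have z: "z \<in> Lv n" unfolding z_def using A_B[OF a] i by (intro monom_Lv I_mult_left Pi_power_I)
  have S: "(\<Sum>k=1..N. lterm z k) \<in> I j0" by (intro I_sum lterm_bounds(2) z) auto
  have 1: "reduced_norm \<Delta> N (\<one>\<^bsub>\<Delta>\<^esub> \<oplus>\<^bsub>\<Delta>\<^esub> z) - 1 - (\<Sum>k=1..N. lterm z k) \<in> I j0"
    by (rule I_mono[OF _ norm_expansion[OF z]]) simp
  have 2: "reduced_norm \<Delta> N (\<one>\<^bsub>\<Delta>\<^esub> \<oplus>\<^bsub>\<Delta>\<^esub> z) - 1 - lead_total i a \<in> I j0"
    unfolding z_def by (rule I_mono[OF _ norm_monom[OF i a]]) simp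
  from I_diff[OF I_add[OF 1 S] 2] show ?thesis by simp
qed

text \<open>This avoids powers of a sum of non-commuting monomials: the norm is multiplicative, and
  the leading parts of the factors add up because products of two of them lie in
  \<open>I (j0 + j0)\<close>, beyond the precision in use.\<close>

lemma monom_product:
  assumes a: "\<And>i. a i \<in> A" and k: "k \<le> N"
  shows "\<exists>x\<in>Units \<Delta>. x \<ominus>\<^bsub>\<Delta>\<^esub> \<one>\<^bsub>\<Delta>\<^esub> \<in> Lv n \<and>
    (\<forall>i. x i - \<one>\<^bsub>\<Delta>\<^esub> i - (if i < k then \<Pi> ^ n * a i else 0) \<in> I (n + 1)) \<and>
    reduced_norm \<Delta> N x - 1 - (\<Sum>i<k. lead_total i (a i)) \<in> I (j0 + 1)"
  using k
proof (induction k)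
  case 0
  have "\<one>\<^bsub>\<Delta>\<^esub> \<ominus>\<^bsub>\<Delta>\<^esub> \<one>\<^bsub>\<Delta>\<^esub> \<in> Lv n" by (rule LvI) (simp_all add: B.a_minus_nth)
  then show ?case by (intro bexI[of _ "\<one>\<^bsub>\<Delta>\<^esub>"]) (simp_all add: B.reduced_norm_one)
next
  case (Suc k)
  then obtain x where x: "x \<in> Units \<Delta>" "x \<ominus>\<^bsub>\<Delta>\<^esub> \<one>\<^bsub>\<Delta>\<^esub> \<in> Lv n"
    "\<And>i. x i - \<one>\<^bsub>\<Delta>\<^esub> i - (if i < k then \<Pi> ^ n * a i else 0) \<in> I (n + 1)"
    "reduced_norm \<Delta> N x - 1 - (\<Sum>i<k. lead_total i (a i)) \<in> I (j0 + 1)" by (meson Suc_leD)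
  have k: "k < N" using Suc.prems by simp
  define z where "z = cyc_monom (a k * \<Pi> ^ n) k"
  have z: "z \<in> Lv n" unfolding z_def using A_B[OF a] k by (intro monom_Lv I_mult_left Pi_power_I)
  have xc: "x \<in> carrier \<Delta>" using x(1) by auto
  have zc: "z \<in> carrier \<Delta>" using z by simp
  define y where "y = \<one>\<^bsub>\<Delta>\<^esub> \<oplus>\<^bsub>\<Delta>\<^esub> z"
  have yU: "y \<in> Units \<Delta>" unfolding y_def using z n(2) by (rule unit_one_plus_Lv)
  have yc: "y \<in> carrier \<Delta>" using yU by auto
  define w where "w = (x \<ominus>\<^bsub>\<Delta>\<^esub> \<one>\<^bsub>\<Delta>\<^esub>) \<otimes>\<^bsub>\<Delta>\<^esub> z"
  have w: "w \<in> Lv (n + 1)" unfolding w_def by (rule Lv_mono[OF _ Lv_mult[OF x(2) z]]) (use n(2) in simp)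
  have xy: "x \<otimes>\<^bsub>\<Delta>\<^esub> y = x \<oplus>\<^bsub>\<Delta>\<^esub> (z \<oplus>\<^bsub>\<Delta>\<^esub> w)"
  proof -
    have "x \<otimes>\<^bsub>\<Delta>\<^esub> z = ((x \<ominus>\<^bsub>\<Delta>\<^esub> \<one>\<^bsub>\<Delta>\<^esub>) \<oplus>\<^bsub>\<Delta>\<^esub> \<one>\<^bsub>\<Delta>\<^esub>) \<otimes>\<^bsub>\<Delta>\<^esub> z"
      using xc by (simp add: a_minus_def B.ring.a_assoc B.ring.l_neg)
    also have "\<dots> = w \<oplus>\<^bsub>\<Delta>\<^esub> z" unfolding w_def using xc zc by (simp add: B.ring.l_distr)
    finally show ?thesis unfolding y_def using xc zc w by (simp add: B.ring.r_distr B.ring.a_comm)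
  qed
  have nth: "(x \<otimes>\<^bsub>\<Delta>\<^esub> y) i = x i + z i + w i" for i unfolding xy by (simp add: B.add_nth)
  have coord: "(x \<otimes>\<^bsub>\<Delta>\<^esub> y) i - \<one>\<^bsub>\<Delta>\<^esub> i - (if i < Suc k then \<Pi> ^ n * a i else 0) \<in> I (n + 1)" for i
  proof -
    have "(x \<otimes>\<^bsub>\<Delta>\<^esub> y) i - \<one>\<^bsub>\<Delta>\<^esub> i - (if i < Suc k then \<Pi> ^ n * a i else 0) =
       (x i - \<one>\<^bsub>\<Delta>\<^esub> i - (if i < k then \<Pi> ^ n * a i else 0)) + w i"
      unfolding nth by (auto simp: z_def cyc_monom_def less_Suc_eq)
    then show ?thesis using I_add[OF x(3)[of i] Lv_nth[OF w, of i]] by (simp only:)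
  qed
  have lv: "x \<otimes>\<^bsub>\<Delta>\<^esub> y \<ominus>\<^bsub>\<Delta>\<^esub> \<one>\<^bsub>\<Delta>\<^esub> \<in> Lv n"
  proof (rule LvI)
    show "x \<otimes>\<^bsub>\<Delta>\<^esub> y \<ominus>\<^bsub>\<Delta>\<^esub> \<one>\<^bsub>\<Delta>\<^esub> \<in> carrier \<Delta>" using xc yc by simp
    fix i
    have "(x \<otimes>\<^bsub>\<Delta>\<^esub> y \<ominus>\<^bsub>\<Delta>\<^esub> \<one>\<^bsub>\<Delta>\<^esub>) i = (x \<ominus>\<^bsub>\<Delta>\<^esub> \<one>\<^bsub>\<Delta>\<^esub>) i + z i + w i"
      using xc yc by (simp add: B.a_minus_nth nth)
    moreover have "w i \<in> I n" by (rule I_mono[OF _ Lv_nth[OF w]]) simp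
    ultimately show "(x \<otimes>\<^bsub>\<Delta>\<^esub> y \<ominus>\<^bsub>\<Delta>\<^esub> \<one>\<^bsub>\<Delta>\<^esub>) i \<in> I n"
      using Lv_nth[OF x(2), of i] Lv_nth[OF z, of i] by (simp add: I_add)
  qed
  define S where "S = (\<Sum>i<k. lead_total i (a i))"
  have S: "S \<in> I j0" unfolding S_def using k a by (intro I_sum lead_total_I) auto
  have l: "lead_total k (a k) \<in> I j0" using k a by (intro lead_total_I)
  define \<alpha> where "\<alpha> = reduced_norm \<Delta> N x - 1 - S"
  define \<beta> where "\<beta> = reduced_norm \<Delta> N y - 1 - lead_total k (a k)"
  have \<alpha>: "\<alpha> \<in> I (j0 + 1)" using x(4) by (simp add: \<alpha>_def S_def)
  have \<beta>: "\<beta> \<in> I (j0 + 1)" using norm_monom[OF k a] by (simp add: \<beta>_def y_def z_def)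
  have "\<alpha> \<in> I j0" "\<beta> \<in> I j0" using \<alpha> \<beta> I_mono[of j0 "j0 + 1"] by auto
  then have "(S + \<alpha>) * (lead_total k (a k) + \<beta>) \<in> I (j0 + j0)" using S l by (intro I_mult I_add)
  then have prod: "(S + \<alpha>) * (lead_total k (a k) + \<beta>) \<in> I (j0 + 1)" by (rule I_mono[rotated]) (use j0_pos in simp)
  have "reduced_norm \<Delta> N (x \<otimes>\<^bsub>\<Delta>\<^esub> y) = (1 + S + \<alpha>) * (1 + lead_total k (a k) + \<beta>)"
    using B.reduced_norm_mult[OF xc yc] by (simp add: \<alpha>_def \<beta>_def)
  then have "reduced_norm \<Delta> N (x \<otimes>\<^bsub>\<Delta>\<^esub> y) - 1 - (\<Sum>i<Suc k. lead_total i (a i)) =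
      \<alpha> + \<beta> + (S + \<alpha>) * (lead_total k (a k) + \<beta>)"
    by (simp add: S_def algebra_simps)
  also have "\<dots> \<in> I (j0 + 1)" using \<alpha> \<beta> prod by (intro I_add)
  finally have "reduced_norm \<Delta> N (x \<otimes>\<^bsub>\<Delta>\<^esub> y) - 1 - (\<Sum>i<Suc k. lead_total i (a i)) \<in> I (j0 + 1)" .
  moreover have "x \<otimes>\<^bsub>\<Delta>\<^esub> y \<in> Units \<Delta>" using x(1) yU by simp
  ultimately show ?case using coord lv by blast
qed

text \<open>\<open>d\<close> is a product of monomial factors times some \<open>1 + z\<close> with
  \<open>z\<close> one level deeper, and by \<open>norm_deep\<close> the norm of that last factor is
  1 to the precision in use.\<close>

lemma norm_one_lead:
  assumes d: "d \<in> carrier \<Delta>" and norm: "reduced_norm \<Delta> N d = 1" and a: "\<And>i. a i \<in> A"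
    and da: "\<And>i. i < N \<Longrightarrow> d i - \<one>\<^bsub>\<Delta>\<^esub> i - \<Pi> ^ n * a i \<in> I (n + 1)"
  shows "(\<Sum>i<N. lead_total i (a i)) \<in> I (j0 + 1)"
proof -
  have "\<exists>x\<in>Units \<Delta>. x \<ominus>\<^bsub>\<Delta>\<^esub> \<one>\<^bsub>\<Delta>\<^esub> \<in> Lv n \<and>
    (\<forall>i. x i - \<one>\<^bsub>\<Delta>\<^esub> i - (if i < N then \<Pi> ^ n * a i else 0) \<in> I (n + 1)) \<and>
    reduced_norm \<Delta> N x - 1 - (\<Sum>i<N. lead_total i (a i)) \<in> I (j0 + 1)"
    by (rule monom_product) (simp_all add: a)
  then obtain x where x: "x \<in> Units \<Delta>" "x \<ominus>\<^bsub>\<Delta>\<^esub> \<one>\<^bsub>\<Delta>\<^esub> \<in> Lv n"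
    "\<forall>i. x i - \<one>\<^bsub>\<Delta>\<^esub> i - (if i < N then \<Pi> ^ n * a i else 0) \<in> I (n + 1)"
    "reduced_norm \<Delta> N x - 1 - (\<Sum>i<N. lead_total i (a i)) \<in> I (j0 + 1)"
    by (elim bexE conjE)
  have xc: "x \<in> carrier \<Delta>" "inv\<^bsub>\<Delta>\<^esub> x \<in> carrier \<Delta>" using x(1) by auto
  have dx: "d \<ominus>\<^bsub>\<Delta>\<^esub> x \<in> Lv (n + 1)"
  proof (rule LvI)
    show "d \<ominus>\<^bsub>\<Delta>\<^esub> x \<in> carrier \<Delta>" using d xc by simp
    fix i assume i: "i < N"
    have "(d \<ominus>\<^bsub>\<Delta>\<^esub> x) i = (d i - \<one>\<^bsub>\<Delta>\<^esub> i - \<Pi> ^ n * a i) - (x i - \<one>\<^bsub>\<Delta>\<^esub> i - \<Pi> ^ n * a i)"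
      using d xc by (simp add: B.a_minus_nth)
    moreover have "x i - \<one>\<^bsub>\<Delta>\<^esub> i - \<Pi> ^ n * a i \<in> I (n + 1)" using spec[OF x(3), of i] i by simp
    ultimately show "(d \<ominus>\<^bsub>\<Delta>\<^esub> x) i \<in> I (n + 1)" using I_diff[OF da[OF i]] by (simp only:)
  qed
  define z where "z = inv\<^bsub>\<Delta>\<^esub> x \<otimes>\<^bsub>\<Delta>\<^esub> (d \<ominus>\<^bsub>\<Delta>\<^esub> x)"
  have z: "z \<in> Lv (n + 1)" unfolding z_def using xc dx by (intro Lv_mult_left)
  have "x \<otimes>\<^bsub>\<Delta>\<^esub> (\<one>\<^bsub>\<Delta>\<^esub> \<oplus>\<^bsub>\<Delta>\<^esub> z) = d"
  proof -
    have "x \<otimes>\<^bsub>\<Delta>\<^esub> z = (x \<otimes>\<^bsub>\<Delta>\<^esub> inv\<^bsub>\<Delta>\<^esub> x) \<otimes>\<^bsub>\<Delta>\<^esub> (d \<ominus>\<^bsub>\<Delta>\<^esub> x)"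
      unfolding z_def using xc d by (simp add: B.ring.m_assoc)
    also have "\<dots> = d \<ominus>\<^bsub>\<Delta>\<^esub> x" using x(1) xc d by simp
    finally have "x \<otimes>\<^bsub>\<Delta>\<^esub> (\<one>\<^bsub>\<Delta>\<^esub> \<oplus>\<^bsub>\<Delta>\<^esub> z) = x \<oplus>\<^bsub>\<Delta>\<^esub> (d \<ominus>\<^bsub>\<Delta>\<^esub> x)"
      using xc z by (simp add: B.ring.r_distr)
    then show ?thesis using xc d by (auto simp: fun_eq_iff B.add_nth B.a_minus_nth)
  qed
  then have "1 = reduced_norm \<Delta> N x * reduced_norm \<Delta> N (\<one>\<^bsub>\<Delta>\<^esub> \<oplus>\<^bsub>\<Delta>\<^esub> z)"
    using B.reduced_norm_mult[OF xc(1), of "\<one>\<^bsub>\<Delta>\<^esub> \<oplus>\<^bsub>\<Delta>\<^esub> z"] z norm by simp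
  moreover define S where "S = (\<Sum>i<N. lead_total i (a i))"
  define \<alpha> where "\<alpha> = reduced_norm \<Delta> N x - 1 - S"
  define \<beta> where "\<beta> = reduced_norm \<Delta> N (\<one>\<^bsub>\<Delta>\<^esub> \<oplus>\<^bsub>\<Delta>\<^esub> z) - 1"
  have \<alpha>: "\<alpha> \<in> I (j0 + 1)" using x(4) by (simp add: \<alpha>_def S_def)
  have \<beta>: "\<beta> \<in> I (j0 + 1)" using norm_deep[OF z] by (simp add: \<beta>_def)
  have S: "S \<in> I j0" unfolding S_def using a by (intro I_sum lead_total_I) auto
  ultimately have "1 = (1 + S + \<alpha>) * (1 + \<beta>)" by (simp add: \<alpha>_def \<beta>_def)
  then have "S = - (\<alpha> + (1 + S + \<alpha>) * \<beta>)" by (simp add: algebra_simps eq_neg_iff_add_eq_0)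
  moreover have "1 + S + \<alpha> \<in> B" using S \<alpha> I_B by (intro B_intros) auto
  ultimately have "S \<in> I (j0 + 1)" using \<alpha> \<beta> by (metis I_uminus I_add I_mult_left)
  then show ?thesis by (simp add: S_def)
qed

lemma norm_one_condition:
  assumes d: "d \<in> carrier \<Delta>" and norm: "reduced_norm \<Delta> N d = 1" and a: "\<And>i. a i \<in> A"
    and da: "\<And>i. i < N \<Longrightarrow> d i - \<one>\<^bsub>\<Delta>\<^esub> i - \<Pi> ^ n * a i \<in> I (n + 1)"
  shows "(\<Sum>i<N. if p ^ q dvd i then a i ^ (p ^ (s - q)) * \<tau> ^ (i div p ^ q) else 0) -
    (if q < s \<and> c = p ^ r then \<Sum>i<N. if p ^ (q + 1) dvd i then a i ^ (p ^ (s - (q + 1))) * \<tau> ^ (i div p ^ (q + 1)) else 0 else 0)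
    \<in> I 1"
proof -
  define f where "f = (\<lambda>q i. if p ^ q dvd i then a i ^ (p ^ (s - q)) * \<tau> ^ (i div p ^ q) else 0)"
  define S1 where "S1 = (\<Sum>i<N. f q i)"
  define S2 where "S2 = (\<Sum>i<N. f (q + 1) i)"
  have fB: "f q i \<in> B" for q i unfolding f_def using A_B[OF a] by (auto intro!: B_intros)
  have S2B: "S2 \<in> B" "S1 \<in> B" unfolding S1_def S2_def by (intro B_sum fB)+
  define \<Lambda> where "\<Lambda> = of_nat (p ^ q) * piA ^ (c - 1)"
  have lead: "lead q' c' i (a i) = of_nat (p ^ q') * piA ^ (c' - 1) * f q' i" for q' c' i
    by (simp add: lead_def f_def)
  obtain u where u: "u \<in> U1" "of_nat p = - (\<Pi> ^ e) * u" using p_eq by blast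
  obtain w where w: "w \<in> U1" "piA ^ (c - 1) = \<Pi> ^ (N * (c - 1)) * w" using piA_power_eq by blast
  have \<Lambda>: "\<Lambda> = \<Pi> ^ j0 * ((-1) ^ q * (u ^ q * w))"
  proof -
    have "(of_nat (p ^ q) :: 'a) = ((-1) * (\<Pi> ^ e * u)) ^ q" by (simp add: u(2))
    also have "\<dots> = (-1) ^ q * (\<Pi> ^ (e * q) * u ^ q)" by (simp only: power_mult_distrib power_mult)
    finally show ?thesis unfolding \<Lambda>_def w(2) j0_def power_add by (simp only: mult_ac)
  qed
  define v where "v = (-1) ^ q * (u ^ q * w)"
  have uw: "u ^ q * w \<in> U1" by (intro U1_mult U1_power u w)
  have v: "inverse v \<in> B" "v \<noteq> 0"
    unfolding v_def using U1_inverse_B[OF uw] U1_ne_0[OF uw] by (auto intro!: B_intros simp: power_inverse[symmetric])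
  have sum1: "(\<Sum>i<N. lead q c i (a i)) = \<Lambda> * S1"
    by (simp add: lead \<Lambda>_def S1_def sum_distrib_left)
  have "\<exists>y\<in>I 1. (\<Sum>i<N. lead_total i (a i)) = \<Lambda> * (S1 - (if bdry then S2 else 0) + y)"
  proof (cases bdry)
    case True
    then have cr: "c = p ^ r" by (simp add: bdry_def)
    obtain w1 where w1: "w1 \<in> U1" "piA ^ (p ^ (r - 1) - 1) = \<Pi> ^ (N * (p ^ (r - 1) - 1)) * w1" using piA_power_eq by blast
    have exps: "e + N * (p ^ (r - 1) - 1) = N * (c - 1)"
    proof -
      have "p ^ (r - 1) \<ge> 1" using p_gt by (intro one_le_power) simp
      then have "\<epsilon> + (p ^ (r - 1) - 1) = c - 1" using eps_p_power cr by simp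
      then have "N * (\<epsilon> + (p ^ (r - 1) - 1)) = N * (c - 1)" by (rule arg_cong)
      then show ?thesis by (simp only: e_def distrib_left)
    qed
    define \<rho> where "\<rho> = u * w1 * inverse w"
    have \<rho>: "\<rho> \<in> U1" unfolding \<rho>_def by (intro U1_mult U1_inverse u w w1)
    \<comment> \<open>Origin of the minus sign before the second sum: \<open>p\<close> is minus a
      principal unit times \<open>Pi ^ e\<close>.\<close>
    have "of_nat p * piA ^ (p ^ (r - 1) - 1) = - (piA ^ (c - 1) * \<rho>)"
      unfolding u(2) w1(2) w(2) exps[symmetric] power_add \<rho>_def using U1_ne_0[OF w(1)] by simp
    then have "of_nat (p ^ (q + 1)) * piA ^ (p ^ (r - 1) - 1) = - (\<Lambda> * \<rho>)"
      by (simp add: \<Lambda>_def power_add mult.assoc)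
    then have "(\<Sum>i<N. lead (q + 1) (p ^ (r - 1)) i (a i)) = - (\<Lambda> * \<rho>) * S2"
      by (simp only: lead S2_def sum_distrib_left)
    then have "(\<Sum>i<N. lead_total i (a i)) = \<Lambda> * (S1 - S2 + (1 - \<rho>) * S2)"
      using True sum1 by (simp add: lead_total_def sum.distrib algebra_simps)
    moreover have "1 - \<rho> \<in> I 1" using \<rho> I_uminus[of "\<rho> - 1" 1] by (simp add: U1_def)
    ultimately show ?thesis using True S2B by (intro bexI[of _ "(1 - \<rho>) * S2"]) (auto intro: I_mult_right)
  next
    case False
    then show ?thesis using sum1 by (intro bexI[of _ 0]) (auto simp: lead_total_def)
  qed
  then obtain y where y: "y \<in> I 1" "(\<Sum>i<N. lead_total i (a i)) = \<Lambda> * (S1 - (if bdry then S2 else 0) + y)" by blast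
  have "\<Pi> ^ j0 * (v * (S1 - (if bdry then S2 else 0) + y)) \<in> I (j0 + 1)"
    using norm_one_lead[OF assms] unfolding y(2) \<Lambda> v_def[symmetric] by (simp only: mult.assoc)
  then have "v * (S1 - (if bdry then S2 else 0) + y) \<in> I 1" by (rule I_cancel)
  with v(1) have "inverse v * (v * (S1 - (if bdry then S2 else 0) + y)) \<in> I 1" by (rule I_mult_left)
  then have "S1 - (if bdry then S2 else 0) + y \<in> I 1" using v(2) by (simp add: mult.assoc[symmetric])
  from I_diff[OF this y(1)] have "S1 - (if bdry then S2 else 0) \<in> I 1" by simp
  then show ?thesis unfolding S1_def S2_def f_def bdry_def .
qed

end

end

subsection \<open>Frobenius and logarithmic derivatives in characteristic \<open>p\<close>\<close>

text \<open>Congruences modulo \<open>p\<close> in such a subring are written below with an explicit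
  cofactor from it, in place of a quotient ring.\<close>

locale closed_subring =
  fixes C :: "'b::comm_ring_1 set"
  assumes C_1: "1 \<in> C" and C_add: "\<And>x y. x \<in> C \<Longrightarrow> y \<in> C \<Longrightarrow> x + y \<in> C"
    and C_mult: "\<And>x y. x \<in> C \<Longrightarrow> y \<in> C \<Longrightarrow> x * y \<in> C" and C_uminus: "\<And>x. x \<in> C \<Longrightarrow> - x \<in> C"
begin

lemma C_0: "0 \<in> C" using C_add[OF C_1 C_uminus[OF C_1]] by simp
lemma C_diff: "x \<in> C \<Longrightarrow> y \<in> C \<Longrightarrow> x - y \<in> C" using C_add[of x "- y"] C_uminus by simp
lemma C_power: "x \<in> C \<Longrightarrow> x ^ n \<in> C" by (induction n) (auto intro: C_1 C_mult)
lemma C_of_nat: "of_nat n \<in> C" by (induction n) (auto intro: C_0 C_1 C_add)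
lemma C_sum: "(\<And>i. i \<in> S \<Longrightarrow> f i \<in> C) \<Longrightarrow> sum f S \<in> C"
  by (induction S rule: infinite_finite_induct) (auto intro: C_0 C_add)

lemmas C_intros = C_0 C_1 C_add C_mult C_uminus C_diff C_power C_of_nat C_sum

lemma freshman_add:
  assumes p: "prime p" and x: "x \<in> C" and y: "y \<in> C"
  shows "\<exists>z\<in>C. (x + y) ^ p = x ^ p + y ^ p + of_nat p * z"
proof -
  have p1: "p > 1" using p prime_gt_1_nat by blast
  define z where "z = (\<Sum>j=1..<p. of_nat ((p choose j) div p) * (x ^ j * y ^ (p - j)))"
  have "(x + y) ^ p = (\<Sum>j\<le>p. of_nat (p choose j) * x ^ j * y ^ (p - j))" by (rule binomial_ring)
  also have "{..p} = insert 0 (insert p {1..<p})" using p1 by auto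
  also have "(\<Sum>j\<in>insert 0 (insert p {1..<p}). of_nat (p choose j) * x ^ j * y ^ (p - j)) =
      y ^ p + x ^ p + (\<Sum>j=1..<p. of_nat (p choose j) * x ^ j * y ^ (p - j))"
    using p1 by (simp add: add.assoc)
  also have "(\<Sum>j=1..<p. of_nat (p choose j) * x ^ j * y ^ (p - j)) = of_nat p * z"
    unfolding z_def sum_distrib_left
  proof (intro sum.cong refl)
    fix j assume j: "j \<in> {1..<p}"
    have "p dvd (p choose j)" using p j by (intro dvd_choose_prime) auto
    then have "of_nat (p choose j) = (of_nat p * of_nat ((p choose j) div p) :: 'b)"
      by (metis dvd_mult_div_cancel of_nat_mult)
    then show "of_nat (p choose j) * x ^ j * y ^ (p - j) = of_nat p * (of_nat ((p choose j) div p) * (x ^ j * y ^ (p - j)))"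
      by (simp only: mult.assoc)
  qed
  finally have "(x + y) ^ p = x ^ p + y ^ p + of_nat p * z" by (simp add: add.commute)
  moreover have "z \<in> C" unfolding z_def using x y by (intro C_intros)
  ultimately show ?thesis by blast
qed

lemma freshman_sum:
  assumes p: "prime p" and x: "\<And>i. i \<in> S \<Longrightarrow> x i \<in> C"
  shows "\<exists>z\<in>C. (\<Sum>i\<in>S. x i) ^ p = (\<Sum>i\<in>S. x i ^ p) + of_nat p * z"
  using x
proof (induction S rule: infinite_finite_induct)
  case (insert i S)
  then obtain z where z: "z \<in> C" "(\<Sum>i\<in>S. x i) ^ p = (\<Sum>i\<in>S. x i ^ p) + of_nat p * z" by auto
  have "x i \<in> C" "(\<Sum>i\<in>S. x i) \<in> C" using insert.prems by (auto intro: C_sum)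
  from freshman_add[OF p this] obtain w where w: "w \<in> C"
    "(x i + (\<Sum>i\<in>S. x i)) ^ p = x i ^ p + (\<Sum>i\<in>S. x i) ^ p + of_nat p * w" by blast
  have "(\<Sum>i\<in>insert i S. x i) ^ p = (\<Sum>i\<in>insert i S. x i ^ p) + of_nat p * (z + w)"
    using insert.hyps w(2) z(2) by (simp add: algebra_simps)
  then show ?case using z(1) w(1) C_add by blast
qed (use prime_gt_0_nat[OF p] in \<open>auto intro!: bexI[of _ 0] C_0 simp: power_0_left\<close>)

lemma freshman_sum_power:
  assumes p: "prime p" and x: "\<And>i. i \<in> S \<Longrightarrow> x i \<in> C"
  shows "\<exists>z\<in>C. (\<Sum>i\<in>S. x i) ^ (p ^ k) = (\<Sum>i\<in>S. x i ^ (p ^ k)) + of_nat p * z"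
proof (induction k)
  case 0
  show ?case by (intro bexI[of _ 0]) (auto intro: C_0)
next
  case (Suc k)
  then obtain z where z: "z \<in> C" "(\<Sum>i\<in>S. x i) ^ (p ^ k) = (\<Sum>i\<in>S. x i ^ (p ^ k)) + of_nat p * z" by blast
  have p1: "p > 0" using p prime_gt_0_nat by blast
  define y where "y = (\<Sum>i\<in>S. x i ^ (p ^ k))"
  have y: "y \<in> C" unfolding y_def using x by (intro C_sum C_power)
  have "of_nat p * z \<in> C" using z(1) by (intro C_intros)
  from freshman_add[OF p y this] obtain w where w: "w \<in> C"
    "(y + of_nat p * z) ^ p = y ^ p + (of_nat p * z) ^ p + of_nat p * w" by blast
  have "\<exists>v\<in>C. y ^ p = (\<Sum>i\<in>S. (x i ^ (p ^ k)) ^ p) + of_nat p * v"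
    unfolding y_def using x by (intro freshman_sum[OF p] C_power)
  then obtain v where v: "v \<in> C" "y ^ p = (\<Sum>i\<in>S. (x i ^ (p ^ k)) ^ p) + of_nat p * v" by blast
  have pz: "(of_nat p * z) ^ p = of_nat p * (z * (of_nat p * z) ^ (p - 1))"
    using p1 by (cases p) (simp_all add: mult_ac del: of_nat_Suc)
  have "(\<Sum>i\<in>S. x i) ^ (p ^ Suc k) = ((\<Sum>i\<in>S. x i) ^ (p ^ k)) ^ p" by (simp add: power_mult[symmetric] mult.commute)
  also have "\<dots> = (\<Sum>i\<in>S. (x i ^ (p ^ k)) ^ p) + of_nat p * (v + z * (of_nat p * z) ^ (p - 1) + w)"
    unfolding z(2) y_def[symmetric] w(2) v(2) pz by (simp add: algebra_simps)
  also have "(\<Sum>i\<in>S. (x i ^ (p ^ k)) ^ p) = (\<Sum>i\<in>S. x i ^ (p ^ Suc k))"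
    by (simp add: power_mult[symmetric] mult.commute)
  finally show ?case using v w z(1) by (intro bexI[of _ "v + z * (of_nat p * z) ^ (p - 1) + w"]) (auto intro!: C_intros)
qed

end

lemma bezout_nat_one:
  fixes a b :: nat
  assumes "coprime a b" "b > 1"
  shows "\<exists>x y. a * x = 1 + b * y"
proof -
  obtain x where x: "[a * x = Suc 0] (mod b)" using cong_solve_coprime_nat[OF assms(1)] by blast
  have "a * x \<noteq> 0"
  proof
    assume "a * x = 0"
    then have "[0 = Suc 0] (mod b)" using x by metis
    then show False using assms(2) by (simp add: cong_def)
  qed
  then have "Suc 0 \<le> a * x" by simp
  then obtain y where "a * x = y * b + Suc 0" using x cong_le_nat[of "Suc 0" "a * x" b] cong_sym by blast
  then have "a * x = 1 + b * y" by (simp add: mult.commute One_nat_def)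
  then show ?thesis by blast
qed

text \<open>
  The summand \<open>jpart n i\<close> of \<open>(\<delta> + f)\<^sup>n(1)\<close> is homogeneous of degree \<open>i\<close> in \<open>f\<close>. Comparing degrees
  gives Jacobson's formula \<open>(\<delta> + f)\<^sup>p(1) = f\<^sup>p + \<delta>\<^sup>p\<^sup>-\<^sup>1(f)\<close> modulo \<open>p\<close>.
\<close>

locale derivation = closed_subring C for C :: "'b::comm_ring_1 set" +
  fixes \<delta> :: "'b \<Rightarrow> 'b" and f :: 'b
  assumes \<delta>_add: "\<And>x y. \<delta> (x + y) = \<delta> x + \<delta> y"
    and \<delta>_mult: "\<And>x y. \<delta> (x * y) = \<delta> x * y + x * \<delta> y"
    and \<delta>_C: "\<And>x. x \<in> C \<Longrightarrow> \<delta> x \<in> C" and f_C: "f \<in> C"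
begin

fun jpart :: "nat \<Rightarrow> nat \<Rightarrow> 'b" where
  "jpart 0 i = (if i = 0 then 1 else 0)"
| "jpart (Suc n) 0 = \<delta> (jpart n 0)"
| "jpart (Suc n) (Suc i) = \<delta> (jpart n (Suc i)) + f * jpart n i"

definition nab :: "'b \<Rightarrow> 'b" where "nab x = \<delta> x + f * x"

lemma \<delta>_0: "\<delta> 0 = 0" using \<delta>_add[of 0 0] by simp

lemma \<delta>_1: "\<delta> 1 = 0" using \<delta>_mult[of 1 1] by simp

lemma \<delta>_sum: "\<delta> (sum h S) = (\<Sum>i\<in>S. \<delta> (h i))"
  by (induction S rule: infinite_finite_induct) (auto simp: \<delta>_0 \<delta>_add)

lemma \<delta>_of_nat: "\<delta> (of_nat n) = 0"
  by (induction n) (auto simp: \<delta>_0 \<delta>_1 \<delta>_add)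

lemma \<delta>_of_nat_mult: "\<delta> (of_nat n * x) = of_nat n * \<delta> x"
  by (simp add: \<delta>_mult \<delta>_of_nat)

lemma jpart_C: "jpart n i \<in> C"
  by (induction n i rule: jpart.induct) (auto intro: C_intros \<delta>_C f_C)

lemma deltak_C: "(\<delta> ^^ k) f \<in> C"
  by (induction k) (auto intro: \<delta>_C f_C)

lemma jpart_gt: "n < i \<Longrightarrow> jpart n i = 0"
proof (induction n arbitrary: i)
  case (Suc n)
  then obtain i' where "i = Suc i'" by (cases i) auto
  then show ?case using Suc by (simp add: \<delta>_0)
qed auto

lemma jpart_diag: "jpart n n = f ^ n"
  by (induction n) (auto simp: jpart_gt \<delta>_0)

lemma jpart_0: "n \<ge> 1 \<Longrightarrow> jpart n 0 = 0"
proof (induction n)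
  case (Suc n)
  then show ?case by (cases n) (auto simp: \<delta>_0 \<delta>_1 One_nat_def)
qed simp

lemma nab_power_1: "(nab ^^ n) 1 = (\<Sum>i\<le>n. jpart n i)"
proof (induction n)
  case (Suc n)
  have "(nab ^^ Suc n) 1 = \<delta> (\<Sum>i\<le>n. jpart n i) + f * (\<Sum>i\<le>n. jpart n i)" by (simp add: Suc nab_def)
  also have "\<dots> = (\<Sum>i\<le>Suc n. \<delta> (jpart n i)) + (\<Sum>i\<le>n. f * jpart n i)"
    by (simp add: \<delta>_sum sum_distrib_left jpart_gt \<delta>_0)
  also have "(\<Sum>i\<le>Suc n. \<delta> (jpart n i)) = \<delta> (jpart n 0) + (\<Sum>i\<le>n. \<delta> (jpart n (Suc i)))"
    by (rule sum.atMost_Suc_shift)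
  also have "\<delta> (jpart n 0) + (\<Sum>i\<le>n. \<delta> (jpart n (Suc i))) + (\<Sum>i\<le>n. f * jpart n i) = (\<Sum>i\<le>Suc n. jpart (Suc n) i)"
    unfolding sum.atMost_Suc_shift by (simp add: sum.distrib add.assoc)
  finally show ?case .
qed simp

text \<open>Formally this is the derivative with respect to a scaling of \<open>f\<close>: one
  factor \<open>f\<close> is singled out, and commuting it to the left produces iterated derivatives
  of \<open>f\<close> with binomial weights. The induction confirms it by the product rule and
  Pascal's rule.\<close>

lemma jpart_euler:
  "of_nat (Suc i) * jpart n (Suc i) = (\<Sum>k<n. of_nat (n choose Suc k) * (\<delta> ^^ k) f * jpart (n - Suc k) i)"
proof (induction n arbitrary: i)
  case (Suc n)
  define c where "c = (\<lambda>k. of_nat (n choose Suc k) :: 'b)"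
  define F where "F = (\<lambda>k. (\<delta> ^^ k) f)"
  have IH: "of_nat (Suc i) * jpart n (Suc i) = (\<Sum>k<n. c k * F k * jpart (n - Suc k) i)" for i
    using Suc.IH by (simp add: c_def F_def)
  have \<delta>F: "\<delta> (F k) = F (Suc k)" for k by (simp add: F_def)
  have A: "of_nat (Suc i) * \<delta> (jpart n (Suc i)) =
     (\<Sum>k<n. c k * F (Suc k) * jpart (n - Suc k) i) + (\<Sum>k<n. c k * F k * \<delta> (jpart (n - Suc k) i))"
  proof -
    have "of_nat (Suc i) * \<delta> (jpart n (Suc i)) = \<delta> (\<Sum>k<n. c k * F k * jpart (n - Suc k) i)"
      using IH[of i] by (metis \<delta>_of_nat_mult)
    also have "\<dots> = (\<Sum>k<n. c k * F (Suc k) * jpart (n - Suc k) i + c k * F k * \<delta> (jpart (n - Suc k) i))"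
      unfolding \<delta>_sum by (intro sum.cong refl) (simp add: \<delta>_mult \<delta>F c_def \<delta>_of_nat algebra_simps)
    finally show ?thesis by (simp only: sum.distrib)
  qed
  have Bf: "of_nat (Suc i) * (f * jpart n i) = f * jpart n i + (\<Sum>k<n. c k * F k * (jpart (n - k) i - \<delta> (jpart (n - Suc k) i)))"
  proof (cases i)
    case 0
    have "jpart (n - k) 0 - \<delta> (jpart (n - Suc k) 0) = 0" if "k < n" for k
    proof -
      have "n - k = Suc (n - Suc k)" using that by simp
      then show ?thesis by simp
    qed
    then show ?thesis using 0 by simp
  next
    case i: (Suc i')
    have "of_nat (Suc i) * (f * jpart n i) = f * jpart n i + f * (of_nat i * jpart n i)" by (simp add: algebra_simps)
    also have "of_nat i * jpart n i = (\<Sum>k<n. c k * F k * jpart (n - Suc k) i')" unfolding i by (rule IH)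
    also have "f * \<dots> = (\<Sum>k<n. c k * F k * (jpart (n - k) i - \<delta> (jpart (n - Suc k) i)))"
      unfolding sum_distrib_left
    proof (intro sum.cong refl)
      fix k assume "k \<in> {..<n}"
      then have "n - k = Suc (n - Suc k)" by simp
      then have "jpart (n - k) i = \<delta> (jpart (n - Suc k) i) + f * jpart (n - Suc k) i'" unfolding i by simp
      then show "f * (c k * F k * jpart (n - Suc k) i') = c k * F k * (jpart (n - k) i - \<delta> (jpart (n - Suc k) i))"
        by (simp add: mult_ac)
    qed
    finally show ?thesis .
  qed
  have "of_nat (Suc i) * jpart (Suc n) (Suc i) =
     (\<Sum>k<n. c k * F (Suc k) * jpart (n - Suc k) i) + f * jpart n i + (\<Sum>k<n. c k * F k * jpart (n - k) i)"
    using A Bf by (simp add: distrib_left right_diff_distrib sum_subtractf)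
  also have "(\<Sum>k<n. c k * F k * jpart (n - k) i) = (\<Sum>k<Suc n. c k * F k * jpart (n - k) i)"
    by (simp add: c_def binomial_eq_0)
  also have "(\<Sum>k<n. c k * F (Suc k) * jpart (n - Suc k) i) + f * jpart n i = (\<Sum>k<Suc n. of_nat (n choose k) * F k * jpart (n - k) i)"
    unfolding sum.lessThan_Suc_shift by (simp add: c_def F_def add.commute)
  also have "(\<Sum>k<Suc n. of_nat (n choose k) * F k * jpart (n - k) i) + (\<Sum>k<Suc n. c k * F k * jpart (n - k) i) =
      (\<Sum>k<Suc n. of_nat (Suc n choose Suc k) * F k * jpart (Suc n - Suc k) i)"
    unfolding sum.distrib[symmetric] by (intro sum.cong refl) (simp add: c_def distrib_right)
  finally show ?case by (simp add: F_def)
qed simp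

theorem jacobson_formula:
  assumes p: "prime p"
  shows "\<exists>G\<in>C. (nab ^^ p) 1 = f ^ p + (\<delta> ^^ (p - 1)) f + of_nat p * G"
proof -
  have p1: "p > 1" using p prime_gt_1_nat by blast
  \<comment> \<open>Every binomial in the Euler identity is divisible by \<open>p\<close> except at
    \<open>k = p - 1\<close>, where \<open>jpart 0 (i - 1)\<close> vanishes because
    \<open>i >= 2\<close>. The factor \<open>i\<close> is then inverted modulo
    \<open>p\<close>.\<close>
  have mid: "\<exists>G\<in>C. jpart p i = of_nat p * G" if i: "2 \<le> i" "i < p" for i
  proof -
    obtain i' where i': "i = Suc i'" "i' \<ge> 1" using i by (cases i) auto
    define G where "G = (\<Sum>k<p. of_nat ((p choose Suc k) div p) * (\<delta> ^^ k) f * jpart (p - Suc k) i')"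
    have GC: "G \<in> C" unfolding G_def by (intro C_intros deltak_C jpart_C)
    have "of_nat i * jpart p i = of_nat p * G"
      unfolding i'(1) jpart_euler G_def sum_distrib_left
    proof (intro sum.cong refl)
      fix k assume k: "k \<in> {..<p}"
      show "of_nat (p choose Suc k) * (\<delta> ^^ k) f * jpart (p - Suc k) i' =
        of_nat p * (of_nat ((p choose Suc k) div p) * (\<delta> ^^ k) f * jpart (p - Suc k) i')"
      proof (cases "Suc k = p")
        case True
        then show ?thesis using i'(2) by simp
      next
        case False
        have "p dvd (p choose Suc k)" using p k False by (intro dvd_choose_prime) auto
        then have "of_nat (p choose Suc k) = (of_nat p * of_nat ((p choose Suc k) div p) :: 'b)"
          by (metis dvd_mult_div_cancel of_nat_mult)
        then show ?thesis by (simp only: mult.assoc)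
      qed
    qed
    moreover have "\<not> p dvd i" using i by (auto dest: dvd_imp_le)
    then have "coprime i p" using p by (metis coprime_commute prime_imp_coprime)
    then obtain x y where xy: "i * x = 1 + p * y"
      using bezout_nat_one[of i p] p1 by blast
    moreover have "jpart p i = of_nat (i * x) * jpart p i - of_nat (p * y) * jpart p i"
      unfolding xy by (simp add: algebra_simps)
    moreover have "of_nat (i * x) * jpart p i = of_nat x * (of_nat i * jpart p i)" by (simp add: mult_ac)
    ultimately have "jpart p i = of_nat p * (of_nat x * G - of_nat y * jpart p i)"
      by (simp add: right_diff_distrib mult_ac)
    moreover have "of_nat x * G - of_nat y * jpart p i \<in> C" by (intro C_intros GC jpart_C)
    ultimately show ?thesis by blast
  qed
  then obtain G where G: "\<And>i. 2 \<le> i \<Longrightarrow> i < p \<Longrightarrow> G i \<in> C \<and> jpart p i = of_nat p * G i" by metis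
  \<comment> \<open>In degree 1 only \<open>k = p - 1\<close> contributes, since
    \<open>jpart n 0\<close> is 0 for positive \<open>n\<close>.\<close>
  have one: "jpart p 1 = (\<delta> ^^ (p - 1)) f"
  proof -
    have "of_nat (Suc 0) * jpart p (Suc 0) = (\<Sum>k<p. of_nat (p choose Suc k) * (\<delta> ^^ k) f * jpart (p - Suc k) 0)"
      by (rule jpart_euler)
    also have "\<dots> = (\<Sum>k<p. if k = p - 1 then (\<delta> ^^ (p - 1)) f else 0)"
    proof (intro sum.cong refl)
      fix k assume "k \<in> {..<p}"
      then have k: "k < p" by simp
      show "of_nat (p choose Suc k) * (\<delta> ^^ k) f * jpart (p - Suc k) 0 = (if k = p - 1 then (\<delta> ^^ (p - 1)) f else 0)"
      proof (cases "k = p - 1")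
        case True
        then have "Suc k = p" using p1 by simp
        then show ?thesis using True by simp
      next
        case False
        then have "p - Suc k \<ge> 1" using k by (simp add: One_nat_def)
        then show ?thesis using False jpart_0 by simp
      qed
    qed
    also have "\<dots> = (\<delta> ^^ (p - 1)) f" using p1 by simp
    finally show ?thesis by (simp add: One_nat_def)
  qed
  have set: "{..p} = insert 0 (insert 1 (insert p {2..<p}))" using p1 by auto
  have "(nab ^^ p) 1 = jpart p 0 + jpart p 1 + jpart p p + (\<Sum>i=2..<p. jpart p i)"
    unfolding nab_power_1 set using p1 by (simp add: add.assoc)
  also have "(\<Sum>i=2..<p. jpart p i) = of_nat p * (\<Sum>i=2..<p. G i)"
    unfolding sum_distrib_left using G by (intro sum.cong refl) auto
  finally have "(nab ^^ p) 1 = f ^ p + (\<delta> ^^ (p - 1)) f + of_nat p * (\<Sum>i=2..<p. G i)"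
    using jpart_0[of p] p1 by (simp add: one jpart_diag add.commute)
  moreover have "(\<Sum>i=2..<p. G i) \<in> C" using G by (intro C_sum) auto
  ultimately show ?thesis by blast
qed

lemma nab_C: "x \<in> C \<Longrightarrow> nab x \<in> C"
  unfolding nab_def by (intro C_intros \<delta>_C f_C)

lemma nab_power_C: "(nab ^^ k) 1 \<in> C"
  by (induction k) (auto intro: nab_C C_1)

lemma nab_add: "nab (x + y) = nab x + nab y"
  by (simp add: nab_def \<delta>_add algebra_simps)

lemma nab_of_nat_mult: "nab (of_nat n * x) = of_nat n * nab x"
  by (simp only: nab_def \<delta>_of_nat_mult distrib_left mult.left_commute)

lemma nab_0: "nab 0 = 0" by (simp add: nab_def \<delta>_0)

lemma nab_uminus: "nab (- x) = - nab x"
  using nab_add[of x "- x"] by (simp add: nab_0 eq_neg_iff_add_eq_0 add.commute)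

lemma nab_sum: "nab (sum h S) = (\<Sum>i\<in>S. nab (h i))"
  by (induction S rule: infinite_finite_induct) (auto simp: nab_0 nab_add)

text \<open>
  Since \<open>\<nabla>\<^sup>p(1) \<equiv> \<nabla>(1)\<close>, the component of \<open>1\<close> in the eigenspace of \<open>\<nabla>\<close> for \<open>i \<in> \<bbbF>\<^sub>p\<close> is
  given by Lagrange interpolation.
\<close>

definition eigpart :: "nat \<Rightarrow> nat \<Rightarrow> 'b" where
  "eigpart p i = (if i = 0 then 1 else 0) - (\<Sum>l=1..<p. of_nat (i ^ (p - 1 - l)) * (nab ^^ l) 1)"

lemma eigpart_C: "eigpart p i \<in> C"
  unfolding eigpart_def by (intro C_intros nab_power_C) (auto intro: C_intros)

text \<open>Modulo \<open>p\<close> the polynomial behind \<open>eigpart\<close> is minus the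
  quotient of \<open>x ^ p - x\<close> by \<open>x - i\<close>, taken at \<open>x = nab\<close>, so
  applying \<open>nab - i\<close> telescopes. The case \<open>i = 0\<close> carries an extra 1
  because \<open>0 ^ (p - 1)\<close> is not 1.\<close>

lemma nab_eigpart:
  assumes "p > 1"
  shows "nab (eigpart p i) - of_nat i * eigpart p i =
    (of_nat (i ^ (p - 1)) + (if i = 0 then 1 else 0)) * nab 1 - (nab ^^ p) 1"
proof -
  define t where "t = (\<lambda>l. of_nat (i ^ (p - l)) * (nab ^^ l) 1)"
  have "nab (\<Sum>l=1..<p. of_nat (i ^ (p - 1 - l)) * (nab ^^ l) 1) = (\<Sum>l=1..<p. t (Suc l))"
    unfolding nab_sum by (intro sum.cong refl) (simp only: nab_of_nat_mult t_def funpow.simps o_apply diff_diff_left plus_1_eq_Suc)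
  moreover have "of_nat i * (\<Sum>l=1..<p. of_nat (i ^ (p - 1 - l)) * (nab ^^ l) 1) = (\<Sum>l=1..<p. t l)"
    unfolding sum_distrib_left
  proof (intro sum.cong refl)
    fix l assume "l \<in> {1..<p}"
    then have "p - l = Suc (p - 1 - l)" by (metis Suc_diff_Suc diff_diff_left plus_1_eq_Suc atLeastLessThan_iff)
    then have "(of_nat (i ^ (p - l)) :: 'b) = of_nat i * of_nat (i ^ (p - 1 - l))" by (simp only: power_Suc of_nat_mult)
    then show "of_nat i * (of_nat (i ^ (p - 1 - l)) * (nab ^^ l) 1) = t l" unfolding t_def by (simp only: mult.assoc)
  qed
  moreover have "(\<Sum>l=1..<p. t (Suc l)) - (\<Sum>l=1..<p. t l) = t p - t 1"
    using assms by (subst sum_subtractf[symmetric]) (rule sum_Suc_diff', simp)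
  moreover have "of_nat i * (if i = 0 then 1 else 0 :: 'b) = 0" by simp
  moreover have "nab (if i = 0 then 1 else 0) = (if i = 0 then 1 else 0) * nab 1" by (simp add: nab_0)
  moreover have "nab (eigpart p i) = nab (if i = 0 then 1 else 0) - nab (\<Sum>l=1..<p. of_nat (i ^ (p - 1 - l)) * (nab ^^ l) 1)"
    unfolding eigpart_def diff_conv_add_uminus nab_add nab_uminus ..
  ultimately have "nab (eigpart p i) - of_nat i * eigpart p i = (if i = 0 then 1 else 0) * nab 1 - (t p - t 1)"
    unfolding eigpart_def by (simp only: right_diff_distrib) (simp add: algebra_simps)
  then show ?thesis by (simp add: t_def algebra_simps One_nat_def)
qed

end

text \<open>The differences \<open>(i + 1) ^ (m + 1) - i ^ (m + 1)\<close> add up to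
  \<open>p ^ (m + 1)\<close>. Lower power sums are divisible by induction, and \<open>m + 1\<close>
  is prime to \<open>p\<close>. Because of this the components \<open>eigpart\<close> add up to 1
  modulo \<open>p\<close>.\<close>

lemma prime_dvd_power_sum:
  assumes p: "prime p" and m: "m + 1 < p"
  shows "p dvd (\<Sum>i<p. i ^ m)"
  using m
proof (induction m rule: less_induct)
  case (less m)
  define S where "S = (\<lambda>k. \<Sum>i<p. i ^ k)"
  have "int p ^ (m + 1) = (\<Sum>i<p. int (Suc i) ^ (m + 1) - int i ^ (m + 1))"
    using sum_lessThan_telescope[of "\<lambda>i. int i ^ (m + 1)" p] by simp
  also have "\<dots> = (\<Sum>i<p. \<Sum>k<m + 1. int ((m + 1) choose k) * int i ^ k)"
  proof (intro sum.cong refl)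
    fix i
    have "int (Suc i) ^ (m + 1) = (int i + 1) ^ (m + 1)" by (simp add: add.commute)
    also have "\<dots> = (\<Sum>k\<le>m + 1. int ((m + 1) choose k) * int i ^ k)"
      using binomial_ring[of "int i" 1 "m + 1"] by simp
    also have "{..m + 1} = insert (m + 1) {..<m + 1}" by auto
    finally show "int (Suc i) ^ (m + 1) - int i ^ (m + 1) = (\<Sum>k<m + 1. int ((m + 1) choose k) * int i ^ k)"
      by simp
  qed
  also have "\<dots> = (\<Sum>k<m + 1. int ((m + 1) choose k) * int (S k))"
    by (subst sum.swap) (simp add: S_def sum_distrib_left)
  also have "{..<m + 1} = insert m {..<m}" by auto
  finally have eq: "int p ^ (m + 1) = int (m + 1) * int (S m) + (\<Sum>k<m. int ((m + 1) choose k) * int (S k))"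
  proof -
    have "(m + 1) choose m = m + 1" using binomial_Suc_n[of m] by (simp only: Suc_eq_plus1)
    then show "int p ^ (m + 1) = (\<Sum>k\<in>insert m {..<m}. int ((m + 1) choose k) * int (S k)) \<Longrightarrow> ?thesis" by simp
  qed
  have "int p dvd (\<Sum>k<m. int ((m + 1) choose k) * int (S k))"
    using less unfolding S_def by (intro dvd_sum dvd_mult) (simp only: int_dvd_int_iff lessThan_iff)
  moreover have "int p dvd int p ^ (m + 1)" by simp
  ultimately have "int p dvd int (m + 1) * int (S m)" unfolding eq by (simp add: dvd_add_left_iff)
  then have "p dvd (m + 1) * S m" by (metis int_dvd_int_iff of_nat_mult)
  moreover have "\<not> p dvd m + 1" using less.prems by (auto dest: dvd_imp_le)
  ultimately show ?case using p by (auto simp: prime_dvd_mult_iff S_def)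
qed

context cyclotomic_order
begin

subsection \<open>The commutative suborder generated by a power of \<open>u\<close>\<close>

definition AP :: "'a poly set" where "AP = {h. \<forall>i. poly.coeff h i \<in> A}"

text \<open>The derivation \<open>V * d/dV\<close>: powers of \<open>V\<close> are eigenvectors with
  their exponents as eigenvalues.\<close>

definition \<delta>p :: "'a poly \<Rightarrow> 'a poly" where "\<delta>p h = [:0, 1:] * pderiv h"

lemma coeff_\<delta>p: "poly.coeff (\<delta>p h) i = of_nat i * poly.coeff h i"
  by (cases i) (simp_all add: \<delta>p_def coeff_pderiv coeff_pCons)

lemma AP_coeff: "h \<in> AP \<Longrightarrow> poly.coeff h i \<in> A"
  by (simp add: AP_def)

lemma AP_closed: "closed_subring AP"
proof
  show "1 \<in> AP" using A_0 A_1 by (simp add: AP_def coeff_pCons split: nat.split)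
  show "x + y \<in> AP" if "x \<in> AP" "y \<in> AP" for x y using that by (simp add: AP_def A_add)
  show "x * y \<in> AP" if "x \<in> AP" "y \<in> AP" for x y
    using that by (auto simp: AP_def coeff_mult intro!: A_sum A_mult)
  show "- x \<in> AP" if "x \<in> AP" for x using that by (simp add: AP_def A_uminus)
qed

interpretation AP: closed_subring AP by (rule AP_closed)

lemma AP_monom: "b \<in> A \<Longrightarrow> monom b i \<in> AP"
  using A_0 by (simp add: AP_def)

lemma \<delta>p_derivation: "f \<in> AP \<Longrightarrow> derivation AP \<delta>p f"
proof
  show "\<delta>p (x + y) = \<delta>p x + \<delta>p y" for x y by (simp add: \<delta>p_def pderiv_add distrib_left)
  show "\<delta>p (x * y) = \<delta>p x * y + x * \<delta>p y" for x y
    by (simp add: \<delta>p_def pderiv_mult algebra_simps)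
  show "\<delta>p x \<in> AP" if "x \<in> AP" for x
    using that by (auto simp: AP_def coeff_\<delta>p intro: A_mult A_of_nat)
qed

lemma AP_poly_1: "h \<in> AP \<Longrightarrow> poly h 1 \<in> A"
  by (auto simp: poly_altdef intro!: A_sum AP_coeff)

text \<open>The element \<open>V ^ i\<close> for \<open>V = u ^ (p ^ q)\<close>, reduced by
  \<open>V ^ (p ^ (s - q)) = 1 + T\<close>; the next definition substitutes \<open>V\<close> into a
  polynomial. Polynomials are kept because for \<open>q < s\<close> the derivation respects this
  relation only modulo \<open>p\<close>.\<close>

definition wv :: "nat \<Rightarrow> nat \<Rightarrow> nat \<Rightarrow> 'a" where
  "wv q i = cyc_monom (\<tau> ^ (i div p ^ (s - q))) (p ^ q * (i mod p ^ (s - q)))"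

definition ev :: "nat \<Rightarrow> 'a poly \<Rightarrow> nat \<Rightarrow> 'a" where
  "ev q h = (\<lambda>k. \<Sum>i\<le>Polynomial.degree h. poly.coeff h i * wv q i k)"

context
  fixes q :: nat
  assumes q: "q \<le> s"
begin

abbreviation M where "M \<equiv> p ^ (s - q)"

lemma N_split: "N = p ^ q * M" using q by (simp add: power_add[symmetric])

lemma wv_idx: "p ^ q * (i mod M) < N"
  unfolding N_split by simp

lemma wv_carrier: "wv q i \<in> carrier \<Delta>"
  unfolding wv_def by (intro B.cyc_monom_carrier wv_idx B_intros)

lemma wv_nth_B: "wv q i k \<in> B"
  using B.carrier_nth[OF wv_carrier] .

lemma wv_mult: "wv q i \<otimes>\<^bsub>\<Delta>\<^esub> wv q j = wv q (i + j)"
proof -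
  define x y where "x = i mod M" "y = j mod M"
  have "wv q i \<otimes>\<^bsub>\<Delta>\<^esub> wv q j = cyc_monom (\<tau> ^ (i div M) * (g ^^ (p ^ q * x)) (\<tau> ^ (j div M)) * \<tau> ^ ((p ^ q * x + p ^ q * y) div N))
      ((p ^ q * x + p ^ q * y) mod N)"
    unfolding wv_def x_y_def by (rule B.monom_mult_monom[OF wv_idx wv_idx]) (intro B_intros)
  also have "(g ^^ (p ^ q * x)) (\<tau> ^ (j div M)) = \<tau> ^ (j div M)" by (intro gi_A A_power tau_A)
  also have "(p ^ q * x + p ^ q * y) div N = (x + y) div M"
    unfolding N_split distrib_left[symmetric] using p_gt by simp
  also have "(p ^ q * x + p ^ q * y) mod N = p ^ q * ((x + y) mod M)"
    unfolding N_split distrib_left[symmetric] by (rule mult_mod_right[symmetric])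
  also have "(x + y) mod M = (i + j) mod M" unfolding x_y_def by (rule mod_add_eq)
  also have "\<tau> ^ (i div M) * \<tau> ^ (j div M) * \<tau> ^ ((x + y) div M) = \<tau> ^ (i div M + j div M + (x + y) div M)"
    by (simp only: power_add)
  also have "i div M + j div M + (x + y) div M = (i + j) div M" unfolding x_y_def by (rule div_add1_eq[symmetric])
  finally show ?thesis by (simp only: wv_def)
qed

lemma mult_sum_right:
  assumes c: "\<And>i. c i \<in> A" and y: "\<And>i. y i \<in> carrier \<Delta>"
  shows "(x \<otimes>\<^bsub>\<Delta>\<^esub> (\<lambda>k. \<Sum>i\<in>S. c i * y i k)) k = (\<Sum>i\<in>S. c i * (x \<otimes>\<^bsub>\<Delta>\<^esub> y i) k)"
proof (cases "k < N")
  case True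
  have "B.rm (\<lambda>k. \<Sum>i\<in>S. c i * y i k) l k = (\<Sum>i\<in>S. c i * B.rm (y i) l k)" for l
  proof -
    have "(g ^^ l) (\<Sum>i\<in>S. c i * y i j) = (\<Sum>i\<in>S. c i * (g ^^ l) (y i j))" for j
      using c y A_B by (simp add: B.gi_sum B.gi_mult gi_A)
    then show ?thesis by (simp add: B.rm_def sum_distrib_right mult.assoc)
  qed
  then have "(x \<otimes>\<^bsub>\<Delta>\<^esub> (\<lambda>k. \<Sum>i\<in>S. c i * y i k)) k = (\<Sum>l<N. \<Sum>i\<in>S. c i * (x l * B.rm (y i) l k))"
    using True by (simp add: B.mult_nth sum_distrib_left mult.left_commute)
  also have "\<dots> = (\<Sum>i\<in>S. \<Sum>l<N. c i * (x l * B.rm (y i) l k))" by (rule sum.swap)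
  finally show ?thesis using True by (simp add: B.mult_nth sum_distrib_left)
qed (simp add: B.mult_nth)

lemma ev_bound: "Polynomial.degree h \<le> n \<Longrightarrow> ev q h k = (\<Sum>i\<le>n. poly.coeff h i * wv q i k)"
  unfolding ev_def by (rule sum.mono_neutral_left) (auto simp: coeff_eq_0)

lemma ev_add: "ev q (h1 + h2) k = ev q h1 k + ev q h2 k"
proof -
  define n where "n = max (Polynomial.degree h1) (Polynomial.degree h2)"
  have "Polynomial.degree (h1 + h2) \<le> n" unfolding n_def by (rule degree_add_le_max)
  then have "ev q (h1 + h2) k = (\<Sum>i\<le>n. poly.coeff (h1 + h2) i * wv q i k)" by (rule ev_bound)
  also have "\<dots> = (\<Sum>i\<le>n. poly.coeff h1 i * wv q i k) + (\<Sum>i\<le>n. poly.coeff h2 i * wv q i k)"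
    by (simp add: distrib_right sum.distrib)
  finally show ?thesis using ev_bound[of h1 n k] ev_bound[of h2 n k] by (simp add: n_def)
qed

lemma ev_smult: "ev q (smult b h) k = b * ev q h k"
  using ev_bound[OF degree_smult_le, of b h k] by (simp add: ev_def sum_distrib_left mult.assoc)

lemma ev_0: "ev q 0 k = 0" by (simp add: ev_def)

lemma ev_uminus: "ev q (- h) k = - ev q h k"
  using ev_smult[of "-1" h k] by simp

lemma ev_diff: "ev q (h1 - h2) k = ev q h1 k - ev q h2 k"
  using ev_add[of h1 "- h2" k] by (simp add: ev_uminus)

lemma ev_sum: "ev q (sum h S) k = (\<Sum>i\<in>S. ev q (h i) k)"
  by (induction S rule: infinite_finite_induct) (auto simp: ev_0 ev_add)

lemma ev_of_nat_mult: "ev q (of_nat n * h) k = of_nat n * ev q h k"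
  by (simp add: of_nat_poly ev_smult)

lemma ev_monom: "ev q (monom b i) k = b * wv q i k"
proof -
  have "ev q (monom b i) k = (\<Sum>j\<le>i. poly.coeff (monom b i) j * wv q j k)"
    by (intro ev_bound degree_monom_le)
  also have "\<dots> = (\<Sum>j\<le>i. if j = i then b * wv q i k else 0)"
    by (intro sum.cong refl) auto
  finally show ?thesis by simp
qed

lemma ev_carrier: "h \<in> AP \<Longrightarrow> ev q h \<in> carrier \<Delta>"
  unfolding B.carrier_iff ev_def
  using A_B AP_coeff wv_nth_B B.carrier_nth_0[OF wv_carrier] by (auto intro!: B_sum B_mult)

lemma wv_0: "wv q 0 = \<one>\<^bsub>\<Delta>\<^esub>" by (simp add: wv_def B.one_eq)

lemma ev_1: "ev q 1 = \<one>\<^bsub>\<Delta>\<^esub>"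
  using ev_monom[of 1 0] by (auto simp: monom_0 one_pCons wv_0)

lemma ev_pCons: "ev q (pCons b h) k = b * \<one>\<^bsub>\<Delta>\<^esub> k + ev q (pCons 0 h) k"
proof -
  have "pCons b h = monom b 0 + pCons 0 h" by (simp add: monom_0)
  then show ?thesis by (simp only: ev_add ev_monom wv_0)
qed

lemma ev_pCons_0:
  assumes h: "h \<in> AP"
  shows "ev q (pCons 0 h) = wv q 1 \<otimes>\<^bsub>\<Delta>\<^esub> ev q h"
proof
  fix k
  define n where "n = Polynomial.degree h"
  have "ev q (pCons 0 h) k = (\<Sum>i\<le>Suc n. poly.coeff (pCons 0 h) i * wv q i k)"
    by (intro ev_bound) (simp add: n_def degree_pCons_le)
  also have "\<dots> = (\<Sum>i\<le>n. poly.coeff h i * wv q (Suc i) k)"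
    by (simp only: sum.atMost_Suc_shift coeff_pCons_0 coeff_pCons_Suc mult_zero_left add_0)
  also have "\<dots> = (\<Sum>i\<le>n. poly.coeff h i * (wv q 1 \<otimes>\<^bsub>\<Delta>\<^esub> wv q i) k)"
    by (simp only: wv_mult plus_1_eq_Suc)
  also have "\<dots> = (wv q 1 \<otimes>\<^bsub>\<Delta>\<^esub> ev q h) k"
    unfolding ev_def n_def using AP_coeff[OF h] by (intro mult_sum_right[symmetric] wv_carrier)
  finally show "ev q (pCons 0 h) k = (wv q 1 \<otimes>\<^bsub>\<Delta>\<^esub> ev q h) k" .
qed

lemma AP_pConsD: "pCons b h \<in> AP \<Longrightarrow> b \<in> A \<and> h \<in> AP"
  unfolding AP_def mem_Collect_eq by (metis coeff_pCons_0 coeff_pCons_Suc)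

lemma ev_mult: "h1 \<in> AP \<Longrightarrow> h2 \<in> AP \<Longrightarrow> ev q (h1 * h2) = ev q h1 \<otimes>\<^bsub>\<Delta>\<^esub> ev q h2"
proof (induction h1)
  case 0
  have "ev q 0 = \<zero>\<^bsub>\<Delta>\<^esub>" by (auto simp: ev_0 B.zero_nth)
  then show ?case using ev_carrier[OF 0(2)] by simp
next
  case (pCons b h1)
  have b: "b \<in> A" "h1 \<in> AP" using AP_pConsD[OF pCons.prems(1)] by auto
  define y where "y = ev q h2"
  define x where "x = ev q h1"
  define w where "w = wv q 1"
  have c: "y \<in> carrier \<Delta>" "x \<in> carrier \<Delta>" "w \<in> carrier \<Delta>" "cyc_monom b 0 \<in> carrier \<Delta>"
    unfolding x_def y_def w_def using b pCons.prems A_B N_gt_1 by (auto intro: ev_carrier wv_carrier)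
  have "ev q (pCons b h1) = cyc_monom b 0 \<oplus>\<^bsub>\<Delta>\<^esub> w \<otimes>\<^bsub>\<Delta>\<^esub> x"
    by (rule ext) (simp add: ev_pCons ev_pCons_0[OF b(2)] B.add_nth x_def w_def one_nth cyc_monom_def)
  then have "ev q (pCons b h1) \<otimes>\<^bsub>\<Delta>\<^esub> y = cyc_monom b 0 \<otimes>\<^bsub>\<Delta>\<^esub> y \<oplus>\<^bsub>\<Delta>\<^esub> w \<otimes>\<^bsub>\<Delta>\<^esub> (x \<otimes>\<^bsub>\<Delta>\<^esub> y)"
    using c by (simp add: B.ring.l_distr B.ring.m_assoc)
  moreover have "ev q (pCons b h1 * h2) = cyc_monom b 0 \<otimes>\<^bsub>\<Delta>\<^esub> y \<oplus>\<^bsub>\<Delta>\<^esub> w \<otimes>\<^bsub>\<Delta>\<^esub> (x \<otimes>\<^bsub>\<Delta>\<^esub> y)"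
  proof
    fix k
    have "ev q (pCons b h1 * h2) k = b * y k + ev q (pCons 0 (h1 * h2)) k"
      by (simp add: mult_pCons_left ev_add ev_smult y_def)
    also have "ev q (pCons 0 (h1 * h2)) = w \<otimes>\<^bsub>\<Delta>\<^esub> (x \<otimes>\<^bsub>\<Delta>\<^esub> y)"
      unfolding w_def x_def y_def using pCons b by (subst ev_pCons_0) (auto intro: AP.C_mult)
    finally show "ev q (pCons b h1 * h2) k = (cyc_monom b 0 \<otimes>\<^bsub>\<Delta>\<^esub> y \<oplus>\<^bsub>\<Delta>\<^esub> w \<otimes>\<^bsub>\<Delta>\<^esub> (x \<otimes>\<^bsub>\<Delta>\<^esub> y)) k"
      using c by (simp add: B.add_nth B.const_mult_nth)
  qed
  ultimately show ?case by (simp add: y_def)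
qed

lemma ev_power: "h \<in> AP \<Longrightarrow> ev q (h ^ k) = ev q h [^]\<^bsub>\<Delta>\<^esub> k"
proof (induction k)
  case (Suc k)
  have "ev q (h ^ Suc k) = ev q (h ^ k * h)" by (simp add: mult.commute)
  also have "\<dots> = ev q (h ^ k) \<otimes>\<^bsub>\<Delta>\<^esub> ev q h" using Suc.prems by (intro ev_mult AP.C_power)
  finally show ?case using Suc by simp
qed (simp add: ev_1)

lemma ev_p_mult: "h \<in> AP \<Longrightarrow> ev q (of_nat p * h) \<in> Lv 1"
proof (rule LvI)
  assume h: "h \<in> AP"
  show "ev q (of_nat p * h) \<in> carrier \<Delta>" using h by (intro ev_carrier AP.C_mult AP.C_of_nat)
  show "ev q (of_nat p * h) i \<in> I 1" for i
    unfolding ev_of_nat_mult using B.carrier_nth[OF ev_carrier[OF h]] by (intro I_mult_right p_I1)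
qed

lemma ev_Lv_add: "ev q h1 \<in> Lv 1 \<Longrightarrow> ev q h2 \<in> Lv 1 \<Longrightarrow> ev q (h1 + h2) \<in> Lv 1"
proof -
  assume "ev q h1 \<in> Lv 1" "ev q h2 \<in> Lv 1"
  then have "ev q h1 \<oplus>\<^bsub>\<Delta>\<^esub> ev q h2 \<in> Lv 1" by (rule Lv_add)
  moreover have "ev q h1 \<oplus>\<^bsub>\<Delta>\<^esub> ev q h2 = ev q (h1 + h2)" by (rule ext) (simp add: B.add_nth ev_add)
  ultimately show ?thesis by simp
qed

lemma ev_Lv_mult: "h1 \<in> AP \<Longrightarrow> h2 \<in> AP \<Longrightarrow> ev q h1 \<in> Lv 1 \<Longrightarrow> ev q (h1 * h2) \<in> Lv 1"
  by (simp only: ev_mult) (intro Lv_mult_right ev_carrier)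

text \<open>A coordinate shows the exponent of \<open>V\<close> only modulo
  \<open>p ^ (s - q)\<close>, but for \<open>q < s\<close> this determines it modulo
  \<open>p\<close>.\<close>

lemma ev_\<delta>:
  assumes qs: "q < s" and h: "h \<in> AP"
  shows "ev q (\<delta>p h) k - of_nat (k div p ^ q) * ev q h k \<in> I 1"
proof -
  define n where "n = Polynomial.degree h"
  have "Polynomial.degree (\<delta>p h) \<le> n"
    unfolding n_def by (intro degree_le allI impI) (simp add: coeff_\<delta>p coeff_eq_0)
  then have "ev q (\<delta>p h) k = (\<Sum>i\<le>n. of_nat i * poly.coeff h i * wv q i k)"
    by (simp add: ev_bound coeff_\<delta>p)
  then have "ev q (\<delta>p h) k - of_nat (k div p ^ q) * ev q h k =
      (\<Sum>i\<le>n. (of_nat i - of_nat (k div p ^ q)) * (poly.coeff h i * wv q i k))"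
    by (simp add: ev_def n_def sum_subtractf sum_distrib_left algebra_simps)
  also have "\<dots> \<in> I 1"
  proof (intro I_sum)
    fix i
    show "(of_nat i - of_nat (k div p ^ q)) * (poly.coeff h i * wv q i k) \<in> I 1"
    proof (cases "k = p ^ q * (i mod M)")
      case True
      then have "k div p ^ q = i mod M" by simp
      moreover have "[i = i mod M] (mod p)"
      proof -
        have "p dvd M" using qs by simp
        then show ?thesis by (metis cong_def mod_mod_cancel)
      qed
      ultimately show ?thesis using A_B AP_coeff[OF h] wv_nth_B
        by (intro I_mult_right B_mult) (auto intro: of_nat_cong_I)
    next
      case False
      then show ?thesis by (simp add: wv_def cyc_monom_def)
    qed
  qed
  finally show ?thesis .
qed

lemma tau_power_mx: "\<tau> ^ i - 1 \<in> mx"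
proof -
  have "\<tau> ^ i - 1 = T * (\<Sum>j<i. \<tau> ^ j)" using power_diff_1_eq[of \<tau> i] by simp
  then show ?thesis using mx_mult[of "\<Sum>j<i. \<tau> ^ j" T] by (simp add: mult.commute T_mx B_intros)
qed

lemma mx_or_unit: "x \<in> B \<Longrightarrow> x \<notin> mx \<Longrightarrow> Bunit x"
  using local[of x] unfolding mx_def by (auto intro: BunitI)

lemma one_notin_mx: "1 \<notin> mx"
  using one_not_max unfolding mx_def by force

lemma Bunit_const: "Bunit b \<Longrightarrow> cyc_monom b 0 \<in> Units \<Delta>"
proof -
  assume b: "Bunit b"
  have "cyc_monom b 0 \<in> carrier \<Delta>" "cyc_monom (inverse b) 0 \<in> carrier \<Delta>"
    using b N_gt_1 by (auto simp: Bunit_def)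
  moreover have "cyc_monom b 0 \<otimes>\<^bsub>\<Delta>\<^esub> cyc_monom (inverse b) 0 = \<one>\<^bsub>\<Delta>\<^esub>"
    "cyc_monom (inverse b) 0 \<otimes>\<^bsub>\<Delta>\<^esub> cyc_monom b 0 = \<one>\<^bsub>\<Delta>\<^esub>"
    using b B.monom_mult_monom[of 0 0 "inverse b" b] B.monom_mult_monom[of 0 0 b "inverse b"] N_gt_1
    by (simp_all add: Bunit_def B.one_eq)
  ultimately show ?thesis unfolding Units_def mem_Collect_eq
    by (intro conjI bexI[of _ "cyc_monom (inverse b) 0"])
qed

lemma unit_of_power_unit:
  assumes x: "x \<in> carrier \<Delta>" and k: "x [^]\<^bsub>\<Delta>\<^esub> Suc k \<in> Units \<Delta>"
  shows "x \<in> Units \<Delta>"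
proof -
  define u where "u = x [^]\<^bsub>\<Delta>\<^esub> Suc k"
  define y where "y = x [^]\<^bsub>\<Delta>\<^esub> k"
  have yc: "y \<in> carrier \<Delta>" unfolding y_def using x by simp
  have u: "u \<in> Units \<Delta>" "inv\<^bsub>\<Delta>\<^esub> u \<in> carrier \<Delta>" using k by (auto simp: u_def)
  have yx: "y \<otimes>\<^bsub>\<Delta>\<^esub> x = u" by (simp add: u_def y_def)
  have xy: "x \<otimes>\<^bsub>\<Delta>\<^esub> y = u" unfolding u_def y_def by (rule B.ring.nat_pow_Suc2[OF x, symmetric])
  have l: "(inv\<^bsub>\<Delta>\<^esub> u \<otimes>\<^bsub>\<Delta>\<^esub> y) \<otimes>\<^bsub>\<Delta>\<^esub> x = \<one>\<^bsub>\<Delta>\<^esub>"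
    using B.ring.m_assoc[OF u(2) yc x] yx u(1) by simp
  have r: "x \<otimes>\<^bsub>\<Delta>\<^esub> (y \<otimes>\<^bsub>\<Delta>\<^esub> inv\<^bsub>\<Delta>\<^esub> u) = \<one>\<^bsub>\<Delta>\<^esub>"
    using B.ring.m_assoc[OF x yc u(2)] xy u(1) by simp
  have "inv\<^bsub>\<Delta>\<^esub> u \<otimes>\<^bsub>\<Delta>\<^esub> y = y \<otimes>\<^bsub>\<Delta>\<^esub> inv\<^bsub>\<Delta>\<^esub> u"
    by (rule B.ring.inv_unique[OF l r x]) (use yc u in simp_all)
  then show ?thesis unfolding Units_def mem_Collect_eq using x yc u l r
    by (intro conjI bexI[of _ "y \<otimes>\<^bsub>\<Delta>\<^esub> inv\<^bsub>\<Delta>\<^esub> u"]) simp_all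
qed

text \<open>By Frobenius, \<open>h ^ M\<close> evaluates modulo \<open>p\<close> to a constant,
  which agrees with \<open>h(1) ^ M\<close> modulo the maximal ideal since \<open>\<tau>\<close> is
  1 there. A power of \<open>ev q h\<close> is thus a unit constant times a factor close to 1, and
  an element with a unit power is a unit.\<close>

lemma ev_unit:
  assumes h: "h \<in> AP" and h1: "poly h 1 \<notin> mx"
  shows "ev q h \<in> Units \<Delta>"
proof -
  define n where "n = Polynomial.degree h"
  define c where "c = poly.coeff h"
  have cA: "c i \<in> A" for i unfolding c_def by (rule AP_coeff[OF h])
  have h_eq: "h = (\<Sum>i\<le>n. monom (c i) i)" by (simp add: c_def n_def poly_as_sum_of_monoms)
  have "\<exists>z\<in>AP. (\<Sum>i\<le>n. monom (c i) i) ^ M = (\<Sum>i\<le>n. monom (c i) i ^ M) + of_nat p * z"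
    by (intro AP.freshman_sum_power[OF p(1)] AP_monom cA)
  then obtain G where G: "G \<in> AP" "h ^ M = (\<Sum>i\<le>n. monom (c i) i ^ M) + of_nat p * G"
    unfolding h_eq[symmetric] by (rule bexE)
  interpret BB: closed_subring B by unfold_locales (auto intro: B_intros)
  have "\<exists>z\<in>B. (\<Sum>i\<le>n. c i) ^ M = (\<Sum>i\<le>n. c i ^ M) + of_nat p * z"
    by (intro BB.freshman_sum_power[OF p(1)] A_B cA)
  then obtain z where z: "z \<in> B" "(\<Sum>i\<le>n. c i) ^ M = (\<Sum>i\<le>n. c i ^ M) + of_nat p * z" by blast
  define b where "b = (\<Sum>i\<le>n. c i ^ M * \<tau> ^ i)"
  have bB: "b \<in> B" unfolding b_def using cA A_B by (auto intro!: B_intros)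
  have ph: "poly h 1 = (\<Sum>i\<le>n. c i)" by (simp add: poly_altdef c_def n_def)
  have b_mx: "b - poly h 1 ^ M \<in> mx"
  proof -
    have "b - poly h 1 ^ M = (\<Sum>i\<le>n. c i ^ M * (\<tau> ^ i - 1)) + - (of_nat p * z)"
      unfolding ph z(2) b_def by (simp add: algebra_simps sum_subtractf)
    moreover have "(\<Sum>i\<le>n. c i ^ M * (\<tau> ^ i - 1)) \<in> mx"
      using cA A_B by (intro mx_sum mx_mult tau_power_mx B_power) auto
    moreover have "- (of_nat p * z) \<in> mx" using z(1) by (intro mx_uminus I1_mx I_mult_right p_I1)
    ultimately show ?thesis by (metis mx_add)
  qed
  have Bu: "Bunit (poly h 1)" using h1 A_B[OF AP_poly_1[OF h]] by (intro mx_or_unit)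
  have "b \<notin> mx"
  proof
    assume "b \<in> mx"
    then have "b + - (b - poly h 1 ^ M) \<in> mx" using b_mx by (intro mx_add mx_uminus)
    then have "poly h 1 ^ M \<in> mx" by simp
    then have "inverse (poly h 1) ^ M * poly h 1 ^ M \<in> mx" using Bu unfolding Bunit_def by (intro mx_mult B_power) auto
    then have "1 \<in> mx" using Bu by (simp add: Bunit_def power_mult_distrib[symmetric])
    then show False using one_notin_mx by simp
  qed
  then have b: "Bunit b" using bB by (intro mx_or_unit)
  have evM: "ev q (h ^ M) k = b * \<one>\<^bsub>\<Delta>\<^esub> k + of_nat p * ev q G k" for k
  proof -
    have "ev q (monom (c i) i ^ M) k = c i ^ M * \<tau> ^ i * \<one>\<^bsub>\<Delta>\<^esub> k" for i
    proof -
      have "wv q (i * M) = cyc_monom (\<tau> ^ i) 0" by (simp add: wv_def)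
      then show ?thesis by (simp add: monom_power ev_monom one_nth cyc_monom_def)
    qed
    then show ?thesis unfolding G(2) by (simp add: ev_add ev_sum ev_of_nat_mult b_def sum_distrib_right)
  qed
  have evMc: "ev q (h ^ M) \<in> carrier \<Delta>" by (intro ev_carrier AP.C_power h)
  define x where "x = cyc_monom (inverse b) 0 \<otimes>\<^bsub>\<Delta>\<^esub> ev q (h ^ M)"
  have bi: "Bunit (inverse b)" using b by (auto simp: Bunit_def)
  have bic: "cyc_monom (inverse b) 0 \<in> Units \<Delta>" by (rule Bunit_const[OF bi])
  have xU: "x \<in> Units \<Delta>"
  proof (rule unit_mx)
    show "x \<in> carrier \<Delta>" unfolding x_def using bic evMc by (intro B.mult_closed) auto
    fix k
    have "x k - \<one>\<^bsub>\<Delta>\<^esub> k = inverse b * (of_nat p * ev q G k)"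
      unfolding x_def B.const_mult_nth[OF evMc] evM using b by (simp add: Bunit_def distrib_left)
    moreover have "of_nat p * ev q G k \<in> I 1" using B.carrier_nth[OF ev_carrier[OF G(1)]] by (intro I_mult_right p_I1)
    moreover have "inverse b \<in> B" using b by (simp add: Bunit_def)
    ultimately show "x k - \<one>\<^bsub>\<Delta>\<^esub> k \<in> mx" by (metis I1_mx I_mult_left)
  qed
  have bc: "cyc_monom b 0 \<in> Units \<Delta>" by (rule Bunit_const[OF b])
  have "cyc_monom b 0 \<otimes>\<^bsub>\<Delta>\<^esub> x = ev q (h ^ M)"
    using xU evMc b unfolding fun_eq_iff by (simp add: B.const_mult_nth x_def Bunit_def)
  then have "ev q (h ^ M) \<in> Units \<Delta>" using B.ring.Units_m_closed[OF bc xU] by simp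
  then have "ev q h [^]\<^bsub>\<Delta>\<^esub> Suc (M - 1) \<in> Units \<Delta>" unfolding ev_power[OF h, symmetric] using p_pos by (simp add: One_nat_def)
  then show ?thesis by (rule unit_of_power_unit[OF ev_carrier[OF h]])
qed

end

end

section \<open>Cartier's criterion and the existence of a logarithmic derivative\<close>

lemma sum_lessThan_add: "(\<Sum>l<a + b. f l) = (\<Sum>l<a. f l) + (\<Sum>l<b. f (a + l))"
  for f :: "nat \<Rightarrow> 'a::comm_monoid_add" and a b :: nat
  by (induction b) (simp_all add: add.assoc)

lemma sum_lessThan_mult: "(\<Sum>l<a * b. f l) = (\<Sum>l<a. \<Sum>c<b. f (l + a * c))"
  for f :: "nat \<Rightarrow> 'a::comm_monoid_add" and a b :: nat
proof (induction b)
  case (Suc b)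
  have "(\<Sum>l<a * Suc b. f l) = (\<Sum>l<a * b + a. f l)" by (simp add: add.commute)
  also have "\<dots> = (\<Sum>l<a * b. f l) + (\<Sum>l<a. f (a * b + l))" by (rule sum_lessThan_add)
  finally show ?case unfolding Suc by (simp add: sum.distrib add.commute)
qed simp

lemma sum_dvd_lessThan:
  fixes F :: "nat \<Rightarrow> nat \<Rightarrow> 'a::comm_monoid_add"
  assumes "u > 0"
  shows "(\<Sum>i<u * v. if u dvd i then F (i div u) i else 0) = (\<Sum>j<v. F j (u * j))"
proof -
  have "(\<Sum>i<u * v. if u dvd i then F (i div u) i else 0) =
      (\<Sum>l<u. \<Sum>c<v. if u dvd (l + u * c) then F ((l + u * c) div u) (l + u * c) else 0)"
    by (rule sum_lessThan_mult)
  also have "\<dots> = (\<Sum>l<u. if l = 0 then (\<Sum>c<v. F c (u * c)) else 0)"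
  proof (intro sum.cong refl)
    fix l assume "l \<in> {..<u}"
    then have l: "l < u" by simp
    have "u dvd (l + u * c) \<longleftrightarrow> l = 0" for c
      using l by (metis dvd_add_left_iff dvd_triv_left dvd_0_right nat_dvd_not_less neq0_conv)
    then show "(\<Sum>c<v. if u dvd (l + u * c) then F ((l + u * c) div u) (l + u * c) else 0) =
      (if l = 0 then (\<Sum>c<v. F c (u * c)) else 0)"
      using assms by simp
  qed
  also have "\<dots> = (\<Sum>j<v. F j (u * j))" using assms by simp
  finally show ?thesis .
qed

text \<open>Applied to exponents: modulo \<open>p\<close> the operator
  \<open>\<delta>p ^^ (p - 1)\<close> kills the powers of \<open>V\<close> whose exponent is
  divisible by \<open>p\<close> and fixes the others.\<close>

lemma fermat_indicator:
  fixes j p :: nat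
  assumes p: "prime p"
  shows "\<exists>t. j ^ (p - 1) + (if p dvd j then 1 else 0) = 1 + p * t"
proof (cases "p dvd j")
  case True
  have "p - 1 > 0" using prime_gt_1_nat[OF p] by simp
  then have "p dvd j ^ (p - 1)" using True by (metis dvd_power_same dvd_trans dvd_power)
  then show ?thesis using True by (auto elim!: dvdE)
next
  case False
  with p have "[j ^ (p - 1) = 1] (mod p)" by (rule fermat_theorem)
  moreover have "j \<noteq> 0" using False by (cases j) auto
  then have "1 \<le> j ^ (p - 1)" by (intro one_le_power) (simp add: Suc_le_eq One_nat_def)
  ultimately obtain t where "j ^ (p - 1) = t * p + 1" using cong_le_nat cong_sym by blast
  then show ?thesis using False by (auto simp: mult.commute)
qed

context cyclotomic_order
begin

interpretation AP: closed_subring AP by (rule AP_closed)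

text \<open>
  The congruence \<open>f\<^sup>p \<equiv> P\<^sub>0 f\<close>, where \<open>P\<^sub>0\<close> keeps the powers of \<open>V\<^sup>p\<close>, is the condition of Cartier
  and Jacobson for \<open>f\<close> to be a logarithmic derivative.
\<close>

lemma cartier_condition:
  assumes q: "q < s" and a: "\<And>j. a j \<in> A"
    and S: "(\<Sum>j<p ^ (s - q). a j ^ (p ^ (s - q)) * \<tau> ^ j) -
      (\<Sum>j<p ^ (s - q - 1). a (p * j) ^ (p ^ (s - q - 1)) * \<tau> ^ j) \<in> I 1"
    and j: "j < p ^ (s - q - 1)"
  shows "(\<Sum>l<p. a (j + p ^ (s - q - 1) * l) ^ p * \<tau> ^ l) - a (p * j) \<in> I 1"
proof -
  define M' where "M' = p ^ (s - q - 1)"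
  \<comment> \<open>\<open>c j\<close> is the coefficient of the difference between the
    \<open>p\<close>-th power of \<open>f\<close>, taken termwise, and its part in powers of
    \<open>V ^ p\<close>, at \<open>V ^ (p * j)\<close> and after replacing
    \<open>V ^ (p ^ (s - q))\<close> by \<open>\<tau>\<close>. Frobenius rewrites the hypothesis as
    a relation between the \<open>M'\<close>-th powers of the \<open>c j\<close>, from which
    \<open>frobenius_basis\<close> isolates each one.\<close>
  define c where "c = (\<lambda>j. (\<Sum>l<p. a (j + M' * l) ^ p * \<tau> ^ l) - a (p * j))"
  have MM: "p ^ (s - q) = M' * p"
  proof -
    have "s - q = Suc (s - q - 1)" using q by simp
    then show ?thesis unfolding M'_def by (metis power_Suc2)
  qed
  have oddM: "odd M'" using p by (simp add: M'_def)
  have M'pos: "M' > 0" by (simp add: M'_def)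
  interpret AA: closed_subring A by unfold_locales (auto intro: A_1 A_add A_mult A_uminus)
  have cA: "c j \<in> A" for j unfolding c_def using a by (intro A_diff A_sum A_mult A_power tau_A)
  have "\<exists>z\<in>A. c j ^ M' = (\<Sum>l<p. a (j + M' * l) ^ (p ^ (s - q)) * \<tau> ^ (M' * l)) - a (p * j) ^ M' + of_nat p * z" for j
  proof -
    define x where "x = (\<lambda>l. if l < p then a (j + M' * l) ^ p * \<tau> ^ l else - a (p * j))"
    have "\<exists>z\<in>A. (\<Sum>l\<le>p. x l) ^ M' = (\<Sum>l\<le>p. x l ^ M') + of_nat p * z"
      unfolding M'_def x_def using a by (intro AA.freshman_sum_power[OF p(1)]) (auto intro!: A_mult A_power tau_A A_uminus)
    then obtain z where z: "z \<in> A" "(\<Sum>l\<le>p. x l) ^ M' = (\<Sum>l\<le>p. x l ^ M') + of_nat p * z" by (rule bexE)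
    have set: "{..p} = insert p {..<p}" by auto
    have "(\<Sum>l\<le>p. x l) = c j" unfolding set by (simp add: x_def c_def)
    moreover have "(\<Sum>l\<le>p. x l ^ M') = (\<Sum>l<p. a (j + M' * l) ^ (p ^ (s - q)) * \<tau> ^ (M' * l)) - a (p * j) ^ M'"
    proof -
      have "x p ^ M' = - (a (p * j) ^ M')" using oddM by (simp add: x_def power_minus_odd)
      moreover have "(\<Sum>l<p. x l ^ M') = (\<Sum>l<p. a (j + M' * l) ^ (p ^ (s - q)) * \<tau> ^ (M' * l))"
        unfolding MM by (intro sum.cong refl) (simp add: x_def power_mult_distrib power_mult[symmetric] mult.commute)
      ultimately show ?thesis unfolding set by simp
    qed
    ultimately show ?thesis using z by metis
  qed
  then have "\<forall>j. \<exists>z. z \<in> A \<and> c j ^ M' = (\<Sum>l<p. a (j + M' * l) ^ (p ^ (s - q)) * \<tau> ^ (M' * l)) - a (p * j) ^ M' + of_nat p * z"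
    unfolding Bex_def by (rule allI)
  from choice[OF this] obtain z where zz:
    "\<forall>j. z j \<in> A \<and> c j ^ M' = (\<Sum>l<p. a (j + M' * l) ^ (p ^ (s - q)) * \<tau> ^ (M' * l)) - a (p * j) ^ M' + of_nat p * z j"
    by (rule exE)
  have z: "\<And>j. z j \<in> A"
    "\<And>j. c j ^ M' = (\<Sum>l<p. a (j + M' * l) ^ (p ^ (s - q)) * \<tau> ^ (M' * l)) - a (p * j) ^ M' + of_nat p * z j"
    by (rule spec[OF zz, THEN conjunct1], rule spec[OF zz, THEN conjunct2])
  have "(\<Sum>j<M'. c j ^ M' * \<tau> ^ j) =
      ((\<Sum>j<M'. \<Sum>l<p. a (j + M' * l) ^ (p ^ (s - q)) * \<tau> ^ (j + M' * l)) - (\<Sum>j<M'. a (p * j) ^ M' * \<tau> ^ j))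
      + of_nat p * (\<Sum>j<M'. z j * \<tau> ^ j)"
    unfolding z(2) by (simp add: algebra_simps sum.distrib sum_subtractf sum_distrib_left power_add)
  also have "(\<Sum>j<M'. \<Sum>l<p. a (j + M' * l) ^ (p ^ (s - q)) * \<tau> ^ (j + M' * l)) = (\<Sum>j<p ^ (s - q). a j ^ (p ^ (s - q)) * \<tau> ^ j)"
    unfolding MM by (rule sum_lessThan_mult[symmetric])
  finally have "(\<Sum>j<M'. c j ^ M' * \<tau> ^ j) = ((\<Sum>j<p ^ (s - q). a j ^ (p ^ (s - q)) * \<tau> ^ j) - (\<Sum>j<M'. a (p * j) ^ M' * \<tau> ^ j))
      + of_nat p * (\<Sum>j<M'. z j * \<tau> ^ j)" .
  moreover have "of_nat p * (\<Sum>j<M'. z j * \<tau> ^ j) \<in> I 1"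
    using z(1) A_B by (intro I_mult_right p_I1 B_sum B_mult B_power tau_B) auto
  ultimately have "(\<Sum>j<M'. c j ^ M' * \<tau> ^ j) \<in> I 1"
    unfolding M'_def by (simp only: I_add[OF S])
  then have "\<exists>b\<in>B. (\<Sum>j<p ^ (s - q - 1). c j ^ (p ^ (s - q - 1)) * \<tau> ^ j) = \<Pi> * b"
    unfolding M'_def by (elim IE) (simp only: power_one_right, rule bexI, rule refl)
  then obtain b where b: "b \<in> B" "(\<Sum>j<p ^ (s - q - 1). c j ^ (p ^ (s - q - 1)) * \<tau> ^ j) = \<Pi> * b"
    by (rule bexE)
  have "\<exists>b\<in>B. c j = \<Pi> * b" by (rule frobenius_basis[OF cA b j])
  then obtain b' where "b' \<in> B" "c j = \<Pi> * b'" by (rule bexE)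
  then have "c j \<in> I 1" using II[of b' 1] by simp
  then show ?thesis by (simp add: c_def M'_def)
qed

text \<open>Exponents \<open>p * (j + M' * l)\<close> with different \<open>l\<close> meet in one
  coordinate with weights \<open>\<tau> ^ l\<close>, so the coordinates are the quantities
  controlled by \<open>cartier_condition\<close>.\<close>

lemma ev_frobenius:
  assumes q: "q < s" and a: "\<And>j. a j \<in> A"
    and S: "(\<Sum>j<p ^ (s - q). a j ^ (p ^ (s - q)) * \<tau> ^ j) -
      (\<Sum>j<p ^ (s - q - 1). a (p * j) ^ (p ^ (s - q - 1)) * \<tau> ^ j) \<in> I 1"
  shows "ev q ((\<Sum>j<p ^ (s - q). monom (a j ^ p) (j * p)) - (\<Sum>j<p ^ (s - q - 1). monom (a (p * j)) (p * j))) \<in> Lv 1"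
proof (rule LvI)
  define M' where "M' = p ^ (s - q - 1)"
  have MM: "p ^ (s - q) = M' * p"
  proof -
    have "s - q = Suc (s - q - 1)" using q by simp
    then show ?thesis unfolding M'_def by (metis power_Suc2)
  qed
  have qs: "q \<le> s" using q by simp
  let ?h = "(\<Sum>j<p ^ (s - q). monom (a j ^ p) (j * p)) - (\<Sum>j<p ^ (s - q - 1). monom (a (p * j)) (p * j))"
  have hAP: "?h \<in> AP" using a by (intro AP.C_diff AP.C_sum AP_monom A_power)
  show "ev q ?h \<in> carrier \<Delta>" by (rule ev_carrier[OF qs hAP])
  fix k
  define c where "c = (\<lambda>j. (\<Sum>l<p. a (j + M' * l) ^ p * \<tau> ^ l) - a (p * j))"
  have w1: "wv q ((j + M' * l) * p) k = (if k = p ^ q * (p * j) then \<tau> ^ l else 0)" if "j < M'" for j l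
  proof -
    have "(j + M' * l) * p = p * j + l * p ^ (s - q)" unfolding MM by (simp add: algebra_simps)
    moreover have "p * j < p ^ (s - q)" unfolding MM using that p_pos by (simp add: mult.commute)
    ultimately have "(j + M' * l) * p div p ^ (s - q) = l" "(j + M' * l) * p mod p ^ (s - q) = p * j"
      by simp_all
    then show ?thesis by (simp add: wv_def cyc_monom_def)
  qed
  have w2: "wv q (p * j) k = (if k = p ^ q * (p * j) then 1 else 0)" if "j < M'" for j
    using w1[OF that, of 0] by (simp add: mult.commute)
  have "ev q ?h k = (\<Sum>j<M' * p. a j ^ p * wv q (j * p) k) - (\<Sum>j<M'. a (p * j) * wv q (p * j) k)"
    using qs by (simp only: ev_diff ev_sum ev_monom MM M'_def)
  also have "(\<Sum>j<M' * p. a j ^ p * wv q (j * p) k) = (\<Sum>j<M'. \<Sum>l<p. a (j + M' * l) ^ p * wv q ((j + M' * l) * p) k)"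
    by (rule sum_lessThan_mult)
  also have "\<dots> - (\<Sum>j<M'. a (p * j) * wv q (p * j) k) = (\<Sum>j<M'. if k = p ^ q * (p * j) then c j else 0)"
    unfolding sum_subtractf[symmetric] by (intro sum.cong refl) (simp add: w1 w2 c_def)
  also have "\<dots> \<in> I 1"
    using cartier_condition[OF q a S] by (intro I_sum) (auto simp: c_def M'_def)
  finally show "ev q ?h k \<in> I 1" .
qed

text \<open>The hypothesis makes the \<open>p\<close>-fold iterate of
  \<open>nab = \<delta>p + f\<close> agree with \<open>nab\<close> at 1, modulo Pi after evaluation,
  so 1 is a sum of eigenvectors. One of them is a unit, and a power of \<open>V\<close> shifts its
  eigenvalue to 0; then \<open>nab h = 0\<close> says that \<open>- f\<close> is the logarithmic
  derivative of \<open>h\<close>.\<close>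

theorem exists_log_derivative:
  assumes q: "q < s" and a: "\<And>j. a j \<in> A"
    and S: "(\<Sum>j<p ^ (s - q). a j ^ (p ^ (s - q)) * \<tau> ^ j) -
      (\<Sum>j<p ^ (s - q - 1). a (p * j) ^ (p ^ (s - q - 1)) * \<tau> ^ j) \<in> I 1"
  defines "f \<equiv> \<Sum>j<p ^ (s - q). monom (a j) j"
  shows "\<exists>h\<in>AP. ev q h \<in> Units \<Delta> \<and> ev q (\<delta>p h + f * h) \<in> Lv 1"
proof -
  have qs: "q \<le> s" using q by simp
  define M where "M = p ^ (s - q)"
  define M' where "M' = p ^ (s - q - 1)"
  have MM: "M = M' * p"
  proof -
    have "s - q = Suc (s - q - 1)" using q by simp
    then show ?thesis unfolding M'_def M_def by (metis power_Suc2)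
  qed
  have p1: "p > 1" using p_gt by simp
  have fAP: "f \<in> AP" unfolding f_def using a by (intro AP.C_sum AP_monom)
  interpret d: derivation AP \<delta>p f by (rule \<delta>p_derivation[OF fAP])
  define P0 where "P0 = (\<Sum>j<M'. monom (a (p * j)) (p * j))"
  obtain G where G: "G \<in> AP" "(d.nab ^^ p) 1 = f ^ p + (\<delta>p ^^ (p - 1)) f + of_nat p * G"
    using d.jacobson_formula[OF p(1)] by blast
  have "\<exists>z\<in>AP. (\<Sum>j<M. monom (a j) j) ^ p = (\<Sum>j<M. monom (a j) j ^ p) + of_nat p * z"
    using a by (intro AP.freshman_sum[OF p(1)] AP_monom)
  then obtain G1 where G1: "G1 \<in> AP" "f ^ p = (\<Sum>j<M. monom (a j) j ^ p) + of_nat p * G1"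
    unfolding f_def M_def[symmetric] by (rule bexE)
  have fp: "f ^ p = (\<Sum>j<M. monom (a j ^ p) (j * p)) + of_nat p * G1"
    unfolding G1(2) by (simp add: monom_power)
  obtain t where t: "\<And>j. j ^ (p - 1) + (if p dvd j then 1 else 0) = 1 + p * t j"
    using fermat_indicator[OF p(1)] by metis
  define G2 where "G2 = (\<Sum>j<M. monom (of_nat (t j) * a j) j)"
  have G2: "G2 \<in> AP" unfolding G2_def using a by (intro AP.C_sum AP_monom A_mult A_of_nat)
  have coeff_dk: "poly.coeff ((\<delta>p ^^ k) h) i = of_nat (i ^ k) * poly.coeff h i" for k h i
    by (induction k) (simp_all add: coeff_\<delta>p mult.assoc)
  have coeff_f: "poly.coeff f i = (if i < M then a i else 0)" for i
    by (simp add: f_def M_def[symmetric] coeff_sum sum.delta)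
  have coeff_P0: "poly.coeff P0 i = (if i < M \<and> p dvd i then a i else 0)" for i
  proof -
    have "poly.coeff P0 i = (\<Sum>j<M'. if p * j = i then a i else 0)"
      unfolding P0_def by (simp add: coeff_sum) (intro sum.cong refl, auto)
    also have "\<dots> = (if i < M \<and> p dvd i then a i else 0)"
    proof (cases "i < M \<and> p dvd i")
      case True
      then obtain j where j: "i = p * j" by (auto elim: dvdE)
      then have "j < M'" using True MM by (simp add: mult.commute)
      have "(\<Sum>j'<M'. if p * j' = i then a i else 0) = (\<Sum>j'<M'. if j' = j then a i else 0)"
        unfolding j using p_gt by (intro sum.cong refl) auto
      then show ?thesis using True \<open>j < M'\<close> by simp
    next
      case False
      then have "p * j \<noteq> i" if "j < M'" for j
        using that MM p_pos by (auto simp: mult.commute)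
      then have "(\<Sum>j<M'. if p * j = i then a i else 0) = 0" by (intro sum.neutral) auto
      then show ?thesis using False by auto
    qed
    finally show ?thesis .
  qed
  have coeff_G2: "poly.coeff G2 i = (if i < M then of_nat (t i) * a i else 0)" for i
    by (simp add: G2_def coeff_sum sum.delta)
  have dpf: "(\<delta>p ^^ (p - 1)) f + P0 = f + of_nat p * G2"
  proof (rule poly_eqI)
    fix i
    have "of_nat (i ^ (p - 1)) + (if p dvd i then 1 else 0) = (1 + of_nat p * of_nat (t i) :: 'a)"
      using arg_cong[OF t[of i], of "of_nat :: nat \<Rightarrow> 'a"] by (simp split: if_splits)
    then have "(of_nat (i ^ (p - 1)) + (if p dvd i then 1 else 0)) * a i = (1 + of_nat p * of_nat (t i)) * a i"
      by (rule arg_cong)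
    then have eq: "of_nat (i ^ (p - 1)) * a i + (if p dvd i then a i else 0) = a i + of_nat p * (of_nat (t i) * a i)"
      by (cases "p dvd i") (simp_all only: if_True if_False distrib_right mult_1 mult_zero_left mult.assoc simp_thms)
    have "poly.coeff (of_nat p * G2) i = of_nat p * poly.coeff G2 i" by (simp add: of_nat_poly)
    then show "poly.coeff ((\<delta>p ^^ (p - 1)) f + P0) i = poly.coeff (f + of_nat p * G2) i"
      unfolding coeff_add coeff_dk coeff_f coeff_P0 coeff_G2 using eq by (cases "i < M") (simp_all only: if_True if_False simp_thms mult_zero_right add_0)
  qed
  have nab1: "d.nab 1 = f" by (simp add: d.nab_def d.\<delta>_1)
  have nabp: "(d.nab ^^ p) 1 - d.nab 1 = ((\<Sum>j<M. monom (a j ^ p) (j * p)) - P0) + of_nat p * (G1 + G2 + G)"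
    unfolding G(2) nab1 fp using dpf by (simp add: algebra_simps)
  have Fr: "ev q ((\<Sum>j<M. monom (a j ^ p) (j * p)) - P0) \<in> Lv 1"
    unfolding M_def P0_def M'_def by (rule ev_frobenius[OF q a S])
  have ev_nabp: "ev q ((d.nab ^^ p) 1 - d.nab 1) \<in> Lv 1"
    unfolding nabp using G(1) G1(1) G2 by (intro ev_Lv_add[OF qs Fr] ev_p_mult[OF qs] AP.C_add)
  have ev_neg: "ev q (- h) \<in> Lv 1" if "h \<in> AP" "ev q h \<in> Lv 1" for h
    using ev_Lv_mult[OF qs that(1) AP.C_uminus[OF AP.C_1] that(2)] by simp
  \<comment> \<open>Substituting 1 for \<open>V\<close> leads to the residue field, where the
    components add up to 1, so one of them is nonzero.\<close>
  have "\<exists>i<p. poly (d.eigpart p i) 1 \<notin> mx"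
  proof (rule ccontr)
    assume "\<not> (\<exists>i<p. poly (d.eigpart p i) 1 \<notin> mx)"
    then have "(\<Sum>i<p. poly (d.eigpart p i) 1) \<in> mx" by (intro mx_sum) auto
    moreover have "\<exists>y\<in>AP. (\<Sum>i<p. d.eigpart p i) = 1 - of_nat p * y"
    proof -
      define y where "y = (\<Sum>l=1..<p. of_nat ((\<Sum>i<p. i ^ (p - 1 - l)) div p) * (d.nab ^^ l) 1)"
      have "(\<Sum>i<p. d.eigpart p i) = (\<Sum>i<p. if i = 0 then 1 else 0) - (\<Sum>i<p. \<Sum>l=1..<p. of_nat (i ^ (p - 1 - l)) * (d.nab ^^ l) 1)"
        by (simp only: d.eigpart_def sum_subtractf)
      also have "(\<Sum>i<p. if i = 0 then 1 else 0) = (1 :: 'a poly)" using p1 by simp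
      also have "(\<Sum>i<p. \<Sum>l=1..<p. of_nat (i ^ (p - 1 - l)) * (d.nab ^^ l) 1) =
          (\<Sum>l=1..<p. of_nat (\<Sum>i<p. i ^ (p - 1 - l)) * (d.nab ^^ l) 1)"
        by (subst sum.swap) (simp only: of_nat_sum sum_distrib_right)
      also have "\<dots> = of_nat p * y"
        unfolding y_def sum_distrib_left
      proof (intro sum.cong refl)
        fix l assume l: "l \<in> {1..<p}"
        then have "p dvd (\<Sum>i<p. i ^ (p - 1 - l))" by (intro prime_dvd_power_sum p) auto
        then have "of_nat (\<Sum>i<p. i ^ (p - 1 - l)) = (of_nat p * of_nat ((\<Sum>i<p. i ^ (p - 1 - l)) div p) :: 'a poly)"
          by (metis dvd_mult_div_cancel of_nat_mult)
        then show "of_nat (\<Sum>i<p. i ^ (p - 1 - l)) * (d.nab ^^ l) 1 = of_nat p * (of_nat ((\<Sum>i<p. i ^ (p - 1 - l)) div p) * (d.nab ^^ l) 1)"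
          by (simp only: mult.assoc)
      qed
      finally have "(\<Sum>i<p. d.eigpart p i) = 1 - of_nat p * y" .
      moreover have "y \<in> AP" unfolding y_def by (intro AP.C_sum AP.C_mult AP.C_of_nat d.nab_power_C)
      ultimately show ?thesis by blast
    qed
    then obtain y where y: "y \<in> AP" "(\<Sum>i<p. d.eigpart p i) = 1 - of_nat p * y" by blast
    have "(\<Sum>i<p. poly (d.eigpart p i) 1) = poly (1 - of_nat p * y) 1" unfolding y(2)[symmetric] by (simp add: poly_sum)
    then have "(\<Sum>i<p. poly (d.eigpart p i) 1) = 1 - of_nat p * poly y 1" by (simp add: of_nat_poly)
    ultimately have "1 - of_nat p * poly y 1 \<in> mx" by simp
    moreover have "of_nat p * poly y 1 \<in> mx" using A_B[OF AP_poly_1[OF y(1)]] by (intro I1_mx I_mult_right p_I1)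
    ultimately have "1 - of_nat p * poly y 1 + of_nat p * poly y 1 \<in> mx" by (rule mx_add)
    then show False using one_notin_mx[OF qs] by simp
  qed
  then obtain i where i: "i < p" "poly (d.eigpart p i) 1 \<notin> mx" by blast
  define h0 where "h0 = d.eigpart p i"
  have h0: "h0 \<in> AP" unfolding h0_def by (rule d.eigpart_C)
  have ev_h0: "ev q (d.nab h0 - of_nat i * h0) \<in> Lv 1"
  proof -
    have "d.nab h0 - of_nat i * h0 = (of_nat (i ^ (p - 1)) + (if i = 0 then 1 else 0)) * d.nab 1 - (d.nab ^^ p) 1"
      unfolding h0_def by (rule d.nab_eigpart[OF p1])
    also have "(of_nat (i ^ (p - 1)) + (if i = 0 then 1 else 0) :: 'a poly) = 1 + of_nat p * of_nat (t i)"
    proof -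
      have "p dvd i \<longleftrightarrow> i = 0" using i(1) by (auto dest: dvd_imp_le)
      then have "i ^ (p - 1) + (if i = 0 then 1 else 0) = 1 + p * t i" using t[of i] by simp
      from arg_cong[OF this, of "of_nat :: nat \<Rightarrow> 'a poly"] show ?thesis by (simp split: if_splits)
    qed
    also have "(1 + of_nat p * of_nat (t i)) * d.nab 1 - (d.nab ^^ p) 1 =
        - ((d.nab ^^ p) 1 - d.nab 1) + of_nat p * (of_nat (t i) * d.nab 1)"
      by (simp add: algebra_simps)
    also have "ev q \<dots> \<in> Lv 1"
    proof (intro ev_Lv_add[OF qs] ev_p_mult[OF qs] ev_neg ev_nabp)
      show "(d.nab ^^ p) 1 - d.nab 1 \<in> AP" by (intro AP.C_diff d.nab_power_C d.nab_C AP.C_1)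
      show "of_nat (t i) * d.nab 1 \<in> AP" by (intro AP.C_mult AP.C_of_nat d.nab_C AP.C_1)
    qed
    finally show ?thesis .
  qed
  \<comment> \<open>Multiplication by this power of \<open>V\<close> raises the eigenvalue from
    \<open>i\<close> to \<open>p\<close>, hence to 0 modulo \<open>p\<close>, and does not change
    the value at 1.\<close>
  define V where "V = (monom 1 (p - i) :: 'a poly)"
  have V: "V \<in> AP" unfolding V_def by (intro AP_monom A_1)
  have dV: "\<delta>p V = of_nat (p - i) * V"
    by (rule poly_eqI) (simp add: coeff_\<delta>p V_def of_nat_poly)
  define h where "h = h0 * V"
  have hAP: "h \<in> AP" unfolding h_def by (intro AP.C_mult h0 V)
  have "\<delta>p h + f * h = (d.nab h0 - of_nat i * h0) * V + of_nat p * (h0 * V)"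
  proof -
    have "(of_nat p :: 'a poly) = of_nat i + of_nat (p - i)" using i(1) by (simp only: of_nat_add[symmetric]) simp
    then show ?thesis unfolding h_def d.\<delta>_mult dV d.nab_def by (simp add: algebra_simps)
  qed
  moreover have "ev q ((d.nab h0 - of_nat i * h0) * V + of_nat p * (h0 * V)) \<in> Lv 1"
    using h0 V ev_h0 by (intro ev_Lv_add[OF qs] ev_p_mult[OF qs] ev_Lv_mult[OF qs] AP.C_mult AP.C_diff AP.C_of_nat d.nab_C)
  ultimately have "ev q (\<delta>p h + f * h) \<in> Lv 1" by simp
  moreover have "poly h 1 = poly h0 1" by (simp add: h_def V_def poly_monom)
  then have "ev q h \<in> Units \<Delta>" using i(2) by (intro ev_unit[OF qs hAP]) (simp add: h0_def)
  ultimately show ?thesis using hAP by blast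
qed


subsection \<open>Commutators near 1\<close>

lemma K_mult_eq: "monoid.mult (cyclic_algebra K g N \<tau>) = monoid.mult \<Delta>"
  unfolding cyclic_algebra_def by (simp only: monoid.select_convs)

lemma K_one_eq: "\<one>\<^bsub>cyclic_algebra K g N \<tau>\<^esub> = \<one>\<^bsub>\<Delta>\<^esub>"
  by (simp only: B.one_eq K.one_eq)

lemma carrier_\<Delta>_K: "x \<in> carrier \<Delta> \<Longrightarrow> x \<in> carrier (cyclic_algebra K g N \<tau>)"
  unfolding B.carrier_iff K.carrier_iff using B_K by blast

lemma Pi_unit_K: "cyc_monom \<Pi> 0 \<in> Units (cyclic_algebra K g N \<tau>)"
proof -
  have \<Pi>K: "\<Pi> \<in> K" "inverse \<Pi> \<in> K" using B_K[OF Pi_B] by (auto intro: K_inverse)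
  have c: "cyc_monom \<Pi> 0 \<in> carrier (cyclic_algebra K g N \<tau>)" "cyc_monom (inverse \<Pi>) 0 \<in> carrier (cyclic_algebra K g N \<tau>)"
    using \<Pi>K N_gt_1 by (auto intro!: K.cyc_monom_carrier)
  have l: "cyc_monom (inverse \<Pi>) 0 \<otimes>\<^bsub>cyclic_algebra K g N \<tau>\<^esub> cyc_monom \<Pi> 0 = \<one>\<^bsub>cyclic_algebra K g N \<tau>\<^esub>"
    using K.monom_mult_monom[of 0 0 \<Pi> "inverse \<Pi>"] \<Pi>K N_gt_1 Pi_ne_0 by (simp add: K.one_eq)
  have r: "cyc_monom \<Pi> 0 \<otimes>\<^bsub>cyclic_algebra K g N \<tau>\<^esub> cyc_monom (inverse \<Pi>) 0 = \<one>\<^bsub>cyclic_algebra K g N \<tau>\<^esub>"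
    using K.monom_mult_monom[of 0 0 "inverse \<Pi>" \<Pi>] \<Pi>K N_gt_1 Pi_ne_0 by (simp add: K.one_eq)
  show ?thesis unfolding Units_def mem_Collect_eq
    by (intro conjI bexI[of _ "cyc_monom (inverse \<Pi>) 0"] c l r)
qed

lemma inv_K_eq: "x \<in> Units \<Delta> \<Longrightarrow> inv\<^bsub>cyclic_algebra K g N \<tau>\<^esub> x = inv\<^bsub>\<Delta>\<^esub> x"
proof (rule sym, rule K.ring.inv_unique')
  assume x: "x \<in> Units \<Delta>"
  show "x \<in> carrier (cyclic_algebra K g N \<tau>)" "inv\<^bsub>\<Delta>\<^esub> x \<in> carrier (cyclic_algebra K g N \<tau>)"
    using x by (auto intro: carrier_\<Delta>_K)
  show "x \<otimes>\<^bsub>cyclic_algebra K g N \<tau>\<^esub> inv\<^bsub>\<Delta>\<^esub> x = \<one>\<^bsub>cyclic_algebra K g N \<tau>\<^esub>"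
    "inv\<^bsub>\<Delta>\<^esub> x \<otimes>\<^bsub>cyclic_algebra K g N \<tau>\<^esub> x = \<one>\<^bsub>cyclic_algebra K g N \<tau>\<^esub>"
    unfolding K_mult_eq K_one_eq by (rule B.ring.Units_r_inv[OF x], rule B.ring.Units_l_inv[OF x])
qed

text \<open>The hypothesis on coefficients says \<open>Pi * x = y * Pi\<close>, so \<open>y\<close>
  is the conjugate of \<open>x\<close> by Pi. In this form nothing is divided inside
  \<open>B\<close>.\<close>

lemma Pi_commutator:
  assumes x: "x \<in> Units \<Delta>" and y: "y \<in> carrier \<Delta>"
    and xy: "\<And>k. k < N \<Longrightarrow> y k * (g ^^ k) \<Pi> = \<Pi> * x k"
  shows "y \<otimes>\<^bsub>\<Delta>\<^esub> inv\<^bsub>\<Delta>\<^esub> x \<in> Pi_commutators (cyclic_algebra K g N \<tau>) \<Delta> (cyc_monom \<Pi> 0)"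
proof -
  let ?D = "cyclic_algebra K g N \<tau>"
  define P where "P = cyc_monom \<Pi> 0"
  have P: "P \<in> Units ?D" unfolding P_def by (rule Pi_unit_K)
  have xK: "x \<in> carrier ?D" and yK: "y \<in> carrier ?D" using x y by (auto intro: carrier_\<Delta>_K)
  have "P \<otimes>\<^bsub>?D\<^esub> x = y \<otimes>\<^bsub>?D\<^esub> P"
  proof
    fix k
    show "(P \<otimes>\<^bsub>?D\<^esub> x) k = (y \<otimes>\<^bsub>?D\<^esub> P) k"
      unfolding P_def K.const_mult_nth[OF xK] K.mult_const_nth using xy K.carrier_nth_0[OF xK] by (cases "k < N") simp_all
  qed
  then have "P \<otimes>\<^bsub>?D\<^esub> x \<otimes>\<^bsub>?D\<^esub> inv\<^bsub>?D\<^esub> P = y"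
    using K.ring.m_assoc[OF yK K.ring.Units_closed[OF P] K.ring.Units_inv_closed[OF P]] K.ring.Units_r_inv[OF P] yK
    by simp
  then have "P \<otimes>\<^bsub>?D\<^esub> x \<otimes>\<^bsub>?D\<^esub> inv\<^bsub>?D\<^esub> P \<otimes>\<^bsub>?D\<^esub> inv\<^bsub>?D\<^esub> x = y \<otimes>\<^bsub>\<Delta>\<^esub> inv\<^bsub>\<Delta>\<^esub> x"
    by (simp only: inv_K_eq[OF x] K_mult_eq)
  then show ?thesis unfolding Pi_commutators_def mem_Collect_eq P_def[symmetric]
    by (intro exI[of _ x] conjI x) (rule sym)
qed

lemma tau_unit: "Bunit \<tau>" by (rule mx_unit[OF T_mx])

lemma u_unit: "cyc_monom 1 1 \<in> Units \<Delta>"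
proof (rule unit_of_power_unit[OF order.refl, where k = "N - 1"])
  show "cyc_monom 1 1 \<in> carrier \<Delta>" using N_gt_1 B_1 by simp
  have "cyc_monom 1 1 [^]\<^bsub>\<Delta>\<^esub> N = cyc_monom \<tau> 0"
    using B.monom_pow[of 1 1 N] N_gt_1 B_1 by simp
  moreover have "Suc (N - 1) = N" using N_gt_1 by (simp add: One_nat_def)
  ultimately show "cyc_monom 1 1 [^]\<^bsub>\<Delta>\<^esub> Suc (N - 1) \<in> Units \<Delta>"
    using Bunit_const[OF order.refl tau_unit] by simp
qed

text \<open>Conjugation by \<open>u\<close> applies \<open>g\<close> to each coefficient.\<close>

lemma u_commutator:
  assumes x: "x \<in> Units \<Delta>"
  shows "(\<lambda>k. g (x k)) \<otimes>\<^bsub>\<Delta>\<^esub> inv\<^bsub>\<Delta>\<^esub> x \<in> derived (units_of \<Delta>) (Units \<Delta>)"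
proof -
  define u where "u = (cyc_monom 1 1 :: nat \<Rightarrow> 'a)"
  define y where "y = (\<lambda>k. g (x k))"
  have u: "u \<in> Units \<Delta>" unfolding u_def by (rule u_unit)
  have xc: "x \<in> carrier \<Delta>" using x by (rule B.ring.Units_closed)
  have yc: "y \<in> carrier \<Delta>" using xc unfolding B.carrier_iff y_def by (simp add: B.g_0)
  have "u \<otimes>\<^bsub>\<Delta>\<^esub> x = y \<otimes>\<^bsub>\<Delta>\<^esub> u" unfolding u_def y_def by (rule B.u_mult[OF xc N_gt_1])
  then have "u \<otimes>\<^bsub>\<Delta>\<^esub> x \<otimes>\<^bsub>\<Delta>\<^esub> inv\<^bsub>\<Delta>\<^esub> u = y"
    using B.ring.m_assoc[OF yc B.ring.Units_closed[OF u] B.ring.Units_inv_closed[OF u]] B.ring.Units_r_inv[OF u] yc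
    by simp
  then have "y \<otimes>\<^bsub>\<Delta>\<^esub> inv\<^bsub>\<Delta>\<^esub> x = u \<otimes>\<^bsub>units_of \<Delta>\<^esub> x \<otimes>\<^bsub>units_of \<Delta>\<^esub> inv\<^bsub>units_of \<Delta>\<^esub> u \<otimes>\<^bsub>units_of \<Delta>\<^esub> inv\<^bsub>units_of \<Delta>\<^esub> x"
    by (simp only: units_of_mult B.ring.units_of_inv[OF u] B.ring.units_of_inv[OF x])
  then show ?thesis unfolding derived_def y_def[symmetric] using u x
    by (intro generate.incl) blast
qed

text \<open>Multiplying \<open>E\<close> by the inverse of \<open>1 + z\<close> changes it only at
  the next level. A commutator is therefore known to first order from the conjugate alone.\<close>

lemma mult_inv_approx:
  assumes z: "z \<in> Lv 1" and E: "E \<in> Lv n"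
  shows "((\<one>\<^bsub>\<Delta>\<^esub> \<oplus>\<^bsub>\<Delta>\<^esub> z \<oplus>\<^bsub>\<Delta>\<^esub> E) \<otimes>\<^bsub>\<Delta>\<^esub> inv\<^bsub>\<Delta>\<^esub> (\<one>\<^bsub>\<Delta>\<^esub> \<oplus>\<^bsub>\<Delta>\<^esub> z)) i - \<one>\<^bsub>\<Delta>\<^esub> i - E i \<in> I (n + 1)"
proof -
  define x where "x = \<one>\<^bsub>\<Delta>\<^esub> \<oplus>\<^bsub>\<Delta>\<^esub> z"
  define w where "w = E \<otimes>\<^bsub>\<Delta>\<^esub> inv\<^bsub>\<Delta>\<^esub> x"
  have x: "x \<in> Units \<Delta>" unfolding x_def by (rule unit_one_plus_Lv[OF z order.refl])
  have c: "x \<in> carrier \<Delta>" "inv\<^bsub>\<Delta>\<^esub> x \<in> carrier \<Delta>" "z \<in> carrier \<Delta>" "E \<in> carrier \<Delta>" using x z E by auto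
  have w: "w \<in> Lv n" unfolding w_def using E c(2) by (rule Lv_mult_right)
  have 1: "(x \<oplus>\<^bsub>\<Delta>\<^esub> E) \<otimes>\<^bsub>\<Delta>\<^esub> inv\<^bsub>\<Delta>\<^esub> x = \<one>\<^bsub>\<Delta>\<^esub> \<oplus>\<^bsub>\<Delta>\<^esub> w"
    unfolding w_def using c x by (simp add: B.ring.l_distr)
  have "w \<otimes>\<^bsub>\<Delta>\<^esub> x = E" unfolding w_def using c x by (simp add: B.ring.m_assoc)
  moreover have "w \<otimes>\<^bsub>\<Delta>\<^esub> x = w \<oplus>\<^bsub>\<Delta>\<^esub> w \<otimes>\<^bsub>\<Delta>\<^esub> z" unfolding x_def using w c(3) by (simp add: B.ring.r_distr)
  ultimately have E_eq: "E = w \<oplus>\<^bsub>\<Delta>\<^esub> w \<otimes>\<^bsub>\<Delta>\<^esub> z" by (rule trans[OF sym])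
  have "E i = w i + (w \<otimes>\<^bsub>\<Delta>\<^esub> z) i" using fun_cong[OF E_eq, of i] by (simp only: B.add_nth)
  then have "((x \<oplus>\<^bsub>\<Delta>\<^esub> E) \<otimes>\<^bsub>\<Delta>\<^esub> inv\<^bsub>\<Delta>\<^esub> x) i - \<one>\<^bsub>\<Delta>\<^esub> i - E i = - (w \<otimes>\<^bsub>\<Delta>\<^esub> z) i"
    unfolding 1 B.add_nth by simp
  moreover have "(w \<otimes>\<^bsub>\<Delta>\<^esub> z) i \<in> I (n + 1)" by (rule Lv_nth[OF Lv_mult[OF w z]])
  ultimately show ?thesis unfolding x_def[symmetric] using I_uminus by simp
qed

lemma mult_approx:
  assumes w: "w \<in> carrier \<Delta>" "w' \<in> carrier \<Delta>" and n: "n \<ge> 1" and E: "E \<in> Lv n" "E' \<in> Lv n"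
    and wE: "\<And>i. w i - \<one>\<^bsub>\<Delta>\<^esub> i - E i \<in> I (n + 1)" "\<And>i. w' i - \<one>\<^bsub>\<Delta>\<^esub> i - E' i \<in> I (n + 1)"
  shows "(w \<otimes>\<^bsub>\<Delta>\<^esub> w') i - \<one>\<^bsub>\<Delta>\<^esub> i - (E i + E' i) \<in> I (n + 1)"
proof -
  have *: "w \<ominus>\<^bsub>\<Delta>\<^esub> \<one>\<^bsub>\<Delta>\<^esub> \<in> Lv n" if "w \<in> carrier \<Delta>" "E \<in> Lv n" "\<And>i. w i - \<one>\<^bsub>\<Delta>\<^esub> i - E i \<in> I (n + 1)" for w E
  proof (rule LvI)
    show "w \<ominus>\<^bsub>\<Delta>\<^esub> \<one>\<^bsub>\<Delta>\<^esub> \<in> carrier \<Delta>" using that by simp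
    fix i
    have "w i - \<one>\<^bsub>\<Delta>\<^esub> i - E i \<in> I n" using that(3)[of i] by (intro I_mono[of n "n + 1"]) simp_all
    then have "w i - \<one>\<^bsub>\<Delta>\<^esub> i - E i + E i \<in> I n" using Lv_nth[OF that(2)] by (rule I_add)
    then show "(w \<ominus>\<^bsub>\<Delta>\<^esub> \<one>\<^bsub>\<Delta>\<^esub>) i \<in> I n" using that(1) by (simp add: B.a_minus_nth)
  qed
  define F where "F = w \<ominus>\<^bsub>\<Delta>\<^esub> \<one>\<^bsub>\<Delta>\<^esub>"
  define F' where "F' = w' \<ominus>\<^bsub>\<Delta>\<^esub> \<one>\<^bsub>\<Delta>\<^esub>"
  have F: "F \<in> Lv n" "F' \<in> Lv n" unfolding F_def F'_def using * w E wE by blast+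
  have wF: "w = \<one>\<^bsub>\<Delta>\<^esub> \<oplus>\<^bsub>\<Delta>\<^esub> F" "w' = \<one>\<^bsub>\<Delta>\<^esub> \<oplus>\<^bsub>\<Delta>\<^esub> F'"
    unfolding F_def F'_def using w by (auto simp: fun_eq_iff B.add_nth B.a_minus_nth)
  have "w \<otimes>\<^bsub>\<Delta>\<^esub> w' = w \<oplus>\<^bsub>\<Delta>\<^esub> (F' \<oplus>\<^bsub>\<Delta>\<^esub> F \<otimes>\<^bsub>\<Delta>\<^esub> F')"
  proof -
    have "w \<otimes>\<^bsub>\<Delta>\<^esub> w' = w \<oplus>\<^bsub>\<Delta>\<^esub> w \<otimes>\<^bsub>\<Delta>\<^esub> F'" unfolding wF(2) using w(1) F by (simp add: B.ring.r_distr)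
    also have "w \<otimes>\<^bsub>\<Delta>\<^esub> F' = F' \<oplus>\<^bsub>\<Delta>\<^esub> F \<otimes>\<^bsub>\<Delta>\<^esub> F'" unfolding wF(1) using F by (simp add: B.ring.l_distr)
    finally show ?thesis .
  qed
  then have "(w \<otimes>\<^bsub>\<Delta>\<^esub> w') i - \<one>\<^bsub>\<Delta>\<^esub> i - (E i + E' i) =
      (w i - \<one>\<^bsub>\<Delta>\<^esub> i - E i) + (w' i - \<one>\<^bsub>\<Delta>\<^esub> i - E' i) + (F \<otimes>\<^bsub>\<Delta>\<^esub> F') i"
    by (simp add: B.add_nth wF(2))
  moreover have "(F \<otimes>\<^bsub>\<Delta>\<^esub> F') i \<in> I (n + 1)"
    using Lv_nth[OF Lv_mult[OF F]] n by (intro I_mono[of "n + 1" "n + n"]) simp_all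
  ultimately show ?thesis using wE by (simp only: I_add)
qed

lemma cong_mod_power_iff:
  assumes x: "x \<in> carrier \<Delta>" "y \<in> carrier \<Delta>"
  shows "cong_mod_power \<Delta> (cyc_monom \<Pi> 0) k x y \<longleftrightarrow> (\<forall>i. x i - y i \<in> I k)"
proof -
  have "cyc_monom \<Pi> 0 [^]\<^bsub>\<Delta>\<^esub> k = cyc_monom (\<Pi> ^ k) 0"
    using B.monom_pow[of 0 \<Pi> k] N_gt_1 Pi_B by simp
  then have *: "(y \<oplus>\<^bsub>\<Delta>\<^esub> (cyc_monom \<Pi> 0 [^]\<^bsub>\<Delta>\<^esub> k) \<otimes>\<^bsub>\<Delta>\<^esub> \<delta>) i = y i + \<Pi> ^ k * \<delta> i" if "\<delta> \<in> carrier \<Delta>" for \<delta> i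
    using that by (simp add: B.add_nth B.const_mult_nth)
  show ?thesis
  proof
    assume "cong_mod_power \<Delta> (cyc_monom \<Pi> 0) k x y"
    then obtain \<delta> where d: "\<delta> \<in> carrier \<Delta>" "x = y \<oplus>\<^bsub>\<Delta>\<^esub> (cyc_monom \<Pi> 0 [^]\<^bsub>\<Delta>\<^esub> k) \<otimes>\<^bsub>\<Delta>\<^esub> \<delta>"
      unfolding cong_mod_power_def by (rule bexE)
    show "\<forall>i. x i - y i \<in> I k"
    proof
      fix i
      have "x i = y i + \<Pi> ^ k * \<delta> i" unfolding *[OF d(1), symmetric] using d(2) by (rule arg_cong)
      then show "x i - y i \<in> I k" using II[OF B.carrier_nth[OF d(1)], of k i] by simp
    qed
  next
    assume I: "\<forall>i. x i - y i \<in> I k"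
    define \<delta> where "\<delta> = (\<lambda>i. (x i - y i) / \<Pi> ^ k)"
    have \<delta>B: "\<delta> i \<in> B" for i
      using spec[OF I, of i] Pi_ne_0 by (auto simp: \<delta>_def elim!: IE)
    have \<delta>: "\<delta> \<in> carrier \<Delta>" unfolding B.carrier_iff using \<delta>B B.carrier_nth_0[OF x(1)] B.carrier_nth_0[OF x(2)] by (simp add: \<delta>_def)
    have "x = y \<oplus>\<^bsub>\<Delta>\<^esub> (cyc_monom \<Pi> 0 [^]\<^bsub>\<Delta>\<^esub> k) \<otimes>\<^bsub>\<Delta>\<^esub> \<delta>"
      by (rule ext) (use *[OF \<delta>] Pi_ne_0 in \<open>simp add: \<delta>_def\<close>)
    then show "cong_mod_power \<Delta> (cyc_monom \<Pi> 0) k x y"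
      unfolding cong_mod_power_def using \<delta> by (rule bexI)
  qed
qed

text \<open>Chosen so that conjugation by Pi sends \<open>u ^ k\<close> to
  \<open>(1 + \<rho> k) * u ^ k\<close>.\<close>

definition \<rho> :: "nat \<Rightarrow> 'a" where "\<rho> k = (\<Pi> - (g ^^ k) \<Pi>) / (g ^^ k) \<Pi>"

lemma giPi_ne_0: "(g ^^ k) \<Pi> \<noteq> 0"
  using gi_Pi[of k] Pi_ne_0 U1_ne_0 by auto

lemma \<rho>_eq: "(1 + \<rho> k) * (g ^^ k) \<Pi> = \<Pi>"
  using giPi_ne_0[of k] by (simp add: \<rho>_def field_simps)

lemma \<rho>_0: "\<rho> 0 = 0" by (simp add: \<rho>_def)

text \<open>This is \<open>gi_Pi_diff\<close> divided by the conjugate of Pi, which lowers every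
  exponent by 1; the definition of \<open>\<rho>\<close> reverses the sign.\<close>

lemma \<rho>_I:
  assumes t: "t < s"
  shows "\<rho> (p ^ t * j) + of_nat j * \<Pi> ^ (p ^ (r + t) - 1) \<in> I (p ^ (r + t))"
proof -
  define Q where "Q = p ^ (r + t)"
  have Q: "Q \<ge> 1" unfolding Q_def using p_gt by (intro one_le_power) simp
  have PQ: "\<Pi> ^ Q = \<Pi> * \<Pi> ^ (Q - 1)" using Q by (cases Q) (simp_all add: One_nat_def)
  obtain u where u: "u \<in> U1" "(g ^^ (p ^ t * j)) \<Pi> = \<Pi> * u" using gi_Pi by blast
  have uB: "u \<in> B" "inverse u \<in> B" "u \<noteq> 0" using u(1) U1_B U1_inverse_B U1_ne_0 by auto
  have "(g ^^ (p ^ t * j)) \<Pi> - \<Pi> - of_nat j * \<Pi> ^ Q \<in> I (Q + 1)"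
    unfolding Q_def by (rule gi_Pi_diff[OF t])
  then have "\<Pi> * u - \<Pi> - of_nat j * \<Pi> ^ Q \<in> I (Q + 1)" unfolding u(2) .
  moreover have "of_nat j * \<Pi> ^ Q * u - of_nat j * \<Pi> ^ Q \<in> I (Q + 1)"
    using u(1) by (intro U1_diff_I I_mult_left Pi_power_I B_of_nat)
  ultimately have "(of_nat j * \<Pi> ^ Q * u - of_nat j * \<Pi> ^ Q) - (\<Pi> * u - \<Pi> - of_nat j * \<Pi> ^ Q) \<in> I (Q + 1)"
    by (rule I_diff[rotated])
  also have "(of_nat j * \<Pi> ^ Q * u - of_nat j * \<Pi> ^ Q) - (\<Pi> * u - \<Pi> - of_nat j * \<Pi> ^ Q) =
      \<Pi> * u * (\<rho> (p ^ t * j) + of_nat j * \<Pi> ^ (Q - 1))"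
    unfolding \<rho>_def u(2) PQ using uB Pi_ne_0 by (simp add: field_simps)
  finally have "inverse u * (\<Pi> * u * (\<rho> (p ^ t * j) + of_nat j * \<Pi> ^ (Q - 1))) \<in> I (Q + 1)"
    by (rule I_mult_left[OF uB(2)])
  moreover have "inverse u * (\<Pi> * u * W) = (inverse u * u) * (\<Pi> ^ 1 * W)" for W by (simp only: mult_ac power_one_right)
  ultimately have "\<Pi> ^ 1 * (\<rho> (p ^ t * j) + of_nat j * \<Pi> ^ (Q - 1)) \<in> I (1 + Q)"
    by (simp only: left_inverse[OF uB(3)] mult_1 add.commute[of Q])
  then show ?thesis unfolding Q_def[symmetric] by (rule I_cancel)
qed

lemma \<rho>_B: "\<rho> k \<in> B"
proof -
  obtain u where u: "u \<in> U1" "(g ^^ k) \<Pi> = \<Pi> * u" using gi_Pi by blast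
  have "\<rho> k = inverse u - 1" unfolding \<rho>_def u(2) using Pi_ne_0 U1_ne_0[OF u(1)] by (simp add: field_simps)
  then show ?thesis using U1_inverse_B[OF u(1)] B_1 by (auto intro: B_diff)
qed

end

subsection \<open>Every norm one element is congruent to a commutator product\<close>

text \<open>With \<open>t\<close> the exact exponent of \<open>p\<close> in \<open>n + 1\<close>,
  the first case is \<open>t < s\<close> and \<open>n + 1 > p ^ (r + t)\<close>. Otherwise the
  minimum \<open>q\<close> of \<open>s\<close> and the least exponent with
  \<open>n + 1 <= p ^ (r + q)\<close> is at most \<open>t\<close>, so \<open>p ^ q\<close> divides
  \<open>n + 1\<close>.\<close>

lemma level_cases:
  fixes p r s n :: nat
  assumes p: "p > 1" and r: "r \<ge> 1" and n: "n \<ge> 1"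
  obtains (orbit) t j where "t < s" "\<not> p dvd j" "n + 1 = p ^ (r + t) + p ^ t * j"
  | (norm) q c where "q \<le> s" "n + 1 = p ^ q * c" "q \<ge> 1 \<Longrightarrow> c > p ^ (r - 1)" "q < s \<Longrightarrow> c \<le> p ^ r"
      "q \<ge> 1 \<Longrightarrow> p ^ (r + q - 1) \<le> n"
proof -
  define t where "t = multiplicity p (n + 1)"
  have pu: "\<not> is_unit p" using p by simp
  have dt: "p ^ t dvd n + 1" unfolding t_def by (rule multiplicity_dvd)
  then obtain c0 where c0: "n + 1 = p ^ t * c0" by (rule dvdE)
  have "\<not> p dvd c0"
  proof
    assume "p dvd c0"
    then have "p ^ Suc t dvd n + 1" unfolding c0 by (simp add: mult_dvd_mono)
    then have "Suc t \<le> t" unfolding t_def by (subst (asm) power_dvd_iff_le_multiplicity) (use pu in auto)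
    then show False by simp
  qed
  note c0 = c0 this
  define q0 where "q0 = (LEAST q. n + 1 \<le> p ^ (r + q))"
  have ex: "n + 1 \<le> p ^ (r + n)"
  proof -
    have "n < p ^ n" using p power_gt_expt[of p n] by (simp add: One_nat_def)
    also have "p ^ n \<le> p ^ (r + n)" using p by (intro power_increasing) simp_all
    finally show ?thesis by simp
  qed
  have q0: "n + 1 \<le> p ^ (r + q0)" unfolding q0_def by (rule LeastI[of "\<lambda>q. n + 1 \<le> p ^ (r + q)" n, OF ex])
  have q0_less: "p ^ (r + q') < n + 1" if "q' < q0" for q'
    using not_less_Least[OF that[unfolded q0_def]] by simp
  define q where "q = min s q0"
  show ?thesis
  proof (cases "t < s \<and> p ^ (r + t) < n + 1")
    case True
    define j where "j = c0 - p ^ r"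
    have "p ^ t * p ^ r < p ^ t * c0" using True c0(1) by (simp add: power_add mult.commute)
    then have "p ^ r < c0" by simp
    then have c0j: "c0 = p ^ r + j" by (simp add: j_def)
    have "p dvd p ^ r" using r by simp
    then have "\<not> p dvd j" using c0(2) unfolding c0j by (simp add: dvd_add_right_iff)
    moreover have "n + 1 = p ^ (r + t) + p ^ t * j" unfolding c0(1) c0j by (simp add: power_add algebra_simps)
    ultimately show ?thesis using True orbit by blast
  next
    case False
    have qt: "q \<le> t"
    proof (cases "t < s")
      case True
      then have "n + 1 \<le> p ^ (r + t)" using False by simp
      then have "q0 \<le> t" unfolding q0_def by (rule Least_le)
      then show ?thesis by (simp add: q_def)
    qed (simp add: q_def)
    have "p ^ q dvd n + 1" using le_imp_power_dvd[OF qt] dt by (rule dvd_trans)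
    then obtain c where c: "n + 1 = p ^ q * c" by (rule dvdE)
    have big: "p ^ (r + q - 1) < n + 1" if "q \<ge> 1"
    proof -
      have "q \<le> q0" by (simp add: q_def)
      then have "q - 1 < q0" using that by linarith
      then have "p ^ (r + (q - 1)) < n + 1" by (rule q0_less)
      then show ?thesis using that by simp
    qed
    show ?thesis
    proof (rule norm)
      show "q \<le> s" by (simp add: q_def)
      show "n + 1 = p ^ q * c" by (rule c)
      show "p ^ (r + q - 1) \<le> n" if "q \<ge> 1" using big[OF that] by simp
      show "c > p ^ (r - 1)" if "q \<ge> 1"
      proof -
        have "r + q - 1 = q + (r - 1)" using r by simp
        then have "p ^ q * p ^ (r - 1) < p ^ q * c" using big[OF that] c by (simp add: power_add[symmetric])
        then show ?thesis by simp
      qed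
      show "c \<le> p ^ r" if "q < s"
      proof -
        have "q = q0" using that by (simp add: q_def)
        then have "p ^ q * c \<le> p ^ q * p ^ r" using q0 c by (simp add: power_add mult.commute)
        then show ?thesis using p by simp
      qed
    qed
  qed
qed

context cyclotomic_order
begin

lemma leading_coeffs:
  assumes "\<And>i. y i \<in> I n"
  shows "\<exists>a. (\<forall>i. a i \<in> A) \<and> (\<forall>i. y i - \<Pi> ^ n * a i \<in> I (n + 1))"
proof -
  have "\<exists>b. b \<in> A \<and> y i - \<Pi> ^ n * b \<in> I (n + 1)" for i
  proof -
    obtain x where x: "x \<in> B" "y i = \<Pi> ^ n * x" using assms[of i] by (rule IE)
    obtain b where b: "b \<in> A" "x - b \<in> I 1" using lift_A[OF x(1)] by (rule bexE)
    have "\<Pi> ^ n * (x - b) \<in> I (n + 1)" using b(2) by (intro I_mult Pi_power_I)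
    then show ?thesis using b(1) unfolding x(2) by (auto simp: right_diff_distrib)
  qed
  then have "\<forall>i. \<exists>b. b \<in> A \<and> y i - \<Pi> ^ n * b \<in> I (n + 1)" by (rule allI)
  from choice[OF this] show ?thesis by (simp only: all_conj_distrib)
qed

text \<open>Conjugation by Pi multiplies the coefficient of \<open>x = 1 + b\<close> at
  \<open>u ^ k\<close> by \<open>1 + \<rho> k\<close>, so to first order the commutator deviates
  from 1 by \<open>\<rho> k * x k\<close>.\<close>

lemma Pi_commutator_approx:
  assumes b: "b \<in> Lv 1" and E: "(\<lambda>k. \<rho> k * (\<one>\<^bsub>\<Delta>\<^esub> k + b k)) \<in> Lv n"
  shows "\<exists>w\<in>Pi_commutators (cyclic_algebra K g N \<tau>) \<Delta> (cyc_monom \<Pi> 0).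
    w \<in> carrier \<Delta> \<and> (\<forall>i. w i - \<one>\<^bsub>\<Delta>\<^esub> i - \<rho> i * (\<one>\<^bsub>\<Delta>\<^esub> i + b i) \<in> I (n + 1))"
proof -
  define x where "x = \<one>\<^bsub>\<Delta>\<^esub> \<oplus>\<^bsub>\<Delta>\<^esub> b"
  define E where "E = (\<lambda>k. \<rho> k * x k)"
  define w where "w = (x \<oplus>\<^bsub>\<Delta>\<^esub> E) \<otimes>\<^bsub>\<Delta>\<^esub> inv\<^bsub>\<Delta>\<^esub> x"
  have EL: "E \<in> Lv n" unfolding E_def x_def B.add_nth by (rule E)
  have x: "x \<in> Units \<Delta>" unfolding x_def by (rule unit_one_plus_Lv[OF b order.refl])
  have xE: "x \<oplus>\<^bsub>\<Delta>\<^esub> E \<in> carrier \<Delta>"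
    by (rule B.ring.add.m_closed[OF B.ring.Units_closed[OF x] Lv_carrier[OF EL]])
  have "w \<in> Pi_commutators (cyclic_algebra K g N \<tau>) \<Delta> (cyc_monom \<Pi> 0)"
    unfolding w_def
  proof (rule Pi_commutator[OF x xE])
    fix k
    have "(x \<oplus>\<^bsub>\<Delta>\<^esub> E) k * (g ^^ k) \<Pi> = (1 + \<rho> k) * (g ^^ k) \<Pi> * x k"
      by (simp add: B.add_nth E_def algebra_simps)
    then show "(x \<oplus>\<^bsub>\<Delta>\<^esub> E) k * (g ^^ k) \<Pi> = \<Pi> * x k" unfolding \<rho>_eq .
  qed
  moreover have "w \<in> carrier \<Delta>" unfolding w_def using x xE by (intro B.mult_closed) auto
  moreover have "w i - \<one>\<^bsub>\<Delta>\<^esub> i - \<rho> i * (\<one>\<^bsub>\<Delta>\<^esub> i + b i) \<in> I (n + 1)" for i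
    using mult_inv_approx[OF b EL, of i] by (simp add: w_def x_def E_def B.add_nth)
  ultimately show ?thesis by (intro bexI conjI allI)
qed

text \<open>For the product \<open>y\<close> of \<open>k = p ^ t * j\<close> successive conjugates
  of Pi, \<open>g y - y\<close> telescopes to \<open>Y\<close> times \<open>g ^ k (Pi) - Pi\<close>,
  where \<open>Y\<close> lacks the first factor. Its level is
  \<open>k - 1 + p ^ (r + t) = n\<close>, with leading coefficient the unit \<open>j\<close>. Since
  \<open>g\<close> fixes \<open>f\<close>, all coefficients are matched at once.\<close>

lemma orbit_commutator_approx:
  assumes t: "t < s" and j: "\<not> p dvd j" and n: "n + 1 = p ^ (r + t) + p ^ t * j" and a: "\<And>i. a i \<in> A"
    and a0: "\<And>i. i \<ge> N \<Longrightarrow> a i = 0"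
  shows "\<exists>w\<in>derived (units_of \<Delta>) (Units \<Delta>).
    w \<in> carrier \<Delta> \<and> (\<forall>i. w i - \<one>\<^bsub>\<Delta>\<^esub> i - \<Pi> ^ n * a i \<in> I (n + 1))"
proof -
  define k where "k = p ^ t * j"
  define Q where "Q = p ^ (r + t)"
  have "j \<noteq> 0" using j by (cases j) auto
  then have k: "k \<ge> 1" by (simp add: k_def Suc_le_eq One_nat_def)
  have nQ: "n = k - 1 + Q" using n k by (simp add: k_def Q_def)
  have ju: "Bunit (of_nat j)" by (rule of_nat_unit[OF j])
  have "\<exists>f. f \<in> A \<and> a i - of_nat j * f \<in> I 1 \<and> (i \<ge> N \<longrightarrow> f = 0)" for i
  proof (cases "i \<ge> N")
    case False
    have "inverse (of_nat j) * a i \<in> B" using ju A_B[OF a] unfolding Bunit_def by (intro B_mult) auto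
    then obtain f where f: "f \<in> A" "inverse (of_nat j) * a i - f \<in> I 1" using lift_A by blast
    have "of_nat j * (inverse (of_nat j) * a i - f) \<in> I 1" using f(2) by (intro I_mult_left B_of_nat)
    moreover have "of_nat j * (inverse (of_nat j) * a i - f) = a i - of_nat j * f"
      using ju by (simp add: Bunit_def right_diff_distrib)
    ultimately show ?thesis using f(1) False by (intro exI[of _ f]) simp
  qed (use a0 A_0 in auto)
  then have "\<forall>i. \<exists>f. f \<in> A \<and> a i - of_nat j * f \<in> I 1 \<and> (i \<ge> N \<longrightarrow> f = 0)" by (rule allI)
  from choice[OF this] obtain f where f': "\<forall>i. f i \<in> A \<and> a i - of_nat j * f i \<in> I 1 \<and> (i \<ge> N \<longrightarrow> f i = 0)"
    by (rule exE)
  have f: "f i \<in> A" "a i - of_nat j * f i \<in> I 1" "i \<ge> N \<Longrightarrow> f i = 0" for i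
    using spec[OF f', of i] by auto
  define y where "y = (\<Prod>l<k. (g ^^ l) \<Pi>)"
  define Y where "Y = (\<Prod>l<k - 1. (g ^^ Suc l) \<Pi>)"
  have kS: "k = Suc (k - 1)" using k by (simp add: One_nat_def)
  have yY: "y = \<Pi> * Y"
    unfolding y_def Y_def by (subst kS) (simp only: prod.lessThan_Suc_shift funpow_0 comp_def)
  have gy: "g y = Y * (g ^^ k) \<Pi>"
  proof -
    have "g y = (\<Prod>l<k. (g ^^ Suc l) \<Pi>)"
      unfolding y_def using B.gi_prod[of "{..<k}" "\<lambda>l. (g ^^ l) \<Pi>" 1] giB Pi_B by (simp add: One_nat_def)
    also have "\<dots> = Y * (g ^^ k) \<Pi>"
      using prod.lessThan_Suc[of "\<lambda>l. (g ^^ Suc l) \<Pi>" "k - 1"] unfolding Y_def kS[symmetric] .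
    finally show ?thesis .
  qed
  obtain u where u: "u \<in> U1" "Y = \<Pi> ^ (k - 1) * u"
  proof -
    have "\<exists>u\<in>U1. (\<Prod>l<m. (g ^^ Suc l) \<Pi>) = \<Pi> ^ m * u" for m
    proof (induction m)
      case (Suc m)
      then obtain u where u: "u \<in> U1" "(\<Prod>l<m. (g ^^ Suc l) \<Pi>) = \<Pi> ^ m * u" by (rule bexE)
      obtain v where v: "v \<in> U1" "(g ^^ Suc m) \<Pi> = \<Pi> * v" using gi_Pi by (rule bexE)
      have "(\<Prod>l<Suc m. (g ^^ Suc l) \<Pi>) = \<Pi> ^ Suc m * (u * v)"
        unfolding prod.lessThan_Suc u(2) v(2) by simp
      then show ?case using U1_mult[OF u(1) v(1)] by (rule bexI)
    qed (use U1_1 in auto)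
    then show ?thesis using that unfolding Y_def by blast
  qed
  have uB: "u \<in> B" using u(1) by (rule U1_B)
  have Y: "Y \<in> I (k - 1)" unfolding u(2) using uB by (rule II)
  have YB: "Y \<in> B" using Y by (rule I_B)
  have yB: "y \<in> B" unfolding yY using YB by (intro B_intros)
  have yI: "y \<in> I 1" unfolding yY using II[OF YB, of 1] by simp
  define z where "z = (\<lambda>i. y * f i)"
  define E where "E = (\<lambda>i. g (z i) - z i)"
  have gz: "g (z i) = g y * f i" for i
    unfolding z_def using f(1)[of i] yB A_B by (simp add: B.g_mult g_A)
  have fB: "f i \<in> B" for i using f(1) by (rule A_B)
  have z: "z \<in> Lv 1"
  proof (rule LvI)
    show "z \<in> carrier \<Delta>" unfolding B.carrier_iff z_def using yB fB f(3) by (auto intro: B_mult)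
    show "z i \<in> I 1" for i unfolding z_def using yI fB by (rule I_mult_right)
  qed
  have diff: "g y - y - of_nat j * \<Pi> ^ n \<in> I (n + 1)"
  proof -
    have "(g ^^ k) \<Pi> - \<Pi> - of_nat j * \<Pi> ^ Q \<in> I (Q + 1)"
      unfolding k_def Q_def by (rule gi_Pi_diff[OF t])
    then have "Y * ((g ^^ k) \<Pi> - \<Pi> - of_nat j * \<Pi> ^ Q) \<in> I (k - 1 + (Q + 1))" by (rule I_mult[OF Y])
    then have "Y * ((g ^^ k) \<Pi> - \<Pi> - of_nat j * \<Pi> ^ Q) \<in> I (n + 1)" unfolding nQ by (simp only: add.assoc)
    moreover have "of_nat j * (\<Pi> ^ n * u - \<Pi> ^ n) \<in> I (n + 1)"
      using u(1) by (intro I_mult_left B_of_nat U1_diff_I Pi_power_I)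
    ultimately have "Y * ((g ^^ k) \<Pi> - \<Pi> - of_nat j * \<Pi> ^ Q) + of_nat j * (\<Pi> ^ n * u - \<Pi> ^ n) \<in> I (n + 1)"
      by (rule I_add)
    moreover have "Y * (of_nat j * \<Pi> ^ Q) = of_nat j * (\<Pi> ^ n * u)"
      unfolding u(2) nQ power_add by (simp only: mult_ac)
    ultimately show ?thesis unfolding gy unfolding yY by (simp add: algebra_simps)
  qed
  have E_approx: "E i - \<Pi> ^ n * a i \<in> I (n + 1)" for i
  proof -
    have "(g y - y - of_nat j * \<Pi> ^ n) * f i - \<Pi> ^ n * (a i - of_nat j * f i) \<in> I (n + 1)"
      by (rule I_diff[OF I_mult_right[OF diff fB] I_mult[OF Pi_power_I f(2)]])
    then show ?thesis unfolding E_def gz by (simp add: z_def algebra_simps)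
  qed
  have EL: "E \<in> Lv n"
  proof (rule LvI)
    have "g (z i) \<in> B" "z i \<in> B" for i using Lv_nth[OF z, of i] I_B g_B by auto
    then show "E \<in> carrier \<Delta>" unfolding B.carrier_iff E_def using f(3) by (auto simp: z_def B.g_0 intro: B_diff)
    fix i
    have "E i - \<Pi> ^ n * a i \<in> I n" by (rule I_mono[OF _ E_approx]) simp
    moreover have "\<Pi> ^ n * a i \<in> I n" using A_B[OF a] by (rule II)
    ultimately have "E i - \<Pi> ^ n * a i + \<Pi> ^ n * a i \<in> I n" by (rule I_add)
    then show "E i \<in> I n" by simp
  qed
  define x where "x = \<one>\<^bsub>\<Delta>\<^esub> \<oplus>\<^bsub>\<Delta>\<^esub> z"
  have x: "x \<in> Units \<Delta>" unfolding x_def by (rule unit_one_plus_Lv[OF z order.refl])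
  have gx: "(\<lambda>k. g (x k)) = x \<oplus>\<^bsub>\<Delta>\<^esub> E"
  proof
    fix i
    have "g (\<one>\<^bsub>\<Delta>\<^esub> i) = \<one>\<^bsub>\<Delta>\<^esub> i" by (simp add: one_nth B.g_0 B.g_1)
    moreover have "\<one>\<^bsub>\<Delta>\<^esub> i \<in> B" "z i \<in> B" using Lv_nth[OF z, of i] I_B B_0 B_1 by (auto simp: one_nth)
    ultimately show "g (x i) = (x \<oplus>\<^bsub>\<Delta>\<^esub> E) i" by (simp add: x_def B.add_nth B.g_add E_def)
  qed
  define w where "w = (x \<oplus>\<^bsub>\<Delta>\<^esub> E) \<otimes>\<^bsub>\<Delta>\<^esub> inv\<^bsub>\<Delta>\<^esub> x"
  have w: "w \<in> derived (units_of \<Delta>) (Units \<Delta>)" unfolding w_def gx[symmetric] by (rule u_commutator[OF x])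
  have wc: "w \<in> carrier \<Delta>" unfolding w_def using x EL by (intro B.mult_closed) auto
  have "w i - \<one>\<^bsub>\<Delta>\<^esub> i - \<Pi> ^ n * a i \<in> I (n + 1)" for i
  proof -
    have "w i - \<one>\<^bsub>\<Delta>\<^esub> i - E i \<in> I (n + 1)" unfolding w_def x_def by (rule mult_inv_approx[OF z EL])
    then have "(w i - \<one>\<^bsub>\<Delta>\<^esub> i - E i) + (E i - \<Pi> ^ n * a i) \<in> I (n + 1)" using E_approx by (rule I_add)
    then show ?thesis by (simp only: diff_add_cancel add_diff_eq)
  qed
  then show ?thesis using w wc by (intro bexI[of _ w] conjI allI)
qed

text \<open>When \<open>i\<close> has fewer than \<open>q\<close> factors \<open>p\<close>, the
  level of \<open>\<rho> i\<close> is below \<open>n\<close>, so a suitable coefficient of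
  \<open>x\<close> produces any prescribed value at level \<open>n\<close>. Coefficients at
  multiples of \<open>p ^ q\<close> are set to 0.\<close>

lemma nonmultiples_commutator_approx:
  assumes q: "q \<le> s" and nq: "q \<ge> 1 \<Longrightarrow> p ^ (r + q - 1) \<le> n" and a: "\<And>i. a i \<in> A"
    and a0: "\<And>i. i \<ge> N \<Longrightarrow> a i = 0"
  shows "\<exists>w\<in>Pi_commutators (cyclic_algebra K g N \<tau>) \<Delta> (cyc_monom \<Pi> 0). w \<in> carrier \<Delta> \<and>
    (\<forall>i. w i - \<one>\<^bsub>\<Delta>\<^esub> i - (if p ^ q dvd i then 0 else \<Pi> ^ n * a i) \<in> I (n + 1))"
proof -
  define a' where "a' = (\<lambda>i. if p ^ q dvd i then 0 else \<Pi> ^ n * a i)"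
  have aB: "a i \<in> B" for i using a by (rule A_B)
  have "\<exists>b. b \<in> I 1 \<and> (i \<ge> N \<longrightarrow> b = 0) \<and> \<rho> i * (\<one>\<^bsub>\<Delta>\<^esub> i + b) - a' i \<in> I (n + 1)" for i
  proof (cases "p ^ q dvd i \<or> i \<ge> N")
    case True
    have "\<rho> i * (\<one>\<^bsub>\<Delta>\<^esub> i + 0) = 0" by (simp add: one_nth \<rho>_0)
    moreover have "a' i = 0" using True a0 by (auto simp: a'_def)
    ultimately have "\<rho> i * (\<one>\<^bsub>\<Delta>\<^esub> i + 0) - a' i = 0" by (simp only: diff_0_right)
    then show ?thesis by (intro exI[of _ 0]) (simp only: I_zero simp_thms)
  next
    case False
    then have i0: "i \<noteq> 0" by (cases i) auto
    define t where "t = multiplicity p i"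
    have pu: "\<not> is_unit p" using p_gt by simp
    have "p ^ t dvd i" unfolding t_def by (rule multiplicity_dvd)
    then obtain j where j: "i = p ^ t * j" by (rule dvdE)
    have pj: "\<not> p dvd j"
    proof
      assume "p dvd j"
      then have "p ^ Suc t dvd i" unfolding j by (simp add: mult_dvd_mono)
      then have "Suc t \<le> t" unfolding t_def by (subst (asm) power_dvd_iff_le_multiplicity) (use pu i0 in auto)
      then show False by simp
    qed
    have tq: "t < q"
    proof (rule ccontr)
      assume "\<not> t < q"
      then have "p ^ q dvd p ^ t" by (intro le_imp_power_dvd) simp
      then show False using False j by auto
    qed
    then have ts: "t < s" using q by simp
    define Q where "Q = p ^ (r + t)"
    have Qn: "Q \<le> n"
    proof -
      have "r + t \<le> r + q - 1" using tq by simp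
      then have "Q \<le> p ^ (r + q - 1)" unfolding Q_def using p_gt by (intro power_increasing) simp_all
      also have "\<dots> \<le> n" using nq tq by simp
      finally show ?thesis .
    qed
    have Q1: "Q \<ge> 1" unfolding Q_def using p_gt by (intro one_le_power) simp
    have ju: "of_nat j \<noteq> (0 :: 'a)" "inverse (of_nat j) \<in> B" using of_nat_unit[OF pj] by (auto simp: Bunit_def)
    \<comment> \<open>Solves \<open>\<rho> i * b = Pi ^ n * a i\<close> to first order, since
      \<open>\<rho> i\<close> is \<open>- j * Pi ^ (Q - 1)\<close>. The exponent
      \<open>n + 1 - Q\<close> is positive because \<open>t < q\<close> and \<open>nq\<close> give
      \<open>Q <= n\<close>.\<close>
    define b where "b = - (inverse (of_nat j) * a i * \<Pi> ^ (n + 1 - Q))"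
    have bI: "b \<in> I (n + 1 - Q)" unfolding b_def using ju aB by (intro I_uminus I_mult_left Pi_power_I B_mult)
    have "(\<rho> i + of_nat j * \<Pi> ^ (Q - 1)) * b \<in> I (Q + (n + 1 - Q))"
      unfolding j Q_def by (intro I_mult \<rho>_I[OF ts] bI[unfolded Q_def])
    moreover have "of_nat j * \<Pi> ^ (Q - 1) * b = - (\<Pi> ^ n * a i)"
    proof -
      have "\<Pi> ^ (Q - 1) * \<Pi> ^ (n + 1 - Q) = \<Pi> ^ n" unfolding power_add[symmetric] using Qn Q1 by (intro arg_cong[of _ _ "\<lambda>k. \<Pi> ^ k"]) simp
      moreover have "of_nat j * \<Pi> ^ (Q - 1) * b = - ((of_nat j * inverse (of_nat j)) * (\<Pi> ^ (Q - 1) * \<Pi> ^ (n + 1 - Q)) * a i)"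
        unfolding b_def by (simp add: mult_ac)
      ultimately show ?thesis using ju(1) by simp
    qed
    moreover have "Q + (n + 1 - Q) = n + 1" using Qn by simp
    ultimately have "\<rho> i * b - \<Pi> ^ n * a i \<in> I (n + 1)" by (simp add: distrib_right)
    moreover have "a' i = \<Pi> ^ n * a i" using False by (simp add: a'_def)
    moreover have "b \<in> I 1" by (rule I_mono[OF _ bI]) (use Qn in simp)
    ultimately show ?thesis using False i0 by (intro exI[of _ b]) (simp add: one_nth)
  qed
  then have "\<forall>i. \<exists>b. b \<in> I 1 \<and> (i \<ge> N \<longrightarrow> b = 0) \<and> \<rho> i * (\<one>\<^bsub>\<Delta>\<^esub> i + b) - a' i \<in> I (n + 1)" by (rule allI)
  from choice[OF this] obtain b where b': "\<forall>i. b i \<in> I 1 \<and> (i \<ge> N \<longrightarrow> b i = 0) \<and> \<rho> i * (\<one>\<^bsub>\<Delta>\<^esub> i + b i) - a' i \<in> I (n + 1)"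
    by (rule exE)
  have b: "b i \<in> I 1" "i \<ge> N \<Longrightarrow> b i = 0" "\<rho> i * (\<one>\<^bsub>\<Delta>\<^esub> i + b i) - a' i \<in> I (n + 1)" for i
    using spec[OF b', of i] by auto
  have bL: "b \<in> Lv 1"
  proof (rule LvI)
    show "b \<in> carrier \<Delta>" unfolding B.carrier_iff using b(1,2) I_B by blast
  qed (rule b(1))
  have "a' i \<in> I n" for i using aB by (auto simp: a'_def intro: II)
  then have E: "\<rho> i * (\<one>\<^bsub>\<Delta>\<^esub> i + b i) \<in> I n" for i
    using I_add[OF I_mono[OF _ b(3)[of i], of n], of "a' i"] by simp
  have EL: "(\<lambda>k. \<rho> k * (\<one>\<^bsub>\<Delta>\<^esub> k + b k)) \<in> Lv n"
  proof (rule LvI)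
    show "(\<lambda>k. \<rho> k * (\<one>\<^bsub>\<Delta>\<^esub> k + b k)) \<in> carrier \<Delta>"
      unfolding B.carrier_iff using I_B[OF E] b(2) N_gt_1 by (auto simp: one_nth)
  qed (rule E)
  obtain w where w: "w \<in> Pi_commutators (cyclic_algebra K g N \<tau>) \<Delta> (cyc_monom \<Pi> 0)"
    "w \<in> carrier \<Delta> \<and> (\<forall>i. w i - \<one>\<^bsub>\<Delta>\<^esub> i - \<rho> i * (\<one>\<^bsub>\<Delta>\<^esub> i + b i) \<in> I (n + 1))"
    using Pi_commutator_approx[OF bL EL] by (rule bexE)
  have "w i - \<one>\<^bsub>\<Delta>\<^esub> i - a' i \<in> I (n + 1)" for i
  proof -
    have "w i - \<one>\<^bsub>\<Delta>\<^esub> i - \<rho> i * (\<one>\<^bsub>\<Delta>\<^esub> i + b i) \<in> I (n + 1)" using w(2) by blast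
    from I_add[OF this b(3)[of i]] show ?thesis by (simp only: diff_add_cancel add_diff_eq)
  qed
  then show ?thesis using w unfolding a'_def by (intro bexI[of _ w] conjI allI) auto
qed

text \<open>
  At the boundary level \<open>n = p\<^bsup>r+q\<^esup> - 1\<close> the remaining coefficients are those of a logarithmic derivative,
  and are realised by \<open>[\<Pi>, H]\<close> with \<open>H\<close> the corresponding unit of the commutative suborder.
\<close>

lemma boundary_commutator_approx:
  assumes q: "q < s" and n: "n + 1 = p ^ (r + q)" and a: "\<And>i. a i \<in> A"
    and a0: "\<And>i. i \<ge> N \<Longrightarrow> a i = 0"
    and S: "(\<Sum>j<p ^ (s - q). a (p ^ q * j) ^ (p ^ (s - q)) * \<tau> ^ j) -
      (\<Sum>j<p ^ (s - q - 1). a (p ^ q * (p * j)) ^ (p ^ (s - q - 1)) * \<tau> ^ j) \<in> I 1"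
  shows "\<exists>w\<in>Pi_commutators (cyclic_algebra K g N \<tau>) \<Delta> (cyc_monom \<Pi> 0). w \<in> carrier \<Delta> \<and>
    (\<forall>i. w i - \<one>\<^bsub>\<Delta>\<^esub> i - (if p ^ q dvd i then \<Pi> ^ n * a i else 0) \<in> I (n + 1))"
proof -
  have qs: "q \<le> s" using q by simp
  interpret AP: closed_subring AP by (rule AP_closed)
  define f where "f = (\<Sum>j<p ^ (s - q). monom (a (p ^ q * j)) j)"
  obtain h where h: "h \<in> AP" "ev q h \<in> Units \<Delta> \<and> ev q (\<delta>p h + f * h) \<in> Lv 1"
    using exists_log_derivative[OF q, of "\<lambda>j. a (p ^ q * j)", OF a S] unfolding f_def by (rule bexE)
  have f: "f \<in> AP" unfolding f_def using a by (intro AP.C_sum AP_monom)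
  define H where "H = ev q h"
  define F where "F = ev q f"
  have H: "H \<in> Units \<Delta>" unfolding H_def using h(2) by (rule conjunct1)
  have Hc: "H \<in> carrier \<Delta>" using H by (rule B.ring.Units_closed)
  have Fc: "F \<in> carrier \<Delta>" unfolding F_def by (rule ev_carrier[OF qs f])
  have FH: "F \<otimes>\<^bsub>\<Delta>\<^esub> H \<in> carrier \<Delta>" using Fc Hc by (rule B.mult_closed)
  have F_nth: "F i = (if p ^ q dvd i then a i else 0)" for i
  proof -
    have NM: "N = p ^ q * p ^ (s - q)" by (rule N_split[OF qs])
    have "F i = (\<Sum>j<p ^ (s - q). a (p ^ q * j) * wv q j i)"
      unfolding F_def f_def by (simp only: ev_sum[OF qs] ev_monom[OF qs])
    also have "\<dots> = (\<Sum>j<p ^ (s - q). if i = p ^ q * j then a i else 0)"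
      by (intro sum.cong refl) (auto simp: wv_def cyc_monom_def)
    also have "\<dots> = (if p ^ q dvd i then a i else 0)"
    proof (cases "p ^ q dvd i \<and> i < N")
      case True
      then obtain j where j: "i = p ^ q * j" by (auto elim: dvdE)
      then have jM: "j < p ^ (s - q)" using True NM by simp
      have "(\<Sum>j'<p ^ (s - q). if i = p ^ q * j' then a i else 0) = (\<Sum>j'<p ^ (s - q). if j' = j then a i else 0)"
        unfolding j using p_gt by (intro sum.cong refl) auto
      then show ?thesis using True jM by simp
    next
      case False
      have "(\<Sum>j<p ^ (s - q). if i = p ^ q * j then a i else 0) = 0"
        using False NM p_gt by (intro sum.neutral) auto
      then show ?thesis using False a0[of i] by auto
    qed
    finally show ?thesis .
  qed
  define E where "E = (\<lambda>k. \<rho> k * H k)"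
  have Ec: "E \<in> carrier \<Delta>" unfolding B.carrier_iff E_def
    using B.carrier_nth[OF Hc] B.carrier_nth_0[OF Hc] \<rho>_B by (auto intro: B_mult)
  have H0: "H k = 0" if "\<not> p ^ q dvd k" for k
    unfolding H_def ev_def wv_def cyc_monom_def using that by (intro sum.neutral) auto
  \<comment> \<open>On multiples of \<open>p ^ q\<close>, \<open>\<rho> k\<close> is
    \<open>- Pi ^ n\<close> times the exponent of \<open>V\<close>, so \<open>E\<close> is
    \<open>- Pi ^ n\<close> times the derivative of \<open>H\<close>, which is
    \<open>Pi ^ n * F * H\<close> by the choice of \<open>h\<close>.\<close>
  have E_approx: "E k - \<Pi> ^ n * (F \<otimes>\<^bsub>\<Delta>\<^esub> H) k \<in> I (n + 1)" for k
  proof -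
    define m where "m = k div p ^ q"
    have 1: "\<rho> k * H k + of_nat m * \<Pi> ^ n * H k \<in> I (n + 1)"
    proof (cases "p ^ q dvd k")
      case True
      then have "k = p ^ q * m" by (simp add: m_def)
      moreover have "n = p ^ (r + q) - 1" using n by simp
      ultimately have "\<rho> k + of_nat m * \<Pi> ^ n \<in> I (n + 1)" using \<rho>_I[OF q, of m] n by simp
      then have "(\<rho> k + of_nat m * \<Pi> ^ n) * H k \<in> I (n + 1)" using B.carrier_nth[OF Hc] by (rule I_mult_right)
      then show ?thesis by (simp add: distrib_right)
    qed (simp add: H0)
    have "ev q (\<delta>p h) k - of_nat m * H k \<in> I 1" unfolding m_def H_def by (rule ev_\<delta>[OF qs q h(1)])
    moreover have "ev q (\<delta>p h) k + (F \<otimes>\<^bsub>\<Delta>\<^esub> H) k \<in> I 1"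
      using Lv_nth[OF conjunct2[OF h(2)], of k] unfolding ev_add[OF qs] ev_mult[OF qs f h(1)] F_def H_def .
    ultimately have "(ev q (\<delta>p h) k - of_nat m * H k) - (ev q (\<delta>p h) k + (F \<otimes>\<^bsub>\<Delta>\<^esub> H) k) \<in> I 1" by (rule I_diff)
    then have "\<Pi> ^ n * ((ev q (\<delta>p h) k - of_nat m * H k) - (ev q (\<delta>p h) k + (F \<otimes>\<^bsub>\<Delta>\<^esub> H) k)) \<in> I (n + 1)"
      by (intro I_mult Pi_power_I)
    from I_add[OF 1 this] show ?thesis unfolding E_def by (simp add: algebra_simps)
  qed
  define P where "P = cyc_monom (\<Pi> ^ n) 0"
  have Pc: "P \<in> carrier \<Delta>" unfolding P_def using N_gt_1 by (intro B.cyc_monom_carrier B_intros) simp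
  define R where "R = E \<ominus>\<^bsub>\<Delta>\<^esub> P \<otimes>\<^bsub>\<Delta>\<^esub> (F \<otimes>\<^bsub>\<Delta>\<^esub> H)"
  have PFH: "P \<otimes>\<^bsub>\<Delta>\<^esub> (F \<otimes>\<^bsub>\<Delta>\<^esub> H) \<in> carrier \<Delta>" using Pc FH by (rule B.mult_closed)
  have R: "R \<in> Lv (n + 1)"
  proof (rule LvI)
    show "R \<in> carrier \<Delta>" unfolding R_def using Ec PFH by simp
    fix i
    have "R i = E i - (P \<otimes>\<^bsub>\<Delta>\<^esub> (F \<otimes>\<^bsub>\<Delta>\<^esub> H)) i" unfolding R_def by (rule B.a_minus_nth[OF Ec PFH])
    also have "(P \<otimes>\<^bsub>\<Delta>\<^esub> (F \<otimes>\<^bsub>\<Delta>\<^esub> H)) i = \<Pi> ^ n * (F \<otimes>\<^bsub>\<Delta>\<^esub> H) i"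
      unfolding P_def by (rule B.const_mult_nth[OF FH])
    finally show "R i \<in> I (n + 1)" using E_approx by (simp only:)
  qed
  have Rc: "R \<in> carrier \<Delta>" using R by simp
  have E_eq: "E = R \<oplus>\<^bsub>\<Delta>\<^esub> P \<otimes>\<^bsub>\<Delta>\<^esub> (F \<otimes>\<^bsub>\<Delta>\<^esub> H)"
    by (rule ext) (simp add: R_def B.add_nth B.a_minus_nth[OF Ec PFH])
  have inv: "inv\<^bsub>\<Delta>\<^esub> H \<in> carrier \<Delta>" using H by (rule B.ring.Units_inv_closed)
  have PF: "P \<otimes>\<^bsub>\<Delta>\<^esub> F \<in> carrier \<Delta>" using Pc Fc by (rule B.mult_closed)
  define w where "w = (H \<oplus>\<^bsub>\<Delta>\<^esub> E) \<otimes>\<^bsub>\<Delta>\<^esub> inv\<^bsub>\<Delta>\<^esub> H"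
  have HE: "H \<oplus>\<^bsub>\<Delta>\<^esub> E \<in> carrier \<Delta>" using Hc Ec by simp
  have wc: "w \<in> carrier \<Delta>" unfolding w_def using HE inv by (rule B.mult_closed)
  have "(P \<otimes>\<^bsub>\<Delta>\<^esub> (F \<otimes>\<^bsub>\<Delta>\<^esub> H)) \<otimes>\<^bsub>\<Delta>\<^esub> inv\<^bsub>\<Delta>\<^esub> H = P \<otimes>\<^bsub>\<Delta>\<^esub> F"
    using B.ring.m_assoc[OF Pc Fc Hc] B.ring.m_assoc[OF PF Hc inv] B.ring.Units_r_inv[OF H] PF by simp
  then have w_eq: "w = \<one>\<^bsub>\<Delta>\<^esub> \<oplus>\<^bsub>\<Delta>\<^esub> (R \<otimes>\<^bsub>\<Delta>\<^esub> inv\<^bsub>\<Delta>\<^esub> H \<oplus>\<^bsub>\<Delta>\<^esub> P \<otimes>\<^bsub>\<Delta>\<^esub> F)"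
    unfolding w_def B.ring.l_distr[OF Hc Ec inv] B.ring.Units_r_inv[OF H]
    by (subst E_eq) (simp only: B.ring.l_distr[OF Rc PFH inv])
  have "w i - \<one>\<^bsub>\<Delta>\<^esub> i - \<Pi> ^ n * F i \<in> I (n + 1)" for i
  proof -
    have "w i - \<one>\<^bsub>\<Delta>\<^esub> i - \<Pi> ^ n * F i = (R \<otimes>\<^bsub>\<Delta>\<^esub> inv\<^bsub>\<Delta>\<^esub> H) i"
      unfolding w_eq B.add_nth P_def B.const_mult_nth[OF Fc] by simp
    then show ?thesis using Lv_nth[OF Lv_mult_right[OF R inv], of i] by simp
  qed
  moreover have "w \<in> Pi_commutators (cyclic_algebra K g N \<tau>) \<Delta> (cyc_monom \<Pi> 0)"
    unfolding w_def
  proof (rule Pi_commutator[OF H HE])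
    fix k
    have "(H \<oplus>\<^bsub>\<Delta>\<^esub> E) k * (g ^^ k) \<Pi> = (1 + \<rho> k) * (g ^^ k) \<Pi> * H k"
      by (simp add: B.add_nth E_def algebra_simps)
    then show "(H \<oplus>\<^bsub>\<Delta>\<^esub> E) k * (g ^^ k) \<Pi> = \<Pi> * H k" unfolding \<rho>_eq .
  qed
  ultimately show ?thesis using wc unfolding F_nth by (intro bexI[of _ w] conjI allI) (simp_all add: if_distrib cong: if_cong)
qed

lemma Pi_commutator_products_1:
  assumes "w \<in> carrier \<Delta>"
    "w \<in> Pi_commutators (cyclic_algebra K g N \<tau>) \<Delta> (cyc_monom \<Pi> 0) \<union> derived (units_of \<Delta>) (Units \<Delta>)"
  shows "w \<in> Pi_commutator_products (cyclic_algebra K g N \<tau>) \<Delta> (cyc_monom \<Pi> 0)"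
proof -
  have "foldr (monoid.mult (cyclic_algebra K g N \<tau>)) [w] \<one>\<^bsub>cyclic_algebra K g N \<tau>\<^esub> = w"
    using carrier_\<Delta>_K[OF assms(1)] by simp
  then show ?thesis unfolding Pi_commutator_products_def mem_Collect_eq
    using assms(2) by (intro exI[of _ "[w]"] conjI) simp_all
qed

lemma Pi_commutator_products_2:
  assumes c: "w \<in> carrier \<Delta>" "w' \<in> carrier \<Delta>"
    and "w \<in> Pi_commutators (cyclic_algebra K g N \<tau>) \<Delta> (cyc_monom \<Pi> 0)"
    "w' \<in> Pi_commutators (cyclic_algebra K g N \<tau>) \<Delta> (cyc_monom \<Pi> 0)"
  shows "w \<otimes>\<^bsub>\<Delta>\<^esub> w' \<in> Pi_commutator_products (cyclic_algebra K g N \<tau>) \<Delta> (cyc_monom \<Pi> 0)"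
proof -
  have "foldr (monoid.mult (cyclic_algebra K g N \<tau>)) [w, w'] \<one>\<^bsub>cyclic_algebra K g N \<tau>\<^esub> = w \<otimes>\<^bsub>\<Delta>\<^esub> w'"
    using carrier_\<Delta>_K[OF c(2)] by (simp add: K_mult_eq[symmetric])
  then show ?thesis unfolding Pi_commutator_products_def mem_Collect_eq
    using assms(3,4) by (intro exI[of _ "[w, w']"] conjI) simp_all
qed

theorem norm_one_cong_commutator_product:
  assumes d: "d \<in> carrier \<Delta>" and norm: "reduced_norm \<Delta> N d = 1" and n: "n \<ge> 1"
    and dn: "cong_mod_power \<Delta> (cyc_monom \<Pi> 0) n d \<one>\<^bsub>\<Delta>\<^esub>"
  shows "\<exists>z\<in>Pi_commutator_products (cyclic_algebra K g N \<tau>) \<Delta> (cyc_monom \<Pi> 0).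
    cong_mod_power \<Delta> (cyc_monom \<Pi> 0) (n + 1) d z"
proof -
  have dI: "d i - \<one>\<^bsub>\<Delta>\<^esub> i \<in> I n" for i
    using dn unfolding cong_mod_power_iff[OF d B.ring.one_closed] by blast
  obtain a0 where a0: "\<forall>i. a0 i \<in> A" "\<forall>i. d i - \<one>\<^bsub>\<Delta>\<^esub> i - \<Pi> ^ n * a0 i \<in> I (n + 1)"
    using leading_coeffs[of "\<lambda>i. d i - \<one>\<^bsub>\<Delta>\<^esub> i", OF dI] by (elim exE conjE)
  define a where "a = (\<lambda>i. if i < N then a0 i else 0)"
  have a: "a i \<in> A" for i using a0(1) A_0 by (simp add: a_def)
  have aN: "a i = 0" if "i \<ge> N" for i using that by (simp add: a_def)
  have da: "d i - \<one>\<^bsub>\<Delta>\<^esub> i - \<Pi> ^ n * a i \<in> I (n + 1)" for i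
  proof (cases "i < N")
    case False
    then have "d i = 0" "\<one>\<^bsub>\<Delta>\<^esub> i = 0" "a i = 0" using B.carrier_nth_0[OF d] N_gt_1 aN by (simp_all add: one_nth)
    then show ?thesis by simp
  qed (use a0(2) in \<open>simp add: a_def\<close>)
  have finish: ?thesis
    if "z \<in> Pi_commutator_products (cyclic_algebra K g N \<tau>) \<Delta> (cyc_monom \<Pi> 0)" "z \<in> carrier \<Delta>"
      "\<And>i. z i - \<one>\<^bsub>\<Delta>\<^esub> i - \<Pi> ^ n * a i \<in> I (n + 1)" for z
  proof (rule bexI[OF _ that(1)])
    show "cong_mod_power \<Delta> (cyc_monom \<Pi> 0) (n + 1) d z"
      unfolding cong_mod_power_iff[OF d that(2)]
    proof
      fix i
      show "d i - z i \<in> I (n + 1)" using I_diff[OF da[of i] that(3)[of i]] by simp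
    qed
  qed
  have p1: "p > 1" using p_gt by simp
  show ?thesis
  proof (rule level_cases[OF p1 r n, of s])
    fix t j assume orbit: "t < s" "\<not> p dvd j" "n + 1 = p ^ (r + t) + p ^ t * j"
    obtain w where w: "w \<in> derived (units_of \<Delta>) (Units \<Delta>)"
      "w \<in> carrier \<Delta> \<and> (\<forall>i. w i - \<one>\<^bsub>\<Delta>\<^esub> i - \<Pi> ^ n * a i \<in> I (n + 1))"
      using orbit_commutator_approx[OF orbit a aN] by (rule bexE)
    show ?thesis by (rule finish[OF Pi_commutator_products_1]) (use w in auto)
  next
    fix q c assume q: "q \<le> s" "n + 1 = p ^ q * c" "q \<ge> 1 \<Longrightarrow> c > p ^ (r - 1)" "q < s \<Longrightarrow> c \<le> p ^ r"
      "q \<ge> 1 \<Longrightarrow> p ^ (r + q - 1) \<le> n"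
    obtain w where w: "w \<in> Pi_commutators (cyclic_algebra K g N \<tau>) \<Delta> (cyc_monom \<Pi> 0)"
      "w \<in> carrier \<Delta> \<and> (\<forall>i. w i - \<one>\<^bsub>\<Delta>\<^esub> i - (if p ^ q dvd i then 0 else \<Pi> ^ n * a i) \<in> I (n + 1))"
      using nonmultiples_commutator_approx[OF q(1) q(5) a aN] by (rule bexE)
    have S: "(\<Sum>i<N. if p ^ q dvd i then a i ^ (p ^ (s - q)) * \<tau> ^ (i div p ^ q) else 0) -
      (if q < s \<and> c = p ^ r then \<Sum>i<N. if p ^ (q + 1) dvd i then a i ^ (p ^ (s - (q + 1))) * \<tau> ^ (i div p ^ (q + 1)) else 0 else 0)
      \<in> I 1"
      by (rule norm_one_condition[OF q(1,2) n q(3,4) d assms(2) a da])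
    have S1: "(\<Sum>i<N. if p ^ q dvd i then a i ^ (p ^ (s - q)) * \<tau> ^ (i div p ^ q) else 0) =
        (\<Sum>j<p ^ (s - q). a (p ^ q * j) ^ (p ^ (s - q)) * \<tau> ^ j)"
      unfolding N_split[OF q(1)] by (rule sum_dvd_lessThan) simp
    show ?thesis
    proof (cases "q < s \<and> c = p ^ r")
      case False
      have "a i \<in> I 1" if iq: "p ^ q dvd i" for i
      proof (cases "i < N")
        case True
        obtain j where j: "i = p ^ q * j" using iq by (rule dvdE)
        have jM: "j < p ^ (s - q)" using True unfolding N_split[OF q(1)] j by simp
        have "(\<Sum>j<p ^ (s - q). a (p ^ q * j) ^ (p ^ (s - q)) * \<tau> ^ j) \<in> I 1" using S unfolding S1 if_not_P[OF False] by simp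
        then obtain b where b: "b \<in> B" "(\<Sum>j<p ^ (s - q). a (p ^ q * j) ^ (p ^ (s - q)) * \<tau> ^ j) = \<Pi> ^ 1 * b" by (rule IE)
        have "\<exists>b\<in>B. a (p ^ q * j) = \<Pi> * b"
          using b(2) by (intro frobenius_basis[of "\<lambda>j. a (p ^ q * j)" b "s - q", OF a b(1) _ jM]) simp
        then obtain b' where "b' \<in> B" "a (p ^ q * j) = \<Pi> * b'" by (rule bexE)
        then show ?thesis using II[of b' 1] by (simp add: j)
      qed (simp add: aN)
      then have m: "\<Pi> ^ n * a i \<in> I (n + 1)" if "p ^ q dvd i" for i using that by (intro I_mult Pi_power_I)
      have "w i - \<one>\<^bsub>\<Delta>\<^esub> i - \<Pi> ^ n * a i \<in> I (n + 1)" for i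
      proof (cases "p ^ q dvd i")
        case True
        then have "w i - \<one>\<^bsub>\<Delta>\<^esub> i \<in> I (n + 1)" using spec[OF conjunct2[OF w(2)], of i] by simp
        from I_diff[OF this m[OF True]] show ?thesis .
      qed (use spec[OF conjunct2[OF w(2)], of i] in simp)
      then show ?thesis using w by (intro finish[OF Pi_commutator_products_1]) auto
    next
      case True
      have s1: "s - (q + 1) = s - q - 1" by simp
      have N1: "N = p ^ (q + 1) * p ^ (s - q - 1)" unfolding power_add[symmetric] using True by (intro arg_cong[of _ _ "\<lambda>k. p ^ k"]) simp
      have S2: "(\<Sum>i<N. if p ^ (q + 1) dvd i then a i ^ (p ^ (s - q - 1)) * \<tau> ^ (i div p ^ (q + 1)) else 0) =
          (\<Sum>j<p ^ (s - q - 1). a (p ^ q * (p * j)) ^ (p ^ (s - q - 1)) * \<tau> ^ j)"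
        unfolding N1 by (subst sum_dvd_lessThan) (simp_all add: power_add mult_ac)
      have "n + 1 = p ^ (r + q)" using q(2) True by (simp add: power_add mult.commute)
      moreover have "(\<Sum>j<p ^ (s - q). a (p ^ q * j) ^ (p ^ (s - q)) * \<tau> ^ j) -
          (\<Sum>j<p ^ (s - q - 1). a (p ^ q * (p * j)) ^ (p ^ (s - q - 1)) * \<tau> ^ j) \<in> I 1"
        using S unfolding S1 if_P[OF True] s1 S2 .
      ultimately have "\<exists>w'\<in>Pi_commutators (cyclic_algebra K g N \<tau>) \<Delta> (cyc_monom \<Pi> 0). w' \<in> carrier \<Delta> \<and>
          (\<forall>i. w' i - \<one>\<^bsub>\<Delta>\<^esub> i - (if p ^ q dvd i then \<Pi> ^ n * a i else 0) \<in> I (n + 1))"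
        by (intro boundary_commutator_approx[OF conjunct1[OF True]] a aN)
      then obtain w' where w': "w' \<in> Pi_commutators (cyclic_algebra K g N \<tau>) \<Delta> (cyc_monom \<Pi> 0)"
        "w' \<in> carrier \<Delta> \<and> (\<forall>i. w' i - \<one>\<^bsub>\<Delta>\<^esub> i - (if p ^ q dvd i then \<Pi> ^ n * a i else 0) \<in> I (n + 1))"
        by (rule bexE)
      \<comment> \<open>The two commutators cover complementary sets of coordinates, and to first
        order the deviations of a product from 1 add up.\<close>
      define E where "E = (\<lambda>i. if p ^ q dvd i then 0 else \<Pi> ^ n * a i)"
      define E' where "E' = (\<lambda>i. if p ^ q dvd i then \<Pi> ^ n * a i else 0)"
      have aI: "\<Pi> ^ n * a i \<in> I n" "\<Pi> ^ n * a i \<in> B" for i using II[OF A_B[OF a]] I_B by blast+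
      have E: "E \<in> Lv n" "E' \<in> Lv n"
        unfolding E_def E'_def using aI aN by (auto intro!: LvI simp: B.carrier_iff)
      have ww: "w \<otimes>\<^bsub>\<Delta>\<^esub> w' \<in> Pi_commutator_products (cyclic_algebra K g N \<tau>) \<Delta> (cyc_monom \<Pi> 0)"
        using w w' by (intro Pi_commutator_products_2) auto
      have wwc: "w \<otimes>\<^bsub>\<Delta>\<^esub> w' \<in> carrier \<Delta>" using w(2) w'(2) by (intro B.mult_closed) auto
      have "(w \<otimes>\<^bsub>\<Delta>\<^esub> w') i - \<one>\<^bsub>\<Delta>\<^esub> i - (E i + E' i) \<in> I (n + 1)" for i
      proof (rule mult_approx[OF conjunct1[OF w(2)] conjunct1[OF w'(2)] n E])
        show "w i - \<one>\<^bsub>\<Delta>\<^esub> i - E i \<in> I (n + 1)" for i unfolding E_def by (rule spec[OF conjunct2[OF w(2)]])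
        show "w' i - \<one>\<^bsub>\<Delta>\<^esub> i - E' i \<in> I (n + 1)" for i unfolding E'_def by (rule spec[OF conjunct2[OF w'(2)]])
      qed
      moreover have "E i + E' i = \<Pi> ^ n * a i" for i by (simp add: E_def E'_def)
      ultimately show ?thesis by (intro finish[OF ww wwc]) simp
    qed
  qed
qed

end

subsection \<open>Integers of an unramified extension\<close>

lemma amb_simps:
  "carrier amb = UNIV" "x \<otimes>\<^bsub>amb\<^esub> y = x * y" "x \<oplus>\<^bsub>amb\<^esub> y = x + y" "\<one>\<^bsub>amb\<^esub> = 1" "\<zero>\<^bsub>amb\<^esub> = 0"
  by (simp_all add: ring_of_type_algebra_def)

lemma amb_field: "field (amb :: 'k::field ring)" by (rule field_from_type_algebra)

lemma amb_ring: "ring (amb :: 'k::field ring)" by (rule ring_from_type_algebra)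

lemma subfield_amb:
  fixes F :: "'k::field set"
  assumes F: "subfield F amb"
  shows "closed_subring F" and "x \<in> F \<Longrightarrow> inverse x \<in> F"
proof -
  interpret amb: field "amb :: 'k ring" by (rule amb_field)
  have sub: "subring F amb" using F by (rule subfieldE(1))
  note E = subringE[OF sub, unfolded amb_simps]
  have uminus: "\<ominus>\<^bsub>amb\<^esub> x = - x" for x :: 'k
    by (rule amb.minus_equality) (simp_all add: amb_simps)
  show "closed_subring F"
    by unfold_locales (use E uminus in \<open>auto simp: amb_simps\<close>)
  show "inverse x \<in> F" if x: "x \<in> F"
  proof (cases "x = 0")
    case False
    have "inverse x = inv\<^bsub>amb\<^esub> x"
      by (rule amb.inv_unique') (use False in \<open>simp_all add: amb_simps\<close>)
    then show ?thesis using amb.subfield_m_inv(1)[OF F, of x] x False by (simp add: amb_simps)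
  qed (use x in simp)
qed

lemma padic_abs_self: "prime p \<Longrightarrow> padic_abs p (of_nat p) = 1 / real p"
proof -
  assume p: "prime p"
  have "quotient_of (of_nat p) = (int p, 1)" using quotient_of_int[of "int p"] by (simp add: Rat.of_int_def)
  moreover have "multiplicity (int p) (int p) = 1" using p prime_gt_1_nat[OF p] by (intro multiplicity_self) auto
  ultimately show ?thesis using prime_gt_0_nat[OF p] by (simp add: padic_abs_def power_int_minus divide_inverse)
qed

text \<open>Since \<open>F\<close> has the value group of the \<open>p\<close>-adic field, absolute
  values are powers of \<open>p\<close>, and \<open>p\<close> generates the maximal ideal of the
  integers. These three facts are the interface to the cyclotomic extension.\<close>

lemma int_ring_local:
  fixes F Qp :: "'k::field_char_0 set" and v :: "'k \<Rightarrow> real"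
  assumes p: "prime p" and Qp: "is_padic_field p Qp v" and F: "finite_unramified Qp F v"
  shows "closed_subring (int_ring F v)"
    and "x \<in> int_ring F v \<Longrightarrow> (\<exists>y\<in>int_ring F v. x = of_nat p * y) \<or> (\<exists>y\<in>int_ring F v. x * y = 1)"
    and "y \<in> int_ring F v \<Longrightarrow> of_nat p * y \<noteq> 1"
proof -
  have Q: "subfield Qp amb" "nonarch_abs_on Qp v" "\<And>x. v (of_rat x) = padic_abs p x"
    "\<And>x e. x \<in> Qp \<Longrightarrow> e > 0 \<Longrightarrow> \<exists>q. v (x - of_rat q) < e"
    using Qp unfolding is_padic_field_def by auto
  have FF: "subfield F amb" "Qp \<subseteq> F" "nonarch_abs_on F v" "v ` (F - {0}) = v ` (Qp - {0})"
    using F unfolding finite_unramified_def by auto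
  interpret F: closed_subring F by (rule subfield_amb(1)[OF FF(1)])
  interpret Q: closed_subring Qp by (rule subfield_amb(1)[OF Q(1)])
  have F_inv: "inverse x \<in> F" if "x \<in> F" for x using subfield_amb(2)[OF FF(1) that] .
  have v_ge: "v x \<ge> 0" and v_0: "v x = 0 \<longleftrightarrow> x = 0" if "x \<in> F" for x
    using FF(3) that unfolding nonarch_abs_on_def by auto
  have v_mult: "v (x * y) = v x * v y" and v_add: "v (x + y) \<le> max (v x) (v y)" if "x \<in> F" "y \<in> F" for x y
    using FF(3) that unfolding nonarch_abs_on_def by auto
  have v1: "v 1 = 1" using v_mult[of 1 1] v_0[of 1] F.C_1 by simp
  have vm1: "v (- 1) = 1"
  proof -
    have "v (- 1) * v (- 1) = 1" using v_mult[of "-1" "-1"] F.C_1 F.C_uminus v1 by simp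
    then have "(v (- 1) - 1) * (v (- 1) + 1) = 0" by (simp add: algebra_simps)
    then show ?thesis using v_ge[of "-1"] F.C_1 F.C_uminus by force
  qed
  have v_uminus: "v (- x) = v x" if "x \<in> F" for x
    using v_mult[of "-1" x] that F.C_1 F.C_uminus vm1 by simp
  have p0: "real p > 1" using prime_gt_1_nat[OF p] by simp
  have vp: "v (of_nat p) = 1 / real p"
    using Q(3)[of "of_nat p"] padic_abs_self[OF p] by simp
  have ratQ: "of_rat c \<in> Qp" for c
  proof -
    obtain a b where ab: "quotient_of c = (a, b)" by (cases "quotient_of c")
    have int: "of_int n \<in> Qp" for n by (cases n rule: int_cases2) (auto intro: Q.C_of_nat Q.C_uminus)
    have "of_rat c = (of_int a * inverse (of_int b) :: 'k)"
      using quotient_of_div[OF ab] by (simp add: of_rat_divide of_rat_mult of_rat_inverse divide_inverse)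
    then show ?thesis using int subfield_amb(2)[OF Q(1)] by (auto intro: Q.C_mult)
  qed
  \<comment> \<open>The value of \<open>x\<close> is attained on the \<open>p\<close>-adic field and
    hence, by density, at a rational number; it is therefore an integral power of
    \<open>p\<close>.\<close>
  have small: "v x \<le> 1 / real p" if x: "x \<in> F" "v x < 1" for x
  proof (cases "x = 0")
    case False
    then have "v x \<in> v ` (Qp - {0})" using x FF(4) by blast
    then obtain y where y: "y \<in> Qp" "y \<noteq> 0" "v x = v y" by blast
    have yF: "y \<in> F" using y FF(2) by blast
    have vy: "v y > 0" using v_ge[OF yF] v_0[OF yF] y(2) by simp
    obtain c where c: "v (y - of_rat c) < v y" using Q(4)[OF y(1) vy] by blast
    have cF: "of_rat c \<in> F" using ratQ FF(2) by blast
    have ycF: "y - of_rat c \<in> F" using yF cF by (rule F.C_diff)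
    have "v y \<le> v (of_rat c)" using v_add[OF ycF cF] c by simp
    moreover have "v (of_rat c) \<le> v y"
      using v_add[OF yF F.C_uminus[OF ycF]] v_uminus[OF ycF] c by simp
    ultimately have vc: "v y = v (of_rat c)" by simp
    then have "c \<noteq> 0" using vy v_0[OF F.C_0] by auto
    then obtain k :: int where k: "v x = real p powi k" using Q(3)[of c] y(3) vc by (auto simp: padic_abs_def)
    have "k \<le> -1"
    proof (rule ccontr)
      assume "\<not> k \<le> -1"
      then have "real p powi 0 \<le> real p powi k" using p0 by (intro power_int_increasing) auto
      then show False using k x(2) by simp
    qed
    then have "real p powi k \<le> real p powi (-1)" using p0 by (intro power_int_increasing) auto
    then show ?thesis using k by (simp add: power_int_minus divide_inverse)
  qed (use v_0[OF F.C_0] in simp)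
  have memO: "x \<in> int_ring F v \<longleftrightarrow> x \<in> F \<and> v x \<le> 1" for x by (simp add: int_ring_def)
  show "closed_subring (int_ring F v)"
  proof
    show "1 \<in> int_ring F v" using v1 F.C_1 by (simp add: memO)
    show "x + y \<in> int_ring F v" if "x \<in> int_ring F v" "y \<in> int_ring F v" for x y
      using that v_add[of x y] by (auto simp: memO F.C_add)
    show "x * y \<in> int_ring F v" if "x \<in> int_ring F v" "y \<in> int_ring F v" for x y
      using that v_mult[of x y] v_ge[of x] v_ge[of y] by (auto simp: memO F.C_mult mult_le_one)
    show "- x \<in> int_ring F v" if "x \<in> int_ring F v" for x
      using that v_uminus[of x] by (auto simp: memO F.C_uminus)
  qed
  show "(\<exists>y\<in>int_ring F v. x = of_nat p * y) \<or> (\<exists>y\<in>int_ring F v. x * y = 1)" if xO: "x \<in> int_ring F v"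
  proof (cases "v x < 1")
    case True
    have x: "x \<in> F" using xO by (simp add: memO)
    define y where "y = x * inverse (of_nat p)"
    have pn: "of_nat p \<noteq> (0 :: 'k)" using prime_gt_0_nat[OF p] by simp
    have y: "y \<in> F" unfolding y_def using x by (intro F.C_mult F_inv F.C_of_nat)
    have xy: "x = of_nat p * y" using pn by (simp add: y_def)
    have "v x = 1 / real p * v y" using v_mult[OF F.C_of_nat y, of p] vp xy by simp
    then have "v y \<le> 1" using small[OF x True] p0 by (simp add: field_simps)
    then show ?thesis using xy y by (auto simp: memO)
  next
    case False
    have x: "x \<in> F" "v x = 1" using xO False by (auto simp: memO)
    then have x0: "x \<noteq> 0" using v_0[OF F.C_0] by auto
    have "v x * v (inverse x) = 1" using v_mult[OF x(1) F_inv[OF x(1)]] x0 v1 by simp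
    then have "inverse x \<in> int_ring F v" using x F_inv by (simp add: memO)
    then show ?thesis using x0 by (intro disjI2 bexI[of _ "inverse x"]) simp_all
  qed
  show "of_nat p * y \<noteq> 1" if yO: "y \<in> int_ring F v"
  proof
    assume "of_nat p * y = 1"
    then have "1 = 1 / real p * v y" using v_mult[OF F.C_of_nat, of y p] yO vp v1 by (simp add: memO)
    then have "v y = real p" using p0 by (simp add: field_simps)
    then show False using yO p0 by (simp add: memO)
  qed
qed

subsection \<open>Adjoining a root of unity\<close>

lemma simple_extension_0: "0 \<in> ring.simple_extension amb R z" for R :: "'k::field set"
  using ring.simple_extension.zero[OF amb_ring, of R z] by (simp add: amb_simps)

lemma simple_extension_lin:
  "x \<in> ring.simple_extension amb R z \<Longrightarrow> y \<in> R \<Longrightarrow> x * z + y \<in> ring.simple_extension amb R z" for R :: "'k::field set"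
  using ring.simple_extension.lin[OF amb_ring, of x R z y] by (simp add: amb_simps)

lemma simple_extension_induct [consumes 1, case_names 0 lin]:
  fixes R :: "'k::field set"
  assumes "x \<in> ring.simple_extension amb R z" "P 0"
    "\<And>x y. x \<in> ring.simple_extension amb R z \<Longrightarrow> P x \<Longrightarrow> y \<in> R \<Longrightarrow> P (x * z + y)"
  shows "P x"
  using ring.simple_extension.induct[OF amb_ring, of x R z P] assms by (simp add: amb_simps)

lemma simple_extension_mult_gen: "x \<in> ring.simple_extension amb R z \<Longrightarrow> 0 \<in> R \<Longrightarrow> x * z \<in> ring.simple_extension amb R z"
  for R :: "'k::field set"
  using simple_extension_lin[of x R z 0] by simp

lemma simple_extension_base: "y \<in> R \<Longrightarrow> y \<in> ring.simple_extension amb R z" for R :: "'k::field set"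
  using simple_extension_lin[OF simple_extension_0, of y R z] by simp

lemma simple_extension_gen: "1 \<in> R \<Longrightarrow> 0 \<in> R \<Longrightarrow> z \<in> ring.simple_extension amb R z" for R :: "'k::field set"
  using simple_extension_mult_gen[OF simple_extension_base, of 1 R z] by simp

text \<open>The extension is generated by Horner steps \<open>x * z + y\<close>, so closure under
  sums and products has to be established by induction on them.\<close>

lemma simple_extension_closed:
  fixes R :: "'k::field set"
  assumes R: "closed_subring R"
  shows "closed_subring (ring.simple_extension amb R z)"
proof -
  interpret closed_subring R by (rule R)
  let ?E = "ring.simple_extension amb R z"
  have base_add: "x + c \<in> ?E" if "x \<in> ?E" "c \<in> R" for x c
    using that
  proof (induction x rule: simple_extension_induct)
    case (lin x y)
    then have "x * z + (y + c) \<in> ?E" by (intro simple_extension_lin C_add)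
    then show ?case by (simp add: add.assoc)
  qed (simp add: simple_extension_base)
  have add: "x + y \<in> ?E" if "x \<in> ?E" "y \<in> ?E" for x y
    using that
  proof (induction x arbitrary: y rule: simple_extension_induct)
    case (lin x c)
    from lin.prems lin.hyps lin.IH show ?case
    proof (induction y rule: simple_extension_induct)
      case 0
      then show ?case by (simp add: simple_extension_lin)
    next
      case (lin y d)
      then have "(x + y) * z + (c + d) \<in> ?E" by (intro simple_extension_lin C_add) blast+
      then show ?case by (simp add: algebra_simps)
    qed
  qed simp
  have smult: "c * x \<in> ?E" if "x \<in> ?E" "c \<in> R" for c x
    using that
  proof (induction x rule: simple_extension_induct)
    case (lin x y)
    then have "c * x * z + c * y \<in> ?E" by (intro simple_extension_lin C_mult) auto
    then show ?case by (simp add: algebra_simps)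
  qed (simp add: simple_extension_0)
  have mult: "x * y \<in> ?E" if "x \<in> ?E" "y \<in> ?E" for x y
    using that
  proof (induction x rule: simple_extension_induct)
    case (lin x c)
    then have "(x * y) * z + c * y \<in> ?E" by (intro add[OF simple_extension_mult_gen[OF _ C_0] smult]) auto
    then show ?case by (simp add: algebra_simps)
  qed (simp add: simple_extension_0)
  show ?thesis
  proof
    show "- x \<in> ?E" if "x \<in> ?E" for x using smult[OF that C_uminus[OF C_1]] by simp
  qed (use add mult simple_extension_base[OF C_1] in auto)
qed

text \<open>Horner steps keep the degree below \<open>n\<close> because the overflowing power
  \<open>z ^ n\<close> lies in the coefficient ring. Coefficients from a larger ring
  \<open>S\<close> are allowed, as needed for \<open>B\<close> over \<open>A\<close>.\<close>

lemma simple_extension_span: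
  fixes R S :: "'k::field set"
  assumes S: "closed_subring S" and RS: "R \<subseteq> S" and z: "z ^ n \<in> S" and n: "n > 0"
    and x: "x \<in> ring.simple_extension amb R z"
  shows "\<exists>c. (\<forall>j. c j \<in> S) \<and> x = (\<Sum>j<n. c j * z ^ j)"
  using x
proof (induction x rule: simple_extension_induct)
  case 0
  interpret closed_subring S by (rule S)
  show ?case by (intro exI[of _ "\<lambda>_. 0"]) (simp add: C_0)
next
  case (lin x y)
  interpret closed_subring S by (rule S)
  obtain k where k: "n = Suc k" using n by (cases n) auto
  from lin obtain c where c: "\<And>j. c j \<in> S" "x = (\<Sum>j<n. c j * z ^ j)" by blast
  define c' where "c' = (\<lambda>j. if j = 0 then c k * z ^ n + y else c (j - 1))"
  have "c' j \<in> S" for j unfolding c'_def using c(1) z lin.hyps RS by (auto intro!: C_add C_mult)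
  moreover have "x * z + y = (\<Sum>j<n. c' j * z ^ j)"
  proof -
    have "(\<Sum>j<n. c' j * z ^ j) = c k * z ^ n + y + (\<Sum>j<k. c j * z ^ Suc j)"
      unfolding k sum.lessThan_Suc_shift by (simp add: c'_def k)
    also have "(\<Sum>j<k. c j * z ^ Suc j) = (\<Sum>j<k. c j * z ^ j) * z" by (simp add: sum_distrib_left mult_ac)
    also have "c k * z ^ n + y + (\<Sum>j<k. c j * z ^ j) * z = y + (\<Sum>j<Suc k. c j * z ^ j) * z"
      unfolding k sum.lessThan_Suc distrib_right by (simp only: power_Suc2 mult.assoc add_ac)
    finally show ?thesis unfolding c(2) k by simp
  qed
  ultimately show ?case by blast
qed

text \<open>The assumptions say that \<open>R0\<close> is local with maximal ideal generated by
  \<open>p\<close>, and that \<open>z\<close> has exact order \<open>p ^ m\<close>.\<close>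

locale cyclotomic_integers =
  fixes R0 :: "'k::field_char_0 set" and p m :: nat and z :: 'k
  assumes p: "prime p" "odd p" and R0: "closed_subring R0"
    and R0_local: "\<And>x. x \<in> R0 \<Longrightarrow> (\<exists>y\<in>R0. x = of_nat p * y) \<or> (\<exists>y\<in>R0. x * y = 1)"
    and R0_p: "\<And>y. y \<in> R0 \<Longrightarrow> of_nat p * y \<noteq> 1"
    and m: "m \<ge> 1" and z_pow: "z ^ (p ^ m) = 1" and z_ne: "z ^ (p ^ (m - 1)) \<noteq> 1"
begin

abbreviation R where "R \<equiv> ring.simple_extension amb R0 z"

sublocale R0: closed_subring R0 by (rule R0)
sublocale R: closed_subring R by (rule simple_extension_closed[OF R0])

lemma z_R: "z \<in> R" using R0.C_1 R0.C_0 by (rule simple_extension_gen)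

lemma p_pos: "p > 0" using p prime_gt_0_nat by blast

lemma one_minus_z_power: "1 - z ^ k = (1 - z) * (\<Sum>l<k. z ^ l)"
  by (rule one_diff_power_eq)

text \<open>The \<open>p\<close>-th roots of unity add up to 0, so \<open>p\<close> is the sum of
  the \<open>1 - w ^ l\<close>, each a multiple of \<open>1 - z\<close>.\<close>

lemma p_eq_pi: "\<exists>y\<in>R. of_nat p = (1 - z) * y"
proof -
  define w where "w = z ^ (p ^ (m - 1))"
  have "p ^ (m - 1) * p = p ^ m" using m by (cases m) simp_all
  then have w: "w ^ p = 1" "w \<noteq> 1" using z_pow z_ne by (simp_all add: w_def power_mult[symmetric])
  have "(1 - w) * (\<Sum>l<p. w ^ l) = 0" using one_diff_power_eq[of w p] w(1) by simp
  then have "(\<Sum>l<p. w ^ l) = 0" using w(2) by simp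
  then have "of_nat p = (\<Sum>l<p. 1 - w ^ l)" by (simp add: sum_subtractf)
  also have "\<dots> = (1 - z) * (\<Sum>l<p. \<Sum>i<p ^ (m - 1) * l. z ^ i)"
    by (simp only: w_def power_mult[symmetric] one_minus_z_power sum_distrib_left)
  finally show ?thesis by (rule bexI) (intro R.C_sum R.C_power z_R)
qed

lemma pi_power_p: "\<exists>y\<in>R. (1 - z) ^ (p ^ m) = of_nat p * y"
proof -
  have "\<exists>y\<in>R. (\<Sum>i\<in>{0, 1 :: nat}. if i = 0 then 1 else - z) ^ (p ^ m) =
      (\<Sum>i\<in>{0, 1 :: nat}. (if i = 0 then 1 else - z) ^ (p ^ m)) + of_nat p * y"
    by (rule R.freshman_sum_power[OF p(1)]) (auto intro: R.C_1 R.C_uminus z_R)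
  moreover have "(- z) ^ (p ^ m) = - 1" using p(2) z_pow by (simp add: power_minus_odd)
  ultimately show ?thesis by simp
qed

text \<open>\<open>R\<close> is finitely generated over \<open>R0\<close>, so \<open>p\<close> lies
  in its radical. Nakayama is applied to coefficient vectors of multiples of
  \<open>1 + p * c\<close>; since an element may have several such vectors, \<open>U\<close>
  collects all of them.\<close>

lemma one_plus_p_unit:
  assumes c: "c \<in> R"
  shows "\<exists>y\<in>R. (1 + of_nat p * c) * y = 1"
proof -
  define n where "n = p ^ m"
  have n: "n > 0" using p_pos by (simp add: n_def)
  have span: "\<exists>a. (\<forall>j. a j \<in> R0) \<and> x = (\<Sum>j<n. a j * z ^ j)" if "x \<in> R" for x
    using that z_pow R0.C_1 n by (intro simple_extension_span[OF R0 order.refl]) (auto simp: n_def)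
  define U where "U = {a. (\<forall>j. a j \<in> R0) \<and> (\<forall>j\<ge>n. a j = 0) \<and> (\<exists>y\<in>R. (\<Sum>j<n. a j * z ^ j) = (1 + of_nat p * c) * y)}"
  define M where "M = {of_nat p * y | y. y \<in> R0}"
  have "(\<lambda>j. if j = 0 then 1 else 0) \<in> U"
  proof (rule nakayama_vectors[where S = R0 and M = M and n = n])
    show "x \<in> R0" if "x \<in> M" for x using that by (auto simp: M_def intro: R0.C_mult R0.C_of_nat)
    show "0 \<in> M" unfolding M_def using R0.C_0 by force
    show "x + y \<in> M" if xy: "x \<in> M" "y \<in> M" for x y
    proof -
      obtain a b where ab: "a \<in> R0" "b \<in> R0" "x = of_nat p * a" "y = of_nat p * b" using xy by (auto simp: M_def)
      then have "x + y = of_nat p * (a + b)" by (simp add: distrib_left)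
      then show ?thesis unfolding M_def using ab R0.C_add by blast
    qed
    show "x * y \<in> M" if xy: "x \<in> R0" "y \<in> M" for x y
    proof -
      obtain b where b: "b \<in> R0" "y = of_nat p * b" using xy by (auto simp: M_def)
      then have "x * y = of_nat p * (x * b)" by simp
      then show ?thesis unfolding M_def using b xy R0.C_mult by blast
    qed
    show "\<exists>y\<in>R0. (1 + x) * y = 1" if x: "x \<in> M" for x
    proof -
      obtain b where b: "b \<in> R0" "x = of_nat p * b" using x by (auto simp: M_def)
      have "\<not> (\<exists>y\<in>R0. 1 + x = of_nat p * y)"
      proof
        assume "\<exists>y\<in>R0. 1 + x = of_nat p * y"
        then obtain y where y: "y \<in> R0" "1 + x = of_nat p * y" by blast
        have "of_nat p * (y - b) = 1" using y(2) b(2) by (simp add: algebra_simps)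
        then show False using R0_p R0.C_diff[OF y(1) b(1)] by blast
      qed
      moreover have "1 + x \<in> R0" using b by (auto intro: R0.C_intros)
      ultimately show ?thesis using R0_local by blast
    qed
    show "(\<lambda>j. x j + y j) \<in> U" if xy: "x \<in> U" "y \<in> U" for x y
    proof -
      obtain b b' where b: "b \<in> R" "(\<Sum>j<n. x j * z ^ j) = (1 + of_nat p * c) * b"
        "b' \<in> R" "(\<Sum>j<n. y j * z ^ j) = (1 + of_nat p * c) * b'" using xy by (auto simp: U_def)
      have "(\<Sum>j<n. (x j + y j) * z ^ j) = (1 + of_nat p * c) * (b + b')"
        unfolding distrib_left[of _ b] b(2,4)[symmetric] by (simp only: distrib_right sum.distrib)
      then show ?thesis using xy R.C_add[OF b(1,3)] unfolding U_def by (auto intro: R0.C_add)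
    qed
    show "(\<lambda>j. a * x j) \<in> U" if ax: "a \<in> R0" "x \<in> U" for a x
    proof -
      obtain b where b: "b \<in> R" "(\<Sum>j<n. x j * z ^ j) = (1 + of_nat p * c) * b" using ax by (auto simp: U_def)
      have "(\<Sum>j<n. a * x j * z ^ j) = a * (\<Sum>j<n. x j * z ^ j)" by (simp add: sum_distrib_left mult.assoc)
      also have "\<dots> = (1 + of_nat p * c) * (a * b)" unfolding b(2) by (rule mult.left_commute)
      finally show ?thesis using ax R.C_mult[OF simple_extension_base[OF ax(1)] b(1)] unfolding U_def by (auto intro: R0.C_mult)
    qed
    show "x j = 0" if "x \<in> U" "j \<ge> n" for x j using that by (auto simp: U_def)
    show "\<exists>w\<in>U. \<forall>j<n. w j - (if j = i then 1 else 0) \<in> M" if i: "i < n" for i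
    proof -
      have "c * z ^ i \<in> R" using c z_R by (intro R.C_intros)
      then obtain a where a: "\<And>j. a j \<in> R0" "c * z ^ i = (\<Sum>j<n. a j * z ^ j)" using span by blast
      define w where "w = (\<lambda>j. if j < n then (if j = i then 1 else 0) + of_nat p * a j else 0)"
      have "(\<Sum>j<n. w j * z ^ j) = (\<Sum>j<n. (if j = i then z ^ i else 0) + of_nat p * (a j * z ^ j))"
        by (intro sum.cong refl) (simp add: w_def algebra_simps)
      also have "\<dots> = (1 + of_nat p * c) * z ^ i"
        using i a(2) by (simp add: sum.distrib sum_distrib_left[symmetric] algebra_simps)
      finally have "w \<in> U" unfolding U_def using a(1) R.C_power[OF z_R, of i] by (auto simp: w_def intro!: R0.C_intros)
      moreover have "w j - (if j = i then 1 else 0) \<in> M" if "j < n" for j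
        using that a(1) by (auto simp: w_def M_def)
      ultimately show ?thesis by blast
    qed
  qed (use n in \<open>auto intro: R0.C_intros\<close>)
  then obtain y where y: "y \<in> R" "(\<Sum>j<n. (if j = 0 then 1 else 0) * z ^ j) = (1 + of_nat p * c) * y"
    unfolding U_def by auto
  have "(\<Sum>j<n. (if j = 0 then 1 else 0) * z ^ j) = (\<Sum>j<n. if j = 0 then 1 else 0)"
    by (intro sum.cong refl) simp
  then have "(\<Sum>j<n. (if j = 0 then 1 else 0) * z ^ j) = 1" using n by simp
  then show ?thesis using y by (intro bexI[of _ y]) simp_all
qed

text \<open>A geometric series: a high power of \<open>1 - z\<close> is divisible by
  \<open>p\<close>, so \<open>1 - x ^ n\<close> is a unit, and \<open>1 - x\<close> divides
  it.\<close>

lemma one_plus_pi_unit: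
  assumes c: "c \<in> R"
  shows "\<exists>y\<in>R. (1 + (1 - z) * c) * y = 1"
proof -
  define x where "x = - ((1 - z) * c)"
  define n where "n = p ^ m"
  have x: "x \<in> R" unfolding x_def using c z_R by (intro R.C_intros)
  obtain b where b: "b \<in> R" "(1 - z) ^ n = of_nat p * b" using pi_power_p by (auto simp: n_def)
  have "x ^ n = ((1 - z) * (- c)) ^ n" by (simp add: x_def)
  also have "\<dots> = of_nat p * b * (- c) ^ n" unfolding power_mult_distrib b(2) ..
  finally have "1 - x ^ n = 1 + of_nat p * (- (b * (- c) ^ n))" by simp
  moreover have "- (b * (- c) ^ n) \<in> R" using b(1) c by (intro R.C_intros)
  ultimately obtain y where y: "y \<in> R" "(1 - x ^ n) * y = 1" using one_plus_p_unit by metis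
  have "(1 - x) * ((\<Sum>i<n. x ^ i) * y) = 1" unfolding mult.assoc[symmetric] one_diff_power_eq[symmetric] by (rule y(2))
  moreover have "(\<Sum>i<n. x ^ i) * y \<in> R" using x y(1) by (intro R.C_intros)
  ultimately show ?thesis by (intro bexI) (simp_all add: x_def)
qed

lemma pi_not_unit: "c \<in> R \<Longrightarrow> (1 - z) * c \<noteq> 1"
proof
  assume c: "c \<in> R" "(1 - z) * c = 1"
  obtain y where "(1 + (1 - z) * (- c)) * y = 1" using one_plus_pi_unit[OF R.C_uminus[OF c(1)]] by blast
  then show False using c(2) by simp
qed

text \<open>Modulo \<open>1 - z\<close> an element is congruent to the sum of its coefficients,
  which lies in the local ring \<open>R0\<close>.\<close>

lemma R_local:
  assumes x: "x \<in> R"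
  shows "(\<exists>y\<in>R. x = (1 - z) * y) \<or> (\<exists>y\<in>R. x * y = 1)"
proof -
  obtain a where a: "\<And>j. a j \<in> R0" "x = (\<Sum>j<p ^ m. a j * z ^ j)"
    using simple_extension_span[OF R0 order.refl, of z "p ^ m" x] z_pow R0.C_1 p_pos x by auto
  have aR: "a j \<in> R" for j using a(1) by (rule simple_extension_base)
  define c where "c = (\<Sum>j<p ^ m. a j)"
  define w where "w = - (\<Sum>j<p ^ m. a j * (\<Sum>l<j. z ^ l))"
  have w: "w \<in> R" unfolding w_def using aR z_R by (intro R.C_intros)
  have xc: "x = c + (1 - z) * w"
  proof -
    have "c - x = (\<Sum>j<p ^ m. a j * (1 - z ^ j))" unfolding a(2) c_def by (simp add: sum_subtractf algebra_simps)
    also have "\<dots> = - ((1 - z) * w)"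
      unfolding w_def one_minus_z_power by (simp add: sum_distrib_left mult_ac)
    finally show ?thesis by (simp add: algebra_simps)
  qed
  have "c \<in> R0" unfolding c_def using a(1) by (intro R0.C_intros)
  from R0_local[OF this] show ?thesis
  proof
    assume "\<exists>y\<in>R0. c = of_nat p * y"
    then obtain y where y: "y \<in> R0" "c = of_nat p * y" by blast
    obtain b where b: "b \<in> R" "of_nat p = (1 - z) * b" using p_eq_pi by blast
    have "x = (1 - z) * (b * y + w)" unfolding xc y(2) b(2) by (simp add: algebra_simps)
    moreover have "b * y + w \<in> R" using b w simple_extension_base[OF y(1)] by (intro R.C_intros)
    ultimately show ?thesis by blast
  next
    assume "\<exists>y\<in>R0. c * y = 1"
    then obtain y where y: "y \<in> R0" "c * y = 1" by blast
    have yR: "y \<in> R" using y(1) by (rule simple_extension_base)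
    obtain u where u: "u \<in> R" "(1 + (1 - z) * (w * y)) * u = 1" using one_plus_pi_unit[OF R.C_mult[OF w yR]] by blast
    have "x * (y * u) = (c * y + (1 - z) * (w * y)) * u" unfolding xc by (simp add: algebra_simps)
    then have "x * (y * u) = 1" unfolding y(2) u(2) .
    then show ?thesis using R.C_mult[OF yR u(1)] by blast
  qed
qed

end

subsection \<open>Power series over a local ring\<close>

lemma ps_ring_nth: "f \<in> ps_ring R \<Longrightarrow> fps_nth f i \<in> R"
  by (simp add: ps_ring_def)

lemma ps_ring_closed:
  assumes "closed_subring R"
  shows "closed_subring (ps_ring R)"
proof -
  interpret closed_subring R by (rule assms)
  show ?thesis
    by unfold_locales (auto simp: ps_ring_def fps_mult_nth intro: C_intros)
qed

lemma ps_ring_const: "0 \<in> R \<Longrightarrow> c \<in> R \<Longrightarrow> fps_const c \<in> ps_ring R"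
  by (simp add: ps_ring_def)

lemma ps_ring_X: "0 \<in> R \<Longrightarrow> 1 \<in> R \<Longrightarrow> fps_X \<in> ps_ring R"
  by (simp add: ps_ring_def)

lemma ps_ring_shift: "f \<in> ps_ring R \<Longrightarrow> fps_shift n f \<in> ps_ring R"
  by (simp add: ps_ring_def)

lemma fps_one_plus_X_power_nth: "fps_nth ((1 + fps_X) ^ n) i = (of_nat (n choose i) :: 'a::field_char_0)"
proof -
  have "fps_nth ((1 + fps_X) ^ n) i = fps_nth (fps_binomial (of_nat n :: 'a)) i" by (simp only: fps_binomial_of_nat)
  then show ?thesis by (simp add: binomial_gbinomial)
qed

locale residue_ring = closed_subring R for R :: "'k::field_char_0 set" +
  fixes \<pi> :: 'k and p :: nat
  assumes p: "prime p" and pi_R: "\<pi> \<in> R" and p_pi: "\<exists>y\<in>R. of_nat p = \<pi> * y"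
    and pi_not_unit: "\<And>y. y \<in> R \<Longrightarrow> \<pi> * y \<noteq> 1"
    and R_local: "\<And>x. x \<in> R \<Longrightarrow> (\<exists>y\<in>R. x = \<pi> * y) \<or> (\<exists>y\<in>R. x * y = 1)"
begin

definition J where "J = {\<pi> * y | y. y \<in> R}"

lemma J_0: "0 \<in> J" unfolding J_def using C_0 by force

lemma J_add: "x \<in> J \<Longrightarrow> y \<in> J \<Longrightarrow> x + y \<in> J"
  unfolding J_def by (auto simp: distrib_left[symmetric] intro: C_add)

lemma J_mult: "x \<in> J \<Longrightarrow> y \<in> R \<Longrightarrow> x * y \<in> J"
  unfolding J_def by (auto simp: mult.assoc intro: C_mult)

lemma J_mult': "x \<in> R \<Longrightarrow> y \<in> J \<Longrightarrow> x * y \<in> J"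
  using J_mult[of y x] by (simp add: mult.commute)

lemma J_uminus: "x \<in> J \<Longrightarrow> - x \<in> J"
  using J_mult[of x "-1"] C_uminus[OF C_1] by simp

lemma J_diff: "x \<in> J \<Longrightarrow> y \<in> J \<Longrightarrow> x - y \<in> J"
  using J_add[of x "- y"] J_uminus by simp

lemma J_sum: "(\<And>i. i \<in> S \<Longrightarrow> f i \<in> J) \<Longrightarrow> sum f S \<in> J"
  by (induction S rule: infinite_finite_induct) (auto intro: J_0 J_add)

lemma p_J: "of_nat p \<in> J" using p_pi by (auto simp: J_def)

lemma one_notin_J: "1 \<notin> J" using pi_not_unit by (auto simp: J_def)

lemma J_prime: "x \<in> R \<Longrightarrow> y \<in> R \<Longrightarrow> x * y \<in> J \<Longrightarrow> x \<in> J \<or> y \<in> J"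
proof (rule ccontr)
  assume xy: "x \<in> R" "y \<in> R" "x * y \<in> J" "\<not> (x \<in> J \<or> y \<in> J)"
  then obtain x' y' where u: "x' \<in> R" "x * x' = 1" "y' \<in> R" "y * y' = 1"
    using R_local[of x] R_local[of y] unfolding J_def by blast
  have "(x * y) * (x' * y') \<in> J" by (rule J_mult[OF xy(3) C_mult[OF u(1,3)]])
  also have "(x * y) * (x' * y') = (x * x') * (y * y')" by (simp only: mult_ac)
  finally show False using u one_notin_J by simp
qed

lemma J_power: "x \<in> R \<Longrightarrow> x ^ n \<in> J \<Longrightarrow> x \<in> J"
proof (induction n)
  case 0
  then show ?case using one_notin_J by simp
next
  case (Suc n)
  then show ?case using J_prime[of x "x ^ n"] by (auto intro: C_power)
qed

lemma ps_J_iff: "f \<in> ps_ring J \<longleftrightarrow> (\<exists>h\<in>ps_ring R. f = fps_const \<pi> * h)"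
proof
  assume "f \<in> ps_ring J"
  then have "\<forall>i. \<exists>y. y \<in> R \<and> fps_nth f i = \<pi> * y" by (auto simp: ps_ring_def J_def)
  from choice[OF this] obtain h where "\<forall>i. h i \<in> R \<and> fps_nth f i = \<pi> * h i" by (rule exE)
  then show "\<exists>h\<in>ps_ring R. f = fps_const \<pi> * h"
    by (intro bexI[of _ "Abs_fps h"]) (simp_all add: ps_ring_def fps_eq_iff)
qed (auto simp: ps_ring_def J_def)

lemma ps_J_mult: "f \<in> ps_ring J \<Longrightarrow> h \<in> ps_ring R \<Longrightarrow> f * h \<in> ps_ring J"
  by (auto simp: ps_ring_def fps_mult_nth intro: J_sum J_mult)

text \<open>Gauss's argument: the product of the first coefficients outside \<open>J\<close> is,
  modulo \<open>J\<close>, a coefficient of the product series.\<close>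

lemma ps_J_prime:
  assumes f: "f \<in> ps_ring R" and h: "h \<in> ps_ring R" and fh: "f * h \<in> ps_ring J"
  shows "f \<in> ps_ring J \<or> h \<in> ps_ring J"
proof (rule ccontr)
  assume "\<not> (f \<in> ps_ring J \<or> h \<in> ps_ring J)"
  then have ex: "\<exists>i. fps_nth f i \<notin> J" "\<exists>i. fps_nth h i \<notin> J" by (auto simp: ps_ring_def)
  define i0 where "i0 = (LEAST i. fps_nth f i \<notin> J)"
  define j0 where "j0 = (LEAST i. fps_nth h i \<notin> J)"
  have i0: "fps_nth f i0 \<notin> J" unfolding i0_def by (rule LeastI_ex[OF ex(1)])
  have j0: "fps_nth h j0 \<notin> J" unfolding j0_def by (rule LeastI_ex[OF ex(2)])
  have fi: "fps_nth f i \<in> J" if "i < i0" for i using not_less_Least[OF that[unfolded i0_def]] by blast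
  have hj: "fps_nth h i \<in> J" if "i < j0" for i using not_less_Least[OF that[unfolded j0_def]] by blast
  define t where "t = (\<lambda>i. fps_nth f i * fps_nth h (i0 + j0 - i))"
  have t: "t i \<in> J" if "i \<in> {0..i0 + j0} - {i0}" for i
  proof (cases "i < i0")
    case True
    then show ?thesis unfolding t_def using ps_ring_nth[OF h] by (intro J_mult fi)
  next
    case False
    then have "i0 + j0 - i < j0" using that by auto
    then show ?thesis unfolding t_def using ps_ring_nth[OF f] by (intro J_mult' hj)
  qed
  have "fps_nth (f * h) (i0 + j0) = t i0 + (\<Sum>i\<in>{0..i0 + j0} - {i0}. t i)"
    unfolding fps_mult_nth t_def by (rule sum.remove) auto
  then have "t i0 = fps_nth (f * h) (i0 + j0) - (\<Sum>i\<in>{0..i0 + j0} - {i0}. t i)" by simp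
  also have "\<dots> \<in> J" using ps_ring_nth[OF fh] t by (intro J_diff J_sum)
  finally show False using J_prime[OF ps_ring_nth[OF f] ps_ring_nth[OF h], of i0 j0] i0 j0 by (simp add: t_def)
qed

lemma ps_unit:
  assumes f: "f \<in> ps_ring R" and y: "y \<in> R" "fps_nth f 0 * y = 1"
  shows "\<exists>h\<in>ps_ring R. f * h = 1"
proof
  have f0: "fps_nth f 0 \<noteq> 0" using y by auto
  then have inv: "f * inverse f = 1" by (simp add: inverse_mult_eq_1')
  then show "f * inverse f = 1" .
  have "fps_nth (inverse f) n \<in> R" for n
  proof (induction n rule: less_induct)
    case (less n)
    have "fps_nth f 0 * fps_nth (inverse f) n + (\<Sum>i\<in>{0..n} - {0}. fps_nth f i * fps_nth (inverse f) (n - i)) = fps_nth (1 :: 'k fps) n"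
      unfolding inv[symmetric] fps_mult_nth by (subst sum.remove[of "{0..n}" 0]) auto
    then have "fps_nth f 0 * fps_nth (inverse f) n = fps_nth 1 n - (\<Sum>i\<in>{0..n} - {0}. fps_nth f i * fps_nth (inverse f) (n - i))"
      by (simp add: eq_diff_eq)
    moreover have "fps_nth (1 :: 'k fps) n - (\<Sum>i\<in>{0..n} - {0}. fps_nth f i * fps_nth (inverse f) (n - i)) \<in> R"
      using ps_ring_nth[OF f] less C_0 C_1 by (intro C_diff C_sum C_mult) auto
    ultimately have "fps_nth f 0 * fps_nth (inverse f) n \<in> R" by (simp only:)
    then have "y * (fps_nth f 0 * fps_nth (inverse f) n) \<in> R" by (rule C_mult[OF y(1)])
    moreover have "y * (fps_nth f 0 * fps_nth (inverse f) n) = (fps_nth f 0 * y) * fps_nth (inverse f) n" by (simp only: mult_ac)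
    ultimately show ?case using y(2) by simp
  qed
  then show "inverse f \<in> ps_ring R" by (simp add: ps_ring_def)
qed

lemma ps_local:
  assumes f: "f \<in> ps_ring R"
  shows "(\<exists>a\<in>ps_ring R. \<exists>b\<in>ps_ring R. f = fps_const \<pi> * a + fps_X * b) \<or> (\<exists>h\<in>ps_ring R. f * h = 1)"
  using R_local[OF ps_ring_nth[OF f, of 0]]
proof
  assume "\<exists>y\<in>R. fps_nth f 0 = \<pi> * y"
  then obtain y where y: "y \<in> R" "fps_nth f 0 = \<pi> * y" by blast
  have "f = fps_const \<pi> * fps_const y + fps_X * fps_shift 1 f"
    by (rule fps_ext) (simp add: y(2) One_nat_def)
  then show ?thesis using ps_ring_const[OF C_0 y(1)] ps_ring_shift[OF f] by blast
qed (use ps_unit[OF f] in blast)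

lemma ps_not_unit: "a \<in> ps_ring R \<Longrightarrow> fps_const \<pi> * a + fps_X * b \<noteq> 1"
proof
  assume a: "a \<in> ps_ring R" and "fps_const \<pi> * a + fps_X * b = 1"
  then have "fps_nth (fps_const \<pi> * a + fps_X * b) 0 = 1" by simp
  then show False using pi_not_unit[OF ps_ring_nth[OF a, of 0]] by simp
qed

text \<open>The matrix of the \<open>j choose i\<close> is unitriangular, so the system is solved
  from the largest index downwards.\<close>

lemma binomial_triangular:
  assumes e: "\<And>i. i < q \<Longrightarrow> (\<Sum>j<q. e j * of_nat (j choose i)) \<in> J" and eR: "\<And>j. e j \<in> R" and j: "j < q"
  shows "e j \<in> J"
  using j
proof (induction "q - j" arbitrary: j rule: less_induct)
  case less
  have "(\<Sum>i<q. e i * of_nat (i choose j)) = e j + (\<Sum>i\<in>{..<q} - {j}. e i * of_nat (i choose j))"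
    using less.prems by (subst sum.remove[of _ j]) auto
  then have "e j = (\<Sum>i<q. e i * of_nat (i choose j)) - (\<Sum>i\<in>{..<q} - {j}. e i * of_nat (i choose j))" by simp
  also have "\<dots> \<in> J"
  proof (rule J_diff[OF e[OF less.prems] J_sum])
    fix i assume i: "i \<in> {..<q} - {j}"
    show "e i * of_nat (i choose j) \<in> J"
    proof (cases "i < j")
      case True
      then show ?thesis by (simp add: binomial_eq_0 J_0)
    next
      case False
      then have "e i \<in> J" using i less.prems by (intro less.hyps) auto
      then show ?thesis by (intro J_mult C_of_nat)
    qed
  qed
  finally show ?case .
qed

text \<open>Coefficients of the \<open>c j\<close> are treated in increasing order \<open>k\<close>.
  Once the lower ones are discarded, the \<open>q\<close>-th power of the rest starts in degree
  \<open>k * q\<close>, and within the next \<open>q\<close> degrees only the \<open>q\<close>-th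
  power of its first coefficient is visible, spread by \<open>(1 + T) ^ j\<close> with binomial
  weights.\<close>

lemma ps_frobenius_basis:
  assumes c: "\<And>j. c j \<in> ps_ring R" and S: "(\<Sum>j<p ^ m. c j ^ (p ^ m) * (1 + fps_X) ^ j) \<in> ps_ring J"
    and i: "i < p ^ m"
  shows "c i \<in> ps_ring J"
proof -
  interpret P: closed_subring "ps_ring R" by (rule ps_ring_closed) unfold_locales
  define q where "q = p ^ m"
  have q: "q > 0" using prime_gt_0_nat[OF p] by (simp add: q_def)
  have X1: "(1 + fps_X) ^ j \<in> ps_ring R" for j using ps_ring_X[OF C_0 C_1] by (intro P.C_intros)
  have "\<forall>j<q. fps_nth (c j) k \<in> J" for k
  proof (induction k rule: less_induct)
    case (less k)
    define e where "e = (\<lambda>j. fps_shift k (c j))"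
    define l where "l = (\<lambda>j. fps_cutoff k (c j))"
    have e: "e j \<in> ps_ring R" for j unfolding e_def by (rule ps_ring_shift[OF c])
    have l: "l j \<in> ps_ring J" if "j < q" for j using less.IH that by (auto simp: l_def ps_ring_def J_0)
    have cj: "c j = e j * fps_X ^ k + l j" for j
      by (rule fps_ext) (simp add: e_def l_def fps_X_power_mult_right_nth)
    have eX: "e j * fps_X ^ k \<in> ps_ring R" for j using ps_ring_X[OF C_0 C_1] by (intro P.C_intros e)
    have low: "c j ^ q - e j ^ q * fps_X ^ (k * q) \<in> ps_ring J" if "j < q" for j
    proof -
      have "c j ^ q - (e j * fps_X ^ k) ^ q = (c j - e j * fps_X ^ k) * (\<Sum>i<q. (e j * fps_X ^ k) ^ (q - Suc i) * c j ^ i)"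
        by (rule power_diff_sumr2)
      also have "c j - e j * fps_X ^ k = l j" by (subst cj) simp
      also have "l j * (\<Sum>i<q. (e j * fps_X ^ k) ^ (q - Suc i) * c j ^ i) \<in> ps_ring J"
        by (intro ps_J_mult l that P.C_sum P.C_mult P.C_power eX c)
      finally show ?thesis by (simp add: power_mult_distrib power_mult)
    qed
    define W where "W = (\<Sum>j<q. e j ^ q * (1 + fps_X) ^ j)"
    have "fps_nth (fps_X ^ (k * q) * W) n \<in> J" for n
    proof -
      have "fps_X ^ (k * q) * W = (\<Sum>j<q. c j ^ q * (1 + fps_X) ^ j) - (\<Sum>j<q. (c j ^ q - e j ^ q * fps_X ^ (k * q)) * (1 + fps_X) ^ j)"
        unfolding W_def sum_distrib_left sum_subtractf[symmetric] by (intro sum.cong refl) (simp add: algebra_simps)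
      then have "fps_nth (fps_X ^ (k * q) * W) n = fps_nth (\<Sum>j<q. c j ^ q * (1 + fps_X) ^ j) n -
          (\<Sum>j<q. fps_nth ((c j ^ q - e j ^ q * fps_X ^ (k * q)) * (1 + fps_X) ^ j) n)"
        by (simp add: fps_sum_nth)
      also have "\<dots> \<in> J"
        using ps_ring_nth[OF S] by (intro J_diff J_sum ps_ring_nth[OF ps_J_mult[OF low X1]]) (simp_all add: q_def)
      finally show ?thesis .
    qed
    then have W: "fps_nth W n \<in> J" for n
      by (metis add_diff_cancel_right' fps_X_power_mult_nth not_add_less2)
    have "\<exists>w\<in>ps_ring R. \<exists>w'\<in>ps_ring R. e j ^ q = fps_const (fps_nth (e j) 0 ^ q) + fps_X ^ q * w + of_nat p * w'" for j
    proof -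
      define x where "x = (\<lambda>i :: nat. if i = 0 then fps_const (fps_nth (e j) 0) else fps_X * fps_shift 1 (e j))"
      have "\<exists>w'\<in>ps_ring R. (\<Sum>i\<in>{0, 1}. x i) ^ (p ^ m) = (\<Sum>i\<in>{0, 1}. x i ^ (p ^ m)) + of_nat p * w'"
        using ps_ring_shift[OF e] ps_ring_X[OF C_0 C_1] ps_ring_const[OF C_0 ps_ring_nth[OF e]]
        by (intro P.freshman_sum_power[OF p]) (auto simp: x_def intro: P.C_mult)
      then obtain w' where w': "w' \<in> ps_ring R" "(\<Sum>i\<in>{0, 1}. x i) ^ q = (\<Sum>i\<in>{0, 1}. x i ^ q) + of_nat p * w'"
        unfolding q_def by (rule bexE)
      have "e j = fps_const (fps_nth (e j) 0) + fps_X * fps_shift 1 (e j)"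
        by (rule fps_ext) (simp add: One_nat_def)
      then have "(\<Sum>i\<in>{0, 1}. x i) = e j" by (simp add: x_def)
      moreover have "(\<Sum>i\<in>{0, 1}. x i ^ q) = fps_const (fps_nth (e j) 0 ^ q) + fps_X ^ q * fps_shift 1 (e j) ^ q"
        by (simp add: x_def power_mult_distrib fps_const_power)
      moreover have "fps_shift 1 (e j) ^ q \<in> ps_ring R" by (intro P.C_power ps_ring_shift e)
      ultimately show ?thesis using w' by auto
    qed
    then have "\<forall>j. \<exists>w w'. w \<in> ps_ring R \<and> w' \<in> ps_ring R \<and>
        e j ^ q = fps_const (fps_nth (e j) 0 ^ q) + fps_X ^ q * w + of_nat p * w'"
      by blast
    then obtain w w' where w: "\<And>j. w j \<in> ps_ring R" "\<And>j. w' j \<in> ps_ring R"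
      "\<And>j. e j ^ q = fps_const (fps_nth (e j) 0 ^ q) + fps_X ^ q * w j + of_nat p * w' j"
      by metis
    have tri: "(\<Sum>j<q. fps_nth (e j) 0 ^ q * of_nat (j choose i)) \<in> J" if i: "i < q" for i
    proof -
      have "e j ^ q * (1 + fps_X) ^ j = fps_const (fps_nth (e j) 0 ^ q) * (1 + fps_X) ^ j
          + fps_X ^ q * (w j * (1 + fps_X) ^ j) + fps_const (of_nat p) * (w' j * (1 + fps_X) ^ j)" for j
        unfolding w(3) by (simp add: fps_of_nat algebra_simps)
      then have "fps_nth (e j ^ q * (1 + fps_X) ^ j) i = fps_nth (e j) 0 ^ q * of_nat (j choose i)
          + of_nat p * fps_nth (w' j * (1 + fps_X) ^ j) i" for j
        using i by (simp add: fps_X_power_mult_nth fps_one_plus_X_power_nth)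
      then have "fps_nth W i = (\<Sum>j<q. fps_nth (e j) 0 ^ q * of_nat (j choose i)) + (\<Sum>j<q. of_nat p * fps_nth (w' j * (1 + fps_X) ^ j) i)"
        unfolding W_def by (simp add: fps_sum_nth sum.distrib)
      then have "(\<Sum>j<q. fps_nth (e j) 0 ^ q * of_nat (j choose i)) = fps_nth W i - (\<Sum>j<q. of_nat p * fps_nth (w' j * (1 + fps_X) ^ j) i)"
        by simp
      also have "\<dots> \<in> J"
        by (intro J_diff W J_sum J_mult p_J ps_ring_nth[OF P.C_mult[OF w(2) X1]])
      finally show ?thesis .
    qed
    show ?case
    proof (intro allI impI)
      fix j assume j: "j < q"
      have "fps_nth (e j) 0 ^ q \<in> J"
        by (rule binomial_triangular[OF tri _ j]) (simp_all add: ps_ring_nth[OF e] C_power)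
      then have "fps_nth (e j) 0 \<in> J" by (rule J_power[OF ps_ring_nth[OF e]])
      then show "fps_nth (c j) k \<in> J" by (simp add: e_def)
    qed
  qed
  then show ?thesis using i by (simp add: ps_ring_def q_def)
qed

end

lemma (in cyclotomic_integers) residue_ring: "residue_ring R (1 - z) p"
  by unfold_locales (use p(1) p_eq_pi pi_not_unit R_local z_R in \<open>auto intro: R.C_intros\<close>)

lemma ps_ring_span:
  assumes "\<And>x. x \<in> R \<Longrightarrow> \<exists>c. (\<forall>j. c j \<in> S) \<and> x = (\<Sum>j<n. c j * z ^ j)" and f: "f \<in> ps_ring R"
  shows "\<exists>c. (\<forall>j. c j \<in> ps_ring S) \<and> f = (\<Sum>j<n. c j * fps_const z ^ j)"
proof -
  have "\<forall>i. \<exists>c. (\<forall>j. c j \<in> S) \<and> fps_nth f i = (\<Sum>j<n. c j * z ^ j)"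
    using assms(1)[OF ps_ring_nth[OF f]] by blast
  from choice[OF this] obtain c where c: "\<forall>i. (\<forall>j. c i j \<in> S) \<and> fps_nth f i = (\<Sum>j<n. c i j * z ^ j)" by (rule exE)
  define c' where "c' = (\<lambda>j. Abs_fps (\<lambda>i. c i j))"
  have "f = (\<Sum>j<n. c' j * fps_const z ^ j)"
    by (rule fps_ext) (use c in \<open>simp add: c'_def fps_sum_nth fps_const_power\<close>)
  moreover have "\<forall>j. c' j \<in> ps_ring S" using c by (simp add: c'_def ps_ring_def)
  ultimately show ?thesis by blast
qed

subsection \<open>The concrete order\<close>

lemma fps_to_fls_sum: "fps_to_fls (sum f S) = (\<Sum>i\<in>S. fps_to_fls (f i))"
  for f :: "'b \<Rightarrow> 'a::comm_ring_1 fps"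
  by (induction S rule: infinite_finite_induct) simp_all

lemma ring_iso_subring_of_type:
  assumes g: "g \<in> ring_iso (subring_of_type S) (subring_of_type S)" and x: "x \<in> S"
  shows "g x \<in> S" and "y \<in> S \<Longrightarrow> g (x + y) = g x + g y" and "y \<in> S \<Longrightarrow> g (x * y) = g x * g y"
  using g x by (auto simp: ring_iso_def Ring.ring_hom_def subring_of_type_def ring_of_type_algebra_def Pi_iff)

text \<open>Power series are viewed inside Laurent series, because \<open>cyclotomic_order\<close>
  wants \<open>A\<close>, \<open>B\<close> and the fraction field inside one field. Its axioms on Pi
  come from the residue ring modulo \<open>1 - z\<close>.\<close>

lemma cyclotomic_order_power_series:
  fixes R0 :: "'k::field_char_0 set" and p r s :: nat and z :: 'k and g :: "'k fls \<Rightarrow> 'k fls"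
  defines "R1 \<equiv> ring.simple_extension amb R0 (z ^ (p ^ s))" and "R \<equiv> ring.simple_extension amb R0 z"
  assumes z: "cyclotomic_integers R0 p (r + s) z" and r: "r \<ge> 1" and s: "s \<ge> 1"
    and g: "g \<in> ring_iso (subring_of_type (frac_field (ps_ring R))) (subring_of_type (frac_field (ps_ring R)))"
    and gA: "\<And>a. a \<in> frac_field (ps_ring R1) \<Longrightarrow> g a = a"
    and gz: "g (fls_const z) = fls_const (z ^ (1 + p ^ r))"
  shows "cyclotomic_order p r s (fps_to_fls ` ps_ring R1) (fps_to_fls ` ps_ring R) (frac_field (ps_ring R)) (fls_const z) fls_X g"
proof -
  interpret C: cyclotomic_integers R0 p "r + s" z by (rule z)
  interpret Q: residue_ring C.R "1 - z" p by (rule C.residue_ring)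
  have R1: "closed_subring R1" unfolding R1_def by (rule simple_extension_closed[OF C.R0])
  interpret R1: closed_subring R1 by (rule R1)
  interpret PA: closed_subring "ps_ring R1" by (rule ps_ring_closed[OF R1])
  interpret PB: closed_subring "ps_ring R" unfolding R_def by (rule ps_ring_closed) unfold_locales
  have R1_R: "x \<in> R" if "x \<in> R1" for x
    using that unfolding R1_def
  proof (induction x rule: simple_extension_induct)
    case (lin x y)
    then show ?case unfolding R_def
      by (intro C.R.C_add[OF C.R.C_mult[OF _ C.R.C_power[OF C.z_R]] simple_extension_base])
  qed (simp add: R_def C.R.C_0)
  have A_B: "f \<in> ps_ring R" if "f \<in> ps_ring R1" for f using that R1_R by (auto simp: ps_ring_def)
  have pi: "1 - fls_const z = fps_to_fls (fps_const (1 - z))"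
    by (simp only: fps_const_to_fls fls_minus_const[symmetric] fls_const_1)
  have R0_R1: "R0 \<subseteq> R1" unfolding R1_def by (auto intro: simple_extension_base)
  have zR1: "z ^ (p ^ s) \<in> R1" unfolding R1_def using C.R0.C_1 C.R0.C_0 by (rule simple_extension_gen)
  have lift: "fps_to_fls f \<in> fps_to_fls ` ps_ring R \<longleftrightarrow> f \<in> ps_ring R" for f by (auto simp: image_iff)
  show ?thesis
  proof unfold_locales
    show "prime p" "odd p" "r \<ge> 1" "s \<ge> 1" using C.p r s by auto
    show "x \<in> fps_to_fls ` ps_ring R" if "x \<in> fps_to_fls ` ps_ring R1" for x using that A_B by blast
    show "x \<in> frac_field (ps_ring R)" if x: "x \<in> fps_to_fls ` ps_ring R" for x
    proof -
      obtain f where f: "f \<in> ps_ring R" "x = fps_to_fls f" using x by blast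
      show ?thesis unfolding frac_field_def f(2)
        by (intro CollectI exI[of _ f] exI[of _ 1] conjI f(1) PB.C_1) simp_all
    qed
    show "1 \<in> fps_to_fls ` ps_ring R1" using PA.C_1 by (intro image_eqI[of _ _ 1]) simp_all
    show "x + y \<in> fps_to_fls ` ps_ring R1" if "x \<in> fps_to_fls ` ps_ring R1" "y \<in> fps_to_fls ` ps_ring R1" for x y
      using that PA.C_add by (auto simp: fps_to_fls_plus[symmetric] simp del: fps_to_fls_plus)
    show "x * y \<in> fps_to_fls ` ps_ring R1" if "x \<in> fps_to_fls ` ps_ring R1" "y \<in> fps_to_fls ` ps_ring R1" for x y
      using that PA.C_mult by (auto simp: fls_times_fps_to_fls[symmetric])
    show "- x \<in> fps_to_fls ` ps_ring R1" if "x \<in> fps_to_fls ` ps_ring R1" for x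
      using that PA.C_uminus by (auto simp: fps_to_fls_uminus[symmetric] simp del: fps_to_fls_uminus)
    show "x + y \<in> fps_to_fls ` ps_ring R" if "x \<in> fps_to_fls ` ps_ring R" "y \<in> fps_to_fls ` ps_ring R" for x y
      using that PB.C_add by (auto simp: fps_to_fls_plus[symmetric] simp del: fps_to_fls_plus)
    show "x * y \<in> fps_to_fls ` ps_ring R" if "x \<in> fps_to_fls ` ps_ring R" "y \<in> fps_to_fls ` ps_ring R" for x y
      using that PB.C_mult by (auto simp: fls_times_fps_to_fls[symmetric])
    show "- x \<in> fps_to_fls ` ps_ring R" if "x \<in> fps_to_fls ` ps_ring R" for x
      using that PB.C_uminus by (auto simp: fps_to_fls_uminus[symmetric] simp del: fps_to_fls_uminus)
    show "x \<in> frac_field (ps_ring R) \<longleftrightarrow> (\<exists>b\<in>fps_to_fls ` ps_ring R. \<exists>c\<in>fps_to_fls ` ps_ring R. c \<noteq> 0 \<and> x = b / c)" for x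
      unfolding frac_field_def by auto
    show "fls_X \<in> fps_to_fls ` ps_ring R1"
      using ps_ring_X[OF R1.C_0 R1.C_1] by (intro image_eqI[of _ _ fps_X]) simp_all
    show "fls_const z \<in> fps_to_fls ` ps_ring R"
      using ps_ring_const[OF C.R.C_0 C.z_R] unfolding R_def by (intro image_eqI[of _ _ "fps_const z"]) simp_all
    show "fls_const z ^ (p ^ s) \<in> fps_to_fls ` ps_ring R1"
      using ps_ring_const[OF R1.C_0 zR1] by (intro image_eqI[of _ _ "fps_const (z ^ (p ^ s))"]) (simp_all add: fls_const_power)
    show "fls_const z ^ (p ^ (r + s)) = 1" unfolding fls_const_power[symmetric] C.z_pow by simp
    show "fls_const z ^ (p ^ (r + s - 1)) \<noteq> 1"
      using C.z_ne unfolding fls_const_power[symmetric] fls_const_1[symmetric] by (metis fls_const_nth)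
    show "\<exists>c. (\<forall>j. c j \<in> fps_to_fls ` ps_ring R1) \<and> b = (\<Sum>j<p ^ s. c j * fls_const z ^ j)"
      if b: "b \<in> fps_to_fls ` ps_ring R" for b
    proof -
      obtain f where f: "f \<in> ps_ring R" "b = fps_to_fls f" using b by blast
      have sp: "\<exists>c. (\<forall>j. c j \<in> R1) \<and> x = (\<Sum>j<p ^ s. c j * z ^ j)" if "x \<in> R" for x
        using that C.p_pos unfolding R_def by (intro simple_extension_span[OF R1 R0_R1 zR1]) simp_all
      have "\<exists>c. (\<forall>j. c j \<in> ps_ring R1) \<and> f = (\<Sum>j<p ^ s. c j * fps_const z ^ j)"
        by (rule ps_ring_span[OF _ f(1)]) (rule sp)
      then obtain c where c: "\<forall>j. c j \<in> ps_ring R1" "f = (\<Sum>j<p ^ s. c j * fps_const z ^ j)"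
        by (elim exE conjE)
      have "b = (\<Sum>j<p ^ s. fps_to_fls (c j) * fls_const z ^ j)"
        unfolding f(2) c(2) by (simp only: fps_to_fls_sum fls_times_fps_to_fls fps_to_fls_power fps_const_to_fls)
      then show ?thesis using c(1) by (intro exI[of _ "\<lambda>j. fps_to_fls (c j)"]) simp
    qed
    show "(1 - fls_const z) * b + fls_X * c \<noteq> 1"
      if bc: "b \<in> fps_to_fls ` ps_ring R" "c \<in> fps_to_fls ` ps_ring R" for b c
    proof
      assume eq: "(1 - fls_const z) * b + fls_X * c = 1"
      obtain f h where f: "f \<in> ps_ring R" "b = fps_to_fls f" "c = fps_to_fls h" using bc by blast
      have "fps_to_fls (fps_const (1 - z) * f + fps_X * h) = fps_to_fls 1"
        using eq unfolding pi f by (simp only: fps_to_fls_plus fls_times_fps_to_fls fps_X_to_fls fps_one_to_fls)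
      then have "fps_const (1 - z) * f + fps_X * h = 1" by (simp only: fps_to_fls_eq_iff)
      then show False using Q.ps_not_unit[of f h] f(1) unfolding R_def by blast
    qed
    show "(\<exists>b\<in>fps_to_fls ` ps_ring R. \<exists>c\<in>fps_to_fls ` ps_ring R. x = (1 - fls_const z) * b + fls_X * c) \<or>
        (\<exists>y\<in>fps_to_fls ` ps_ring R. x * y = 1)" if x: "x \<in> fps_to_fls ` ps_ring R" for x
    proof -
      obtain f where f: "f \<in> ps_ring R" "x = fps_to_fls f" using x by blast
      from Q.ps_local[OF f(1)[unfolded R_def]] show ?thesis
      proof
        assume "\<exists>a\<in>ps_ring C.R. \<exists>b\<in>ps_ring C.R. f = fps_const (1 - z) * a + fps_X * b"
        then obtain a b where ab: "a \<in> ps_ring C.R" "b \<in> ps_ring C.R" "f = fps_const (1 - z) * a + fps_X * b" by blast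
        have "x = (1 - fls_const z) * fps_to_fls a + fls_X * fps_to_fls b"
          unfolding f(2) ab(3) pi by (simp only: fps_to_fls_plus fls_times_fps_to_fls fps_X_to_fls)
        then show ?thesis using ab(1,2) unfolding R_def by blast
      next
        assume "\<exists>h\<in>ps_ring C.R. f * h = 1"
        then obtain h where h: "h \<in> ps_ring C.R" "f * h = 1" by blast
        have "x * fps_to_fls h = 1" unfolding f(2) fls_times_fps_to_fls[symmetric] h(2) by simp
        then show ?thesis using h(1) unfolding R_def by blast
      qed
    qed
    show "(\<exists>b\<in>fps_to_fls ` ps_ring R. x = (1 - fls_const z) * b) \<or> (\<exists>b\<in>fps_to_fls ` ps_ring R. y = (1 - fls_const z) * b)"
      if xy: "x \<in> fps_to_fls ` ps_ring R" "y \<in> fps_to_fls ` ps_ring R" "b \<in> fps_to_fls ` ps_ring R"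
        "x * y = (1 - fls_const z) * b" for x y b
    proof -
      obtain f h k where f: "f \<in> ps_ring R" "x = fps_to_fls f" "h \<in> ps_ring R" "y = fps_to_fls h"
        "k \<in> ps_ring R" "b = fps_to_fls k" using xy by blast
      have "f * h = fps_const (1 - z) * k"
        using xy(4) unfolding f(2,4,6) pi fls_times_fps_to_fls[symmetric] fps_to_fls_eq_iff .
      then have "f * h \<in> ps_ring Q.J" unfolding Q.ps_J_iff using f(5) unfolding R_def by blast
      then have "f \<in> ps_ring Q.J \<or> h \<in> ps_ring Q.J" using f(1,3) unfolding R_def by (intro Q.ps_J_prime)
      then show ?thesis unfolding Q.ps_J_iff f(2,4) pi R_def by (auto simp: fls_times_fps_to_fls)
    qed
    show "\<exists>b\<in>fps_to_fls ` ps_ring R. c i = (1 - fls_const z) * b"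
      if h: "\<And>j. c j \<in> fps_to_fls ` ps_ring R1" "b \<in> fps_to_fls ` ps_ring R"
        "(\<Sum>j<p ^ m. c j ^ (p ^ m) * (1 + fls_X) ^ j) = (1 - fls_const z) * b" "i < p ^ m" for m c b i
    proof -
      have "\<forall>j. \<exists>f. f \<in> ps_ring R1 \<and> c j = fps_to_fls f" using h(1) by blast
      from choice[OF this] obtain f where f: "\<forall>j. f j \<in> ps_ring R1 \<and> c j = fps_to_fls (f j)" by (rule exE)
      have cf: "c j = fps_to_fls (f j)" and fR: "f j \<in> ps_ring C.R" for j
        using f A_B unfolding R_def by auto
      obtain k where k: "k \<in> ps_ring R" "b = fps_to_fls k" using h(2) by blast
      have "fps_to_fls (\<Sum>j<p ^ m. f j ^ (p ^ m) * (1 + fps_X) ^ j) = fps_to_fls (fps_const (1 - z) * k)"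
        using h(3) unfolding cf k(2) pi
        by (simp only: fps_to_fls_sum fls_times_fps_to_fls fps_to_fls_power fps_to_fls_plus fps_X_to_fls fps_one_to_fls)
      then have "(\<Sum>j<p ^ m. f j ^ (p ^ m) * (1 + fps_X) ^ j) = fps_const (1 - z) * k" unfolding fps_to_fls_eq_iff .
      then have "(\<Sum>j<p ^ m. f j ^ (p ^ m) * (1 + fps_X) ^ j) \<in> ps_ring Q.J"
        unfolding Q.ps_J_iff using k(1) unfolding R_def by blast
      then have "f i \<in> ps_ring Q.J" by (rule Q.ps_frobenius_basis[OF fR _ h(4)])
      then show ?thesis unfolding Q.ps_J_iff cf pi R_def by (auto simp: fls_times_fps_to_fls)
    qed
    show "g x \<in> frac_field (ps_ring R)" if "x \<in> frac_field (ps_ring R)" for x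
      by (rule ring_iso_subring_of_type(1)[OF g that])
    show "g (x + y) = g x + g y" if "x \<in> frac_field (ps_ring R)" "y \<in> frac_field (ps_ring R)" for x y
      by (rule ring_iso_subring_of_type(2)[OF g that])
    show "g (x * y) = g x * g y" if "x \<in> frac_field (ps_ring R)" "y \<in> frac_field (ps_ring R)" for x y
      by (rule ring_iso_subring_of_type(3)[OF g that])
    show "g x = x" if x: "x \<in> fps_to_fls ` ps_ring R1" for x
    proof (rule gA)
      obtain f where f: "f \<in> ps_ring R1" "x = fps_to_fls f" using x by blast
      show "x \<in> frac_field (ps_ring R1)" unfolding frac_field_def f(2)
        by (intro CollectI exI[of _ f] exI[of _ 1] conjI f(1) PA.C_1) simp_all
    qed
    show "g (fls_const z) = fls_const z ^ (1 + p ^ r)" using gz by (simp only: fls_const_power)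
  qed
qed

text \<open>The multiplication formula does not mention the coefficient ring, so restricting
  coefficients gives the cyclic algebra over the smaller ring, which is the form used by the
  locale.\<close>

lemma cyclic_order_cyclic_algebra:
  assumes "\<And>x. x \<in> S \<Longrightarrow> x \<in> K"
  shows "cyclic_order (cyclic_algebra K g N a) S N = cyclic_algebra S g N a"
proof -
  have "{x \<in> {x. (\<forall>j<N. x j \<in> K) \<and> (\<forall>j\<ge>N. x j = 0)}. \<forall>j<N. x j \<in> S} = {x. (\<forall>j<N. x j \<in> S) \<and> (\<forall>j\<ge>N. x j = 0)}"
    using assms by blast
  then show ?thesis unfolding cyclic_order_def cyclic_algebra_def
    by (simp only: partial_object.select_convs partial_object.update_convs)
qed

lemma reduced_norm_cyclic_algebra: "reduced_norm (cyclic_algebra K g N a) N d = reduced_norm (cyclic_algebra S g N a) N d"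
proof -
  have "monoid.mult (cyclic_algebra K g N a) = monoid.mult (cyclic_algebra S g N a)"
    unfolding cyclic_algebra_def by (simp only: monoid.select_convs)
  then show ?thesis by (simp only: reduced_norm_def splitting_matrix_def)
qed

theorem mainTheorem7:
  fixes p r s n w :: nat
    and Qp F :: "'k::field_char_0 set"
    and v :: "'k \<Rightarrow> real"
    and \<zeta> :: "nat \<Rightarrow> 'k"
    and \<OO> :: "nat \<Rightarrow> 'k set"
    and A B :: "'k fps set"
    and g :: "'k fls \<Rightarrow> 'k fls"
    and D \<Delta> :: "(nat \<Rightarrow> 'k fls) ring"
    and P d :: "nat \<Rightarrow> 'k fls"
  assumes "prime p" "odd p" "r \<ge> 1" "s \<ge> 1"
    and "is_padic_field p Qp v"
    and "finite_unramified Qp F v"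
    and "\<And>m. primitive_root (p ^ m) (\<zeta> m)"
    and "\<zeta> 0 = 1"
    and "\<And>m. \<zeta> (Suc m) ^ p = \<zeta> m"
    and "\<And>m. \<OO> m = ring.simple_extension amb (int_ring F v) (\<zeta> m)"
    and "A = ps_ring (\<OO> r)"
    and "B = ps_ring (\<OO> (r + s))"
    and "g \<in> ring_iso (subring_of_type (frac_field B)) (subring_of_type (frac_field B))"
    and "\<And>a. a \<in> frac_field A \<Longrightarrow> g a = a"
    and "g (fls_const (\<zeta> (r + s))) = fls_const (\<zeta> (r + s) ^ (1 + p ^ r))"
    and "D = cyclic_algebra (frac_field B) g (p ^ s) (1 + fls_X)"
    and "\<Delta> = cyclic_order D (fps_to_fls ` B) (p ^ s)"
    and "P = cyc_monom (fls_const (1 - \<zeta> (r + s))) 0"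
    and "w = weight p r n"
    and "d \<in> Units \<Delta>"
    and "reduced_norm D (p ^ s) d = 1"
    and "is_level \<Delta> P d n"
    and "\<And>z. z \<in> Pi_commutator_products D \<Delta> P \<Longrightarrow> \<not> cong_mod_power \<Delta> P (n + 1) d z"
  shows "p ^ r - 1 \<le> n \<and> n < p ^ (r + s - 1) \<and>
         ((\<exists>t. has_type p r n t \<and> t < w \<and> w \<le> s - 1) \<or>
          (exceptional p r n \<and> has_type p r n w \<and> w < s - 1))"
proof -
  define z where "z = \<zeta> (r + s)"
  have "\<zeta> (m + k) ^ (p ^ k) = \<zeta> m" for m k
  proof (induction k)
    case (Suc k)
    have "\<zeta> (m + Suc k) ^ (p ^ Suc k) = (\<zeta> (Suc (m + k)) ^ p) ^ (p ^ k)" by (simp add: power_mult)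
    then show ?case unfolding assms(9) using Suc by simp
  qed simp
  \<comment> \<open>By the tower relation the ring below is generated by the \<open>p ^ s\<close>-th
    power of the top root, so one root \<open>z\<close> describes both \<open>A\<close> and
    \<open>B\<close>.\<close>
  then have zr: "\<zeta> r = z ^ (p ^ s)" by (simp add: z_def)
  have zprim: "z ^ (p ^ (r + s)) = 1" "\<And>k. 0 < k \<Longrightarrow> k < p ^ (r + s) \<Longrightarrow> z ^ k \<noteq> 1"
    using assms(7)[of "r + s"] by (auto simp: primitive_root_def z_def)
  have p1: "p > 1" by (rule prime_gt_1_nat[OF assms(1)])
  have "cyclotomic_integers (int_ring F v) p (r + s) z"
  proof (rule cyclotomic_integers.intro)
    show "closed_subring (int_ring F v)" by (rule int_ring_local(1)[OF assms(1,5,6)])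
    show "(\<exists>y\<in>int_ring F v. x = of_nat p * y) \<or> (\<exists>y\<in>int_ring F v. x * y = 1)" if "x \<in> int_ring F v" for x
      by (rule int_ring_local(2)[OF assms(1,5,6) that])
    show "of_nat p * y \<noteq> 1" if "y \<in> int_ring F v" for y by (rule int_ring_local(3)[OF assms(1,5,6) that])
    have "p ^ (r + s - 1) < p ^ (r + s)" using p1 assms(3) by (intro power_strict_increasing) simp_all
    then show "z ^ (p ^ (r + s - 1)) \<noteq> 1" using p1 by (intro zprim(2)) simp_all
  qed (use assms(1-3) zprim(1) in simp_all)
  moreover have AB: "A = ps_ring (ring.simple_extension amb (int_ring F v) (z ^ (p ^ s)))"
    "B = ps_ring (ring.simple_extension amb (int_ring F v) z)"
    unfolding assms(10-12) zr by (simp_all add: z_def)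
  ultimately interpret L: cyclotomic_order p r s "fps_to_fls ` A" "fps_to_fls ` B" "frac_field B" "fls_const z" fls_X g
    using cyclotomic_order_power_series[of "int_ring F v" p r s z g] assms(3,4,13,14,15) by (simp add: z_def)
  have \<Delta>: "\<Delta> = cyclic_algebra (fps_to_fls ` B) g (p ^ s) (1 + fls_X)"
    unfolding assms(16,17) by (rule cyclic_order_cyclic_algebra) (rule L.B_K)
  have P: "P = cyc_monom (1 - fls_const z) 0"
    unfolding assms(18) z_def[symmetric] by (simp only: fls_minus_const[symmetric] fls_const_1)
  have d: "d \<in> carrier \<Delta>" using assms(20) by (simp add: Units_def)
  have norm: "reduced_norm \<Delta> (p ^ s) d = 1"
    using assms(21) unfolding assms(16) \<Delta> by (simp only: reduced_norm_cyclic_algebra[of "frac_field B" g "p ^ s" "1 + fls_X" d "fps_to_fls ` B"])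
  have n: "n \<ge> 1" "cong_mod_power \<Delta> P n d \<one>\<^bsub>\<Delta>\<^esub>" using assms(22) by (simp_all add: is_level_def)
  have "\<exists>z\<in>Pi_commutator_products D \<Delta> P. cong_mod_power \<Delta> P (n + 1) d z"
    using d norm n unfolding \<Delta> P assms(16) by (intro L.norm_one_cong_commutator_product)
  then show ?thesis using assms(23) by blast
qed

end
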